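(* Let $\mathbf{k}$ be a field and $\mathbb{A}$ the category of $\mathbf{k}$-vector spaces. Let $\mathscr{A}$ be an operad and $\mathscr{C}$ a cooperad in $\mathbb{A}$, and let $\mathcal{T}_{\mathscr{A}}=(F_{\mathscr{A}},m,e_{\mathscr{A}})$ and $\mathcal{G}_{\mathscr{C}}=(F_{\mathscr{C}},\delta,\varepsilon_{\mathscr{C}})$ be the corresponding monad and comonad on $\mathbb{A}$. Suppose that: (H0) there is given a distributive law between $\mathscr{A}$ and $\mathscr{C}$, i.e. a morphism of $\mathbb{S}$-modules $\mathscr{A}\circ\mathscr{C}\to\mathscr{C}\circ\mathscr{A}$ whose corresponding natural transformation $\lambda:F_{\mathscr{A}}F_{\mathscr{C}}\to F_{\mathscr{C}}F_{\mathscr{A}}$ is an entwining from $\mathcal{T}_{\mathscr{A}}$ to $\mathcal{G}_{\mathscr{C}}$; (H1) there is given a morphism of $\mathbb{S}$-modules $\alpha:\mathscr{A}\to\mathscr{C}\circ\mathscr{A}$ making $\mathscr{A}$ a left $\mathscr{C}$-comodule, such that for every vector space $V$ the free $\mathscr{A}$-algebra $(F_{\mathscr{A}}(V),m_V)$ together with $\alpha_V:F_{\mathscr{A}}(V)\to F_{\mathscr{C}}F_{\mathscr{A}}(V)$ is a $(\mathscr{C},\mathscr{A})$-bialgebra; (H2iso) the morphism $\varphi=(\mathscr{C}\circ\varepsilon_{\mathscr{A}})\cdot\alpha:\mathscr{A}\to\mathscr{C}$ is an isomorphism. Then the comparison functor $$K_{e_{\mathscr{C}}}:\mathbb{A}\to(\mathbb{A}_{\mathcal{T}_{\mathscr{A}}})^{\widehat{\mathcal{G}_{\mathscr{C}}}},\qquad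 V\mapsto\big((F_{\mathscr{A}}(V),m_V),\ \lambda_V\cdot F_{\mathscr{A}}((e_{\mathscr{C}})_V)\big)$$ is an equivalence of categories. Hence, in particular, any $(\mathscr{C},\mathscr{A})$-bialgebra $(H,h,\theta)$ is a free $\mathscr{A}$-algebra and a cofree conilpotent $\mathscr{C}$-coalgebra generated by $\mathrm{Prim}\,H$.
   Context: An $\mathbb{S}$-module $\mathscr{M}$ is a collection of $\mathbf{k}$-vector spaces $\mathscr{M}(n)$, $n>0$, with an action of the symmetric group $S_n$ on $\mathscr{M}(n)$. Standing assumptions on all $\mathbb{S}$-modules: $\mathscr{M}(1)=\mathbf{k}$, each $\mathscr{M}(n)$ is finite dimensional, and either the symmetric group actions are free or $\mathbf{k}$ has characteristic $0$. The Schur functor of $\mathscr{M}$ is $F_{\mathscr{M}}(V)=\bigoplus_{n>0}\mathscr{M}(n)\otimes_{\mathbf{k}[S_n]}V^{\otimes n}$. The plethysm is $$(\mathscr{M}\circ\mathscr{N})(n)=\bigoplus_{k>0,\ i_1+\dots+i_k=n}\mathscr{M}(k)\otimes_{\mathbf{k}[S_k]}\mathrm{Ind}_{S_{i_1}\times\dots\times S_{i_k}}^{S_n}\mathscr{N}(i_1)\otimes\dots\otimes\mathscr{N}(i_k),$$ so that $F_{\mathscr{M}}F_{\mathscr{N}}=F_{\mathscr{M}\circ\mathscr{N}}$; its unit is the $\mathbb{S}$-module $1$ with $1(1)=\mathbf{k}$ and $1(n)=0$ for $n\neq1$. Let $e_{\mathscr{M}}:1\to F_{\mathscr{M}}$ be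 the inclusion of $V$ as the arity-one summand of $F_{\mathscr{M}}(V)$, and $\varepsilon_{\mathscr{M}}:F_{\mathscr{M}}\to1$ the projection onto that summand (the same symbols are used for the $\mathbb{S}$-module morphisms). An operad is a monoid for $\circ$, giving a monad $\mathcal{T}_{\mathscr{A}}=(F_{\mathscr{A}},m_{\mathscr{A}},e_{\mathscr{A}})$; an $\mathscr{A}$-algebra is a $\mathcal{T}_{\mathscr{A}}$-module (Eilenberg–Moore algebra). A cooperad is a comonoid for $\circ$, giving a comonad $\mathcal{G}_{\mathscr{C}}=(F_{\mathscr{C}},\delta_{\mathscr{C}},\varepsilon_{\mathscr{C}})$; a $\mathscr{C}$-coalgebra is a $\mathcal{G}_{\mathscr{C}}$-comodule (Eilenberg–Moore coalgebra); with these conventions every $\mathscr{C}$-coalgebra is conilpotent. An entwining from a monad $(T,m,e)$ to a comonad $(G,\delta,\varepsilon)$ is a natural transformation $\lambda:TG\to GT$ with $\lambda\cdot mG=Gm\cdot\lambda T\cdot T\lambda$, $\delta T\cdot\lambda=G\lambda\cdot\lambda G\cdot T\delta$, $\lambda\cdot eG=Ge$, $\varepsilon T\cdot\lambda=T\varepsilon$. The lifted comonad $\widehat{\mathcal{G}_{\mathscr{C}}}$ on the category $\mathbb{A}_{\mathcal{T}_{\mathscr{A}}}$ of $\mathscr{A}$-algebras sends $(V,h)$ to $(F_{\mathscr{C}}(V),F_{\mathscr{C}}(h)\cdot\lambda_V)$ with comultiplication and counit those of $\mathcal{G}_{\mathscr{C}}$. A $(\mathscr{C},\mathscr{A})$-bialgebra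 is an object of $(\mathbb{A}_{\mathcal{T}_{\mathscr{A}}})^{\widehat{\mathcal{G}_{\mathscr{C}}}}$ (comodules over the lifted comonad), i.e. a triple $(V,h,\theta)$ with $(V,h)$ an $\mathscr{A}$-algebra, $(V,\theta)$ a $\mathscr{C}$-coalgebra and $\theta\cdot h=F_{\mathscr{C}}(h)\cdot\lambda_V\cdot F_{\mathscr{A}}(\theta)$; morphisms are linear maps that are both algebra and coalgebra morphisms. $\mathscr{A}$ being a left $\mathscr{C}$-comodule via $\alpha$ means $(\varepsilon_{\mathscr{C}}\circ\mathscr{A})\cdot\alpha=1$ and $(\delta_{\mathscr{C}}\circ\mathscr{A})\cdot\alpha=(\mathscr{C}\circ\alpha)\cdot\alpha$. The functor $K_{e_{\mathscr{C}}}$ acts on morphisms by $f\mapsto F_{\mathscr{A}}(f)$. The primitive part of a $(\mathscr{C},\mathscr{A})$-bialgebra $(H,h,\theta)$ is $\mathrm{Prim}\,H=\{x\in H:\theta(x)=(e_{\mathscr{C}})_H(x)\}$. The free $\mathscr{A}$-algebra generated by $V$ is $(F_{\mathscr{A}}(V),m_V)$ and the cofree (conilpotent) $\mathscr{C}$-coalgebra generated by $V$ is $(F_{\mathscr{C}}(V),\delta_V)$. *)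

theory Defs
  imports "HOL-Algebra.Module" "HOL-Combinatorics.Permutations"
begin

section \<open>Categories, functors, natural transformations\<close>

record ('o, 'a) category =
  Ob :: "'o set"
  Arr :: "'a set"
  Dom :: "'a \<Rightarrow> 'o"
  Cod :: "'a \<Rightarrow> 'o"
  Comp :: "'a \<Rightarrow> 'a \<Rightarrow> 'a" (infixr \<open>\<bullet>\<index>\<close> 55)
  Ide :: "'o \<Rightarrow> 'a"

definition Hom :: "('o, 'a) category \<Rightarrow> 'o \<Rightarrow> 'o \<Rightarrow> 'a set" where
  "Hom C X Y = {f \<in> Arr C. Dom C f = X \<and> Cod C f = Y}"

definition is_category :: "('o, 'a) category \<Rightarrow> bool" where
  "is_category C \<longleftrightarrow>
     (\<forall>f\<in>Arr C. Dom C f \<in> Ob C \<and> Cod C f \<in> Ob C) \<and>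
     (\<forall>X\<in>Ob C. Ide C X \<in> Hom C X X) \<and>
     (\<forall>f\<in>Arr C. \<forall>g\<in>Arr C. Cod C f = Dom C g \<longrightarrow> g \<bullet>\<^bsub>C\<^esub> f \<in> Hom C (Dom C f) (Cod C g)) \<and>
     (\<forall>f\<in>Arr C. f \<bullet>\<^bsub>C\<^esub> Ide C (Dom C f) = f \<and> Ide C (Cod C f) \<bullet>\<^bsub>C\<^esub> f = f) \<and>
     (\<forall>f\<in>Arr C. \<forall>g\<in>Arr C. \<forall>h\<in>Arr C. Cod C f = Dom C g \<longrightarrow> Cod C g = Dom C h \<longrightarrow>
        (h \<bullet>\<^bsub>C\<^esub> g) \<bullet>\<^bsub>C\<^esub> f = h \<bullet>\<^bsub>C\<^esub> (g \<bullet>\<^bsub>C\<^esub> f))"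

definition iso_arr :: "('o, 'a) category \<Rightarrow> 'a \<Rightarrow> bool" where
  "iso_arr C f \<longleftrightarrow> f \<in> Arr C \<and>
     (\<exists>g\<in>Hom C (Cod C f) (Dom C f). g \<bullet>\<^bsub>C\<^esub> f = Ide C (Dom C f) \<and> f \<bullet>\<^bsub>C\<^esub> g = Ide C (Cod C f))"

record ('o, 'a, 'p, 'b) func =
  FOb :: "'o \<Rightarrow> 'p"
  FArr :: "'a \<Rightarrow> 'b"

definition is_functor ::
  "('o, 'a) category \<Rightarrow> ('p, 'b) category \<Rightarrow> ('o, 'a, 'p, 'b) func \<Rightarrow> bool" where
  "is_functor C D F \<longleftrightarrow> is_category C \<and> is_category D \<and>
     (\<forall>X\<in>Ob C. FOb F X \<in> Ob D) \<and>
     (\<forall>f\<in>Arr C. FArr F f \<in> Hom D (FOb F (Dom C f)) (FOb F (Cod C f))) \<and>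
     (\<forall>X\<in>Ob C. FArr F (Ide C X) = Ide D (FOb F X)) \<and>
     (\<forall>f\<in>Arr C. \<forall>g\<in>Arr C. Cod C f = Dom C g \<longrightarrow>
        FArr F (g \<bullet>\<^bsub>C\<^esub> f) = FArr F g \<bullet>\<^bsub>D\<^esub> FArr F f)"

definition id_func :: "('o, 'a, 'o, 'a) func" where
  "id_func = \<lparr>FOb = \<lambda>X. X, FArr = \<lambda>f. f\<rparr>"

definition comp_func ::
  "('p, 'b, 'q, 'c) func \<Rightarrow> ('o, 'a, 'p, 'b) func \<Rightarrow> ('o, 'a, 'q, 'c) func" where
  "comp_func G F = \<lparr>FOb = \<lambda>X. FOb G (FOb F X), FArr = \<lambda>f. FArr G (FArr F f)\<rparr>"

definition nat_trans ::
  "('o, 'a) category \<Rightarrow> ('p, 'b) category \<Rightarrow> ('o, 'a, 'p, 'b) func \<Rightarrow> ('o, 'a, 'p, 'b) func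
     \<Rightarrow> ('o \<Rightarrow> 'b) \<Rightarrow> bool" where
  "nat_trans C D F G \<eta> \<longleftrightarrow>
     (\<forall>X\<in>Ob C. \<eta> X \<in> Hom D (FOb F X) (FOb G X)) \<and>
     (\<forall>f\<in>Arr C. \<eta> (Cod C f) \<bullet>\<^bsub>D\<^esub> FArr F f = FArr G f \<bullet>\<^bsub>D\<^esub> \<eta> (Dom C f))"

definition nat_iso ::
  "('o, 'a) category \<Rightarrow> ('p, 'b) category \<Rightarrow> ('o, 'a, 'p, 'b) func \<Rightarrow> ('o, 'a, 'p, 'b) func
     \<Rightarrow> ('o \<Rightarrow> 'b) \<Rightarrow> bool" where
  "nat_iso C D F G \<eta> \<longleftrightarrow> nat_trans C D F G \<eta> \<and> (\<forall>X\<in>Ob C. iso_arr D (\<eta> X))"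

definition is_equivalence ::
  "('o, 'a) category \<Rightarrow> ('p, 'b) category \<Rightarrow> ('o, 'a, 'p, 'b) func \<Rightarrow> bool" where
  "is_equivalence C D F \<longleftrightarrow> is_functor C D F \<and>
     (\<exists>G \<eta> \<epsilon>. is_functor D C G \<and>
        nat_iso C C id_func (comp_func G F) \<eta> \<and> nat_iso D D (comp_func F G) id_func \<epsilon>)"

section \<open>Eilenberg-Moore categories, entwinings, the lifted comonad\<close>

type_synonym ('o, 'a) tarr = "'o \<times> 'a \<times> 'o"

definition em_algs ::
  "('o, 'a) category \<Rightarrow> ('o, 'a, 'o, 'a) func \<Rightarrow> ('o \<Rightarrow> 'a) \<Rightarrow> ('o \<Rightarrow> 'a) \<Rightarrow> ('o \<times> 'a) set" where
  "em_algs C T m e = {(V, h). V \<in> Ob C \<and> h \<in> Hom C (FOb T V) V \<and>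
     h \<bullet>\<^bsub>C\<^esub> m V = h \<bullet>\<^bsub>C\<^esub> FArr T h \<and> h \<bullet>\<^bsub>C\<^esub> e V = Ide C V}"

definition em_alg ::
  "('o, 'a) category \<Rightarrow> ('o, 'a, 'o, 'a) func \<Rightarrow> ('o \<Rightarrow> 'a) \<Rightarrow> ('o \<Rightarrow> 'a)
     \<Rightarrow> ('o \<times> 'a, ('o \<times> 'a, 'a) tarr) category" where
  "em_alg C T m e = \<lparr>
     Ob = em_algs C T m e,
     Arr = {(X, f, Y). X \<in> em_algs C T m e \<and> Y \<in> em_algs C T m e \<and> f \<in> Hom C (fst X) (fst Y) \<and>
              f \<bullet>\<^bsub>C\<^esub> snd X = snd Y \<bullet>\<^bsub>C\<^esub> FArr T f},
     Dom = (\<lambda>(X, f, Y). X),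
     Cod = (\<lambda>(X, f, Y). Y),
     Comp = (\<lambda>(Y', g, Z) (X, f, Y). (X, g \<bullet>\<^bsub>C\<^esub> f, Z)),
     Ide = (\<lambda>X. (X, Ide C (fst X), X))\<rparr>"

definition em_coalgs ::
  "('o, 'a) category \<Rightarrow> ('o, 'a, 'o, 'a) func \<Rightarrow> ('o \<Rightarrow> 'a) \<Rightarrow> ('o \<Rightarrow> 'a) \<Rightarrow> ('o \<times> 'a) set" where
  "em_coalgs C G \<delta> \<epsilon> = {(V, \<theta>). V \<in> Ob C \<and> \<theta> \<in> Hom C V (FOb G V) \<and>
     \<delta> V \<bullet>\<^bsub>C\<^esub> \<theta> = FArr G \<theta> \<bullet>\<^bsub>C\<^esub> \<theta> \<and> \<epsilon> V \<bullet>\<^bsub>C\<^esub> \<theta> = Ide C V}"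

definition em_coalg ::
  "('o, 'a) category \<Rightarrow> ('o, 'a, 'o, 'a) func \<Rightarrow> ('o \<Rightarrow> 'a) \<Rightarrow> ('o \<Rightarrow> 'a)
     \<Rightarrow> ('o \<times> 'a, ('o \<times> 'a, 'a) tarr) category" where
  "em_coalg C G \<delta> \<epsilon> = \<lparr>
     Ob = em_coalgs C G \<delta> \<epsilon>,
     Arr = {(X, f, Y). X \<in> em_coalgs C G \<delta> \<epsilon> \<and> Y \<in> em_coalgs C G \<delta> \<epsilon> \<and> f \<in> Hom C (fst X) (fst Y) \<and>
              snd Y \<bullet>\<^bsub>C\<^esub> f = FArr G f \<bullet>\<^bsub>C\<^esub> snd X},
     Dom = (\<lambda>(X, f, Y). X),
     Cod = (\<lambda>(X, f, Y). Y),
     Comp = (\<lambda>(Y', g, Z) (X, f, Y). (X, g \<bullet>\<^bsub>C\<^esub> f, Z)),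
     Ide = (\<lambda>X. (X, Ide C (fst X), X))\<rparr>"

definition entwining ::
  "('o, 'a) category \<Rightarrow> ('o, 'a, 'o, 'a) func \<Rightarrow> ('o \<Rightarrow> 'a) \<Rightarrow> ('o \<Rightarrow> 'a)
     \<Rightarrow> ('o, 'a, 'o, 'a) func \<Rightarrow> ('o \<Rightarrow> 'a) \<Rightarrow> ('o \<Rightarrow> 'a) \<Rightarrow> ('o \<Rightarrow> 'a) \<Rightarrow> bool" where
  "entwining C T m e G \<delta> \<epsilon> l \<longleftrightarrow>
     nat_trans C C (comp_func T G) (comp_func G T) l \<and>
     (\<forall>X\<in>Ob C.
        l X \<bullet>\<^bsub>C\<^esub> m (FOb G X) = FArr G (m X) \<bullet>\<^bsub>C\<^esub> l (FOb T X) \<bullet>\<^bsub>C\<^esub> FArr T (l X) \<and>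
        \<delta> (FOb T X) \<bullet>\<^bsub>C\<^esub> l X = FArr G (l X) \<bullet>\<^bsub>C\<^esub> l (FOb G X) \<bullet>\<^bsub>C\<^esub> FArr T (\<delta> X) \<and>
        l X \<bullet>\<^bsub>C\<^esub> e (FOb G X) = FArr G (e X) \<and>
        \<epsilon> (FOb T X) \<bullet>\<^bsub>C\<^esub> l X = FArr T (\<epsilon> X))"

definition lift_ob ::
  "('o, 'a) category \<Rightarrow> ('o, 'a, 'o, 'a) func \<Rightarrow> ('o \<Rightarrow> 'a) \<Rightarrow> 'o \<times> 'a \<Rightarrow> 'o \<times> 'a" where
  "lift_ob C G l X = (FOb G (fst X), FArr G (snd X) \<bullet>\<^bsub>C\<^esub> l (fst X))"

definition lift_func ::
  "('o, 'a) category \<Rightarrow> ('o, 'a, 'o, 'a) func \<Rightarrow> ('o \<Rightarrow> 'a)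
     \<Rightarrow> ('o \<times> 'a, ('o \<times> 'a, 'a) tarr, 'o \<times> 'a, ('o \<times> 'a, 'a) tarr) func" where
  "lift_func C G l = \<lparr>FOb = lift_ob C G l,
     FArr = (\<lambda>(X, f, Y). (lift_ob C G l X, FArr G f, lift_ob C G l Y))\<rparr>"

definition lift_comult ::
  "('o, 'a) category \<Rightarrow> ('o, 'a, 'o, 'a) func \<Rightarrow> ('o \<Rightarrow> 'a) \<Rightarrow> ('o \<Rightarrow> 'a)
     \<Rightarrow> 'o \<times> 'a \<Rightarrow> ('o \<times> 'a, 'a) tarr" where
  "lift_comult C G l \<delta> X = (lift_ob C G l X, \<delta> (fst X), lift_ob C G l (lift_ob C G l X))"

definition lift_counit ::
  "('o, 'a) category \<Rightarrow> ('o, 'a, 'o, 'a) func \<Rightarrow> ('o \<Rightarrow> 'a) \<Rightarrow> ('o \<Rightarrow> 'a)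
     \<Rightarrow> 'o \<times> 'a \<Rightarrow> ('o \<times> 'a, 'a) tarr" where
  "lift_counit C G l \<epsilon> X = (lift_ob C G l X, \<epsilon> (fst X), X)"

section \<open>Vector spaces in a universe, presented by generators and relations\<close>

text \<open>
  Vector spaces over a field \<open>K\<close> are modules over \<open>K\<close> in the sense of HOL-Algebra (whose record
  fields \<open>mult\<close> and \<open>one\<close> play no role). Their carriers are subsets of the type below, which is
  closed under Schur functors and plethysm, so that these are honest endofunctors of one category.
  The type \<open>'a\<close> is arbitrary, so every vector space on a HOL type has a copy, via \<open>Atom\<close>.
  Formal linear combinations are lists of pairs of a
  coefficient and a generator; a generator is a pair of an operation and its list of arguments.
  A term \<open>Labelled \<nu> l\<close> is an operation \<open>\<nu>\<close> whose inputs carry the labels listed in \<open>l\<close>; it only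
  occurs as an argument in the generators of a plethysm.
\<close>

datatype ('k, 'a) univ =
    Atom 'a
  | Scalar (scalar_of: 'k)
  | Labelled (op_of: "('k, 'a) univ") (labels_of: "nat list")
  | Comb (terms: "('k \<times> ('k, 'a) univ \<times> ('k, 'a) univ list) list")

type_synonym ('k, 'a) gen = "('k, 'a) univ \<times> ('k, 'a) univ list"
type_synonym ('k, 'a) formal = "('k \<times> ('k, 'a) gen) list"
type_synonym ('k, 'a) vs = "('k, ('k, 'a) univ) module"

definition scale_formal :: "'k ring \<Rightarrow> 'k \<Rightarrow> ('k, 'a) formal \<Rightarrow> ('k, 'a) formal" where
  "scale_formal K c ts = map (\<lambda>(d, g). (c \<otimes>\<^bsub>K\<^esub> d, g)) ts"

text \<open>
  Equality in the vector space with generators \<open>X\<close> and relations \<open>R\<close>: the least congruence on formal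
  combinations that contains the vector space axioms and the pairs in \<open>R\<close>.
\<close>

inductive pres_eq ::
  "'k ring \<Rightarrow> ('k, 'a) gen set \<Rightarrow> (('k, 'a) formal \<times> ('k, 'a) formal) set
     \<Rightarrow> ('k, 'a) formal \<Rightarrow> ('k, 'a) formal \<Rightarrow> bool"
  for K X R where
  refl: "ts \<in> lists (carrier K \<times> X) \<Longrightarrow> pres_eq K X R ts ts"
| sym: "pres_eq K X R ts us \<Longrightarrow> pres_eq K X R us ts"
| trans: "pres_eq K X R ts us \<Longrightarrow> pres_eq K X R us ws \<Longrightarrow> pres_eq K X R ts ws"
| append: "pres_eq K X R ts ts' \<Longrightarrow> pres_eq K X R us us' \<Longrightarrow> pres_eq K X R (ts @ us) (ts' @ us')"
| scale: "c \<in> carrier K \<Longrightarrow> pres_eq K X R ts us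
    \<Longrightarrow> pres_eq K X R (scale_formal K c ts) (scale_formal K c us)"
| comm: "ts \<in> lists (carrier K \<times> X) \<Longrightarrow> us \<in> lists (carrier K \<times> X)
    \<Longrightarrow> pres_eq K X R (ts @ us) (us @ ts)"
| collect: "c \<in> carrier K \<Longrightarrow> d \<in> carrier K \<Longrightarrow> g \<in> X
    \<Longrightarrow> pres_eq K X R [(c, g), (d, g)] [(c \<oplus>\<^bsub>K\<^esub> d, g)]"
| zero: "g \<in> X \<Longrightarrow> pres_eq K X R [(\<zero>\<^bsub>K\<^esub>, g)] []"
| rel: "(ts, us) \<in> R \<Longrightarrow> pres_eq K X R ts us"

text \<open>An element of a presented space is a chosen representative of its class.\<close>

definition pres_cls ::
  "'k ring \<Rightarrow> ('k, 'a) gen set \<Rightarrow> (('k, 'a) formal \<times> ('k, 'a) formal) set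
     \<Rightarrow> ('k, 'a) formal \<Rightarrow> ('k, 'a) univ" where
  "pres_cls K X R ts = Comb (SOME us. pres_eq K X R ts us)"

definition presented ::
  "'k ring \<Rightarrow> ('k, 'a) gen set \<Rightarrow> (('k, 'a) formal \<times> ('k, 'a) formal) set \<Rightarrow> ('k, 'a) vs" where
  "presented K X R = \<lparr>
     carrier = pres_cls K X R ` lists (carrier K \<times> X),
     monoid.mult = undefined, one = undefined,
     zero = pres_cls K X R [],
     add = (\<lambda>x y. pres_cls K X R (terms x @ terms y)),
     smult = (\<lambda>c x. pres_cls K X R (scale_formal K c (terms x)))\<rparr>"

text \<open>The value at \<open>x\<close> of the linear extension to a presented space of a map \<open>f\<close> on generators.\<close>

definition lin_ext :: "('k, 'a) vs \<Rightarrow> (('k, 'a) gen \<Rightarrow> ('k, 'a) univ) \<Rightarrow> ('k, 'a) univ \<Rightarrow> ('k, 'a) univ" where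
  "lin_ext W f x = foldr (\<lambda>(c, g) w. c \<odot>\<^bsub>W\<^esub> f g \<oplus>\<^bsub>W\<^esub> w) (terms x) \<zero>\<^bsub>W\<^esub>"

definition lin_maps :: "'k ring \<Rightarrow> ('k, 'a) vs \<Rightarrow> ('k, 'a) vs \<Rightarrow> (('k, 'a) univ \<Rightarrow> ('k, 'a) univ) set" where
  "lin_maps K V W = {f \<in> carrier V \<rightarrow> carrier W.
     (\<forall>x\<in>carrier V. \<forall>y\<in>carrier V. f (x \<oplus>\<^bsub>V\<^esub> y) = f x \<oplus>\<^bsub>W\<^esub> f y) \<and>
     (\<forall>c\<in>carrier K. \<forall>x\<in>carrier V. f (c \<odot>\<^bsub>V\<^esub> x) = c \<odot>\<^bsub>W\<^esub> f x)}"

type_synonym ('k, 'a) vmap = "(('k, 'a) vs, ('k, 'a) univ \<Rightarrow> ('k, 'a) univ) tarr"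

definition Vect :: "'k ring \<Rightarrow> (('k, 'a) vs, ('k, 'a) vmap) category" where
  "Vect K = \<lparr>
     Ob = {V. Module.module K V},
     Arr = {(V, f, W). Module.module K V \<and> Module.module K W \<and>
              f \<in> lin_maps K V W \<and> f \<in> extensional (carrier V)},
     Dom = (\<lambda>(V, f, W). V),
     Cod = (\<lambda>(V, f, W). W),
     Comp = (\<lambda>(W', g, U) (V, f, W). (V, compose (carrier V) g f, U)),
     Ide = (\<lambda>V. (V, \<lambda>x\<in>carrier V. x, V))\<rparr>"

definition vmap_fun :: "('k, 'a) vmap \<Rightarrow> ('k, 'a) univ \<Rightarrow> ('k, 'a) univ" where
  "vmap_fun f = fst (snd f)"

text \<open>The inverse of a bijective linear map.\<close>

definition vmap_inv :: "('k, 'a) vmap \<Rightarrow> ('k, 'a) vmap" where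
  "vmap_inv = (\<lambda>(V, f, W). (W, \<lambda>y\<in>carrier W. inv_into (carrier V) f y, V))"

text \<open>The ground field as a vector space.\<close>

definition ground :: "'k ring \<Rightarrow> ('k, 'a) vs" where
  "ground K = \<lparr>
     carrier = Scalar ` carrier K,
     monoid.mult = (\<lambda>x y. Scalar (scalar_of x \<otimes>\<^bsub>K\<^esub> scalar_of y)), one = Scalar \<one>\<^bsub>K\<^esub>,
     zero = Scalar \<zero>\<^bsub>K\<^esub>,
     add = (\<lambda>x y. Scalar (scalar_of x \<oplus>\<^bsub>K\<^esub> scalar_of y)),
     smult = (\<lambda>c x. Scalar (c \<otimes>\<^bsub>K\<^esub> scalar_of x))\<rparr>"

definition fin_dim :: "'k ring \<Rightarrow> ('k, 'a) vs \<Rightarrow> bool" where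
  "fin_dim K V \<longleftrightarrow> (\<exists>B. finite B \<and> B \<subseteq> carrier V \<and>
     (\<forall>x\<in>carrier V. \<exists>c\<in>B \<rightarrow> carrier K. x = finsum V (\<lambda>b. c b \<odot>\<^bsub>V\<^esub> b) B))"

section \<open>S-modules\<close>

text \<open>
  The symmetric group \<open>S\<^sub>n\<close> consists of the permutations of \<open>{..<n}\<close>, with composition as product; it
  acts on \<open>M(n)\<close> from the right (\<open>act M n x \<sigma> = x\<sigma>\<close>) and on lists of length \<open>n\<close> from the left. The
  arity \<open>0\<close> components of the record are never used.
\<close>

record ('k, 'a) smodule =
  sp :: "nat \<Rightarrow> ('k, 'a) vs"
  act :: "nat \<Rightarrow> ('k, 'a) univ \<Rightarrow> (nat \<Rightarrow> nat) \<Rightarrow> ('k, 'a) univ"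

definition lperm :: "(nat \<Rightarrow> nat) \<Rightarrow> 'b list \<Rightarrow> 'b list" where
  "lperm \<sigma> xs = permute_list (Hilbert_Choice.inv \<sigma>) xs"

definition is_smodule :: "'k ring \<Rightarrow> ('k, 'a) smodule \<Rightarrow> bool" where
  "is_smodule K M \<longleftrightarrow> (\<forall>n>0. Module.module K (sp M n) \<and>
     (\<forall>\<sigma>. \<sigma> permutes {..<n} \<longrightarrow> (\<lambda>x. act M n x \<sigma>) \<in> lin_maps K (sp M n) (sp M n)) \<and>
     (\<forall>x\<in>carrier (sp M n). act M n x id = x) \<and>
     (\<forall>x\<in>carrier (sp M n). \<forall>\<sigma> \<tau>. \<sigma> permutes {..<n} \<longrightarrow> \<tau> permutes {..<n} \<longrightarrow>
        act M n x (\<sigma> \<circ> \<tau>) = act M n (act M n x \<sigma>) \<tau>))"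

text \<open>The action on \<open>M(n)\<close> is free, i.e.\ \<open>M(n)\<close> is a (finitely generated) free \<open>K[S\<^sub>n]\<close>-module:
  there is \<open>B\<close> such that the family of all \<open>b\<sigma>\<close> with \<open>b \<in> B\<close>, \<open>\<sigma> \<in> S\<^sub>n\<close> is a basis.\<close>

definition free_action :: "'k ring \<Rightarrow> ('k, 'a) smodule \<Rightarrow> nat \<Rightarrow> bool" where
  "free_action K M n \<longleftrightarrow> (\<exists>B. finite B \<and> B \<subseteq> carrier (sp M n) \<and>
     (\<forall>x\<in>carrier (sp M n). \<exists>!c. c \<in> B \<times> {\<sigma>. \<sigma> permutes {..<n}} \<rightarrow>\<^sub>E carrier K \<and>
        x = finsum (sp M n) (\<lambda>(b, \<sigma>). c (b, \<sigma>) \<odot>\<^bsub>sp M n\<^esub> act M n b \<sigma>)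
              (B \<times> {\<sigma>. \<sigma> permutes {..<n}})))"

definition char_zero :: "'k ring \<Rightarrow> bool" where
  "char_zero K \<longleftrightarrow> (\<forall>n::nat. n > 0 \<longrightarrow> add_pow K n \<one>\<^bsub>K\<^esub> \<noteq> \<zero>\<^bsub>K\<^esub>)"

text \<open>S-modules satisfying the standing assumptions.\<close>

definition std_smodule :: "'k ring \<Rightarrow> ('k, 'a) smodule \<Rightarrow> bool" where
  "std_smodule K M \<longleftrightarrow> is_smodule K M \<and> sp M 1 = ground K \<and>
     (\<forall>n>0. fin_dim K (sp M n)) \<and> ((\<forall>n>0. free_action K M n) \<or> char_zero K)"

type_synonym ('k, 'a) smap = "nat \<Rightarrow> ('k, 'a) univ \<Rightarrow> ('k, 'a) univ"

definition smor :: "'k ring \<Rightarrow> ('k, 'a) smodule \<Rightarrow> ('k, 'a) smodule \<Rightarrow> ('k, 'a) smap \<Rightarrow> bool" where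
  "smor K M N f \<longleftrightarrow> (\<forall>n>0. f n \<in> lin_maps K (sp M n) (sp N n) \<and>
     (\<forall>x\<in>carrier (sp M n). \<forall>\<sigma>. \<sigma> permutes {..<n} \<longrightarrow> f n (act M n x \<sigma>) = act N n (f n x) \<sigma>))"

definition smor_eq :: "('k, 'a) smodule \<Rightarrow> ('k, 'a) smap \<Rightarrow> ('k, 'a) smap \<Rightarrow> bool" where
  "smor_eq M f g \<longleftrightarrow> (\<forall>n>0. \<forall>x\<in>carrier (sp M n). f n x = g n x)"

definition sid :: "('k, 'a) smap" where
  "sid n x = x"

definition scomp :: "('k, 'a) smap \<Rightarrow> ('k, 'a) smap \<Rightarrow> ('k, 'a) smap" (infixr \<open>\<cdot>\<^sub>s\<close> 55) where
  "(g \<cdot>\<^sub>s f) n x = g n (f n x)"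

definition smor_iso :: "'k ring \<Rightarrow> ('k, 'a) smodule \<Rightarrow> ('k, 'a) smodule \<Rightarrow> ('k, 'a) smap \<Rightarrow> bool" where
  "smor_iso K M N f \<longleftrightarrow> smor K M N f \<and>
     (\<exists>g. smor K N M g \<and> smor_eq M (g \<cdot>\<^sub>s f) sid \<and> smor_eq N (f \<cdot>\<^sub>s g) sid)"

section \<open>Schur functors\<close>

text \<open>
  \<open>schur K M V\<close> is the direct sum over \<open>n > 0\<close> of the tensor products over \<open>K[S\<^sub>n]\<close> of \<open>M(n)\<close> and
  the \<open>n\<close>-th tensor power of \<open>V\<close>: the generator \<open>(\<mu>, [v\<^sub>1, \<dots>, v\<^sub>n])\<close> stands for
  \<open>\<mu> \<otimes> (v\<^sub>1 \<otimes> \<dots> \<otimes> v\<^sub>n)\<close>, and each relation lies in a single arity \<open>n\<close>.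
\<close>

definition schur_gens :: "('k, 'a) smodule \<Rightarrow> ('k, 'a) vs \<Rightarrow> ('k, 'a) gen set" where
  "schur_gens M V = {(\<mu>, vs). vs \<noteq> [] \<and> \<mu> \<in> carrier (sp M (length vs)) \<and> set vs \<subseteq> carrier V}"

inductive_set schur_rels ::
  "'k ring \<Rightarrow> ('k, 'a) smodule \<Rightarrow> ('k, 'a) vs \<Rightarrow> (('k, 'a) formal \<times> ('k, 'a) formal) set"
  for K M V where
  op_add: "(\<mu>, vs) \<in> schur_gens M V \<Longrightarrow> (\<mu>', vs) \<in> schur_gens M V \<Longrightarrow>
    ([(\<one>\<^bsub>K\<^esub>, (\<mu> \<oplus>\<^bsub>sp M (length vs)\<^esub> \<mu>', vs))], [(\<one>\<^bsub>K\<^esub>, (\<mu>, vs)), (\<one>\<^bsub>K\<^esub>, (\<mu>', vs))])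
      \<in> schur_rels K M V"
| op_scale: "(\<mu>, vs) \<in> schur_gens M V \<Longrightarrow> c \<in> carrier K \<Longrightarrow>
    ([(\<one>\<^bsub>K\<^esub>, (c \<odot>\<^bsub>sp M (length vs)\<^esub> \<mu>, vs))], [(c, (\<mu>, vs))]) \<in> schur_rels K M V"
| arg_add: "(\<mu>, vs) \<in> schur_gens M V \<Longrightarrow> i < length vs \<Longrightarrow> v \<in> carrier V \<Longrightarrow> w \<in> carrier V \<Longrightarrow>
    ([(\<one>\<^bsub>K\<^esub>, (\<mu>, vs[i := v \<oplus>\<^bsub>V\<^esub> w]))], [(\<one>\<^bsub>K\<^esub>, (\<mu>, vs[i := v])), (\<one>\<^bsub>K\<^esub>, (\<mu>, vs[i := w]))])
      \<in> schur_rels K M V"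
| arg_scale: "(\<mu>, vs) \<in> schur_gens M V \<Longrightarrow> i < length vs \<Longrightarrow> v \<in> carrier V \<Longrightarrow> c \<in> carrier K \<Longrightarrow>
    ([(\<one>\<^bsub>K\<^esub>, (\<mu>, vs[i := c \<odot>\<^bsub>V\<^esub> v]))], [(c, (\<mu>, vs[i := v]))]) \<in> schur_rels K M V"
| balance: "(\<mu>, vs) \<in> schur_gens M V \<Longrightarrow> \<sigma> permutes {..<length vs} \<Longrightarrow>
    ([(\<one>\<^bsub>K\<^esub>, (act M (length vs) \<mu> \<sigma>, vs))], [(\<one>\<^bsub>K\<^esub>, (\<mu>, lperm \<sigma> vs))]) \<in> schur_rels K M V"

definition schur :: "'k ring \<Rightarrow> ('k, 'a) smodule \<Rightarrow> ('k, 'a) vs \<Rightarrow> ('k, 'a) vs" where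
  "schur K M V = presented K (schur_gens M V) (schur_rels K M V)"

definition schur_cls :: "'k ring \<Rightarrow> ('k, 'a) smodule \<Rightarrow> ('k, 'a) vs \<Rightarrow> ('k, 'a) gen \<Rightarrow> ('k, 'a) univ" where
  "schur_cls K M V g = pres_cls K (schur_gens M V) (schur_rels K M V) [(\<one>\<^bsub>K\<^esub>, g)]"

definition schur_map :: "'k ring \<Rightarrow> ('k, 'a) smodule \<Rightarrow> ('k, 'a) vmap \<Rightarrow> ('k, 'a) vmap" where
  "schur_map K M = (\<lambda>(V, f, W). (schur K M V,
     \<lambda>x\<in>carrier (schur K M V).
       lin_ext (schur K M W) (\<lambda>(\<mu>, vs). schur_cls K M W (\<mu>, map f vs)) x,
     schur K M W))"

definition schur_func ::
  "'k ring \<Rightarrow> ('k, 'a) smodule \<Rightarrow> (('k, 'a) vs, ('k, 'a) vmap, ('k, 'a) vs, ('k, 'a) vmap) func" where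
  "schur_func K M = \<lparr>FOb = schur K M, FArr = schur_map K M\<rparr>"

text \<open>The natural transformation \<open>F\<^sub>M \<rightarrow> F\<^sub>N\<close> induced by a morphism \<open>f : M \<rightarrow> N\<close>.\<close>

definition schur_nat ::
  "'k ring \<Rightarrow> ('k, 'a) smodule \<Rightarrow> ('k, 'a) smodule \<Rightarrow> ('k, 'a) smap \<Rightarrow> ('k, 'a) vs \<Rightarrow> ('k, 'a) vmap" where
  "schur_nat K M N f V = (schur K M V,
     \<lambda>x\<in>carrier (schur K M V).
       lin_ext (schur K N V) (\<lambda>(\<mu>, vs). schur_cls K N V (f (length vs) \<mu>, vs)) x,
     schur K N V)"

text \<open>Inclusion of and projection onto the arity one summand \<open>V\<close>, for \<open>M\<close> with \<open>M(1)\<close> the ground field.\<close>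

definition schur_unit :: "'k ring \<Rightarrow> ('k, 'a) smodule \<Rightarrow> ('k, 'a) vs \<Rightarrow> ('k, 'a) vmap" where
  "schur_unit K M V = (V, \<lambda>v\<in>carrier V. schur_cls K M V (Scalar \<one>\<^bsub>K\<^esub>, [v]), schur K M V)"

definition schur_counit :: "'k ring \<Rightarrow> ('k, 'a) smodule \<Rightarrow> ('k, 'a) vs \<Rightarrow> ('k, 'a) vmap" where
  "schur_counit K M V = (schur K M V,
     \<lambda>x\<in>carrier (schur K M V).
       lin_ext V (\<lambda>(\<mu>, vs). if length vs = 1 then scalar_of \<mu> \<odot>\<^bsub>V\<^esub> hd vs else \<zero>\<^bsub>V\<^esub>) x,
     V)"

section \<open>Plethysm\<close>

text \<open>
  In arity \<open>n\<close>, the generator \<open>(\<mu>, [Labelled \<nu>\<^sub>1 l\<^sub>1, \<dots>, Labelled \<nu>\<^sub>k l\<^sub>k])\<close> has \<open>\<mu> \<in> M(k)\<close>,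
  \<open>\<nu>\<^sub>j \<in> N(i\<^sub>j)\<close> with \<open>i\<^sub>j = length l\<^sub>j\<close>, and the concatenation of the \<open>l\<^sub>j\<close> is the word
  \<open>w(0) \<dots> w(n-1)\<close> of a permutation \<open>w\<close> of \<open>{..<n}\<close>. It stands for
  \<open>\<mu> \<otimes> (\<nu>\<^sub>1 \<otimes> \<dots> \<otimes> \<nu>\<^sub>k) \<otimes> w\<^sup>-\<^sup>1\<close>, where the last factor is in \<open>K[S\<^sub>n]\<close>, i.e.\ for
  \<open>\<mu>(\<nu>\<^sub>1(x\<^bsub>l\<^sub>1\<^esub>), \<dots>, \<nu>\<^sub>k(x\<^bsub>l\<^sub>k\<^esub>))\<close>. The relation \<open>inner_balance\<close> is the tensor product over
  \<open>S\<^bsub>i\<^sub>1\<^esub> \<times> \<dots> \<times> S\<^bsub>i\<^sub>k\<^esub>\<close> defining the induced representation, \<open>outer_balance\<close> the tensor product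
  over \<open>S\<^sub>k\<close>, which permutes the \<open>\<nu>\<^sub>j\<close> together with their blocks of labels.
\<close>

definition circ_gens :: "('k, 'a) smodule \<Rightarrow> ('k, 'a) smodule \<Rightarrow> nat \<Rightarrow> ('k, 'a) gen set" where
  "circ_gens M N n = {(\<mu>, ps). ps \<noteq> [] \<and> \<mu> \<in> carrier (sp M (length ps)) \<and>
     set ps \<subseteq> {Labelled \<nu> l |\<nu> l. l \<noteq> [] \<and> \<nu> \<in> carrier (sp N (length l))} \<and>
     distinct (concat (map labels_of ps)) \<and> set (concat (map labels_of ps)) = {..<n}}"

inductive_set circ_rels ::
  "'k ring \<Rightarrow> ('k, 'a) smodule \<Rightarrow> ('k, 'a) smodule \<Rightarrow> nat \<Rightarrow> (('k, 'a) formal \<times> ('k, 'a) formal) set"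
  for K M N n where
  op_add: "(\<mu>, ps) \<in> circ_gens M N n \<Longrightarrow> (\<mu>', ps) \<in> circ_gens M N n \<Longrightarrow>
    ([(\<one>\<^bsub>K\<^esub>, (\<mu> \<oplus>\<^bsub>sp M (length ps)\<^esub> \<mu>', ps))], [(\<one>\<^bsub>K\<^esub>, (\<mu>, ps)), (\<one>\<^bsub>K\<^esub>, (\<mu>', ps))])
      \<in> circ_rels K M N n"
| op_scale: "(\<mu>, ps) \<in> circ_gens M N n \<Longrightarrow> c \<in> carrier K \<Longrightarrow>
    ([(\<one>\<^bsub>K\<^esub>, (c \<odot>\<^bsub>sp M (length ps)\<^esub> \<mu>, ps))], [(c, (\<mu>, ps))]) \<in> circ_rels K M N n"
| arg_add: "(\<mu>, ps) \<in> circ_gens M N n \<Longrightarrow> i < length ps \<Longrightarrow> ps ! i = Labelled \<nu> l \<Longrightarrow>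
    \<nu>' \<in> carrier (sp N (length l)) \<Longrightarrow>
    ([(\<one>\<^bsub>K\<^esub>, (\<mu>, ps[i := Labelled (\<nu> \<oplus>\<^bsub>sp N (length l)\<^esub> \<nu>') l]))],
     [(\<one>\<^bsub>K\<^esub>, (\<mu>, ps)), (\<one>\<^bsub>K\<^esub>, (\<mu>, ps[i := Labelled \<nu>' l]))]) \<in> circ_rels K M N n"
| arg_scale: "(\<mu>, ps) \<in> circ_gens M N n \<Longrightarrow> i < length ps \<Longrightarrow> ps ! i = Labelled \<nu> l \<Longrightarrow>
    c \<in> carrier K \<Longrightarrow>
    ([(\<one>\<^bsub>K\<^esub>, (\<mu>, ps[i := Labelled (c \<odot>\<^bsub>sp N (length l)\<^esub> \<nu>) l]))], [(c, (\<mu>, ps))])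
      \<in> circ_rels K M N n"
| inner_balance: "(\<mu>, ps) \<in> circ_gens M N n \<Longrightarrow> i < length ps \<Longrightarrow> ps ! i = Labelled \<nu> l \<Longrightarrow>
    \<tau> permutes {..<length l} \<Longrightarrow>
    ([(\<one>\<^bsub>K\<^esub>, (\<mu>, ps[i := Labelled (act N (length l) \<nu> \<tau>) l]))],
     [(\<one>\<^bsub>K\<^esub>, (\<mu>, ps[i := Labelled \<nu> (lperm \<tau> l)]))]) \<in> circ_rels K M N n"
| outer_balance: "(\<mu>, ps) \<in> circ_gens M N n \<Longrightarrow> \<sigma> permutes {..<length ps} \<Longrightarrow>
    ([(\<one>\<^bsub>K\<^esub>, (act M (length ps) \<mu> \<sigma>, ps))], [(\<one>\<^bsub>K\<^esub>, (\<mu>, lperm \<sigma> ps))]) \<in> circ_rels K M N n"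

definition circ_cls ::
  "'k ring \<Rightarrow> ('k, 'a) smodule \<Rightarrow> ('k, 'a) smodule \<Rightarrow> nat \<Rightarrow> ('k, 'a) gen \<Rightarrow> ('k, 'a) univ" where
  "circ_cls K M N n g = pres_cls K (circ_gens M N n) (circ_rels K M N n) [(\<one>\<^bsub>K\<^esub>, g)]"

definition circ_sp :: "'k ring \<Rightarrow> ('k, 'a) smodule \<Rightarrow> ('k, 'a) smodule \<Rightarrow> nat \<Rightarrow> ('k, 'a) vs" where
  "circ_sp K M N n = presented K (circ_gens M N n) (circ_rels K M N n)"

text \<open>Since labels form the word of \<open>w\<close> with \<open>w\<^sup>-\<^sup>1 \<in> S\<^sub>n\<close>, right multiplication by \<open>\<sigma>\<close> relabels by
  the inverse of \<open>\<sigma>\<close>.\<close>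

definition circ :: "'k ring \<Rightarrow> ('k, 'a) smodule \<Rightarrow> ('k, 'a) smodule \<Rightarrow> ('k, 'a) smodule" where
  "circ K M N = \<lparr>
     sp = circ_sp K M N,
     act = (\<lambda>n x \<sigma>. lin_ext (circ_sp K M N n) (\<lambda>(\<mu>, ps). circ_cls K M N n
              (\<mu>, map (\<lambda>p. Labelled (op_of p) (map (Hilbert_Choice.inv \<sigma>) (labels_of p))) ps)) x)\<rparr>"

text \<open>The morphism \<open>f \<circ> g\<close> with values in \<open>M' \<circ> N'\<close>.\<close>

definition circ_map ::
  "'k ring \<Rightarrow> ('k, 'a) smodule \<Rightarrow> ('k, 'a) smodule \<Rightarrow> ('k, 'a) smap \<Rightarrow> ('k, 'a) smap \<Rightarrow> ('k, 'a) smap" where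
  "circ_map K M' N' f g n x = lin_ext (circ_sp K M' N' n) (\<lambda>(\<mu>, ps). circ_cls K M' N' n
     (f (length ps) \<mu>,
      map (\<lambda>p. Labelled (g (length (labels_of p)) (op_of p)) (labels_of p)) ps)) x"

text \<open>The associativity isomorphism \<open>(M \<circ> N) \<circ> P \<rightarrow> M \<circ> (N \<circ> P)\<close>. In a generator
  \<open>((\<mu>; Labelled \<nu>\<^sub>j l\<^sub>j), [q\<^sub>0, q\<^sub>1, \<dots>])\<close> of the source, the entries of \<open>l\<^sub>j\<close> say which of the
  \<open>q\<^sub>i\<close> are the inputs of \<open>\<nu>\<^sub>j\<close>. These are grafted on \<open>\<nu>\<^sub>j\<close>, after replacing their labels by consecutive
  numbers; the original labels become those of the resulting operation.\<close>

fun relabel_from :: "nat \<Rightarrow> ('k, 'a) univ list \<Rightarrow> ('k, 'a) univ list" where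
  "relabel_from s [] = []"
| "relabel_from s (q # qs) =
     Labelled (op_of q) [s..<s + length (labels_of q)] # relabel_from (s + length (labels_of q)) qs"

definition graft ::
  "'k ring \<Rightarrow> ('k, 'a) smodule \<Rightarrow> ('k, 'a) smodule \<Rightarrow> ('k, 'a) univ \<Rightarrow> ('k, 'a) univ list \<Rightarrow> ('k, 'a) univ" where
  "graft K N P \<nu> qs = (let l = concat (map labels_of qs)
     in Labelled (circ_cls K N P (length l) (\<nu>, relabel_from 0 qs)) l)"

definition circ_assoc ::
  "'k ring \<Rightarrow> ('k, 'a) smodule \<Rightarrow> ('k, 'a) smodule \<Rightarrow> ('k, 'a) smodule \<Rightarrow> ('k, 'a) smap" where
  "circ_assoc K M N P n x = lin_ext (circ_sp K M (circ K N P) n)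
     (\<lambda>(y, qs). lin_ext (circ_sp K M (circ K N P) n)
        (\<lambda>(\<mu>, ps). circ_cls K M (circ K N P) n
           (\<mu>, map (\<lambda>p. graft K N P (op_of p) (map (\<lambda>i. qs ! i) (labels_of p))) ps)) y) x"

text \<open>The unit S-module, and the canonical isomorphisms \<open>M \<rightarrow> 1 \<circ> M\<close> and \<open>M \<rightarrow> M \<circ> 1\<close>.\<close>

definition sunit :: "'k ring \<Rightarrow> ('k, 'a) smodule" where
  "sunit K = \<lparr>
     sp = (\<lambda>n. if n = 1 then ground K else (ground K)\<lparr>carrier := {Scalar \<zero>\<^bsub>K\<^esub>}\<rparr>),
     act = (\<lambda>n x \<sigma>. x)\<rparr>"

definition lunit_inv :: "'k ring \<Rightarrow> ('k, 'a) smodule \<Rightarrow> ('k, 'a) smap" where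
  "lunit_inv K M n x = circ_cls K (sunit K) M n (Scalar \<one>\<^bsub>K\<^esub>, [Labelled x [0..<n]])"

definition runit_inv :: "'k ring \<Rightarrow> ('k, 'a) smodule \<Rightarrow> ('k, 'a) smap" where
  "runit_inv K M n x =
     circ_cls K M (sunit K) n (x, map (\<lambda>i. Labelled (Scalar \<one>\<^bsub>K\<^esub>) [i]) [0..<n])"

definition runit :: "'k ring \<Rightarrow> ('k, 'a) smodule \<Rightarrow> ('k, 'a) smap" where
  "runit K M n = inv_into (carrier (sp M n)) (runit_inv K M n)"

text \<open>The S-module morphisms \<open>e\<^sub>M : 1 \<rightarrow> M\<close> and \<open>\<epsilon>\<^sub>M : M \<rightarrow> 1\<close>, for \<open>M\<close> with \<open>M(1)\<close> the ground field.\<close>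

definition s_unit :: "('k, 'a) smodule \<Rightarrow> ('k, 'a) smap" where
  "s_unit M n x = (if n = 1 then x else \<zero>\<^bsub>sp M n\<^esub>)"

definition s_counit :: "'k ring \<Rightarrow> ('k, 'a) smap" where
  "s_counit K n x = (if n = 1 then x else Scalar \<zero>\<^bsub>K\<^esub>)"

text \<open>The isomorphism from \<open>F\<^bsub>M \<circ> N\<^esub>(V)\<close> to \<open>F\<^sub>M(F\<^sub>N(V))\<close>, used in both directions to identify the
  two functors.\<close>

definition schur_circ ::
  "'k ring \<Rightarrow> ('k, 'a) smodule \<Rightarrow> ('k, 'a) smodule \<Rightarrow> ('k, 'a) vs \<Rightarrow> ('k, 'a) vmap" where
  "schur_circ K M N V = (schur K (circ K M N) V,
     \<lambda>x\<in>carrier (schur K (circ K M N) V).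
       lin_ext (schur K M (schur K N V))
         (\<lambda>(y, vs). lin_ext (schur K M (schur K N V))
            (\<lambda>(\<mu>, ps). schur_cls K M (schur K N V)
               (\<mu>, map (\<lambda>p. schur_cls K N V (op_of p, map (\<lambda>i. vs ! i) (labels_of p))) ps)) y) x,
     schur K M (schur K N V))"

section \<open>Operads, cooperads, bialgebras\<close>

definition operad :: "'k ring \<Rightarrow> ('k, 'a) smodule \<Rightarrow> ('k, 'a) smap \<Rightarrow> bool" where
  "operad K A \<gamma> \<longleftrightarrow> std_smodule K A \<and> smor K (circ K A A) A \<gamma> \<and>
     smor_eq (circ K (circ K A A) A)
       (\<gamma> \<cdot>\<^sub>s circ_map K A A \<gamma> sid) (\<gamma> \<cdot>\<^sub>s circ_map K A A sid \<gamma> \<cdot>\<^sub>s circ_assoc K A A A) \<and>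
     smor_eq A (\<gamma> \<cdot>\<^sub>s circ_map K A A (s_unit A) sid \<cdot>\<^sub>s lunit_inv K A) sid \<and>
     smor_eq A (\<gamma> \<cdot>\<^sub>s circ_map K A A sid (s_unit A) \<cdot>\<^sub>s runit_inv K A) sid"

definition cooperad :: "'k ring \<Rightarrow> ('k, 'a) smodule \<Rightarrow> ('k, 'a) smap \<Rightarrow> bool" where
  "cooperad K C \<Delta> \<longleftrightarrow> std_smodule K C \<and> smor K C (circ K C C) \<Delta> \<and>
     smor_eq C (circ_assoc K C C C \<cdot>\<^sub>s circ_map K (circ K C C) C \<Delta> sid \<cdot>\<^sub>s \<Delta>)
       (circ_map K C (circ K C C) sid \<Delta> \<cdot>\<^sub>s \<Delta>) \<and>
     smor_eq C (circ_map K (sunit K) C (s_counit K) sid \<cdot>\<^sub>s \<Delta>) (lunit_inv K C) \<and>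
     smor_eq C (circ_map K C (sunit K) sid (s_counit K) \<cdot>\<^sub>s \<Delta>) (runit_inv K C)"

definition left_comodule ::
  "'k ring \<Rightarrow> ('k, 'a) smodule \<Rightarrow> ('k, 'a) smap \<Rightarrow> ('k, 'a) smodule \<Rightarrow> ('k, 'a) smap \<Rightarrow> bool" where
  "left_comodule K C \<Delta> A \<alpha> \<longleftrightarrow> smor K A (circ K C A) \<alpha> \<and>
     smor_eq A (circ_map K (sunit K) A (s_counit K) sid \<cdot>\<^sub>s \<alpha>) (lunit_inv K A) \<and>
     smor_eq A (circ_assoc K C C A \<cdot>\<^sub>s circ_map K (circ K C C) A \<Delta> sid \<cdot>\<^sub>s \<alpha>)
       (circ_map K C (circ K C A) sid \<alpha> \<cdot>\<^sub>s \<alpha>)"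

definition operad_mult ::
  "'k ring \<Rightarrow> ('k, 'a) smodule \<Rightarrow> ('k, 'a) smap \<Rightarrow> ('k, 'a) vs \<Rightarrow> ('k, 'a) vmap" where
  "operad_mult K A \<gamma> V = schur_nat K (circ K A A) A \<gamma> V \<bullet>\<^bsub>Vect K\<^esub> vmap_inv (schur_circ K A A V)"

definition cooperad_comult ::
  "'k ring \<Rightarrow> ('k, 'a) smodule \<Rightarrow> ('k, 'a) smap \<Rightarrow> ('k, 'a) vs \<Rightarrow> ('k, 'a) vmap" where
  "cooperad_comult K C \<Delta> V = schur_circ K C C V \<bullet>\<^bsub>Vect K\<^esub> schur_nat K C (circ K C C) \<Delta> V"

text \<open>The natural transformations induced by \<open>A \<circ> C \<rightarrow> C \<circ> A\<close> and by \<open>A \<rightarrow> C \<circ> A\<close>.\<close>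

definition dist_nat ::
  "'k ring \<Rightarrow> ('k, 'a) smodule \<Rightarrow> ('k, 'a) smodule \<Rightarrow> ('k, 'a) smap \<Rightarrow> ('k, 'a) vs \<Rightarrow> ('k, 'a) vmap" where
  "dist_nat K A C l V = schur_circ K C A V \<bullet>\<^bsub>Vect K\<^esub> schur_nat K (circ K A C) (circ K C A) l V
     \<bullet>\<^bsub>Vect K\<^esub> vmap_inv (schur_circ K A C V)"

definition coaction_nat ::
  "'k ring \<Rightarrow> ('k, 'a) smodule \<Rightarrow> ('k, 'a) smodule \<Rightarrow> ('k, 'a) smap \<Rightarrow> ('k, 'a) vs \<Rightarrow> ('k, 'a) vmap" where
  "coaction_nat K A C \<alpha> V = schur_circ K C A V \<bullet>\<^bsub>Vect K\<^esub> schur_nat K A (circ K C A) \<alpha> V"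

definition distributive_law ::
  "'k ring \<Rightarrow> ('k, 'a) smodule \<Rightarrow> ('k, 'a) smap \<Rightarrow> ('k, 'a) smodule \<Rightarrow> ('k, 'a) smap \<Rightarrow> ('k, 'a) smap \<Rightarrow> bool" where
  "distributive_law K A \<gamma> C \<Delta> l \<longleftrightarrow> smor K (circ K A C) (circ K C A) l \<and>
     entwining (Vect K) (schur_func K A) (operad_mult K A \<gamma>) (schur_unit K A)
       (schur_func K C) (cooperad_comult K C \<Delta>) (schur_counit K C) (dist_nat K A C l)"

type_synonym ('k, 'a) alg = "('k, 'a) vs \<times> ('k, 'a) vmap"
type_synonym ('k, 'a) algmap = "(('k, 'a) alg, ('k, 'a) vmap) tarr"
type_synonym ('k, 'a) bialg = "('k, 'a) alg \<times> ('k, 'a) algmap"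
type_synonym ('k, 'a) bialgmap = "(('k, 'a) bialg, ('k, 'a) algmap) tarr"

definition operad_algebras ::
  "'k ring \<Rightarrow> ('k, 'a) smodule \<Rightarrow> ('k, 'a) smap
     \<Rightarrow> (('k, 'a) alg, ('k, 'a) algmap) category" where
  "operad_algebras K A \<gamma> = em_alg (Vect K) (schur_func K A) (operad_mult K A \<gamma>) (schur_unit K A)"

definition cooperad_coalgebras ::
  "'k ring \<Rightarrow> ('k, 'a) smodule \<Rightarrow> ('k, 'a) smap
     \<Rightarrow> (('k, 'a) alg, ('k, 'a) algmap) category" where
  "cooperad_coalgebras K C \<Delta> =
     em_coalg (Vect K) (schur_func K C) (cooperad_comult K C \<Delta>) (schur_counit K C)"

definition bialgebras ::
  "'k ring \<Rightarrow> ('k, 'a) smodule \<Rightarrow> ('k, 'a) smap \<Rightarrow> ('k, 'a) smodule \<Rightarrow> ('k, 'a) smap \<Rightarrow> ('k, 'a) smap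
     \<Rightarrow> (('k, 'a) bialg, ('k, 'a) bialgmap) category" where
  "bialgebras K A \<gamma> C \<Delta> l = em_coalg (operad_algebras K A \<gamma>)
     (lift_func (Vect K) (schur_func K C) (dist_nat K A C l))
     (lift_comult (Vect K) (schur_func K C) (dist_nat K A C l) (cooperad_comult K C \<Delta>))
     (lift_counit (Vect K) (schur_func K C) (dist_nat K A C l) (schur_counit K C))"

text \<open>The triple \<open>(H, h, \<theta>)\<close> as a candidate object of \<^const>\<open>bialgebras\<close>: there the coaction is an
  arrow of algebras from \<open>(H, h)\<close> to its image under the lifted comonad, with underlying map \<open>\<theta>\<close>.\<close>

definition bialg_of ::
  "'k ring \<Rightarrow> ('k, 'a) smodule \<Rightarrow> ('k, 'a) smodule \<Rightarrow> ('k, 'a) smap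
     \<Rightarrow> ('k, 'a) vs \<Rightarrow> ('k, 'a) vmap \<Rightarrow> ('k, 'a) vmap \<Rightarrow> ('k, 'a) bialg" where
  "bialg_of K A C l H h \<theta> =
     ((H, h), ((H, h), \<theta>, lift_ob (Vect K) (schur_func K C) (dist_nat K A C l) (H, h)))"

definition free_alg :: "'k ring \<Rightarrow> ('k, 'a) smodule \<Rightarrow> ('k, 'a) smap \<Rightarrow> ('k, 'a) vs \<Rightarrow> ('k, 'a) alg" where
  "free_alg K A \<gamma> V = (schur K A V, operad_mult K A \<gamma> V)"

definition cofree_coalg :: "'k ring \<Rightarrow> ('k, 'a) smodule \<Rightarrow> ('k, 'a) smap \<Rightarrow> ('k, 'a) vs \<Rightarrow> ('k, 'a) alg" where
  "cofree_coalg K C \<Delta> V = (schur K C V, cooperad_comult K C \<Delta> V)"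

definition comparison_ob ::
  "'k ring \<Rightarrow> ('k, 'a) smodule \<Rightarrow> ('k, 'a) smap \<Rightarrow> ('k, 'a) smodule \<Rightarrow> ('k, 'a) smap
     \<Rightarrow> ('k, 'a) vs \<Rightarrow> ('k, 'a) bialg" where
  "comparison_ob K A \<gamma> C l V = bialg_of K A C l (schur K A V) (operad_mult K A \<gamma> V)
     (dist_nat K A C l V \<bullet>\<^bsub>Vect K\<^esub> schur_map K A (schur_unit K C V))"

definition comparison ::
  "'k ring \<Rightarrow> ('k, 'a) smodule \<Rightarrow> ('k, 'a) smap \<Rightarrow> ('k, 'a) smodule \<Rightarrow> ('k, 'a) smap
     \<Rightarrow> (('k, 'a) vs, ('k, 'a) vmap, ('k, 'a) bialg, ('k, 'a) bialgmap) func" where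
  "comparison K A \<gamma> C l = \<lparr>
     FOb = comparison_ob K A \<gamma> C l,
     FArr = (\<lambda>f. let V = Dom (Vect K) f; W = Cod (Vect K) f in
       (comparison_ob K A \<gamma> C l V,
        (free_alg K A \<gamma> V, schur_map K A f, free_alg K A \<gamma> W),
        comparison_ob K A \<gamma> C l W))\<rparr>"

definition Prim ::
  "'k ring \<Rightarrow> ('k, 'a) smodule \<Rightarrow> ('k, 'a) vs \<Rightarrow> ('k, 'a) vmap \<Rightarrow> ('k, 'a) vs" where
  "Prim K C H \<theta> =
     H\<lparr>carrier := {x \<in> carrier H. vmap_fun \<theta> x = vmap_fun (schur_unit K C H) x}\<rparr>"

text \<open>\<open>(H, h)\<close> is free on its subspace \<open>P\<close>: it is isomorphic to the free algebra on \<open>P\<close>, compatibly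
  with the inclusions of \<open>P\<close> on both sides. Dually for coalgebras.\<close>

definition free_on ::
  "'k ring \<Rightarrow> ('k, 'a) smodule \<Rightarrow> ('k, 'a) smap \<Rightarrow> ('k, 'a) alg \<Rightarrow> ('k, 'a) vs \<Rightarrow> bool" where
  "free_on K A \<gamma> X P \<longleftrightarrow> (\<exists>f.
     iso_arr (operad_algebras K A \<gamma>) (free_alg K A \<gamma> P, f, X) \<and>
     (\<forall>x\<in>carrier P. vmap_fun f (vmap_fun (schur_unit K A P) x) = x))"

definition cofree_on ::
  "'k ring \<Rightarrow> ('k, 'a) smodule \<Rightarrow> ('k, 'a) smap \<Rightarrow> ('k, 'a) alg \<Rightarrow> ('k, 'a) vs \<Rightarrow> bool" where
  "cofree_on K C \<Delta> X P \<longleftrightarrow> (\<exists>f.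
     iso_arr (cooperad_coalgebras K C \<Delta>) (X, f, cofree_coalg K C \<Delta> P) \<and>
     (\<forall>x\<in>carrier P. vmap_fun f x = vmap_fun (schur_unit K C P) x))"

end

theory Submission
  imports Defs
begin

text \<open>
  Let \<open>T\<close> and \<open>G\<close> be the monad of \<open>A\<close> and the comonad of \<open>C\<close>. As \<open>A(1)\<close> and \<open>C(1)\<close> are the ground field, the
  coaction \<open>a\<close> of the free algebras satisfies \<open>a e\<^sub>A = e\<^sub>C e\<^sub>A\<close>, and compatibility with the multiplication
  gives \<open>a = \<lambda> T(e\<^sub>C)\<close>; so the free bialgebras are the values of the comparison functor.
  For every algebra \<open>(H, h)\<close> the map \<open>\<kappa> = G(h) a : T(H) \<rightarrow> G(H)\<close> is bijective, because it
  differs from the isomorphism \<open>\<phi> = G(\<epsilon>\<^sub>A) a\<close> by a map that lowers the arity. It is a morphism from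
  the comonad of free algebras to the lifted comonad.
  For a bialgebra \<open>(H, h, \<theta>)\<close> put \<open>S = \<kappa>\<^sup>-\<^sup>1 \<theta> : H \<rightarrow> T(H)\<close>. Then \<open>h S = 1\<close> and \<open>T(S) S = T(e\<^sub>A) S\<close>, and
  since \<open>e\<^sub>A\<close> has the natural retraction \<open>\<epsilon>\<^sub>A\<close>, the map \<open>\<epsilon>\<^sub>A S\<close> is an idempotent with image
  \<open>Prim H\<close> such that \<open>T(\<epsilon>\<^sub>A S) S = S\<close>. So \<open>S\<close> factors through \<open>T(Prim H)\<close> and inverts the
  algebra map \<open>T(Prim H) \<rightarrow> H\<close>; no exactness of Schur functors is needed.
  The identification of \<open>F\<^bsub>M \<circ> N\<^esub>\<close> with the composite of \<open>F\<^sub>M\<close> and \<open>F\<^sub>N\<close>, on which the multiplication of \<open>T\<close> rests, is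
  inverted by multilinear extension from generators.
\<close>

text \<open>An element of a presented space is a chosen representative, so maps out of such a space
  are given on generators and compared there. The inverse of \<open>F_(M o N) -> F_M F_N\<close>
  resists this: the arguments of a generator of \<open>F_M F_N(V)\<close> are arbitrary elements of
  \<open>F_N(V)\<close>, and a choice of representatives for them is not additive. Hence the
  existence and uniqueness of multilinear maps prescribed on generators. \<open>\<kappa>\<close> is
  bijective because \<open>\<phi>\<^sup>-\<^sup>1 \<kappa>\<close> is the identity plus a map that
  strictly lowers arity, and each element involves finitely many arities. The equations for
  \<open>S\<close> are the axioms of \<open>\<theta>\<close> read through \<open>\<kappa>\<close>:
  the counit gives \<open>h S = 1\<close>, coassociativity the other one. A kernel of
  \<open>\<theta> - e\<close> would have to be preserved by \<open>T\<close>; the retraction of the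
  unit makes the equalizer of \<open>S\<close> and the unit a split one, and split equalizers are
  preserved by every functor. For cofreeness \<open>\<phi>\<close> takes the place of
  \<open>\<kappa>\<close>: it is an isomorphism of coalgebras from \<open>T(P)\<close> to
  \<open>G(P)\<close> that carries the unit of \<open>A\<close> to the inclusion of the arity one
  summand of \<open>C\<close>.\<close>

section \<open>Presented spaces\<close>

text \<open>Keeps membership in \<open>lists\<close> from being split into statements on elements.\<close>

declare in_listsI [rule del] in_listsD [rule del]

text \<open>\<open>lin_ext\<close> evaluates the chosen representative of a class. Evaluation of an
  arbitrary list is split off, so that independence of the representative becomes invariance of
  \<open>leval\<close> under \<open>pres_eq\<close>.\<close>

definition leval :: "('k, 'a) vs \<Rightarrow> (('k, 'a) gen \<Rightarrow> ('k, 'a) univ) \<Rightarrow> ('k, 'a) formal \<Rightarrow> ('k, 'a) univ" where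
  "leval W f ts = foldr (\<lambda>(c, g) w. c \<odot>\<^bsub>W\<^esub> f g \<oplus>\<^bsub>W\<^esub> w) ts \<zero>\<^bsub>W\<^esub>"

lemma leval_Nil [simp]: "leval W f [] = \<zero>\<^bsub>W\<^esub>"
  and leval_Cons [simp]: "leval W f ((c, g) # ts) = c \<odot>\<^bsub>W\<^esub> f g \<oplus>\<^bsub>W\<^esub> leval W f ts"
  by (simp_all add: leval_def)

lemma lin_ext_leval: "lin_ext W f x = leval W f (terms x)"
  by (simp add: lin_ext_def leval_def)

lemma lin_mapsI:
  assumes "\<And>x. x \<in> carrier V \<Longrightarrow> f x \<in> carrier W"
    and "\<And>x y. x \<in> carrier V \<Longrightarrow> y \<in> carrier V \<Longrightarrow> f (x \<oplus>\<^bsub>V\<^esub> y) = f x \<oplus>\<^bsub>W\<^esub> f y"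
    and "\<And>c x. c \<in> carrier K \<Longrightarrow> x \<in> carrier V \<Longrightarrow> f (c \<odot>\<^bsub>V\<^esub> x) = c \<odot>\<^bsub>W\<^esub> f x"
  shows "f \<in> lin_maps K V W"
  using assms by (auto simp: lin_maps_def)

lemma lin_maps_closed: "f \<in> lin_maps K V W \<Longrightarrow> x \<in> carrier V \<Longrightarrow> f x \<in> carrier W"
  and lin_maps_add: "f \<in> lin_maps K V W \<Longrightarrow> x \<in> carrier V \<Longrightarrow> y \<in> carrier V \<Longrightarrow> f (x \<oplus>\<^bsub>V\<^esub> y) = f x \<oplus>\<^bsub>W\<^esub> f y"
  and lin_maps_smult: "f \<in> lin_maps K V W \<Longrightarrow> c \<in> carrier K \<Longrightarrow> x \<in> carrier V \<Longrightarrow> f (c \<odot>\<^bsub>V\<^esub> x) = c \<odot>\<^bsub>W\<^esub> f x"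
  by (auto simp: lin_maps_def)

lemma lin_maps_cong: "f \<in> lin_maps K V W \<Longrightarrow> module K V \<Longrightarrow> (\<And>x. x \<in> carrier V \<Longrightarrow> f x = g x) \<Longrightarrow> g \<in> lin_maps K V W"
  unfolding lin_maps_def
  by (auto simp: Pi_iff module.smult_closed abelian_monoid.a_closed[OF abelian_group.axioms(1)[OF module.axioms(2)]])

lemma lin_maps_compose:
  "f \<in> lin_maps K U V \<Longrightarrow> g \<in> lin_maps K V W \<Longrightarrow> (\<lambda>x. g (f x)) \<in> lin_maps K U W"
  by (auto simp: lin_maps_def Pi_iff)

lemma lin_maps_id: "(\<lambda>x. x) \<in> lin_maps K V V"
  by (auto simp: lin_maps_def)

lemma lin_maps_zero:
  assumes "module K M" "module K N" "f \<in> lin_maps K M N"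
  shows "f \<zero>\<^bsub>M\<^esub> = \<zero>\<^bsub>N\<^esub>"
proof -
  interpret M: module K M by fact
  interpret N: module K N by fact
  have "f (\<zero>\<^bsub>K\<^esub> \<odot>\<^bsub>M\<^esub> \<zero>\<^bsub>M\<^esub>) = \<zero>\<^bsub>K\<^esub> \<odot>\<^bsub>N\<^esub> f \<zero>\<^bsub>M\<^esub>"
    using assms by (intro lin_maps_smult) auto
  moreover have "f \<zero>\<^bsub>M\<^esub> \<in> carrier N" using assms by (auto intro: lin_maps_closed)
  ultimately show ?thesis by simp
qed

text \<open>The condition on \<open>R\<close> keeps derivations of \<open>pres_eq\<close> inside
  combinations of scalars from \<open>K\<close> and generators from \<open>X\<close>;
  \<open>eqv_closed\<close> and all evaluation arguments rest on this.\<close>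

locale presentation = cring K for K :: "'k ring" (structure) +
  fixes X :: "('k, 'a) gen set" and R :: "(('k, 'a) formal \<times> ('k, 'a) formal) set"
  assumes rels: "R \<subseteq> lists (carrier K \<times> X) \<times> lists (carrier K \<times> X)"
begin

abbreviation "L \<equiv> lists (carrier K \<times> X)"
abbreviation eqv (infix "\<approx>" 50) where "eqv \<equiv> pres_eq K X R"
abbreviation "cls \<equiv> pres_cls K X R"
abbreviation "V \<equiv> presented K X R"

lemma scale_formal_simps [simp]:
  "scale_formal K c [] = []" "scale_formal K c ((d, g) # ts) = (c \<otimes> d, g) # scale_formal K c ts"
  "scale_formal K c (ts @ us) = scale_formal K c ts @ scale_formal K c us"
  by (simp_all add: scale_formal_def)

lemma scale_formal_closed: "c \<in> carrier K \<Longrightarrow> ts \<in> L \<Longrightarrow> scale_formal K c ts \<in> L"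
  by (induction ts) (auto simp: scale_formal_def)

lemma eqv_closed: "ts \<approx> us \<Longrightarrow> ts \<in> L \<and> us \<in> L"
  by (induction rule: pres_eq.induct) (use rels in \<open>auto intro: scale_formal_closed\<close>)

text \<open>Equivalent lists have the same predicate \<open>eqv ts\<close>, and \<open>SOME\<close>
  makes the same choice for equal predicates. Classes are therefore compared by plain
  equality.\<close>

lemma eqv_cls: "ts \<approx> us \<Longrightarrow> cls ts = cls us"
proof -
  assume *: "ts \<approx> us"
  have "eqv ts = eqv us" using * by (blast intro: pres_eq.trans pres_eq.sym)
  then show ?thesis by (simp add: pres_cls_def)
qed

lemma terms_cls: "ts \<in> L \<Longrightarrow> ts \<approx> terms (cls ts)"
  unfolding pres_cls_def by (simp, rule someI, erule pres_eq.refl)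

lemma cls_closed: "ts \<in> L \<Longrightarrow> cls ts \<in> carrier V"
  by (simp add: presented_def)

lemma carrierE:
  assumes "x \<in> carrier V" obtains ts where "ts \<in> L" "x = cls ts"
  using assms by (auto simp: presented_def)

lemma cls_append: "ts \<in> L \<Longrightarrow> us \<in> L \<Longrightarrow> cls (ts @ us) = cls ts \<oplus>\<^bsub>V\<^esub> cls us"
  by (simp add: presented_def, rule eqv_cls, rule pres_eq.append; rule terms_cls)

lemma cls_scale: "c \<in> carrier K \<Longrightarrow> ts \<in> L \<Longrightarrow> cls (scale_formal K c ts) = c \<odot>\<^bsub>V\<^esub> cls ts"
  by (simp add: presented_def, rule eqv_cls, rule pres_eq.scale, assumption, rule terms_cls)

lemma cls_Nil: "cls [] = \<zero>\<^bsub>V\<^esub>"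
  by (simp add: presented_def)

text \<open>Distributivity over scalars is not a rule of \<open>pres_eq\<close>:
  \<open>collect\<close> merges only two neighbouring terms with the same generator. The induction
  moves the head of the second copy past the tail of the first.\<close>

lemma scale_add: "c \<in> carrier K \<Longrightarrow> d \<in> carrier K \<Longrightarrow> ts \<in> L \<Longrightarrow>
   scale_formal K c ts @ scale_formal K d ts \<approx> scale_formal K (c \<oplus> d) ts"
proof (induction ts)
  case (Cons a ts)
  obtain b g where a: "a = (b, g)" by (rule prod.exhaust)
  have mem: "b \<in> carrier K" "g \<in> X" "ts \<in> L" using Cons.prems a by auto
  note cl = scale_formal_closed[OF Cons.prems(1) mem(3)] scale_formal_closed[OF Cons.prems(2) mem(3)]
  have "[(c \<otimes> b, g)] @ (scale_formal K c ts @ [(d \<otimes> b, g)]) @ scale_formal K d ts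
      \<approx> [(c \<otimes> b, g)] @ ([(d \<otimes> b, g)] @ scale_formal K c ts) @ scale_formal K d ts"
    using cl mem Cons.prems
    by (intro pres_eq.append pres_eq.comm) (auto intro: pres_eq.refl)
  moreover have "([(c \<otimes> b, g)] @ [(d \<otimes> b, g)]) @ (scale_formal K c ts @ scale_formal K d ts) 
     \<approx> [((c \<oplus> d) \<otimes> b, g)] @ scale_formal K (c \<oplus> d) ts"
    using mem Cons pres_eq.collect[of "c \<otimes> b" K "d \<otimes> b" g X R]
    by (intro pres_eq.append) (auto simp: l_distr)
  ultimately show ?case unfolding a by simp (rule pres_eq.trans)
qed (auto intro: pres_eq.refl)

lemma scale_zero: "ts \<in> L \<Longrightarrow> scale_formal K \<zero> ts \<approx> []"
proof (induction ts)
  case (Cons a ts)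
  obtain b g where a: "a = (b, g)" by (rule prod.exhaust)
  have mem: "b \<in> carrier K" "g \<in> X" "ts \<in> L" using Cons.prems a by auto
  show ?case unfolding a using mem Cons pres_eq.append[OF pres_eq.zero[of g X K R], of "scale_formal K \<zero> ts" "[]"]
    by simp
qed (auto intro: pres_eq.refl)

lemma scale_one: "ts \<in> L \<Longrightarrow> scale_formal K \<one> ts = ts"
  by (induction ts) auto

lemma scale_scale: "ts \<in> L \<Longrightarrow> c \<in> carrier K \<Longrightarrow> d \<in> carrier K \<Longrightarrow>
    scale_formal K c (scale_formal K d ts) = scale_formal K (c \<otimes> d) ts"
  by (induction ts) (auto simp: m_assoc)

lemma presented_module: "module K V"
proof (rule moduleI)
  show "abelian_group V"
  proof (rule abelian_groupI)
    fix x y assume "x \<in> carrier V" "y \<in> carrier V"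
    then obtain ts us where t: "ts \<in> L" "x = cls ts" "us \<in> L" "y = cls us" by (auto elim!: carrierE)
    then show "x \<oplus>\<^bsub>V\<^esub> y \<in> carrier V" by (simp flip: cls_append) (rule cls_closed, simp)
    show "x \<oplus>\<^bsub>V\<^esub> y = y \<oplus>\<^bsub>V\<^esub> x" using t by (simp flip: cls_append) (rule eqv_cls, rule pres_eq.comm)
    fix z assume "z \<in> carrier V"
    then obtain ws where "ws \<in> L" "z = cls ws" by (auto elim!: carrierE)
    then show "(x \<oplus>\<^bsub>V\<^esub> y) \<oplus>\<^bsub>V\<^esub> z = x \<oplus>\<^bsub>V\<^esub> (y \<oplus>\<^bsub>V\<^esub> z)" using t 
      by (simp add: append_in_lists_conv flip: cls_append)
  next
    fix x assume "x \<in> carrier V"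
    then obtain ts where t: "ts \<in> L" "x = cls ts" by (auto elim!: carrierE)
    then show "\<zero>\<^bsub>V\<^esub> \<oplus>\<^bsub>V\<^esub> x = x" using cls_append[of "[]" ts] by (simp flip: cls_Nil)
    \<comment> \<open>No negation is built in. The inverse of a class is its multiple by -1;
      \<open>scale_add\<close> and \<open>scale_zero\<close> make the sum vanish.\<close>
    have "cls (scale_formal K (\<ominus> \<one>) ts) \<oplus>\<^bsub>V\<^esub> x = cls (scale_formal K (\<ominus> \<one>) ts @ ts)"
      using t by (subst cls_append) (auto intro: scale_formal_closed)
    also have "\<dots> = cls (scale_formal K (\<ominus> \<one> \<oplus> \<one>) ts)"
      using scale_add[of "\<ominus> \<one>" \<one> ts] t by (intro eqv_cls) (simp add: scale_one)
    also have "\<dots> = \<zero>\<^bsub>V\<^esub>" unfolding cls_Nil[symmetric]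
      using scale_zero[of ts] t by (intro eqv_cls) (simp add: l_neg)
    finally show "\<exists>y\<in>carrier V. y \<oplus>\<^bsub>V\<^esub> x = \<zero>\<^bsub>V\<^esub>"
      using t by (intro bexI[of _ "cls (scale_formal K (\<ominus> \<one>) ts)"] cls_closed scale_formal_closed) auto
  next
    show "\<zero>\<^bsub>V\<^esub> \<in> carrier V" unfolding cls_Nil[symmetric] by (rule cls_closed) simp
  qed
next
  fix c x assume c: "c \<in> carrier K" and "x \<in> carrier V"
  then obtain ts where t: "ts \<in> L" "x = cls ts" by (auto elim!: carrierE)
  show "c \<odot>\<^bsub>V\<^esub> x \<in> carrier V" using t c by (simp add: cls_closed scale_formal_closed flip: cls_scale)
  fix d assume d: "d \<in> carrier K"
  show "(c \<oplus> d) \<odot>\<^bsub>V\<^esub> x = c \<odot>\<^bsub>V\<^esub> x \<oplus>\<^bsub>V\<^esub> d \<odot>\<^bsub>V\<^esub> x"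
    using t c d by (simp add: scale_formal_closed flip: cls_scale cls_append)
      (rule eqv_cls[symmetric], rule scale_add)
  show "(c \<otimes> d) \<odot>\<^bsub>V\<^esub> x = c \<odot>\<^bsub>V\<^esub> (d \<odot>\<^bsub>V\<^esub> x)"
    using t c d by (simp add: scale_formal_closed scale_scale flip: cls_scale)
next
  fix c x y assume c: "c \<in> carrier K" and "x \<in> carrier V" "y \<in> carrier V"
  then obtain ts us where t: "ts \<in> L" "x = cls ts" "us \<in> L" "y = cls us" by (auto elim!: carrierE)
  show "c \<odot>\<^bsub>V\<^esub> (x \<oplus>\<^bsub>V\<^esub> y) = c \<odot>\<^bsub>V\<^esub> x \<oplus>\<^bsub>V\<^esub> c \<odot>\<^bsub>V\<^esub> y"
    using t c by (simp add: scale_formal_closed append_in_lists_conv flip: cls_scale cls_append)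
next
  fix x assume "x \<in> carrier V"
  then show "\<one> \<odot>\<^bsub>V\<^esub> x = x" by (auto elim!: carrierE simp: scale_one simp flip: cls_scale)
qed (rule is_cring)

sublocale V: module K V by (rule presented_module)

abbreviation "gn g \<equiv> cls [(\<one>, g)]"

lemma gn_closed: "g \<in> X \<Longrightarrow> gn g \<in> carrier V"
  by (rule cls_closed) auto

lemma cls_single: "c \<in> carrier K \<Longrightarrow> g \<in> X \<Longrightarrow> cls [(c, g)] = c \<odot>\<^bsub>V\<^esub> gn g"
  by (subst cls_scale[symmetric]) auto

lemma cls_Cons: "c \<in> carrier K \<Longrightarrow> g \<in> X \<Longrightarrow> ts \<in> L \<Longrightarrow> cls ((c, g) # ts) = c \<odot>\<^bsub>V\<^esub> gn g \<oplus>\<^bsub>V\<^esub> cls ts"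
  using cls_append[of "[(c, g)]" ts] cls_single[of c g] by simp

lemma cls_rel: "(ts, us) \<in> R \<Longrightarrow> cls ts = cls us"
  by (rule eqv_cls, rule pres_eq.rel)

lemma presented_induct [consumes 1, case_names zero step]:
  assumes "x \<in> carrier V" "P \<zero>\<^bsub>V\<^esub>"
    "\<And>c g y. c \<in> carrier K \<Longrightarrow> g \<in> X \<Longrightarrow> y \<in> carrier V \<Longrightarrow> P y \<Longrightarrow> P (c \<odot>\<^bsub>V\<^esub> gn g \<oplus>\<^bsub>V\<^esub> y)"
  shows "P x"
proof -
  obtain ts where "ts \<in> L" "x = cls ts" using assms(1) by (rule carrierE)
  moreover have "ts \<in> L \<Longrightarrow> P (cls ts)" for ts
  proof (induction ts)
    case Nil
    then show ?case by (simp add: cls_Nil assms)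
  next
    case (Cons a ts)
    obtain c g where "a = (c, g)" by (rule prod.exhaust)
    then show ?case using Cons assms(3)[of c g "cls ts"] cls_Cons[of c g ts] cls_closed by auto
  qed
  ultimately show ?thesis by simp
qed

lemma lin_maps_eqI:
  assumes "module K W" "f \<in> lin_maps K V W" "g \<in> lin_maps K V W" "\<And>z. z \<in> X \<Longrightarrow> f (gn z) = g (gn z)" "x \<in> carrier V"
  shows "f x = g x"
  using assms(5)
proof (induction rule: presented_induct)
  case zero
  show ?case using assms lin_maps_zero[OF presented_module] by metis
next
  case (step c g y)
  then show ?case using assms by (simp add: lin_maps_add lin_maps_smult gn_closed)
qed

context
  fixes W :: "('k, 'a) vs" and f
  assumes W: "module K W" and f: "\<And>g. g \<in> X \<Longrightarrow> f g \<in> carrier W"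
begin

interpretation W: module K W by (rule W)

lemma leval_closed: "ts \<in> L \<Longrightarrow> leval W f ts \<in> carrier W"
  by (induction ts) (auto simp: f)

lemma leval_append: "ts \<in> L \<Longrightarrow> us \<in> L \<Longrightarrow> leval W f (ts @ us) = leval W f ts \<oplus>\<^bsub>W\<^esub> leval W f us"
  by (induction ts) (auto simp: f leval_closed W.a_assoc)

lemma leval_scale: "c \<in> carrier K \<Longrightarrow> ts \<in> L \<Longrightarrow> leval W f (scale_formal K c ts) = c \<odot>\<^bsub>W\<^esub> leval W f ts"
  by (induction ts) (auto simp: f leval_closed W.smult_r_distr W.smult_assoc1)

context
  assumes resp: "\<And>ts us. (ts, us) \<in> R \<Longrightarrow> leval W f ts = leval W f us"
begin

text \<open>Every rule of \<open>pres_eq\<close> other than \<open>rel\<close> is a property of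
  equality or a module law in \<open>W\<close>, so only the listed relations have to be
  checked.\<close>

lemma leval_eqv: "ts \<approx> us \<Longrightarrow> leval W f ts = leval W f us"
proof (induction rule: pres_eq.induct)
  case (append ts ts' us us')
  then show ?case using eqv_closed[OF append.hyps(1)] eqv_closed[OF append.hyps(2)] by (simp add: leval_append)
next
  case (scale c ts us)
  then show ?case using eqv_closed[OF scale.hyps(2)] by (simp add: leval_scale)
next
  case (comm ts us)
  then show ?case by (simp add: leval_append leval_closed W.a_comm)
next
  case (collect c d g)
  then show ?case by (simp add: f W.smult_l_distr)
next
  case (zero g)
  then show ?case by (simp add: f)
qed (auto simp: resp)

lemma lin_ext_cls: "ts \<in> L \<Longrightarrow> lin_ext W f (cls ts) = leval W f ts"
  unfolding lin_ext_leval by (rule leval_eqv[symmetric], rule terms_cls)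

lemma lin_ext_gn: "g \<in> X \<Longrightarrow> lin_ext W f (gn g) = f g"
  by (subst lin_ext_cls) (auto simp: f)

lemma lin_ext_lin: "lin_ext W f \<in> lin_maps K V W"
proof (rule lin_mapsI)
  fix x y assume "x \<in> carrier V" "y \<in> carrier V"
  then obtain ts us where t: "ts \<in> L" "x = cls ts" "us \<in> L" "y = cls us" by (auto elim!: carrierE)
  then show "lin_ext W f x \<in> carrier W" by (simp add: lin_ext_cls leval_closed)
  show "lin_ext W f (x \<oplus>\<^bsub>V\<^esub> y) = lin_ext W f x \<oplus>\<^bsub>W\<^esub> lin_ext W f y"
    using t by (simp add: lin_ext_cls append_in_lists_conv leval_append flip: cls_append)
next
  fix c x assume "c \<in> carrier K" "x \<in> carrier V"
  then show "lin_ext W f (c \<odot>\<^bsub>V\<^esub> x) = c \<odot>\<^bsub>W\<^esub> lin_ext W f x"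
    by (auto elim!: carrierE simp: lin_ext_cls scale_formal_closed leval_scale simp flip: cls_scale)
qed

end
end

end

section \<open>Schur functors\<close>

lemma length_lperm [simp]: "length (lperm \<sigma> xs) = length xs"
  by (simp add: lperm_def)

lemma lperm_Nil_iff [simp]: "lperm \<sigma> xs = [] \<longleftrightarrow> xs = []"
  using length_lperm[of \<sigma> xs] by (metis length_0_conv)

lemma nth_lperm:
  assumes "\<sigma> permutes {..<length xs}" "i < length xs"
  shows "lperm \<sigma> xs ! i = xs ! (Hilbert_Choice.inv \<sigma> i)"
  using assms by (simp add: lperm_def permute_list_nth permutes_inv)

lemma set_lperm: "\<sigma> permutes {..<length xs} \<Longrightarrow> set (lperm \<sigma> xs) = set xs"
  by (simp add: lperm_def permutes_inv)

lemma map_lperm: "\<sigma> permutes {..<length xs} \<Longrightarrow> map f (lperm \<sigma> xs) = lperm \<sigma> (map f xs)"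
  by (simp add: lperm_def permute_list_map permutes_inv)

text \<open>Position \<open>j\<close> of \<open>lperm \<sigma> xs\<close> reads \<open>xs\<close> at
  the preimage of \<open>j\<close>, so the entry at \<open>i\<close> travels to position
  \<open>\<sigma> i\<close>.\<close>

lemma lperm_update:
  assumes "\<sigma> permutes {..<length xs}" "i < length xs"
  shows "lperm \<sigma> (xs[i := v]) = (lperm \<sigma> xs)[\<sigma> i := v]"
proof (rule nth_equalityI)
  fix j assume j: "j < length (lperm \<sigma> (xs[i := v]))"
  have "Hilbert_Choice.inv \<sigma> j = i \<longleftrightarrow> \<sigma> i = j" "Hilbert_Choice.inv \<sigma> j < length xs"
    using permutes_inverses[OF assms(1)] permutes_in_image[OF permutes_inv[OF assms(1)], of j] j by auto
  then show "lperm \<sigma> (xs[i := v]) ! j = (lperm \<sigma> xs)[\<sigma> i := v] ! j"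
    using assms j by (auto simp: nth_lperm nth_list_update)
qed (use assms in simp)

section \<open>Multilinear maps on lists\<close>

definition mlin :: "'k ring \<Rightarrow> nat \<Rightarrow> ('k, 'a) vs \<Rightarrow> ('k, 'a) vs \<Rightarrow> (('k, 'a) univ list \<Rightarrow> ('k, 'a) univ) \<Rightarrow> bool" where
  "mlin K k V W f \<longleftrightarrow> (\<forall>ys. length ys = k \<longrightarrow> set ys \<subseteq> carrier V \<longrightarrow> f ys \<in> carrier W \<and>
     (\<forall>i<k. (\<forall>v\<in>carrier V. \<forall>w\<in>carrier V. f (ys[i := v \<oplus>\<^bsub>V\<^esub> w]) = f (ys[i := v]) \<oplus>\<^bsub>W\<^esub> f (ys[i := w])) \<and>
       (\<forall>c\<in>carrier K. \<forall>v\<in>carrier V. f (ys[i := c \<odot>\<^bsub>V\<^esub> v]) = c \<odot>\<^bsub>W\<^esub> f (ys[i := v]))))"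

lemma mlinI:
  assumes "\<And>ys. length ys = k \<Longrightarrow> set ys \<subseteq> carrier V \<Longrightarrow> f ys \<in> carrier W"
    and "\<And>ys i v w. length ys = k \<Longrightarrow> set ys \<subseteq> carrier V \<Longrightarrow> i < k \<Longrightarrow> v \<in> carrier V \<Longrightarrow> w \<in> carrier V \<Longrightarrow>
      f (ys[i := v \<oplus>\<^bsub>V\<^esub> w]) = f (ys[i := v]) \<oplus>\<^bsub>W\<^esub> f (ys[i := w])"
    and "\<And>ys i c v. length ys = k \<Longrightarrow> set ys \<subseteq> carrier V \<Longrightarrow> i < k \<Longrightarrow> c \<in> carrier K \<Longrightarrow> v \<in> carrier V \<Longrightarrow>
      f (ys[i := c \<odot>\<^bsub>V\<^esub> v]) = c \<odot>\<^bsub>W\<^esub> f (ys[i := v])"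
  shows "mlin K k V W f"
  unfolding mlin_def using assms by blast

lemma mlin_closed: "mlin K k V W f \<Longrightarrow> length ys = k \<Longrightarrow> set ys \<subseteq> carrier V \<Longrightarrow> f ys \<in> carrier W"
  and mlin_add: "mlin K k V W f \<Longrightarrow> length ys = k \<Longrightarrow> set ys \<subseteq> carrier V \<Longrightarrow> i < k \<Longrightarrow>
    v \<in> carrier V \<Longrightarrow> w \<in> carrier V \<Longrightarrow> f (ys[i := v \<oplus>\<^bsub>V\<^esub> w]) = f (ys[i := v]) \<oplus>\<^bsub>W\<^esub> f (ys[i := w])"
  and mlin_smult: "mlin K k V W f \<Longrightarrow> length ys = k \<Longrightarrow> set ys \<subseteq> carrier V \<Longrightarrow> i < k \<Longrightarrow>
    c \<in> carrier K \<Longrightarrow> v \<in> carrier V \<Longrightarrow> f (ys[i := c \<odot>\<^bsub>V\<^esub> v]) = c \<odot>\<^bsub>W\<^esub> f (ys[i := v])"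
  unfolding mlin_def by blast+

lemma mlin_compose: "mlin K k V W f \<Longrightarrow> h \<in> lin_maps K W U \<Longrightarrow> mlin K k V U (\<lambda>ys. h (f ys))"
  by (rule mlinI) (simp_all add: mlin_closed mlin_add mlin_smult lin_maps_closed lin_maps_add lin_maps_smult set_update_subsetI)

lemma mlin_map:
  assumes "mlin K k V W f" "g \<in> lin_maps K V' V"
  shows "mlin K k V' W (\<lambda>ys. f (map g ys))"
proof -
  have "set ys \<subseteq> carrier V' \<Longrightarrow> set (map g ys) \<subseteq> carrier V" for ys
    using assms(2) by (auto intro: lin_maps_closed)
  then show ?thesis
    using assms by (intro mlinI) (simp_all add: map_update mlin_closed mlin_add mlin_smult lin_maps_closed lin_maps_add lin_maps_smult del: set_map)
qed

lemma mlin_lperm: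
  assumes "mlin K k V W f" "\<sigma> permutes {..<k}"
  shows "mlin K k V W (\<lambda>ys. f (lperm \<sigma> ys))"
proof -
  have "\<sigma> i < k" if "i < k" for i using assms(2) that permutes_in_image by force
  then show ?thesis
  using assms by (intro mlinI) (auto simp add: lperm_update set_lperm mlin_closed mlin_add mlin_smult)
qed

text \<open>Induction on the number \<open>j\<close> of leading positions that may carry arbitrary
  elements: one more position is freed by spanning induction in that argument alone. The induction
  principle of \<open>Z\<close> enters as the premise \<open>ind\<close>, so that any spanning set
  \<open>G\<close> with such a principle will do.\<close>

lemma mlin_eqI:
  assumes Z: "module K Z" and W: "module K W"
    and ind: "\<And>P x. x \<in> carrier Z \<Longrightarrow> P \<zero>\<^bsub>Z\<^esub> \<Longrightarrow> (\<And>c g y. c \<in> carrier K \<Longrightarrow> g \<in> G \<Longrightarrow> y \<in> carrier Z \<Longrightarrow> P y \<Longrightarrow> P (c \<odot>\<^bsub>Z\<^esub> g \<oplus>\<^bsub>Z\<^esub> y)) \<Longrightarrow> P x"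
    and G: "G \<subseteq> carrier Z"
    and f: "mlin K k Z W f" "mlin K k Z W f'"
    and eq: "\<And>gs. length gs = k \<Longrightarrow> set gs \<subseteq> G \<Longrightarrow> f gs = f' gs"
    and ys: "length ys = k" "set ys \<subseteq> carrier Z"
  shows "f ys = f' ys"
proof -
  interpret Z: module K Z by (rule Z)
  interpret W: module K W by (rule W)
  have zero: "h (xs[i := \<zero>\<^bsub>Z\<^esub>]) = \<zero>\<^bsub>W\<^esub>" if "mlin K k Z W h" "length xs = k" "set xs \<subseteq> carrier Z" "i < k" for h xs i
    using mlin_smult[OF that(1-4), of "\<zero>\<^bsub>K\<^esub>" "\<zero>\<^bsub>Z\<^esub>"] mlin_closed[OF that(1), of "xs[i := \<zero>\<^bsub>Z\<^esub>]"] that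
    by (simp add: set_update_subsetI)
  have "\<forall>ys. length ys = k \<longrightarrow> set ys \<subseteq> carrier Z \<longrightarrow> set (drop j ys) \<subseteq> G \<longrightarrow> f ys = f' ys" if "j \<le> k" for j
    using that
  proof (induction j)
    case 0
    then show ?case using eq by simp
  next
    case (Suc j)
    show ?case
    proof (intro allI impI)
      fix ys assume ys: "length ys = k" "set ys \<subseteq> carrier Z" "set (drop (Suc j) ys) \<subseteq> G"
      have j: "j < k" using Suc by simp
      have "f (ys[j := x]) = f' (ys[j := x])" if "x \<in> carrier Z" for x
      proof (rule ind[OF that])
        show "f (ys[j := \<zero>\<^bsub>Z\<^esub>]) = f' (ys[j := \<zero>\<^bsub>Z\<^esub>])" using zero[of f ys j] zero[of f' ys j] f ys j by simp
        fix c g y assume *: "c \<in> carrier K" "g \<in> G" "y \<in> carrier Z" "f (ys[j := y]) = f' (ys[j := y])"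
        \<comment> \<open>With a generator at position \<open>j\<close> the tail from
          \<open>j\<close> on consists of generators again, so the induction hypothesis
          applies.\<close>
        have "drop j (ys[j := g]) = g # drop (Suc j) ys"
          using j ys by (simp add: Cons_nth_drop_Suc[symmetric] drop_update_cancel)
        then have "set (drop j (ys[j := g])) \<subseteq> G" "set (ys[j := g]) \<subseteq> carrier Z"
          using ys * G set_update_subsetI[of ys "carrier Z" g j] by auto
        then have "f (ys[j := g]) = f' (ys[j := g])"
          using Suc ys by simp
        then show "f (ys[j := c \<odot>\<^bsub>Z\<^esub> g \<oplus>\<^bsub>Z\<^esub> y]) = f' (ys[j := c \<odot>\<^bsub>Z\<^esub> g \<oplus>\<^bsub>Z\<^esub> y])"
          using mlin_add[OF f(1) ys(1,2) j, of "c \<odot>\<^bsub>Z\<^esub> g" y] mlin_smult[OF f(1) ys(1,2) j, of c g]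
              mlin_add[OF f(2) ys(1,2) j, of "c \<odot>\<^bsub>Z\<^esub> g" y] mlin_smult[OF f(2) ys(1,2) j, of c g] * G by auto
      qed
      from this[of "ys ! j"] show "f ys = f' ys" using ys j by (auto simp: subset_iff)
    qed
  qed
  from this[of k] show ?thesis using ys by simp
qed

text \<open>The maps on generators that extend to linear maps out of \<open>F_M(V)\<close>:
  multilinear in the arguments, linear in the operation, balanced over the symmetric group. The
  three clauses are used separately, whereas \<open>schur_rels\<close> lists single
  equations.\<close>

definition schur_hom ::
  "'k ring \<Rightarrow> ('k, 'a) smodule \<Rightarrow> ('k, 'a) vs \<Rightarrow> ('k, 'a) vs \<Rightarrow> (('k, 'a) gen \<Rightarrow> ('k, 'a) univ) \<Rightarrow> bool" where
  "schur_hom K M V W f \<longleftrightarrow>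
     (\<forall>n>0. \<forall>\<mu>\<in>carrier (sp M n). mlin K n V W (\<lambda>vs. f (\<mu>, vs))) \<and>
     (\<forall>vs. vs \<noteq> [] \<longrightarrow> set vs \<subseteq> carrier V \<longrightarrow> (\<lambda>\<mu>. f (\<mu>, vs)) \<in> lin_maps K (sp M (length vs)) W) \<and>
     (\<forall>\<mu> vs \<sigma>. (\<mu>, vs) \<in> schur_gens M V \<longrightarrow> \<sigma> permutes {..<length vs} \<longrightarrow>
        f (act M (length vs) \<mu> \<sigma>, vs) = f (\<mu>, lperm \<sigma> vs))"

lemma schur_homI:
  assumes "\<And>n \<mu>. n > 0 \<Longrightarrow> \<mu> \<in> carrier (sp M n) \<Longrightarrow> mlin K n V W (\<lambda>vs. f (\<mu>, vs))"
    and "\<And>vs. vs \<noteq> [] \<Longrightarrow> set vs \<subseteq> carrier V \<Longrightarrow> (\<lambda>\<mu>. f (\<mu>, vs)) \<in> lin_maps K (sp M (length vs)) W"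
    and "\<And>\<mu> vs \<sigma>. (\<mu>, vs) \<in> schur_gens M V \<Longrightarrow> \<sigma> permutes {..<length vs} \<Longrightarrow>
        f (act M (length vs) \<mu> \<sigma>, vs) = f (\<mu>, lperm \<sigma> vs)"
  shows "schur_hom K M V W f"
  using assms by (simp add: schur_hom_def)

lemma schur_hom_mlin: "schur_hom K M V W f \<Longrightarrow> n > 0 \<Longrightarrow> \<mu> \<in> carrier (sp M n) \<Longrightarrow> mlin K n V W (\<lambda>vs. f (\<mu>, vs))"
  and schur_hom_lin: "schur_hom K M V W f \<Longrightarrow> vs \<noteq> [] \<Longrightarrow> set vs \<subseteq> carrier V \<Longrightarrow> (\<lambda>\<mu>. f (\<mu>, vs)) \<in> lin_maps K (sp M (length vs)) W"
  and schur_hom_balance: "schur_hom K M V W f \<Longrightarrow> (\<mu>, vs) \<in> schur_gens M V \<Longrightarrow> \<sigma> permutes {..<length vs} \<Longrightarrow>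
        f (act M (length vs) \<mu> \<sigma>, vs) = f (\<mu>, lperm \<sigma> vs)"
  by (simp_all add: schur_hom_def)

lemma schur_gensI: "vs \<noteq> [] \<Longrightarrow> \<mu> \<in> carrier (sp M (length vs)) \<Longrightarrow> set vs \<subseteq> carrier V \<Longrightarrow> (\<mu>, vs) \<in> schur_gens M V"
  by (simp add: schur_gens_def)

lemma schur_gensD: "(\<mu>, vs) \<in> schur_gens M V \<Longrightarrow> vs \<noteq> [] \<and> 0 < length vs \<and> \<mu> \<in> carrier (sp M (length vs)) \<and> set vs \<subseteq> carrier V"
  by (simp add: schur_gens_def)

lemma schur_gens_update: "(\<mu>, vs) \<in> schur_gens M V \<Longrightarrow> v \<in> carrier V \<Longrightarrow> (\<mu>, vs[i := v]) \<in> schur_gens M V"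
  by (simp add: schur_gens_def set_update_subsetI)

lemma schur_hom_closed: "schur_hom K M V W f \<Longrightarrow> g \<in> schur_gens M V \<Longrightarrow> f g \<in> carrier W"
  by (cases g) (auto dest!: schur_gensD intro: lin_maps_closed[OF schur_hom_lin])

lemma schur_hom_map:
  assumes "schur_hom K M V W f" "g \<in> lin_maps K V' V"
  shows "schur_hom K M V' W (\<lambda>(\<mu>, vs). f (\<mu>, map g vs))"
proof -
  have *: "set ys \<subseteq> carrier V' \<Longrightarrow> set (map g ys) \<subseteq> carrier V" for ys
    using assms(2) by (auto intro: lin_maps_closed)
  show ?thesis
  proof (rule schur_homI)
    fix vs assume "vs \<noteq> []" "set vs \<subseteq> carrier V'"
    then show "(\<lambda>\<mu>. case (\<mu>, vs) of (\<mu>, vs) \<Rightarrow> f (\<mu>, map g vs)) \<in> lin_maps K (sp M (length vs)) W"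
      using schur_hom_lin[OF assms(1), of "map g vs"] * by auto
  next
    fix \<mu> vs \<sigma> assume a: "(\<mu>, vs) \<in> schur_gens M V'" "\<sigma> permutes {..<length vs}"
    then have "(\<mu>, map g vs) \<in> schur_gens M V" using * by (auto simp: schur_gens_def)
    then show "(case (act M (length vs) \<mu> \<sigma>, vs) of (\<mu>, vs) \<Rightarrow> f (\<mu>, map g vs)) = (case (\<mu>, lperm \<sigma> vs) of (\<mu>, vs) \<Rightarrow> f (\<mu>, map g vs))"
      using schur_hom_balance[OF assms(1), of \<mu> "map g vs" \<sigma>] a by (simp add: map_lperm)
  qed (use assms in \<open>auto intro: mlin_map[OF schur_hom_mlin]\<close>)
qed

lemma smor_lin: "smor K M N f \<Longrightarrow> n > 0 \<Longrightarrow> f n \<in> lin_maps K (sp M n) (sp N n)"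
  and smor_act: "smor K M N f \<Longrightarrow> n > 0 \<Longrightarrow> x \<in> carrier (sp M n) \<Longrightarrow> \<sigma> permutes {..<n} \<Longrightarrow> f n (act M n x \<sigma>) = act N n (f n x) \<sigma>"
  by (simp_all add: smor_def)

lemma smor_closed: "smor K M N f \<Longrightarrow> n > 0 \<Longrightarrow> x \<in> carrier (sp M n) \<Longrightarrow> f n x \<in> carrier (sp N n)"
  by (blast intro: lin_maps_closed smor_lin)

lemma smor_gens: "smor K M N f \<Longrightarrow> (\<mu>, vs) \<in> schur_gens M V \<Longrightarrow> (f (length vs) \<mu>, vs) \<in> schur_gens N V"
  by (auto simp: schur_gens_def intro: smor_closed)

lemma lin_gens: "f \<in> lin_maps K V W \<Longrightarrow> (\<mu>, vs) \<in> schur_gens M V \<Longrightarrow> (\<mu>, map f vs) \<in> schur_gens M W"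
  by (auto simp: schur_gens_def intro: lin_maps_closed)

lemma schur_hom_smor:
  assumes "schur_hom K N V W f" "smor K M N \<phi>" "is_smodule K M"
  shows "schur_hom K M V W (\<lambda>(\<mu>, vs). f (\<phi> (length vs) \<mu>, vs))"
proof (rule schur_homI)
  fix n \<mu> assume n: "n > 0" "\<mu> \<in> carrier (sp M n)"
  have "mlin K n V W (\<lambda>vs. f (\<phi> n \<mu>, vs))" by (rule schur_hom_mlin[OF assms(1) n(1) smor_closed[OF assms(2) n]])
  then show "mlin K n V W (\<lambda>vs. case (\<mu>, vs) of (\<mu>, vs) \<Rightarrow> f (\<phi> (length vs) \<mu>, vs))"
    by (auto simp: mlin_def)
next
  fix vs assume "vs \<noteq> []" "set vs \<subseteq> carrier V"
  then show "(\<lambda>\<mu>. case (\<mu>, vs) of (\<mu>, vs) \<Rightarrow> f (\<phi> (length vs) \<mu>, vs)) \<in> lin_maps K (sp M (length vs)) W"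
    using lin_maps_compose[OF smor_lin[OF assms(2)] schur_hom_lin[OF assms(1)], of vs] by auto
next
  fix \<mu> vs \<sigma> assume a: "(\<mu>, vs) \<in> schur_gens M V" "\<sigma> permutes {..<length vs}"
  then show "(case (act M (length vs) \<mu> \<sigma>, vs) of (\<mu>, vs) \<Rightarrow> f (\<phi> (length vs) \<mu>, vs)) = (case (\<mu>, lperm \<sigma> vs) of (\<mu>, vs) \<Rightarrow> f (\<phi> (length vs) \<mu>, vs))"
    using schur_hom_balance[OF assms(1) smor_gens[OF assms(2) a(1)] a(2)] smor_act[OF assms(2), of "length vs" \<mu> \<sigma>] schur_gensD[OF a(1)]
    by simp
qed

locale ground_ring = cring K for K :: "'k ring" (structure)
begin

lemma smodule_module: "is_smodule K M \<Longrightarrow> n > 0 \<Longrightarrow> module K (sp M n)"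
  by (simp add: is_smodule_def)

lemma smodule_act_lin: "is_smodule K M \<Longrightarrow> n > 0 \<Longrightarrow> \<sigma> permutes {..<n} \<Longrightarrow> (\<lambda>x. act M n x \<sigma>) \<in> lin_maps K (sp M n) (sp M n)"
  by (simp add: is_smodule_def)

lemma smodule_act_closed: "is_smodule K M \<Longrightarrow> n > 0 \<Longrightarrow> \<sigma> permutes {..<n} \<Longrightarrow> x \<in> carrier (sp M n) \<Longrightarrow> act M n x \<sigma> \<in> carrier (sp M n)"
  using smodule_act_lin by (rule lin_maps_closed)

lemma module_add: "module K V \<Longrightarrow> x \<in> carrier V \<Longrightarrow> y \<in> carrier V \<Longrightarrow> x \<oplus>\<^bsub>V\<^esub> y \<in> carrier V"
  by (rule abelian_monoid.a_closed[OF abelian_group.axioms(1)[OF module.axioms(2)]])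

lemma module_smult: "module K V \<Longrightarrow> c \<in> carrier K \<Longrightarrow> x \<in> carrier V \<Longrightarrow> c \<odot>\<^bsub>V\<^esub> x \<in> carrier V"
  by (rule module.smult_closed)

lemma schur_presentation:
  assumes M: "is_smodule K M" and V: "module K V"
  shows "presentation K (schur_gens M V) (schur_rels K M V)"
proof unfold_locales
  note [simp] = M V module_add module_smult smodule_module
  have "ts \<in> lists (carrier K \<times> schur_gens M V) \<and> us \<in> lists (carrier K \<times> schur_gens M V)"
    if "(ts, us) \<in> schur_rels K M V" for ts us
    using that
  proof cases
    case (balance \<mu> vs \<sigma>)
    then show ?thesis using smodule_act_closed[OF M] by (auto simp: schur_gens_def set_lperm)
  next
    case (arg_add \<mu> vs i v w)
    then show ?thesis by (auto simp: schur_gens_update)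
  next
    case (arg_scale \<mu> vs i v c)
    then show ?thesis by (auto simp: schur_gens_update)
  qed (auto simp: schur_gens_def)
  then show "schur_rels K M V \<subseteq> lists (carrier K \<times> schur_gens M V) \<times> lists (carrier K \<times> schur_gens M V)"
    by auto
qed

context
  fixes M :: "('k, 'a) smodule" and V :: "('k, 'a) vs" assumes M: "is_smodule K M" and V: "module K V"
begin

interpretation P: presentation K "schur_gens M V" "schur_rels K M V"
  rewrites "presented K (schur_gens M V) (schur_rels K M V) = schur K M V"
    and "\<And>g. pres_cls K (schur_gens M V) (schur_rels K M V) [(\<one>, g)] = schur_cls K M V g"
  using schur_presentation[OF M V] by (simp_all add: schur_def schur_cls_def)

lemma schur_module: "module K (schur K M V)"
  by (rule P.presented_module)

lemma schur_cls_closed: "g \<in> schur_gens M V \<Longrightarrow> schur_cls K M V g \<in> carrier (schur K M V)"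
  by (rule P.gn_closed)

lemmas schur_induct [consumes 1, case_names zero step] = P.presented_induct

lemma schur_lin_maps_eqI:
  assumes "module K W" "f \<in> lin_maps K (schur K M V) W" "g \<in> lin_maps K (schur K M V) W"
    "\<And>\<mu> vs. (\<mu>, vs) \<in> schur_gens M V \<Longrightarrow> f (schur_cls K M V (\<mu>, vs)) = g (schur_cls K M V (\<mu>, vs))" "x \<in> carrier (schur K M V)"
  shows "f x = g x"
  using P.lin_maps_eqI[OF assms(1-3)] assms(4,5) by auto

text \<open>Reads the relations back as equations between classes. This makes
  \<open>schur_cls\<close> the universal instance of \<open>schur_hom\<close>, from which others
  arise by \<open>schur_hom_map\<close> and \<open>schur_hom_smor\<close>.\<close>

lemma schur_cls_hom: "schur_hom K M V (schur K M V) (schur_cls K M V)"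
proof -
  have pair: "P.cls [(\<one>, g), (\<one>, g')] = schur_cls K M V g \<oplus>\<^bsub>schur K M V\<^esub> schur_cls K M V g'"
    if "g \<in> schur_gens M V" "g' \<in> schur_gens M V" for g g'
    using P.cls_Cons[of \<one> g "[(\<one>, g')]"] that by (simp add: P.V.smult_one schur_cls_closed flip: schur_cls_def)
  note * [simp] = M V module_add module_smult smodule_module
  have 1: "schur_cls K M V (\<mu> \<oplus>\<^bsub>sp M (length vs)\<^esub> \<mu>', vs) = schur_cls K M V (\<mu>, vs) \<oplus>\<^bsub>schur K M V\<^esub> schur_cls K M V (\<mu>', vs)"
    if "(\<mu>, vs) \<in> schur_gens M V" "(\<mu>', vs) \<in> schur_gens M V" for \<mu> \<mu>' vs
    using P.cls_rel[OF schur_rels.op_add[OF that]] pair[OF that]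
    by (simp flip: schur_cls_def)
  have 2: "schur_cls K M V (c \<odot>\<^bsub>sp M (length vs)\<^esub> \<mu>, vs) = c \<odot>\<^bsub>schur K M V\<^esub> schur_cls K M V (\<mu>, vs)"
    if "(\<mu>, vs) \<in> schur_gens M V" "c \<in> carrier K" for \<mu> vs c
    using P.cls_rel[OF schur_rels.op_scale[OF that]] P.cls_single[OF that(2,1)] by (simp flip: schur_cls_def)
  have 3: "schur_cls K M V (\<mu>, vs[i := v \<oplus>\<^bsub>V\<^esub> w]) = schur_cls K M V (\<mu>, vs[i := v]) \<oplus>\<^bsub>schur K M V\<^esub> schur_cls K M V (\<mu>, vs[i := w])"
    if "(\<mu>, vs) \<in> schur_gens M V" "i < length vs" "v \<in> carrier V" "w \<in> carrier V" for \<mu> vs i v w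
  proof -
    have "(\<mu>, vs[i := v]) \<in> schur_gens M V" "(\<mu>, vs[i := w]) \<in> schur_gens M V"
      using that by (auto simp: schur_gens_update)
    from pair[OF this] show ?thesis
      using P.cls_rel[OF schur_rels.arg_add[OF that]] by (simp flip: schur_cls_def)
  qed
  have 4: "schur_cls K M V (\<mu>, vs[i := c \<odot>\<^bsub>V\<^esub> v]) = c \<odot>\<^bsub>schur K M V\<^esub> schur_cls K M V (\<mu>, vs[i := v])"
    if "(\<mu>, vs) \<in> schur_gens M V" "i < length vs" "v \<in> carrier V" "c \<in> carrier K" for \<mu> vs i v c
  proof -
    have "(\<mu>, vs[i := v]) \<in> schur_gens M V"
      using that by (auto simp: schur_gens_update)
    then show ?thesis
      using P.cls_rel[OF schur_rels.arg_scale[OF that]] P.cls_single[OF that(4), of "(\<mu>, vs[i := v])"] by (simp flip: schur_cls_def)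
  qed
  show ?thesis
  proof (rule schur_homI)
    fix n \<mu> assume "n > 0" "\<mu> \<in> carrier (sp M n)"
    then show "mlin K n V (schur K M V) (\<lambda>vs. schur_cls K M V (\<mu>, vs))"
      by (intro mlinI) (auto intro!: schur_cls_closed 3 4 schur_gensI)
  next
    fix vs assume "vs \<noteq> []" "set vs \<subseteq> carrier V"
    then show "(\<lambda>\<mu>. schur_cls K M V (\<mu>, vs)) \<in> lin_maps K (sp M (length vs)) (schur K M V)"
      by (intro lin_mapsI) (auto intro!: schur_cls_closed 1 2 schur_gensI)
  next
    fix \<mu> vs \<sigma> assume "(\<mu>, vs) \<in> schur_gens M V" "\<sigma> permutes {..<length vs}"
    then show "schur_cls K M V (act M (length vs) \<mu> \<sigma>, vs) = schur_cls K M V (\<mu>, lperm \<sigma> vs)"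
      using P.cls_rel[OF schur_rels.balance] by (simp flip: schur_cls_def)
  qed
qed

context
  fixes W :: "('k, 'a) vs" and f assumes W: "module K W" and f: "schur_hom K M V W f"
begin

lemma schur_hom_resp:
  assumes "(ts, us) \<in> schur_rels K M V"
  shows "leval W f ts = leval W f us"
proof -
  interpret W: module K W by (rule W)
  note [simp] = schur_hom_closed[OF f]
  show ?thesis using assms
  proof cases
    case (op_add \<mu> vs \<mu>')
    then show ?thesis using lin_maps_add[OF schur_hom_lin[OF f, of vs], of \<mu> \<mu>'] schur_gensD[OF op_add(3)] schur_gensD[OF op_add(4)]
      by (simp add: W.smult_one smodule_module[OF M] module_add schur_gensI)
  next
    case (op_scale \<mu> vs c)
    then show ?thesis using lin_maps_smult[OF schur_hom_lin[OF f, of vs], of c \<mu>] schur_gensD[OF op_scale(3)]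
      by (simp add: W.smult_one smodule_module[OF M] module_smult schur_gensI)
  next
    case (arg_add \<mu> vs i v w)
    note g = schur_gensD[OF arg_add(3)]
    have "(\<mu>, vs[i := u]) \<in> schur_gens M V" if "u \<in> carrier V" for u
      using arg_add that by (auto simp: schur_gens_update)
    then show ?thesis using mlin_add[OF schur_hom_mlin[OF f, of "length vs" \<mu>], of vs i v w] g arg_add
      by (simp add: W.smult_one V module_add)
  next
    case (arg_scale \<mu> vs i v c)
    note g = schur_gensD[OF arg_scale(3)]
    have "(\<mu>, vs[i := u]) \<in> schur_gens M V" if "u \<in> carrier V" for u
      using arg_scale that by (auto simp: schur_gens_update)
    then show ?thesis using mlin_smult[OF schur_hom_mlin[OF f, of "length vs" \<mu>], of vs i c v] g arg_scale
      by (simp add: W.smult_one V module_smult)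
  next
    case (balance \<mu> vs \<sigma>)
    then show ?thesis using schur_hom_balance[OF f, of \<mu> vs \<sigma>] by simp
  qed
qed

lemma schur_lin_ext: "lin_ext W f \<in> lin_maps K (schur K M V) W"
  by (rule P.lin_ext_lin) (use W f in \<open>auto intro: schur_hom_closed schur_hom_resp\<close>)

lemma schur_lin_ext_cls: "g \<in> schur_gens M V \<Longrightarrow> lin_ext W f (schur_cls K M V g) = f g"
  by (rule P.lin_ext_gn) (use W f in \<open>auto intro: schur_hom_closed schur_hom_resp\<close>)

end
end

end

section \<open>The category of vector spaces\<close>

lemma Vect_simps [simp]:
  "Ob (Vect K) = {V. module K V}" "Dom (Vect K) (V, f, W) = V" "Cod (Vect K) (V, f, W) = W"
  "(W', g, U) \<bullet>\<^bsub>Vect K\<^esub> (V, f, W) = (V, compose (carrier V) g f, U)"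
  "Ide (Vect K) V = (V, \<lambda>x\<in>carrier V. x, V)"
  by (simp_all add: Vect_def)

lemma Vect_Hom_iff:
  "a \<in> Hom (Vect K) V W \<longleftrightarrow> (\<exists>f. a = (V, f, W) \<and> module K V \<and> module K W \<and> f \<in> lin_maps K V W \<and> f \<in> extensional (carrier V))"
  by (cases a) (auto simp: Hom_def Vect_def)

lemma lin_maps_restrict: "f \<in> lin_maps K V W \<Longrightarrow> module K V \<Longrightarrow> restrict f (carrier V) \<in> lin_maps K V W"
  by (erule lin_maps_cong) auto

lemma Vect_HomI:
  assumes "module K V" "module K W" "f \<in> lin_maps K V W"
  shows "(V, restrict f (carrier V), W) \<in> Hom (Vect K) V W"
  unfolding Vect_Hom_iff using assms by (auto intro: lin_maps_cong)

lemma Vect_Hom_lin: "a \<in> Hom (Vect K) V W \<Longrightarrow> vmap_fun a \<in> lin_maps K V W"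
  by (auto simp: Vect_Hom_iff vmap_fun_def)

lemma Vect_Hom_closed: "a \<in> Hom (Vect K) V W \<Longrightarrow> x \<in> carrier V \<Longrightarrow> vmap_fun a x \<in> carrier W"
  by (rule lin_maps_closed[OF Vect_Hom_lin])

lemma Vect_Hom_module: "a \<in> Hom (Vect K) V W \<Longrightarrow> module K V" "a \<in> Hom (Vect K) V W \<Longrightarrow> module K W"
  by (auto simp: Vect_Hom_iff)

lemma Vect_Hom_eqI:
  assumes "a \<in> Hom (Vect K) V W" "b \<in> Hom (Vect K) V W" "\<And>x. x \<in> carrier V \<Longrightarrow> vmap_fun a x = vmap_fun b x"
  shows "a = b"
  using assms by (auto simp: Vect_Hom_iff vmap_fun_def intro: extensionalityI)

lemma vmap_fun_restrict [simp]: "x \<in> carrier V \<Longrightarrow> vmap_fun (V, restrict f (carrier V), W) x = f x"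
  by (simp add: vmap_fun_def)

lemma vmap_fun_comp:
  "f \<in> Hom (Vect K) V W \<Longrightarrow> g \<in> Hom (Vect K) W U \<Longrightarrow> x \<in> carrier V \<Longrightarrow>
    vmap_fun (g \<bullet>\<^bsub>Vect K\<^esub> f) x = vmap_fun g (vmap_fun f x)"
  by (auto simp: Vect_Hom_iff vmap_fun_def compose_eq)

lemma Vect_comp_Hom:
  assumes "f \<in> Hom (Vect K) V W" "g \<in> Hom (Vect K) W U"
  shows "g \<bullet>\<^bsub>Vect K\<^esub> f \<in> Hom (Vect K) V U"
proof -
  have "(\<lambda>x. vmap_fun g (vmap_fun f x)) \<in> lin_maps K V U"
    using assms by (intro lin_maps_compose[OF Vect_Hom_lin Vect_Hom_lin])
  then show ?thesis using assms
    by (auto simp: Vect_Hom_iff vmap_fun_def compose_def intro: lin_maps_restrict)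
qed

lemma Vect_Ide_Hom: "module K V \<Longrightarrow> Ide (Vect K) V \<in> Hom (Vect K) V V"
  by (simp add: Vect_HomI lin_maps_id)

lemma vmap_fun_Ide: "x \<in> carrier V \<Longrightarrow> vmap_fun (Ide (Vect K) V) x = x"
  by simp

lemma Vect_category: "is_category (Vect K :: (('k, 'a) vs, ('k, 'a) vmap) category)"
proof -
  have *: "a \<in> Arr (Vect K) \<longleftrightarrow> (\<exists>V W. a \<in> Hom (Vect K) V W)" for a :: "('k, 'a) vmap" by (auto simp: Hom_def)
  have **: "Dom (Vect K) a = V \<and> Cod (Vect K) a = W" if "a \<in> Hom (Vect K) V W" for a :: "('k, 'a) vmap" and V W using that by (simp add: Hom_def)
  show ?thesis
    unfolding is_category_def
  proof (intro conjI ballI impI)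
    fix f :: "('k, 'a) vmap" assume "f \<in> Arr (Vect K)"
    then obtain V W where f: "f \<in> Hom (Vect K) V W" using * by blast
    note m = Vect_Hom_module[OF f]
    show "Dom (Vect K) f \<in> Ob (Vect K)" "Cod (Vect K) f \<in> Ob (Vect K)" using **[OF f] m by auto
    show "f \<bullet>\<^bsub>Vect K\<^esub> Ide (Vect K) (Dom (Vect K) f) = f"
      using f m **[OF f] Vect_Ide_Hom[OF m(1)]
      by (intro Vect_Hom_eqI[of _ K V W]) (auto intro: Vect_comp_Hom simp: vmap_fun_comp vmap_fun_Ide simp del: Vect_simps)
    show "Ide (Vect K) (Cod (Vect K) f) \<bullet>\<^bsub>Vect K\<^esub> f = f"
      using f m **[OF f] Vect_Ide_Hom[OF m(2)] Vect_Hom_closed[OF f]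
      by (intro Vect_Hom_eqI[of _ K V W]) (auto intro: Vect_comp_Hom simp: vmap_fun_comp vmap_fun_Ide simp del: Vect_simps)
    fix g :: "('k, 'a) vmap" assume "g \<in> Arr (Vect K)"
    then obtain W' U where "g \<in> Hom (Vect K) W' U" using * by blast
    moreover assume "Cod (Vect K) f = Dom (Vect K) g"
    ultimately have g: "g \<in> Hom (Vect K) W U" using **[OF f] by (auto simp: Hom_def)
    show "g \<bullet>\<^bsub>Vect K\<^esub> f \<in> Hom (Vect K) (Dom (Vect K) f) (Cod (Vect K) g)"
      using Vect_comp_Hom[OF f g] **[OF f] **[OF g] by simp
    fix h :: "('k, 'a) vmap" assume "h \<in> Arr (Vect K)"
    then obtain W' Z where "h \<in> Hom (Vect K) W' Z" using * by blast
    moreover assume "Cod (Vect K) g = Dom (Vect K) h"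
    ultimately have h: "h \<in> Hom (Vect K) U Z" using **[OF g] by (auto simp: Hom_def)
    show "(h \<bullet>\<^bsub>Vect K\<^esub> g) \<bullet>\<^bsub>Vect K\<^esub> f = h \<bullet>\<^bsub>Vect K\<^esub> g \<bullet>\<^bsub>Vect K\<^esub> f"
      using Vect_comp_Hom[OF f g] Vect_comp_Hom[OF g h] f g h Vect_Hom_closed[OF f]
      by (intro Vect_Hom_eqI[of _ K V Z] Vect_comp_Hom[of f K V W] Vect_comp_Hom[of _ K V U]) (simp_all add: vmap_fun_comp[where V = V] vmap_fun_comp[where V = W])
  qed (simp add: Vect_Ide_Hom del: Vect_simps(5))
qed

section \<open>Schur functors on arrows, units and counits\<close>

context ground_ring
begin

lemma schur_map_fun:
  assumes M: "is_smodule K M" and f: "f \<in> Hom (Vect K) V W"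
  shows "schur_map K M f \<in> Hom (Vect K) (schur K M V) (schur K M W)"
    and "(\<mu>, vs) \<in> schur_gens M V \<Longrightarrow>
      vmap_fun (schur_map K M f) (schur_cls K M V (\<mu>, vs)) = schur_cls K M W (\<mu>, map (vmap_fun f) vs)"
proof -
  obtain f' where f': "f = (V, f', W)" "f' \<in> lin_maps K V W" "module K V" "module K W" "vmap_fun f = f'"
    using f by (auto simp: Vect_Hom_iff vmap_fun_def)
  have h: "schur_hom K M V (schur K M W) (\<lambda>(\<mu>, vs). schur_cls K M W (\<mu>, map f' vs))"
    using schur_hom_map[OF schur_cls_hom[OF M f'(4)] f'(2)] .
  note l = schur_lin_ext[OF M f'(3) schur_module[OF M f'(4)] h] schur_lin_ext_cls[OF M f'(3) schur_module[OF M f'(4)] h]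
  show "schur_map K M f \<in> Hom (Vect K) (schur K M V) (schur K M W)"
    unfolding schur_map_def f' by (simp add: Vect_HomI schur_module M f' l)
  assume "(\<mu>, vs) \<in> schur_gens M V"
  then show "vmap_fun (schur_map K M f) (schur_cls K M V (\<mu>, vs)) = schur_cls K M W (\<mu>, map (vmap_fun f) vs)"
    unfolding f'(5) using l(2) by (simp add: schur_map_def f' schur_cls_closed M)
qed

text \<open>Reduces identities of arrows out of a Schur functor, naturality squares included, to a
  computation on generators.\<close>

lemma schur_Hom_eqI:
  assumes "is_smodule K M" "module K V" "a \<in> Hom (Vect K) (schur K M V) W" "b \<in> Hom (Vect K) (schur K M V) W"
    "\<And>\<mu> vs. (\<mu>, vs) \<in> schur_gens M V \<Longrightarrow> vmap_fun a (schur_cls K M V (\<mu>, vs)) = vmap_fun b (schur_cls K M V (\<mu>, vs))"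
  shows "a = b"
  using assms schur_lin_maps_eqI[OF assms(1,2), of W "vmap_fun a" "vmap_fun b"]
  by (intro Vect_Hom_eqI[OF assms(3,4)]) (auto intro: Vect_Hom_lin Vect_Hom_module)

lemma schur_functor:
  fixes M :: "('k, 'a) smodule"
  assumes M: "is_smodule K M"
  shows "is_functor (Vect K) (Vect K) (schur_func K M)"
  unfolding is_functor_def
proof (intro conjI ballI impI)
  fix V :: "('k, 'a) vs" assume "V \<in> Ob (Vect K)"
  then have V: "module K V" by simp
  then show "FOb (schur_func K M) V \<in> Ob (Vect K)" by (simp add: schur_func_def schur_module M)
  show "FArr (schur_func K M) (Ide (Vect K) V) = Ide (Vect K) (FOb (schur_func K M) V)"
    unfolding schur_func_def func.simps
  proof (rule schur_Hom_eqI[OF M V schur_map_fun(1)[OF M Vect_Ide_Hom[OF V]] Vect_Ide_Hom[OF schur_module[OF M V]]])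
    fix \<mu> vs assume g: "(\<mu>, vs) \<in> schur_gens M V"
    then have "map (vmap_fun (Ide (Vect K) V)) vs = vs"
      by (intro map_idI vmap_fun_Ide) (auto dest: schur_gensD)
    then show "vmap_fun (schur_map K M (Ide (Vect K) V)) (schur_cls K M V (\<mu>, vs)) =
        vmap_fun (Ide (Vect K) (schur K M V)) (schur_cls K M V (\<mu>, vs))"
      using g by (simp only: schur_map_fun(2)[OF M Vect_Ide_Hom[OF V]] vmap_fun_Ide schur_cls_closed[OF M V])
  qed
next
  fix f :: "('k, 'a) vmap" assume "f \<in> Arr (Vect K)"
  then have f: "f \<in> Hom (Vect K) (Dom (Vect K) f) (Cod (Vect K) f)" by (simp add: Hom_def)
  note Ff = schur_map_fun[OF M f]
  show "FArr (schur_func K M) f \<in> Hom (Vect K) (FOb (schur_func K M) (Dom (Vect K) f)) (FOb (schur_func K M) (Cod (Vect K) f))"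
    using Ff(1) by (simp add: schur_func_def)
  fix g :: "('k, 'a) vmap" assume "g \<in> Arr (Vect K)" "Cod (Vect K) f = Dom (Vect K) g"
  then have g: "g \<in> Hom (Vect K) (Cod (Vect K) f) (Cod (Vect K) g)" by (simp add: Hom_def)
  note Fg = schur_map_fun[OF M g]
  note gf = Vect_comp_Hom[OF f g]
  show "FArr (schur_func K M) (g \<bullet>\<^bsub>Vect K\<^esub> f) = FArr (schur_func K M) g \<bullet>\<^bsub>Vect K\<^esub> FArr (schur_func K M) f"
    unfolding schur_func_def func.simps
  proof (rule schur_Hom_eqI[OF M Vect_Hom_module(1)[OF f] schur_map_fun(1)[OF M gf] Vect_comp_Hom[OF Ff(1) Fg(1)]])
    fix \<mu> vs assume *: "(\<mu>, vs) \<in> schur_gens M (Dom (Vect K) f)"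
    show "vmap_fun (schur_map K M (g \<bullet>\<^bsub>Vect K\<^esub> f)) (schur_cls K M (Dom (Vect K) f) (\<mu>, vs)) =
        vmap_fun (schur_map K M g \<bullet>\<^bsub>Vect K\<^esub> schur_map K M f) (schur_cls K M (Dom (Vect K) f) (\<mu>, vs))"
    proof -
      have "map (vmap_fun (g \<bullet>\<^bsub>Vect K\<^esub> f)) vs = map (vmap_fun g) (map (vmap_fun f) vs)"
        using vmap_fun_comp[OF f g] schur_gensD[OF *] by (auto simp: subset_iff)
      then show ?thesis using *
      by (simp add: vmap_fun_comp[OF Ff(1) Fg(1)] schur_cls_closed M Vect_Hom_module(1)[OF f] schur_map_fun(2)[OF M gf] Ff(2) Fg(2)
         lin_gens[OF Vect_Hom_lin[OF f]] del: map_map map_eq_conv)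
    qed
  qed
qed (rule Vect_category)+

lemma schur_nat_fun:
  assumes M: "is_smodule K M" and N: "is_smodule K N" and f: "smor K M N f" and V: "module K V"
  shows "schur_nat K M N f V \<in> Hom (Vect K) (schur K M V) (schur K N V)"
    and "(\<mu>, vs) \<in> schur_gens M V \<Longrightarrow>
      vmap_fun (schur_nat K M N f V) (schur_cls K M V (\<mu>, vs)) = schur_cls K N V (f (length vs) \<mu>, vs)"
proof -
  have h: "schur_hom K M V (schur K N V) (\<lambda>(\<mu>, vs). schur_cls K N V (f (length vs) \<mu>, vs))"
    using schur_hom_smor[OF schur_cls_hom[OF N V] f M] .
  note l = schur_lin_ext[OF M V schur_module[OF N V] h] schur_lin_ext_cls[OF M V schur_module[OF N V] h]
  show "schur_nat K M N f V \<in> Hom (Vect K) (schur K M V) (schur K N V)"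
    unfolding schur_nat_def by (simp add: Vect_HomI schur_module M N V l)
  assume "(\<mu>, vs) \<in> schur_gens M V"
  then show "vmap_fun (schur_nat K M N f V) (schur_cls K M V (\<mu>, vs)) = schur_cls K N V (f (length vs) \<mu>, vs)"
    using l(2) by (simp add: schur_nat_def schur_cls_closed M V)
qed

lemma nat_transI:
  assumes "\<And>V. module K V \<Longrightarrow> \<eta> V \<in> Hom (Vect K) (FOb F V) (FOb G V)"
    and "\<And>V W f. f \<in> Hom (Vect K) V W \<Longrightarrow> \<eta> W \<bullet>\<^bsub>Vect K\<^esub> FArr F f = FArr G f \<bullet>\<^bsub>Vect K\<^esub> \<eta> V"
  shows "nat_trans (Vect K) (Vect K) F G \<eta>"
  using assms by (auto simp: nat_trans_def Hom_def)

lemma schur_nat_trans: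
  fixes M N :: "('k, 'a) smodule"
  assumes M: "is_smodule K M" and N: "is_smodule K N" and f: "smor K M N f"
  shows "nat_trans (Vect K) (Vect K) (schur_func K M) (schur_func K N) (schur_nat K M N f)"
proof (rule nat_transI)
  fix V W and a :: "('k, 'a) vmap" assume a: "a \<in> Hom (Vect K) V W"
  note V = Vect_Hom_module(1)[OF a] and W = Vect_Hom_module(2)[OF a]
  note Ma = schur_map_fun[OF M a] and Na = schur_map_fun[OF N a] and fV = schur_nat_fun[OF M N f V] and fW = schur_nat_fun[OF M N f W]
  show "schur_nat K M N f W \<bullet>\<^bsub>Vect K\<^esub> FArr (schur_func K M) a = FArr (schur_func K N) a \<bullet>\<^bsub>Vect K\<^esub> schur_nat K M N f V"
    unfolding schur_func_def func.simps
    by (rule schur_Hom_eqI[OF M V Vect_comp_Hom[OF Ma(1) fW(1)] Vect_comp_Hom[OF fV(1) Na(1)]])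
     (simp add: vmap_fun_comp[OF Ma(1) fW(1)] vmap_fun_comp[OF fV(1) Na(1)] schur_cls_closed M V Ma(2) fV(2)
        fW(2)[OF lin_gens[OF Vect_Hom_lin[OF a]]] Na(2)[OF smor_gens[OF f]])
qed (simp add: schur_func_def schur_nat_fun M N f)

lemma schur_unit_fun:
  assumes M: "is_smodule K M" "sp M 1 = ground K" and V: "module K V"
  shows "schur_unit K M V \<in> Hom (Vect K) V (schur K M V)"
    and "v \<in> carrier V \<Longrightarrow> vmap_fun (schur_unit K M V) v = schur_cls K M V (Scalar \<one>, [v])"
proof -
  have "Scalar \<one> \<in> carrier (sp M (Suc 0))" using M(2) by (simp add: ground_def)
  then have "mlin K (Suc 0) V (schur K M V) (\<lambda>vs. schur_cls K M V (Scalar \<one>, vs))"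
    by (intro schur_hom_mlin[OF schur_cls_hom[OF M(1) V]]) auto
  then have "(\<lambda>v. schur_cls K M V (Scalar \<one>, [v])) \<in> lin_maps K V (schur K M V)"
    using mlin_closed[of K "Suc 0" V _ _ "[_]"] mlin_add[of K "Suc 0" V _ _ "[_]" 0] mlin_smult[of K "Suc 0" V _ _ "[_]" 0]
    by (intro lin_mapsI) fastforce+
  then show "schur_unit K M V \<in> Hom (Vect K) V (schur K M V)"
    unfolding schur_unit_def by (intro Vect_HomI schur_module M V)
qed (simp add: schur_unit_def)

lemma schur_unit_nat_trans:
  fixes M :: "('k, 'a) smodule"
  assumes M: "is_smodule K M" "sp M 1 = ground K"
  shows "nat_trans (Vect K) (Vect K) id_func (schur_func K M) (schur_unit K M)"
proof (rule nat_transI)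
  fix V W and a :: "('k, 'a) vmap" assume a: "a \<in> Hom (Vect K) V W"
  note V = Vect_Hom_module(1)[OF a] and W = Vect_Hom_module(2)[OF a]
  note Ma = schur_map_fun[OF M(1) a] and eV = schur_unit_fun[OF M V] and eW = schur_unit_fun[OF M W]
  have "Scalar \<one> \<in> carrier (sp M (Suc 0))" using M(2) by (simp add: ground_def)
  then show "schur_unit K M W \<bullet>\<^bsub>Vect K\<^esub> FArr id_func a = FArr (schur_func K M) a \<bullet>\<^bsub>Vect K\<^esub> schur_unit K M V"
    unfolding schur_func_def id_func_def func.simps
    by (intro Vect_Hom_eqI[OF Vect_comp_Hom[OF a eW(1)] Vect_comp_Hom[OF eV(1) Ma(1)]])
     (simp add: vmap_fun_comp[OF a eW(1)] vmap_fun_comp[OF eV(1) Ma(1)] eV(2) eW(2) Vect_Hom_closed[OF a] Ma(2) schur_gens_def)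
qed (simp add: schur_func_def id_func_def schur_unit_fun[OF M])

text \<open>Outside arity one the map is zero. In arity one the group \<open>S_1\<close> is trivial
  and the map is scalar multiplication, so balance reduces to the action of the identity.\<close>

lemma schur_counit_hom:
  assumes M: "is_smodule K M" "sp M 1 = ground K" and V: "module K V"
  shows "schur_hom K M V V (\<lambda>(\<mu>, vs). if length vs = 1 then scalar_of \<mu> \<odot>\<^bsub>V\<^esub> hd vs else \<zero>\<^bsub>V\<^esub>)"
    (is "schur_hom K M V V ?f")
proof -
  interpret V: module K V by (rule V)
  have sc: "scalar_of \<mu> \<in> carrier K" if "\<mu> \<in> carrier (sp M (Suc 0))" for \<mu> using that M(2) by (auto simp: ground_def)
  have one: "length vs = Suc 0 \<longleftrightarrow> (\<exists>v. vs = [v])" for vs :: "'b list" by (cases vs) auto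
  show ?thesis
  proof (rule schur_homI)
    fix n \<mu> assume "n > 0" "\<mu> \<in> carrier (sp M n)"
    then show "mlin K n V V (\<lambda>vs. ?f (\<mu>, vs))"
    proof (cases "n = 1")
      case True
      then show ?thesis using \<open>\<mu> \<in> _\<close>
        by (auto intro!: mlinI simp: one sc V.smult_r_distr V.smult_assoc1[symmetric] m_comm)
    next
      case False
      then show ?thesis by (auto intro!: mlinI)
    qed
  next
    fix vs assume "vs \<noteq> []" "set vs \<subseteq> carrier V"
    then show "(\<lambda>\<mu>. ?f (\<mu>, vs)) \<in> lin_maps K (sp M (length vs)) V"
      using M(2) by (cases "length vs = 1") (auto intro!: lin_mapsI simp: one ground_def V.smult_l_distr V.smult_assoc1)
  next
    fix \<mu> vs \<sigma> assume *: "(\<mu>, vs) \<in> schur_gens M V" "\<sigma> permutes {..<length vs}"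
    show "?f (act M (length vs) \<mu> \<sigma>, vs) = ?f (\<mu>, lperm \<sigma> vs)"
    proof (cases "length vs = 1")
      case True
      then have "\<sigma> = id" using * permutes_sing[of \<sigma> 0] by (simp add: lessThan_Suc)
      then show ?thesis using * M(1) True by (auto simp: lperm_def is_smodule_def schur_gens_def)
    qed simp
  qed
qed

lemma schur_counit_fun:
  assumes M: "is_smodule K M" "sp M 1 = ground K" and V: "module K V"
  shows "schur_counit K M V \<in> Hom (Vect K) (schur K M V) V"
    and "(\<mu>, vs) \<in> schur_gens M V \<Longrightarrow> vmap_fun (schur_counit K M V) (schur_cls K M V (\<mu>, vs)) =
      (if length vs = 1 then scalar_of \<mu> \<odot>\<^bsub>V\<^esub> hd vs else \<zero>\<^bsub>V\<^esub>)"
  unfolding schur_counit_def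
  using schur_lin_ext[OF M(1) V V schur_counit_hom[OF M V]] schur_lin_ext_cls[OF M(1) V V schur_counit_hom[OF M V]]
  by (simp_all add: Vect_HomI schur_module M(1) V schur_cls_closed)

lemma schur_counit_nat_trans:
  fixes M :: "('k, 'a) smodule"
  assumes M: "is_smodule K M" "sp M 1 = ground K"
  shows "nat_trans (Vect K) (Vect K) (schur_func K M) id_func (schur_counit K M)"
proof (rule nat_transI)
  fix V W and a :: "('k, 'a) vmap" assume a: "a \<in> Hom (Vect K) V W"
  note V = Vect_Hom_module(1)[OF a] and W = Vect_Hom_module(2)[OF a]
  note Ma = schur_map_fun[OF M(1) a] and eV = schur_counit_fun[OF M V] and eW = schur_counit_fun[OF M W]
  show "schur_counit K M W \<bullet>\<^bsub>Vect K\<^esub> FArr (schur_func K M) a = FArr id_func a \<bullet>\<^bsub>Vect K\<^esub> schur_counit K M V"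
    unfolding schur_func_def id_func_def func.simps
  proof (rule schur_Hom_eqI[OF M(1) V Vect_comp_Hom[OF Ma(1) eW(1)] Vect_comp_Hom[OF eV(1) a]])
    fix \<mu> vs assume g: "(\<mu>, vs) \<in> schur_gens M V"
    have "scalar_of \<mu> \<in> carrier K" if "\<mu> \<in> carrier (sp M (Suc 0))" using that M(2) by (auto simp: ground_def)
    moreover have "vmap_fun (schur_counit K M W \<bullet>\<^bsub>Vect K\<^esub> schur_map K M a) (schur_cls K M V (\<mu>, vs)) =
        (if length vs = 1 then scalar_of \<mu> \<odot>\<^bsub>W\<^esub> hd (map (vmap_fun a) vs) else \<zero>\<^bsub>W\<^esub>)"
      by (simp add: vmap_fun_comp[OF Ma(1) eW(1)] schur_cls_closed M(1) V Ma(2)[OF g] g eW(2)[OF lin_gens[OF Vect_Hom_lin[OF a] g]])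
    moreover have "vmap_fun (a \<bullet>\<^bsub>Vect K\<^esub> schur_counit K M V) (schur_cls K M V (\<mu>, vs)) =
        vmap_fun a (if length vs = 1 then scalar_of \<mu> \<odot>\<^bsub>V\<^esub> hd vs else \<zero>\<^bsub>V\<^esub>)"
      by (simp add: vmap_fun_comp[OF eV(1) a] schur_cls_closed M(1) V eV(2)[OF g] g)
    ultimately show "vmap_fun (schur_counit K M W \<bullet>\<^bsub>Vect K\<^esub> schur_map K M a) (schur_cls K M V (\<mu>, vs)) =
       vmap_fun (a \<bullet>\<^bsub>Vect K\<^esub> schur_counit K M V) (schur_cls K M V (\<mu>, vs))"
      using schur_gensD[OF g] lin_maps_smult[OF Vect_Hom_lin[OF a]] lin_maps_zero[OF V W Vect_Hom_lin[OF a]]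
      by (cases vs) auto
  qed
qed (simp add: schur_func_def id_func_def schur_counit_fun[OF M])

lemma schur_counit_unit:
  assumes M: "is_smodule K M" "sp M 1 = ground K" and V: "module K V" and "v \<in> carrier V"
  shows "vmap_fun (schur_counit K M V) (vmap_fun (schur_unit K M V) v) = v"
proof -
  have "(Scalar \<one>, [v]) \<in> schur_gens M V" using assms by (auto simp: schur_gens_def ground_def)
  then show ?thesis using assms module.smult_one[OF V] by (simp add: schur_unit_fun schur_counit_fun)
qed

end

section \<open>Plethysm\<close>

text \<open>The labels of a plethysm generator form a permutation word. Stated with multisets, this
  condition visibly survives reordering the blocks and permuting the labels inside a block.\<close>

lemma mset_upt_iff: "mset xs = mset [0..<n] \<longleftrightarrow> distinct xs \<and> set xs = {..<n}"
proof
  assume *: "mset xs = mset [0..<n]"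
  show "distinct xs \<and> set xs = {..<n}"
    using mset_eq_imp_distinct_iff[OF *] mset_eq_setD[OF *] by (auto simp: lessThan_atLeast0)
next
  assume "distinct xs \<and> set xs = {..<n}"
  then show "mset xs = mset [0..<n]"
    by (intro iffD1[OF set_eq_iff_mset_eq_distinct]) (auto simp: lessThan_atLeast0)
qed

lemma circ_gens_iff:
  "(\<mu>, ps) \<in> circ_gens M N n \<longleftrightarrow> ps \<noteq> [] \<and> \<mu> \<in> carrier (sp M (length ps)) \<and>
     set ps \<subseteq> {Labelled \<nu> l |\<nu> l. l \<noteq> [] \<and> \<nu> \<in> carrier (sp N (length l))} \<and>
     mset (concat (map labels_of ps)) = mset [0..<n]"
  unfolding mset_upt_iff by (simp add: circ_gens_def)

lemma circ_gensD:
  assumes "(\<mu>, ps) \<in> circ_gens M N n"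
  shows "ps \<noteq> []" "\<mu> \<in> carrier (sp M (length ps))" "length (concat (map labels_of ps)) = n"
    "distinct (concat (map labels_of ps))" "set (concat (map labels_of ps)) = {..<n}"
    "\<And>p. p \<in> set ps \<Longrightarrow> p = Labelled (op_of p) (labels_of p) \<and> labels_of p \<noteq> [] \<and>
       op_of p \<in> carrier (sp N (length (labels_of p))) \<and> set (labels_of p) \<subseteq> {..<n}"
proof -
  have c: "mset (concat (map labels_of ps)) = mset [0..<n]" using assms by (simp add: circ_gens_iff)
  show 1: "length (concat (map labels_of ps)) = n" using mset_eq_length[OF c] by simp
  show "distinct (concat (map labels_of ps))" and s: "set (concat (map labels_of ps)) = {..<n}"
    using assms by (simp_all add: circ_gens_def)
  fix p assume p: "p \<in> set ps"
  then have "p \<in> {Labelled \<nu> l |\<nu> l. l \<noteq> [] \<and> \<nu> \<in> carrier (sp N (length l))}"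
    using assms unfolding circ_gens_iff by blast
  moreover have "set (labels_of p) \<subseteq> {..<n}" using p s by auto
  ultimately show "p = Labelled (op_of p) (labels_of p) \<and> labels_of p \<noteq> [] \<and>
       op_of p \<in> carrier (sp N (length (labels_of p))) \<and> set (labels_of p) \<subseteq> {..<n}" by auto
qed (use assms in \<open>simp_all add: circ_gens_iff\<close>)

lemma circ_gens_nth:
  assumes "(\<mu>, ps) \<in> circ_gens M N n" "i < length ps" "ps ! i = Labelled \<nu> l"
  shows "l \<noteq> []" "\<nu> \<in> carrier (sp N (length l))" "set l \<subseteq> {..<n}"
  using circ_gensD(6)[OF assms(1), of "ps ! i"] assms(3) nth_mem[OF assms(2)] by auto

lemma circ_gens_op: "(\<mu>, ps) \<in> circ_gens M N n \<Longrightarrow> \<mu>' \<in> carrier (sp M (length ps)) \<Longrightarrow> (\<mu>', ps) \<in> circ_gens M N n"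
  by (simp add: circ_gens_iff)

lemma circ_gens_update:
  assumes g: "(\<mu>, ps) \<in> circ_gens M N n" and i: "i < length ps" "ps ! i = Labelled \<nu> l"
    and \<nu>': "\<nu>' \<in> carrier (sp N (length l))" and l': "mset l' = mset l"
  shows "(\<mu>, ps[i := Labelled \<nu>' l']) \<in> circ_gens M N n"
proof -
  have "l \<noteq> []" by (rule circ_gens_nth(1)[OF g i])
  then have ne: "l' \<noteq> []" "length l' = length l" using l' mset_eq_length[OF l'] by auto
  have ps: "ps = take i ps @ Labelled \<nu> l # drop (Suc i) ps" using id_take_nth_drop[OF i(1)] i(2) by simp
  have "mset (concat (map labels_of (ps[i := Labelled \<nu>' l']))) = mset (concat (map labels_of ps))"
    using arg_cong[OF ps, of "\<lambda>ps. mset (concat (map labels_of ps))"] by (simp add: upd_conv_take_nth_drop i l')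
  moreover have "set (ps[i := Labelled \<nu>' l']) \<subseteq> {Labelled \<nu> l |\<nu> l. l \<noteq> [] \<and> \<nu> \<in> carrier (sp N (length l))}"
    using g ne \<nu>' unfolding circ_gens_iff by (intro set_update_subsetI) auto
  ultimately show ?thesis
    using g by (simp add: circ_gens_iff)
qed

lemma circ_gens_lperm:
  assumes g: "(\<mu>, ps) \<in> circ_gens M N n" and \<sigma>: "\<sigma> permutes {..<length ps}"
  shows "(\<mu>, lperm \<sigma> ps) \<in> circ_gens M N n"
proof -
  have "mset (lperm \<sigma> ps) = mset ps" unfolding lperm_def by (rule mset_permute_list[OF permutes_inv[OF \<sigma>]])
  then have "mset (concat (map labels_of (lperm \<sigma> ps))) = mset (concat (map labels_of ps))"
    by (metis mset_concat mset_map sum_mset_sum_list)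
  then show ?thesis using g \<sigma> by (auto simp: circ_gens_iff set_lperm)
qed

section \<open>Relabelling, and maps out of a plethysm\<close>

definition relabel :: "(nat \<Rightarrow> nat) \<Rightarrow> ('k, 'a) univ \<Rightarrow> ('k, 'a) univ" where
  "relabel w p = Labelled (op_of p) (map w (labels_of p))"

lemma relabel_simps [simp]: "op_of (relabel w p) = op_of p" "labels_of (relabel w p) = map w (labels_of p)"
  "relabel w (Labelled \<nu> l) = Labelled \<nu> (map w l)"
  by (simp_all add: relabel_def)

lemma circ_gens_relabel:
  assumes g: "(\<mu>, ps) \<in> circ_gens M N n" and w: "w permutes {..<n}"
  shows "(\<mu>, map (relabel w) ps) \<in> circ_gens M N n"
proof -
  have e: "concat (map labels_of (map (relabel w) ps)) = map w (concat (map labels_of ps))"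
    by (simp add: map_concat comp_def)
  have "distinct (map w (concat (map labels_of ps)))" "set (map w (concat (map labels_of ps))) = {..<n}"
    using circ_gensD(4,5)[OF g] permutes_inj[OF w] permutes_image[OF w] by (auto simp: distinct_map inj_on_def inj_def simp flip: image_UN)
  moreover have "set (map (relabel w) ps) \<subseteq> {Labelled \<nu> l |\<nu> l. l \<noteq> [] \<and> \<nu> \<in> carrier (sp N (length l))}"
    using circ_gensD(6)[OF g] by (auto simp: relabel_def)
  ultimately show ?thesis
    using circ_gensD(1,2)[OF g] by (simp only: circ_gens_def mem_Collect_eq prod.case e length_map map_is_Nil_conv simp_thms)
qed

text \<open>The counterpart of \<open>schur_hom\<close> for the plethysm. Linearity in a block is
  expressed by overwriting its operation while its labels stay, because a block is a single term of
  the list \<open>ps\<close>.\<close>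

definition circ_hom ::
  "'k ring \<Rightarrow> ('k, 'a) smodule \<Rightarrow> ('k, 'a) smodule \<Rightarrow> nat \<Rightarrow> ('k, 'a) vs \<Rightarrow> (('k, 'a) gen \<Rightarrow> ('k, 'a) univ) \<Rightarrow> bool" where
  "circ_hom K M N n W f \<longleftrightarrow> (\<forall>g\<in>circ_gens M N n. f g \<in> carrier W) \<and>
    (\<forall>\<mu> ps. (\<mu>, ps) \<in> circ_gens M N n \<longrightarrow>
      (\<lambda>\<mu>. f (\<mu>, ps)) \<in> lin_maps K (sp M (length ps)) W \<and>
      (\<forall>i \<nu> l. i < length ps \<longrightarrow> ps ! i = Labelled \<nu> l \<longrightarrow>
         (\<lambda>\<nu>'. f (\<mu>, ps[i := Labelled \<nu>' l])) \<in> lin_maps K (sp N (length l)) W \<and>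
         (\<forall>\<tau>. \<tau> permutes {..<length l} \<longrightarrow> f (\<mu>, ps[i := Labelled (act N (length l) \<nu> \<tau>) l]) = f (\<mu>, ps[i := Labelled \<nu> (lperm \<tau> l)]))) \<and>
      (\<forall>\<sigma>. \<sigma> permutes {..<length ps} \<longrightarrow> f (act M (length ps) \<mu> \<sigma>, ps) = f (\<mu>, lperm \<sigma> ps)))"

lemma circ_homI:
  assumes "\<And>g. g \<in> circ_gens M N n \<Longrightarrow> f g \<in> carrier W"
   and "\<And>\<mu> ps. (\<mu>, ps) \<in> circ_gens M N n \<Longrightarrow> (\<lambda>\<mu>. f (\<mu>, ps)) \<in> lin_maps K (sp M (length ps)) W"
   and "\<And>\<mu> ps i \<nu> l. (\<mu>, ps) \<in> circ_gens M N n \<Longrightarrow> i < length ps \<Longrightarrow> ps ! i = Labelled \<nu> l \<Longrightarrow>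
      (\<lambda>\<nu>'. f (\<mu>, ps[i := Labelled \<nu>' l])) \<in> lin_maps K (sp N (length l)) W"
   and "\<And>\<mu> ps i \<nu> l \<tau>. (\<mu>, ps) \<in> circ_gens M N n \<Longrightarrow> i < length ps \<Longrightarrow> ps ! i = Labelled \<nu> l \<Longrightarrow> \<tau> permutes {..<length l} \<Longrightarrow>
      f (\<mu>, ps[i := Labelled (act N (length l) \<nu> \<tau>) l]) = f (\<mu>, ps[i := Labelled \<nu> (lperm \<tau> l)])"
   and "\<And>\<mu> ps \<sigma>. (\<mu>, ps) \<in> circ_gens M N n \<Longrightarrow> \<sigma> permutes {..<length ps} \<Longrightarrow> f (act M (length ps) \<mu> \<sigma>, ps) = f (\<mu>, lperm \<sigma> ps)"
  shows "circ_hom K M N n W f"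
  using assms unfolding circ_hom_def by blast

lemma circ_hom_closed: "circ_hom K M N n W f \<Longrightarrow> g \<in> circ_gens M N n \<Longrightarrow> f g \<in> carrier W"
  and circ_hom_op: "circ_hom K M N n W f \<Longrightarrow> (\<mu>, ps) \<in> circ_gens M N n \<Longrightarrow> (\<lambda>\<mu>. f (\<mu>, ps)) \<in> lin_maps K (sp M (length ps)) W"
  and circ_hom_arg: "circ_hom K M N n W f \<Longrightarrow> (\<mu>, ps) \<in> circ_gens M N n \<Longrightarrow> i < length ps \<Longrightarrow> ps ! i = Labelled \<nu> l \<Longrightarrow>
      (\<lambda>\<nu>'. f (\<mu>, ps[i := Labelled \<nu>' l])) \<in> lin_maps K (sp N (length l)) W"
  and circ_hom_inner: "circ_hom K M N n W f \<Longrightarrow> (\<mu>, ps) \<in> circ_gens M N n \<Longrightarrow> i < length ps \<Longrightarrow> ps ! i = Labelled \<nu> l \<Longrightarrow>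
      \<tau> permutes {..<length l} \<Longrightarrow>
      f (\<mu>, ps[i := Labelled (act N (length l) \<nu> \<tau>) l]) = f (\<mu>, ps[i := Labelled \<nu> (lperm \<tau> l)])"
  and circ_hom_outer: "circ_hom K M N n W f \<Longrightarrow> (\<mu>, ps) \<in> circ_gens M N n \<Longrightarrow> \<sigma> permutes {..<length ps} \<Longrightarrow>
      f (act M (length ps) \<mu> \<sigma>, ps) = f (\<mu>, lperm \<sigma> ps)"
  unfolding circ_hom_def by blast+

lemma circ_hom_relabel:
  assumes f: "circ_hom K M N n W f" and w: "w permutes {..<n}"
  shows "circ_hom K M N n W (\<lambda>(\<mu>, ps). f (\<mu>, map (relabel w) ps))"
proof (rule circ_homI, unfold split_paired_all prod.case)
  note gw = circ_gens_relabel[OF _ w]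
  fix \<mu> ps assume g: "(\<mu>, ps) \<in> circ_gens M N n"
  show "f (\<mu>, map (relabel w) ps) \<in> carrier W" by (rule circ_hom_closed[OF f gw[OF g]])
  show "(\<lambda>\<mu>. f (\<mu>, map (relabel w) ps)) \<in> lin_maps K (sp M (length ps)) W"
    using circ_hom_op[OF f gw[OF g]] by simp
  show "f (act M (length ps) \<mu> \<sigma>, map (relabel w) ps) = f (\<mu>, map (relabel w) (lperm \<sigma> ps))" if "\<sigma> permutes {..<length ps}" for \<sigma>
    using circ_hom_outer[OF f gw[OF g], of \<sigma>] that by (simp add: map_lperm)
  fix i \<nu> l assume i: "i < length ps" "ps ! i = Labelled \<nu> l"
  show "(\<lambda>\<nu>'. f (\<mu>, map (relabel w) (ps[i := Labelled \<nu>' l]))) \<in> lin_maps K (sp N (length l)) W"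
    using circ_hom_arg[OF f gw[OF g], of i \<nu> "map w l"] i by (simp add: map_update)
  show "f (\<mu>, map (relabel w) (ps[i := Labelled (act N (length l) \<nu> \<tau>) l])) = f (\<mu>, map (relabel w) (ps[i := Labelled \<nu> (lperm \<tau> l)]))"
    if "\<tau> permutes {..<length l}" for \<tau>
    using circ_hom_inner[OF f gw[OF g], of i \<nu> "map w l" \<tau>] i that by (simp add: map_update map_lperm)
qed

definition on_ops :: "('k, 'a) smap \<Rightarrow> ('k, 'a) univ \<Rightarrow> ('k, 'a) univ" where
  "on_ops g p = Labelled (g (length (labels_of p)) (op_of p)) (labels_of p)"

lemma on_ops_simps [simp]: "op_of (on_ops g p) = g (length (labels_of p)) (op_of p)" "labels_of (on_ops g p) = labels_of p"
  "on_ops g (Labelled \<nu> l) = Labelled (g (length l) \<nu>) l"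
  by (simp_all add: on_ops_def)

lemma circ_gens_on_ops:
  assumes \<phi>: "smor K M M' \<phi>" and h: "smor K N N' h" and g: "(\<mu>, ps) \<in> circ_gens M N n"
  shows "(\<phi> (length ps) \<mu>, map (on_ops h) ps) \<in> circ_gens M' N' n"
  using g circ_gensD[OF g] smor_closed[OF \<phi>, of "length ps" \<mu>] smor_closed[OF h]
  by (auto simp: circ_gens_iff comp_def on_ops_def)

lemma circ_hom_on_ops:
  assumes f: "circ_hom K M' N' n W f" and \<phi>: "smor K M M' \<phi>" and h: "smor K N N' h"
  shows "circ_hom K M N n W (\<lambda>(\<mu>, ps). f (\<phi> (length ps) \<mu>, map (on_ops h) ps))"
proof (rule circ_homI, unfold split_paired_all prod.case)
  note gw = circ_gens_on_ops[OF \<phi> h]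
  fix \<mu> ps assume g: "(\<mu>, ps) \<in> circ_gens M N n"
  note gD = circ_gensD[OF g]
  have n: "length ps > 0" using gD(1) by simp
  show "f (\<phi> (length ps) \<mu>, map (on_ops h) ps) \<in> carrier W" by (rule circ_hom_closed[OF f gw[OF g]])
  show "(\<lambda>\<mu>. f (\<phi> (length ps) \<mu>, map (on_ops h) ps)) \<in> lin_maps K (sp M (length ps)) W"
    using lin_maps_compose[OF smor_lin[OF \<phi> n] circ_hom_op[OF f gw[OF g], unfolded length_map]] .
  show "f (\<phi> (length ps) (act M (length ps) \<mu> \<sigma>), map (on_ops h) ps) = f (\<phi> (length (lperm \<sigma> ps)) \<mu>, map (on_ops h) (lperm \<sigma> ps))" if "\<sigma> permutes {..<length ps}" for \<sigma>
    using circ_hom_outer[OF f gw[OF g], of \<sigma>] that smor_act[OF \<phi> n gD(2) that] by (simp add: map_lperm)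
  fix i \<nu> l assume i: "i < length ps" "ps ! i = Labelled \<nu> l"
  have l: "length l > 0" "\<nu> \<in> carrier (sp N (length l))" using circ_gens_nth[OF g i] by auto
  have i': "i < length (map (on_ops h) ps)" "map (on_ops h) ps ! i = Labelled (h (length l) \<nu>) l" using i by auto
  show "(\<lambda>\<nu>'. f (\<phi> (length (ps[i := Labelled \<nu>' l])) \<mu>, map (on_ops h) (ps[i := Labelled \<nu>' l]))) \<in> lin_maps K (sp N (length l)) W"
    using lin_maps_compose[OF smor_lin[OF h l(1)] circ_hom_arg[OF f gw[OF g] i']] by (simp add: map_update)
  show "f (\<phi> (length (ps[i := Labelled (act N (length l) \<nu> \<tau>) l])) \<mu>, map (on_ops h) (ps[i := Labelled (act N (length l) \<nu> \<tau>) l])) =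
      f (\<phi> (length (ps[i := Labelled \<nu> (lperm \<tau> l)])) \<mu>, map (on_ops h) (ps[i := Labelled \<nu> (lperm \<tau> l)]))"
    if "\<tau> permutes {..<length l}" for \<tau>
    using circ_hom_inner[OF f gw[OF g] i' that] smor_act[OF h l that] by (simp add: map_update)
qed

context ground_ring
begin

lemma circ_presentation:
  assumes M: "is_smodule K M" and N: "is_smodule K N"
  shows "presentation K (circ_gens M N n) (circ_rels K M N n)"
proof unfold_locales
  have "ts \<in> lists (carrier K \<times> circ_gens M N n) \<and> us \<in> lists (carrier K \<times> circ_gens M N n)"
    if "(ts, us) \<in> circ_rels K M N n" for ts us
    using that
  proof cases
    case (op_add \<mu> ps \<mu>')
    then show ?thesis using circ_gensD(1,2)[OF op_add(3)] circ_gensD(1,2)[OF op_add(4)]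
      by (auto intro!: circ_gens_op[OF op_add(3)] module_add smodule_module M)
  next
    case (op_scale \<mu> ps c)
    then show ?thesis using circ_gensD(1,2)[OF op_scale(3)]
      by (auto intro!: circ_gens_op[OF op_scale(3)] module_smult smodule_module M)
  next
    case (arg_add \<mu> ps i \<nu> l \<nu>')
    then show ?thesis using circ_gens_nth[OF arg_add(3-5)]
      by (auto intro!: circ_gens_update[OF arg_add(3-5)] module_add smodule_module N)
  next
    case (arg_scale \<mu> ps i \<nu> l c)
    then show ?thesis using circ_gens_nth[OF arg_scale(3-5)]
      by (auto intro!: circ_gens_update[OF arg_scale(3-5)] module_smult smodule_module N)
  next
    case (inner_balance \<mu> ps i \<nu> l \<tau>)
    then show ?thesis using circ_gens_nth[OF inner_balance(3-5)]
      by (auto intro!: circ_gens_update[OF inner_balance(3-5)] smodule_act_closed N mset_permute_list permutes_inv simp: lperm_def)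
  next
    case (outer_balance \<mu> ps \<sigma>)
    then show ?thesis using circ_gensD(1,2)[OF outer_balance(3)]
      by (auto intro!: circ_gens_op[OF outer_balance(3)] circ_gens_lperm smodule_act_closed M)
  qed
  then show "circ_rels K M N n \<subseteq> lists (carrier K \<times> circ_gens M N n) \<times> lists (carrier K \<times> circ_gens M N n)"
    by auto
qed

context
  fixes M N :: "('k, 'a) smodule" assumes M: "is_smodule K M" and N: "is_smodule K N"
begin

interpretation P: presentation K "circ_gens M N n" "circ_rels K M N n"
  rewrites "presented K (circ_gens M N n) (circ_rels K M N n) = circ_sp K M N n" for n
  using circ_presentation[OF M N] by (simp_all add: circ_sp_def)

lemma circ_module: "module K (circ_sp K M N n)"
  by (rule P.presented_module)

lemma circ_cls_closed: "g \<in> circ_gens M N n \<Longrightarrow> circ_cls K M N n g \<in> carrier (circ_sp K M N n)"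
  unfolding circ_cls_def by (rule P.gn_closed)

lemmas circ_induct [consumes 1, case_names zero step] = P.presented_induct[folded circ_cls_def]

lemma circ_lin_maps_eqI:
  assumes "module K W" "f \<in> lin_maps K (circ_sp K M N n) W" "g \<in> lin_maps K (circ_sp K M N n) W"
    "\<And>\<mu> ps. (\<mu>, ps) \<in> circ_gens M N n \<Longrightarrow> f (circ_cls K M N n (\<mu>, ps)) = g (circ_cls K M N n (\<mu>, ps))" "x \<in> carrier (circ_sp K M N n)"
  shows "f x = g x"
  using P.lin_maps_eqI[OF assms(1-3)] assms(4,5) by (auto simp: circ_cls_def)

lemma circ_cls_hom: "circ_hom K M N n (circ_sp K M N n) (circ_cls K M N n)"
proof -
  have pair: "pres_cls K (circ_gens M N n) (circ_rels K M N n) [(\<one>, g), (\<one>, g')] = circ_cls K M N n g \<oplus>\<^bsub>circ_sp K M N n\<^esub> circ_cls K M N n g'"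
    if "g \<in> circ_gens M N n" "g' \<in> circ_gens M N n" for g g'
    using P.cls_Cons[of \<one> g n "[(\<one>, g')]"] that by (simp add: P.V.smult_one circ_cls_closed flip: circ_cls_def)
  note single = P.cls_single[of _ _ n, folded circ_cls_def]
  note fold = circ_cls_def[symmetric]
  show ?thesis
  proof (rule circ_homI)
    fix \<mu> ps assume g: "(\<mu>, ps) \<in> circ_gens M N n"
    have "circ_cls K M N n (\<mu> \<oplus>\<^bsub>sp M (length ps)\<^esub> \<mu>', ps) = circ_cls K M N n (\<mu>, ps) \<oplus>\<^bsub>circ_sp K M N n\<^esub> circ_cls K M N n (\<mu>', ps)"
      if "\<mu> \<in> carrier (sp M (length ps))" "\<mu>' \<in> carrier (sp M (length ps))" for \<mu> \<mu>'
      using pair P.cls_rel[OF circ_rels.op_add] that circ_gens_op[OF g] by (simp add: fold)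
    moreover have "circ_cls K M N n (c \<odot>\<^bsub>sp M (length ps)\<^esub> \<mu>, ps) = c \<odot>\<^bsub>circ_sp K M N n\<^esub> circ_cls K M N n (\<mu>, ps)"
      if "\<mu> \<in> carrier (sp M (length ps))" "c \<in> carrier K" for \<mu> c
      using single P.cls_rel[OF circ_rels.op_scale] that circ_gens_op[OF g] by (simp add: fold)
    ultimately show "(\<lambda>\<mu>. circ_cls K M N n (\<mu>, ps)) \<in> lin_maps K (sp M (length ps)) (circ_sp K M N n)"
      by (auto intro!: lin_mapsI circ_cls_closed circ_gens_op[OF g])
    show "circ_cls K M N n (act M (length ps) \<mu> \<sigma>, ps) = circ_cls K M N n (\<mu>, lperm \<sigma> ps)" if "\<sigma> permutes {..<length ps}" for \<sigma>
      using P.cls_rel[OF circ_rels.outer_balance[OF g that]] by (simp add: fold)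
    fix i \<nu> l assume i: "i < length ps" "ps ! i = Labelled \<nu> l"
    have u: "(\<mu>, ps[i := Labelled \<nu>' l]) \<in> circ_gens M N n" if "\<nu>' \<in> carrier (sp N (length l))" for \<nu>'
      using circ_gens_update[OF g i that] by simp
    \<comment> \<open>The relations \<open>arg_add\<close> and \<open>arg_scale\<close> speak of the
      operation already present in block \<open>i\<close>; they are instantiated at the updated
      list, where this operation is \<open>\<nu>1\<close>.\<close>
    have "circ_cls K M N n (\<mu>, ps[i := Labelled (\<nu>1 \<oplus>\<^bsub>sp N (length l)\<^esub> \<nu>2) l]) =
        circ_cls K M N n (\<mu>, ps[i := Labelled \<nu>1 l]) \<oplus>\<^bsub>circ_sp K M N n\<^esub> circ_cls K M N n (\<mu>, ps[i := Labelled \<nu>2 l])"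
      if "\<nu>1 \<in> carrier (sp N (length l))" "\<nu>2 \<in> carrier (sp N (length l))" for \<nu>1 \<nu>2
      using pair[OF u u] P.cls_rel[OF circ_rels.arg_add[OF u, of \<nu>1 i \<nu>1 l \<nu>2]] that i(1) by (simp add: fold)
    moreover have "circ_cls K M N n (\<mu>, ps[i := Labelled (c \<odot>\<^bsub>sp N (length l)\<^esub> \<nu>1) l]) =
        c \<odot>\<^bsub>circ_sp K M N n\<^esub> circ_cls K M N n (\<mu>, ps[i := Labelled \<nu>1 l])"
      if "\<nu>1 \<in> carrier (sp N (length l))" "c \<in> carrier K" for \<nu>1 c
      using single[OF _ u] P.cls_rel[OF circ_rels.arg_scale[OF u, of \<nu>1 i \<nu>1 l c]] that i(1) by (simp add: fold)
    ultimately show "(\<lambda>\<nu>'. circ_cls K M N n (\<mu>, ps[i := Labelled \<nu>' l])) \<in> lin_maps K (sp N (length l)) (circ_sp K M N n)"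
      by (auto intro!: lin_mapsI circ_cls_closed u)
    show "circ_cls K M N n (\<mu>, ps[i := Labelled (act N (length l) \<nu> \<tau>) l]) = circ_cls K M N n (\<mu>, ps[i := Labelled \<nu> (lperm \<tau> l)])"
      if "\<tau> permutes {..<length l}" for \<tau>
      using P.cls_rel[OF circ_rels.inner_balance[OF g i that]] by (simp add: fold)
  qed (rule circ_cls_closed)
qed

context
  fixes W :: "('k, 'a) vs" and f n assumes W: "module K W" and f: "circ_hom K M N n W f"
begin

lemma circ_hom_resp:
  assumes "(ts, us) \<in> circ_rels K M N n"
  shows "leval W f ts = leval W f us"
proof -
  interpret W: module K W by (rule W)
  note [simp] = circ_hom_closed[OF f]
  show ?thesis using assms
  proof cases
    case (op_add \<mu> ps \<mu>')
    then show ?thesis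
      using lin_maps_add[OF circ_hom_op[OF f op_add(3)], of \<mu> \<mu>'] circ_gensD[OF op_add(3)] circ_gensD[OF op_add(4)]
      by (simp add: W.smult_one smodule_module[OF M] module_add circ_gens_op[OF op_add(3)])
  next
    case (op_scale \<mu> ps c)
    then show ?thesis using lin_maps_smult[OF circ_hom_op[OF f op_scale(3)], of c \<mu>] circ_gensD[OF op_scale(3)]
      by (simp add: W.smult_one smodule_module[OF M] module_smult circ_gens_op[OF op_scale(3)])
  next
    case (arg_add \<mu> ps i \<nu> l \<nu>')
    have *: "l \<noteq> []" "\<nu> \<in> carrier (sp N (length l))" "ps[i := Labelled \<nu> l] = ps"
      using circ_gens_nth[OF arg_add(3-5)] arg_add list_update_id[of ps i] by auto
    have "(\<mu>, ps[i := Labelled \<nu>1 l]) \<in> circ_gens M N n" if "\<nu>1 \<in> carrier (sp N (length l))" for \<nu>1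
      using circ_gens_update[OF arg_add(3-5) that] by simp
    then show ?thesis
      using lin_maps_add[OF circ_hom_arg[OF f arg_add(3-5)], of \<nu> \<nu>'] * arg_add
      by (simp add: W.smult_one smodule_module[OF N] module_add)
  next
    case (arg_scale \<mu> ps i \<nu> l c)
    have *: "l \<noteq> []" "\<nu> \<in> carrier (sp N (length l))" "ps[i := Labelled \<nu> l] = ps"
      using circ_gens_nth[OF arg_scale(3-5)] arg_scale list_update_id[of ps i] by auto
    have "(\<mu>, ps[i := Labelled \<nu>1 l]) \<in> circ_gens M N n" if "\<nu>1 \<in> carrier (sp N (length l))" for \<nu>1
      using circ_gens_update[OF arg_scale(3-5) that] by simp
    then show ?thesis
      using lin_maps_smult[OF circ_hom_arg[OF f arg_scale(3-5)], of c \<nu>] * arg_scale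
      by (simp add: W.smult_one smodule_module[OF N] module_smult)
  next
    case (inner_balance \<mu> ps i \<nu> l \<tau>)
    then show ?thesis using circ_hom_inner[OF f inner_balance(3-6)] by simp
  next
    case (outer_balance \<mu> ps \<sigma>)
    then show ?thesis using circ_hom_outer[OF f outer_balance(3,4)] by simp
  qed
qed

lemma circ_lin_ext: "lin_ext W f \<in> lin_maps K (circ_sp K M N n) W"
  by (rule P.lin_ext_lin) (use W f in \<open>auto intro: circ_hom_closed circ_hom_resp\<close>)

lemma circ_lin_ext_cls: "g \<in> circ_gens M N n \<Longrightarrow> lin_ext W f (circ_cls K M N n g) = f g"
  unfolding circ_cls_def
  by (rule P.lin_ext_gn) (use W f in \<open>auto intro: circ_hom_closed circ_hom_resp\<close>)

end

lemma sp_circ [simp]: "sp (circ K M N) = circ_sp K M N"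
  by (simp add: circ_def)

lemma circ_act_cls:
  assumes "\<sigma> permutes {..<n}"
  shows "(\<lambda>x. act (circ K M N) n x \<sigma>) \<in> lin_maps K (circ_sp K M N n) (circ_sp K M N n)"
    and "(\<mu>, ps) \<in> circ_gens M N n \<Longrightarrow>
      act (circ K M N) n (circ_cls K M N n (\<mu>, ps)) \<sigma> = circ_cls K M N n (\<mu>, map (relabel (Hilbert_Choice.inv \<sigma>)) ps)"
proof -
  have e: "act (circ K M N) n x \<sigma> = lin_ext (circ_sp K M N n) (\<lambda>(\<mu>, ps). circ_cls K M N n (\<mu>, map (relabel (Hilbert_Choice.inv \<sigma>)) ps)) x" for x
    by (simp add: circ_def relabel_def[abs_def])
  note h = circ_hom_relabel[OF circ_cls_hom permutes_inv[OF assms]]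
  show "(\<lambda>x. act (circ K M N) n x \<sigma>) \<in> lin_maps K (circ_sp K M N n) (circ_sp K M N n)"
    unfolding e using circ_lin_ext[OF circ_module h] .
  show "(\<mu>, ps) \<in> circ_gens M N n \<Longrightarrow>
      act (circ K M N) n (circ_cls K M N n (\<mu>, ps)) \<sigma> = circ_cls K M N n (\<mu>, map (relabel (Hilbert_Choice.inv \<sigma>)) ps)"
    unfolding e using circ_lin_ext_cls[OF circ_module h] by simp
qed

lemma circ_smodule: "is_smodule K (circ K M N)"
  unfolding is_smodule_def sp_circ
proof (intro allI impI conjI ballI)
  fix n :: nat assume "n > 0"
  show "module K (circ_sp K M N n)" by (rule circ_module)
  show "\<sigma> permutes {..<n} \<Longrightarrow> (\<lambda>x. act (circ K M N) n x \<sigma>) \<in> lin_maps K (circ_sp K M N n) (circ_sp K M N n)" for \<sigma>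
    by (rule circ_act_cls)
  fix x assume x: "x \<in> carrier (circ_sp K M N n)"
  have id: "id permutes {..<n}" by (rule permutes_id)
  show "act (circ K M N) n x id = x"
  proof (rule circ_lin_maps_eqI[OF circ_module circ_act_cls(1)[OF id] lin_maps_id _ x])
    fix \<mu> ps assume g: "(\<mu>, ps) \<in> circ_gens M N n"
    have "map (relabel id) ps = ps" using circ_gensD(6)[OF g] by (intro map_idI) (simp add: relabel_def)
    then show "act (circ K M N) n (circ_cls K M N n (\<mu>, ps)) id = circ_cls K M N n (\<mu>, ps)"
      using circ_act_cls(2)[OF id g] by simp
  qed
  fix \<sigma> \<tau> assume st: "\<sigma> permutes {..<n}" "\<tau> permutes {..<n}"
  note st' = permutes_compose[OF st(2,1)]
  show "act (circ K M N) n x (\<sigma> \<circ> \<tau>) = act (circ K M N) n (act (circ K M N) n x \<sigma>) \<tau>"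
  proof (rule circ_lin_maps_eqI[OF circ_module circ_act_cls(1)[OF st'] lin_maps_compose[OF circ_act_cls(1)[OF st(1)] circ_act_cls(1)[OF st(2)]] _ x])
    fix \<mu> ps assume g: "(\<mu>, ps) \<in> circ_gens M N n"
    \<comment> \<open>Relabelling is a left action on words; inversion reverses products and so
      turns it into a right action.\<close>
    have "Hilbert_Choice.inv (\<sigma> \<circ> \<tau>) = Hilbert_Choice.inv \<tau> \<circ> Hilbert_Choice.inv \<sigma>"
      by (rule o_inv_distrib[OF permutes_bij[OF st(1)] permutes_bij[OF st(2)]])
    then have "map (relabel (Hilbert_Choice.inv (\<sigma> \<circ> \<tau>))) ps = map (relabel (Hilbert_Choice.inv \<tau>)) (map (relabel (Hilbert_Choice.inv \<sigma>)) ps)"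
      by (simp add: relabel_def)
    then show "act (circ K M N) n (circ_cls K M N n (\<mu>, ps)) (\<sigma> \<circ> \<tau>) = act (circ K M N) n (act (circ K M N) n (circ_cls K M N n (\<mu>, ps)) \<sigma>) \<tau>"
      using circ_act_cls(2)[OF st' g] circ_act_cls(2)[OF st(1) g] circ_act_cls(2)[OF st(2) circ_gens_relabel[OF g permutes_inv[OF st(1)]]]
      by (simp only:)
  qed
qed

end

lemma circ_map_fun:
  assumes M: "is_smodule K M" "is_smodule K M'" and N: "is_smodule K N" "is_smodule K N'"
    and f: "smor K M M' f" and g: "smor K N N' g"
  shows "circ_map K M' N' f g n \<in> lin_maps K (circ_sp K M N n) (circ_sp K M' N' n)"
    and "(\<mu>, ps) \<in> circ_gens M N n \<Longrightarrow>
      circ_map K M' N' f g n (circ_cls K M N n (\<mu>, ps)) = circ_cls K M' N' n (f (length ps) \<mu>, map (on_ops g) ps)"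
proof -
  have e: "circ_map K M' N' f g n = lin_ext (circ_sp K M' N' n) (\<lambda>(\<mu>, ps). circ_cls K M' N' n (f (length ps) \<mu>, map (on_ops g) ps))"
    by (rule ext) (simp add: circ_map_def on_ops_def[abs_def])
  note h = circ_hom_on_ops[OF circ_cls_hom[OF M(2) N(2)] f g]
  show "circ_map K M' N' f g n \<in> lin_maps K (circ_sp K M N n) (circ_sp K M' N' n)"
    unfolding e using circ_lin_ext[OF M(1) N(1) circ_module[OF M(2) N(2)] h] .
  show "(\<mu>, ps) \<in> circ_gens M N n \<Longrightarrow>
      circ_map K M' N' f g n (circ_cls K M N n (\<mu>, ps)) = circ_cls K M' N' n (f (length ps) \<mu>, map (on_ops g) ps)"
    unfolding e using circ_lin_ext_cls[OF M(1) N(1) circ_module[OF M(2) N(2)] h] by simp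
qed

lemma circ_map_smor:
  assumes M: "is_smodule K M" "is_smodule K M'" and N: "is_smodule K N" "is_smodule K N'"
    and f: "smor K M M' f" and g: "smor K N N' g"
  shows "smor K (circ K M N) (circ K M' N') (circ_map K M' N' f g)"
  unfolding smor_def
proof (intro allI impI conjI ballI)
  note cm = circ_map_fun[OF M N f g]
  fix n :: nat assume n: "n > 0"
  show "circ_map K M' N' f g n \<in> lin_maps K (sp (circ K M N) n) (sp (circ K M' N') n)"
    using cm(1) M N by simp
  fix x \<sigma> assume "x \<in> carrier (sp (circ K M N) n)" and s: "\<sigma> permutes {..<n}"
  then have x: "x \<in> carrier (circ_sp K M N n)" using M N by simp
  note a = circ_act_cls[OF M(1) N(1) s] and a' = circ_act_cls[OF M(2) N(2) s]
  show "circ_map K M' N' f g n (act (circ K M N) n x \<sigma>) = act (circ K M' N') n (circ_map K M' N' f g n x) \<sigma>"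
    by (rule circ_lin_maps_eqI[OF M(1) N(1) circ_module[OF M(2) N(2)] lin_maps_compose[OF a(1) cm(1)] lin_maps_compose[OF cm(1) a'(1)] _ x])
      (simp add: a(2) a'(2) cm(2) circ_gens_relabel permutes_inv[OF s] circ_gens_on_ops[OF f g], simp add: on_ops_def relabel_def comp_def)
qed

end

section \<open>The isomorphism between the Schur functor of a plethysm and the composite\<close>

text \<open>Formulas for values often hold only for lists of the right length with entries in
  \<open>V\<close>; multilinearity is transferred along such partial agreement.\<close>

lemma mlin_cong:
  assumes "mlin K k V W f" "module K V" "\<And>ys. length ys = k \<Longrightarrow> set ys \<subseteq> carrier V \<Longrightarrow> f ys = g ys"
  shows "mlin K k V W g"
proof -
  interpret V: module K V by fact
  have c: "length (ys[i := v]) = k \<and> set (ys[i := v]) \<subseteq> carrier V" if "length ys = k" "set ys \<subseteq> carrier V" "v \<in> carrier V" for ys i v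
    using that set_update_subsetI[of ys "carrier V" v i] by simp
  show ?thesis
  proof (rule mlinI)
    fix ys :: "('a, 'b) univ list" assume ys: "length ys = k" "set ys \<subseteq> carrier V"
    show "g ys \<in> carrier W" using assms(3)[OF ys] mlin_closed[OF assms(1) ys] by simp
    fix i v assume i: "i < k" and v: "v \<in> carrier V"
    note g = assms(3)[OF conjunct1[OF c[OF ys]] conjunct2[OF c[OF ys]], symmetric]
    show "g (ys[i := v \<oplus>\<^bsub>V\<^esub> w]) = g (ys[i := v]) \<oplus>\<^bsub>W\<^esub> g (ys[i := w])" if w: "w \<in> carrier V" for w
      using mlin_add[OF assms(1) ys i v w] g v w by simp
    show "g (ys[i := c \<odot>\<^bsub>V\<^esub> v]) = c \<odot>\<^bsub>W\<^esub> g (ys[i := v])" if "c \<in> carrier K" for c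
      using mlin_smult[OF assms(1) ys i that v] g that v by simp
  qed
qed

lemma mlin_arg_lin:
  assumes "mlin K k V W f" "length ys = k" "set ys \<subseteq> carrier V" "i < k"
  shows "(\<lambda>y. f (ys[i := y])) \<in> lin_maps K V W"
  by (rule lin_mapsI) (use assms in \<open>simp_all add: mlin_add mlin_smult mlin_closed set_update_subsetI\<close>)

context ground_ring
begin

lemma mlin_zero: "module K W \<Longrightarrow> mlin K k V W (\<lambda>ys. \<zero>\<^bsub>W\<^esub>)"
proof -
  assume "module K W"
  then interpret W: module K W .
  show ?thesis by (rule mlinI) auto
qed

lemma mlin_comb:
  assumes V: "module K V" and W: "module K W" and f: "mlin K k V W f" and g: "mlin K k V W g" and c: "c \<in> carrier K"
  shows "mlin K k V W (\<lambda>ys. c \<odot>\<^bsub>W\<^esub> f ys \<oplus>\<^bsub>W\<^esub> g ys)"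
proof -
  interpret V: module K V by (rule V)
  interpret W: module K W by (rule W)
  show ?thesis
  proof (rule mlinI)
    fix ys assume ys: "length ys = k" "set ys \<subseteq> carrier V"
    show "c \<odot>\<^bsub>W\<^esub> f ys \<oplus>\<^bsub>W\<^esub> g ys \<in> carrier W" using mlin_closed[OF f ys] mlin_closed[OF g ys] c by simp
    fix i v assume i: "i < k" and v: "v \<in> carrier V"
    have cl: "f (ys[i := u]) \<in> carrier W" "g (ys[i := u]) \<in> carrier W" if "u \<in> carrier V" for u
      using mlin_closed[OF f, of "ys[i := u]"] mlin_closed[OF g, of "ys[i := u]"] set_update_subsetI[OF ys(2) that] ys by auto
    show "c \<odot>\<^bsub>W\<^esub> f (ys[i := v \<oplus>\<^bsub>V\<^esub> w]) \<oplus>\<^bsub>W\<^esub> g (ys[i := v \<oplus>\<^bsub>V\<^esub> w]) =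
       (c \<odot>\<^bsub>W\<^esub> f (ys[i := v]) \<oplus>\<^bsub>W\<^esub> g (ys[i := v])) \<oplus>\<^bsub>W\<^esub> (c \<odot>\<^bsub>W\<^esub> f (ys[i := w]) \<oplus>\<^bsub>W\<^esub> g (ys[i := w]))"
      if w: "w \<in> carrier V" for w
      using mlin_add[OF f ys i v w] mlin_add[OF g ys i v w] cl v w c by (simp add: W.smult_r_distr W.a_ac)
    show "c \<odot>\<^bsub>W\<^esub> f (ys[i := d \<odot>\<^bsub>V\<^esub> v]) \<oplus>\<^bsub>W\<^esub> g (ys[i := d \<odot>\<^bsub>V\<^esub> v]) =
       d \<odot>\<^bsub>W\<^esub> (c \<odot>\<^bsub>W\<^esub> f (ys[i := v]) \<oplus>\<^bsub>W\<^esub> g (ys[i := v]))" if d: "d \<in> carrier K" for d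
      using mlin_smult[OF f ys i d v] mlin_smult[OF g ys i d v] cl v c d
      by (simp add: W.smult_r_distr W.smult_assoc1[symmetric] m_comm)
  qed
qed

end

section \<open>Multilinear maps prescribed on generators\<close>

context presentation
begin

lemma mlin_presented_eqI:
  assumes "module K W" "mlin K k V W f" "mlin K k V W f'"
    "\<And>gs. length gs = k \<Longrightarrow> set gs \<subseteq> X \<Longrightarrow> f (map gn gs) = f' (map gn gs)"
    "length ys = k" "set ys \<subseteq> carrier V"
  shows "f ys = f' ys"
proof (rule mlin_eqI[OF presented_module assms(1) _ _ assms(2,3) _ assms(5,6), of "gn ` X"])
  show "P x" if "x \<in> carrier V" "P \<zero>\<^bsub>V\<^esub>"
    "\<And>c g y. c \<in> carrier K \<Longrightarrow> g \<in> gn ` X \<Longrightarrow> y \<in> carrier V \<Longrightarrow> P y \<Longrightarrow> P (c \<odot>\<^bsub>V\<^esub> g \<oplus>\<^bsub>V\<^esub> y)" for P x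
    using presented_induct[where P = P, OF that(1,2)] that(3) by auto
  show "gn ` X \<subseteq> carrier V" by (auto intro: gn_closed)
  fix ys assume "length ys = k" "set ys \<subseteq> gn ` X"
  moreover have "\<exists>gs. ys = map gn gs \<and> set gs \<subseteq> X" if "set ys \<subseteq> gn ` X" for ys
    using that
  proof (induction ys)
    case (Cons y ys)
    then obtain g gs where "y = gn g" "g \<in> X" "ys = map gn gs" "set gs \<subseteq> X" by auto
    then show ?case by (intro exI[of _ "g # gs"]) simp
  qed simp
  ultimately obtain gs where "ys = map gn gs" "set gs \<subseteq> X" "length gs = k" by (metis length_map)
  then show "f ys = f' ys" using assms(4) by simp
qed

text \<open>Induction on \<open>k\<close>. For each generator \<open>g\<close> in the first slot the
  induction hypothesis yields a multilinear map \<open>h g\<close> of the other slots, and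
  \<open>lin_ext\<close> then extends over the first slot. Relations are required only with
  generators in the other slots, since that is all \<open>F\<close> knows.\<close>

lemma mlin_extension:
  assumes W: "module K W"
    and "\<And>gs. length gs = k \<Longrightarrow> set gs \<subseteq> X \<Longrightarrow> F gs \<in> carrier W"
    and "\<And>gs gs' ts us. Suc (length gs + length gs') = k \<Longrightarrow> set gs \<subseteq> X \<Longrightarrow> set gs' \<subseteq> X \<Longrightarrow> (ts, us) \<in> R \<Longrightarrow>
      leval W (\<lambda>g. F (gs @ g # gs')) ts = leval W (\<lambda>g. F (gs @ g # gs')) us"
  shows "\<exists>h. mlin K k V W h \<and> (\<forall>gs. length gs = k \<longrightarrow> set gs \<subseteq> X \<longrightarrow> h (map gn gs) = F gs)"
  using assms(2,3)
proof (induction k arbitrary: F)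
  case 0
  then show ?case by (intro exI[of _ "\<lambda>_. F []"]) (auto intro!: mlinI)
next
  case (Suc k)
  interpret gr: ground_ring K ..
  interpret W: module K W by (rule W)
  have "\<exists>h. mlin K k V W h \<and> (\<forall>gs. length gs = k \<longrightarrow> set gs \<subseteq> X \<longrightarrow> h (map gn gs) = F (g # gs))" if "g \<in> X" for g
    using that Suc.prems(1)[of "g # _"] Suc.prems(2)[of "g # _"] by (intro Suc.IH) auto
  then obtain h where h: "\<And>g. g \<in> X \<Longrightarrow> mlin K k V W (h g)"
    "\<And>g gs. g \<in> X \<Longrightarrow> length gs = k \<Longrightarrow> set gs \<subseteq> X \<Longrightarrow> h g (map gn gs) = F (g # gs)" by metis
  have lm: "mlin K k V W (\<lambda>ys. leval W (\<lambda>g. h g ys) ts)" if "ts \<in> L" for ts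
    using that
  proof (induction ts)
    case Nil
    then show ?case using gr.mlin_zero[OF W] by simp
  next
    case (Cons a ts)
    obtain c g where a: "a = (c, g)" by (rule prod.exhaust)
    have "c \<in> carrier K" "g \<in> X" using Cons.hyps unfolding a by simp_all
    then show ?case using gr.mlin_comb[OF presented_module W h(1)[of g] Cons.IH, of c] by (simp add: a)
  qed
  \<comment> \<open>A relation in the first slot is assumed for generators in the other slots. Both
    sides are multilinear there, so it holds for all arguments.\<close>
  have eq: "leval W (\<lambda>g. h g ys) ts = leval W (\<lambda>g. h g ys) us" if "(ts, us) \<in> R" "length ys = k" "set ys \<subseteq> carrier V" for ts us ys
  proof (rule mlin_presented_eqI[OF W lm lm _ that(2,3)])
    show L: "ts \<in> L" "us \<in> L" using that rels by auto
    fix gs assume gs: "length gs = k" "set gs \<subseteq> X"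
    have "leval W (\<lambda>g. h g (map gn gs)) ts = leval W (\<lambda>g. F (g # gs)) ts" if "ts \<in> L" for ts
      using that by (induction ts) (auto simp: h(2) gs)
    then show "leval W (\<lambda>g. h g (map gn gs)) ts = leval W (\<lambda>g. h g (map gn gs)) us"
      using Suc.prems(2)[of "[]" gs ts us] gs that L by auto
  qed
  have cl: "h g ys \<in> carrier W" if "g \<in> X" "length ys = k" "set ys \<subseteq> carrier V" for g ys
    using mlin_closed[OF h(1)] that by auto
  note le = lin_ext_lin[OF W cl eq] lin_ext_gn[OF W cl eq]
  let ?h = "\<lambda>ys. lin_ext W (\<lambda>g. h g (tl ys)) (hd ys)"
  have "mlin K (Suc k) V W ?h"
  proof (rule mlinI)
    fix ys assume ys: "length ys = Suc k" "set ys \<subseteq> carrier V"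
    then obtain y zs where y: "ys = y # zs" "length zs = k" "y \<in> carrier V" "set zs \<subseteq> carrier V" by (cases ys) auto
    have le': "lin_ext W (\<lambda>g. h g zs) \<in> lin_maps K V W" using le(1) y by auto
    \<comment> \<open>For the later slots the first argument is frozen as the list
      \<open>terms y\<close>, over which \<open>lin_ext\<close> is a finite combination of the
      multilinear maps \<open>h g\<close>.\<close>
    have ty: "terms y \<in> L" using y(3) terms_cls eqv_closed by (metis carrierE)
    note lm' = lm[OF ty, folded lin_ext_leval]
    show "?h ys \<in> carrier W" using lin_maps_closed[OF le'] y by simp
    fix i v assume i: "i < Suc k" and v: "v \<in> carrier V"
    show "?h (ys[i := v \<oplus>\<^bsub>V\<^esub> w]) = ?h (ys[i := v]) \<oplus>\<^bsub>W\<^esub> ?h (ys[i := w])" if w: "w \<in> carrier V" for w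
      using lin_maps_add[OF le' v w] mlin_add[OF lm' y(2,4) _ v w] i y(1) by (cases i) auto
    show "?h (ys[i := c \<odot>\<^bsub>V\<^esub> v]) = c \<odot>\<^bsub>W\<^esub> ?h (ys[i := v])" if "c \<in> carrier K" for c
      using lin_maps_smult[OF le' that v] mlin_smult[OF lm' y(2,4) _ that v] i y(1) by (cases i) auto
  qed
  moreover have "?h (map gn gs) = F gs" if "length gs = Suc k" "set gs \<subseteq> X" for gs
  proof -
    from that obtain g gs' where g: "gs = g # gs'" "g \<in> X" "length gs' = k" "set gs' \<subseteq> X" by (cases gs) auto
    have "set (map gn gs') \<subseteq> carrier V" using g by (auto intro: gn_closed)
    then have "?h (map gn gs) = h g (map gn gs')" using le(2)[of "map gn gs'" g] g by auto
    then show ?thesis using h(2) g by simp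
  qed
  ultimately show ?case by blast
qed

end

section \<open>Consecutive labellings of blocks\<close>

lemma distinct_concat_nth:
  "distinct (concat xss) \<Longrightarrow> i < length xss \<Longrightarrow> j < length xss \<Longrightarrow> i \<noteq> j \<Longrightarrow> set (xss ! i) \<inter> set (xss ! j) = {}"
proof (induction xss arbitrary: i j)
  case (Cons xs xss)
  have "set xs \<inter> set (xss ! k) = {}" if "k < length xss" for k
    using Cons.prems(1) nth_mem[OF that] by auto
  then show ?case using Cons by (cases i; cases j) auto
qed simp

text \<open>The generator of \<open>F_N(V)\<close> that a block becomes when its labels are read as
  indices into the inputs \<open>vs\<close>.\<close>

definition arg_of :: "('k, 'a) univ list \<Rightarrow> ('k, 'a) univ \<Rightarrow> ('k, 'a) gen" where
  "arg_of vs p = (op_of p, map (\<lambda>i. vs ! i) (labels_of p))"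

lemma arg_of_gens:
  assumes "(\<mu>, ps) \<in> circ_gens M N n" "p \<in> set ps" "length vs = n" "set vs \<subseteq> carrier V"
  shows "arg_of vs p \<in> schur_gens N V"
proof -
  have "set (map (\<lambda>i. vs ! i) (labels_of p)) \<subseteq> carrier V"
    using circ_gensD(6)[OF assms(1,2)] assms(3,4) by (auto simp: subset_iff)
  then show ?thesis using circ_gensD(6)[OF assms(1,2)] unfolding arg_of_def by (intro schur_gensI) auto
qed

text \<open>A normal form: up to the action of permutations on operations and inputs, the labels of
  any plethysm generator can be made consecutive.\<close>

fun blk :: "nat \<Rightarrow> ('k, 'a) gen list \<Rightarrow> ('k, 'a) univ list" where
  "blk s [] = []"
| "blk s ((\<nu>, vs) # gs) = Labelled \<nu> [s..<s + length vs] # blk (s + length vs) gs"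

lemma length_blk [simp]: "length (blk s gs) = length gs"
  by (induction s gs rule: blk.induct) auto

lemma blk_append: "blk s (gs @ hs) = blk s gs @ blk (s + length (concat (map snd gs))) hs"
  by (induction s gs rule: blk.induct) (auto simp: add.assoc)

lemma blk_labels: "concat (map labels_of (blk s gs)) = [s..<s + length (concat (map snd gs))]"
proof (induction s gs rule: blk.induct)
  case (2 s \<nu> vs gs)
  then show ?case using upt_add_eq_append[of s "s + length vs" "length (concat (map snd gs))"]
    by (simp add: add.assoc)
qed simp

lemma blk_gens:
  assumes "gs \<noteq> []" "\<mu> \<in> carrier (sp M (length gs))" "set gs \<subseteq> schur_gens N V"
  shows "(\<mu>, blk 0 gs) \<in> circ_gens M N (length (concat (map snd gs)))"
proof -
  have "set (blk s gs) \<subseteq> {Labelled \<nu> l |\<nu> l. l \<noteq> [] \<and> \<nu> \<in> carrier (sp N (length l))}" for s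
    using assms(3) by (induction s gs rule: blk.induct) (auto simp: schur_gens_def)
  moreover have "blk 0 gs \<noteq> []" using assms(1) length_blk[of 0 gs] by (metis length_0_conv)
  ultimately show ?thesis
    using assms unfolding circ_gens_iff blk_labels by simp
qed

text \<open>The prefix \<open>pre\<close> is there for the induction: blocks numbered from
  \<open>length pre\<close> on read only the inputs behind \<open>pre\<close>.\<close>

lemma arg_of_blk: "map (arg_of (pre @ concat (map snd gs))) (blk (length pre) gs) = gs"
proof (induction gs arbitrary: pre)
  case (Cons g gs)
  obtain \<nu> vs where g: "g = (\<nu>, vs)" by (rule prod.exhaust)
  have "map (\<lambda>i. (pre @ vs @ concat (map snd gs)) ! i) [length pre..<length pre + length vs] = vs"
    by (rule nth_equalityI) (auto simp: nth_append)
  then show ?case using Cons[of "pre @ vs"] by (simp add: g arg_of_def)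
qed simp

lemma blk_relabel:
  assumes "\<And>p. p \<in> set ps \<Longrightarrow> p = Labelled (op_of p) (labels_of p)"
  shows "map (relabel (\<lambda>i. (pre @ concat (map labels_of ps)) ! i)) (blk (length pre) (map (arg_of vs) ps)) = ps"
  using assms
proof (induction ps arbitrary: pre)
  case (Cons p ps)
  have "map (\<lambda>i. (pre @ labels_of p @ concat (map labels_of ps)) ! i) [length pre..<length pre + length (labels_of p)] = labels_of p"
    by (rule nth_equalityI) (auto simp: nth_append)
  then show ?case using Cons.IH[of "pre @ labels_of p"] Cons.prems by (simp add: arg_of_def)
qed simp

section \<open>The map from the Schur functor of a plethysm to the composite\<close>

context ground_ring
begin

context
  fixes M N :: "('k, 'a) smodule" and V :: "('k, 'a) vs"
  assumes M: "is_smodule K M" and N: "is_smodule K N" and V: "module K V"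
begin

private abbreviation "FN \<equiv> schur K N V"
private abbreviation "clsN \<equiv> schur_cls K N V"
private abbreviation "clsM \<equiv> schur_cls K M FN"

lemma schur_inner_module: "module K FN" by (rule schur_module[OF N V])
lemma schur_outer_module: "module K (schur K M FN)" by (rule schur_module[OF M schur_module[OF N V]])

private lemmas FN = schur_inner_module
private lemmas FM = schur_outer_module

lemma arg_cls_closed:
  assumes "(\<mu>, ps) \<in> circ_gens M N n" "length vs = n" "set vs \<subseteq> carrier V"
  shows "(\<mu>, map (\<lambda>p. clsN (arg_of vs p)) ps) \<in> schur_gens M FN"
  using arg_of_gens[OF assms(1) _ assms(2,3)] circ_gensD[OF assms(1)]
  by (intro schur_gensI) (auto intro!: schur_cls_closed N V)

lemma expand_circ_hom:
  assumes vs: "length vs = n" "set vs \<subseteq> carrier V"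
  shows "circ_hom K M N n (schur K M FN) (\<lambda>(\<mu>, ps). clsM (\<mu>, map (\<lambda>p. clsN (arg_of vs p)) ps))"
proof (rule circ_homI, unfold split_paired_all prod.case)
  fix \<mu> ps assume g: "(\<mu>, ps) \<in> circ_gens M N n"
  let ?b = "\<lambda>p. clsN (arg_of vs p)"
  note G = arg_cls_closed[OF g vs]
  note G' = schur_gensD[OF G]
  show "clsM (\<mu>, map ?b ps) \<in> carrier (schur K M FN)" by (rule schur_cls_closed[OF M FN G])
  show "(\<lambda>\<mu>. clsM (\<mu>, map ?b ps)) \<in> lin_maps K (sp M (length ps)) (schur K M FN)"
    using schur_hom_lin[OF schur_cls_hom[OF M FN], of "map ?b ps"] G' by simp
  show "clsM (act M (length ps) \<mu> \<sigma>, map ?b ps) = clsM (\<mu>, map ?b (lperm \<sigma> ps))" if "\<sigma> permutes {..<length ps}" for \<sigma>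
    using schur_hom_balance[OF schur_cls_hom[OF M FN] G, of \<sigma>] that by (simp add: map_lperm)
  fix i \<nu> l assume i: "i < length ps" "ps ! i = Labelled \<nu> l"
  note l = circ_gens_nth[OF g i]
  let ?a = "map (\<lambda>i. vs ! i) l"
  have a: "?a \<noteq> []" "set ?a \<subseteq> carrier V" using l vs by (auto simp: subset_iff)
  have g': "(\<mu>, (map ?b ps)[i := clsN (\<nu>', ?a)]) \<in> schur_gens M FN" if "\<nu>' \<in> carrier (sp N (length l))" for \<nu>'
    using schur_gens_update[OF G] schur_cls_closed[OF N V schur_gensI[of ?a \<nu>' N V]] a that by simp
  have 1: "(\<lambda>\<nu>'. clsN (\<nu>', ?a)) \<in> lin_maps K (sp N (length l)) FN"
    using schur_hom_lin[OF schur_cls_hom[OF N V] a] by simp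
  have 2: "(\<lambda>y. clsM (\<mu>, (map ?b ps)[i := y])) \<in> lin_maps K FN (schur K M FN)"
    using mlin_arg_lin[OF schur_hom_mlin[OF schur_cls_hom[OF M FN], of "length ps" \<mu>], of "map ?b ps" i] G' i(1) by simp
  show "(\<lambda>\<nu>'. clsM (\<mu>, map ?b (ps[i := Labelled \<nu>' l]))) \<in> lin_maps K (sp N (length l)) (schur K M FN)"
    using lin_maps_compose[OF 1 2] by (simp add: map_update arg_of_def)
  show "clsM (\<mu>, map ?b (ps[i := Labelled (act N (length l) \<nu> \<tau>) l])) = clsM (\<mu>, map ?b (ps[i := Labelled \<nu> (lperm \<tau> l)]))"
    if "\<tau> permutes {..<length l}" for \<tau>
    using schur_hom_balance[OF schur_cls_hom[OF N V] schur_gensI[OF a(1) _ a(2)], of \<nu> \<tau>] that l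
    by (simp add: map_update arg_of_def map_lperm)
qed

text \<open>Substitution of the inputs \<open>vs\<close> into an element of the plethysm;
  \<open>schur_circ\<close> is its linear extension over generators.\<close>

definition expand :: "('k, 'a) univ list \<Rightarrow> ('k, 'a) univ \<Rightarrow> ('k, 'a) univ" where
  "expand vs = lin_ext (schur K M FN) (\<lambda>(\<mu>, ps). clsM (\<mu>, map (\<lambda>p. clsN (arg_of vs p)) ps))"

lemma expand_lin:
  assumes "set vs \<subseteq> carrier V"
  shows "expand vs \<in> lin_maps K (circ_sp K M N (length vs)) (schur K M FN)"
  unfolding expand_def by (rule circ_lin_ext[OF M N FM expand_circ_hom]) (use assms in auto)

lemma expand_cls:
  assumes "set vs \<subseteq> carrier V" "(\<mu>, ps) \<in> circ_gens M N (length vs)"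
  shows "expand vs (circ_cls K M N (length vs) (\<mu>, ps)) = clsM (\<mu>, map (\<lambda>p. clsN (arg_of vs p)) ps)"
  unfolding expand_def by (subst circ_lin_ext_cls[OF M N FM expand_circ_hom]) (use assms in auto)

text \<open>The labels are distinct and exhaust the arity, so the input \<open>i\<close> is used
  exactly once, in one block \<open>j\<close> at one place \<open>r\<close>. Changing it alters one
  entry of one inner tensor, and multilinearity of the inner and the outer class finishes the
  proof.\<close>

lemma expand_mlin_cls:
  assumes g: "(\<mu>, ps) \<in> circ_gens M N n"
  shows "mlin K n V (schur K M FN) (\<lambda>vs. clsM (\<mu>, map (\<lambda>p. clsN (arg_of vs p)) ps))"
proof (rule mlinI)
  fix vs assume vs: "length vs = n" "set vs \<subseteq> carrier V"
  note G = arg_cls_closed[OF g vs]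
  show "clsM (\<mu>, map (\<lambda>p. clsN (arg_of vs p)) ps) \<in> carrier (schur K M FN)"
    by (rule schur_cls_closed[OF M FN G])
  fix i v assume i: "i < n" and v: "v \<in> carrier V"
  have "i \<in> set (concat (map labels_of ps))" using circ_gensD(5)[OF g] i by simp
  then obtain p where "p \<in> set ps" "i \<in> set (labels_of p)" by auto
  then obtain j where j: "j < length ps" "i \<in> set (labels_of (ps ! j))" by (auto simp: in_set_conv_nth[of p])
  then obtain r where r: "r < length (labels_of (ps ! j))" "labels_of (ps ! j) ! r = i" by (auto simp: in_set_conv_nth)
  let ?l = "labels_of (ps ! j)" and ?\<nu> = "op_of (ps ! j)"
  note D = circ_gensD(6)[OF g nth_mem[OF j(1)]]
  let ?a = "map (\<lambda>i. vs ! i) ?l"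
  have a: "set ?a \<subseteq> carrier V" "?a \<noteq> []" using D vs by (auto simp: subset_iff)
  have other: "i \<notin> set (labels_of (ps ! j'))" if "j' < length ps" "j' \<noteq> j" for j'
    using distinct_concat_nth[OF circ_gensD(4)[OF g], of j j'] that j by auto
  have dl: "distinct ?l" using circ_gensD(4)[OF g] j(1) by (auto simp: distinct_concat_iff)
  have one: "map (\<lambda>k. vs[i := u] ! k) ?l = ?a[r := u]" for u
    using r dl vs i D by (intro nth_equalityI) (auto simp: nth_list_update nth_eq_iff_index_eq)
  have upd: "map (\<lambda>p. clsN (arg_of (vs[i := u]) p)) ps = (map (\<lambda>p. clsN (arg_of vs p)) ps)[j := clsN (?\<nu>, ?a[r := u])]" for u
  proof (rule nth_equalityI)
    fix j' assume j': "j' < length (map (\<lambda>p. clsN (arg_of (vs[i := u]) p)) ps)"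
    have "arg_of (vs[i := u]) (ps ! j') = arg_of vs (ps ! j')" if "j' \<noteq> j"
      unfolding arg_of_def using other[of j'] that j' by (auto intro!: nth_list_update_neq)
    then show "map (\<lambda>p. clsN (arg_of (vs[i := u]) p)) ps ! j' = (map (\<lambda>p. clsN (arg_of vs p)) ps)[j := clsN (?\<nu>, ?a[r := u])] ! j'"
      using j' one by (cases "j' = j") (simp_all add: arg_of_def del: map_eq_conv)
  qed simp
  note mN = schur_hom_mlin[OF schur_cls_hom[OF N V], of "length ?l" ?\<nu>]
  note mM = schur_hom_mlin[OF schur_cls_hom[OF M FN], of "length ps" \<mu>]
  have cl: "clsN (?\<nu>, ?a[r := u]) \<in> carrier FN" if "u \<in> carrier V" for u
    using schur_cls_closed[OF N V schur_gens_update[OF schur_gensI[OF a(2) _ a(1)]]] that D by simp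
  note G' = schur_gensD[OF G]
  show "clsM (\<mu>, map (\<lambda>p. clsN (arg_of (vs[i := v \<oplus>\<^bsub>V\<^esub> w]) p)) ps) =
      clsM (\<mu>, map (\<lambda>p. clsN (arg_of (vs[i := v]) p)) ps) \<oplus>\<^bsub>schur K M FN\<^esub> clsM (\<mu>, map (\<lambda>p. clsN (arg_of (vs[i := w]) p)) ps)"
    if w: "w \<in> carrier V" for w
    unfolding upd using mlin_add[OF mN _ a(1) r(1) v w] mlin_add[OF mM _ _ _ cl[OF v] cl[OF w]] G' D j by simp
  show "clsM (\<mu>, map (\<lambda>p. clsN (arg_of (vs[i := c \<odot>\<^bsub>V\<^esub> v]) p)) ps) =
      c \<odot>\<^bsub>schur K M FN\<^esub> clsM (\<mu>, map (\<lambda>p. clsN (arg_of (vs[i := v]) p)) ps)"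
    if c: "c \<in> carrier K" for c
    unfolding upd using mlin_smult[OF mN _ a(1) r(1) c v] mlin_smult[OF mM _ _ _ c cl[OF v]] G' D j by simp
qed

text \<open>Multilinear maps are closed under linear combinations, so spanning induction in the
  plethysm element reduces this to generators.\<close>

lemma expand_mlin:
  assumes "y \<in> carrier (circ_sp K M N n)"
  shows "mlin K n V (schur K M FN) (\<lambda>vs. expand vs y)"
  using assms
proof (induction rule: circ_induct[OF M N, consumes 1, case_names zero step])
  case zero
  show ?case by (rule mlin_cong[OF mlin_zero[OF FM] V])
    (use lin_maps_zero[OF circ_module[OF M N] FM expand_lin] in auto)
next
  case (step c g y)
  obtain \<mu> ps where g: "g = (\<mu>, ps)" by (rule prod.exhaust)
  show ?case
  proof (rule mlin_cong[OF mlin_comb[OF V FM expand_mlin_cls[OF step(2)[unfolded g]] step(4) step(1)] V])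
    fix vs assume vs: "length vs = n" "set vs \<subseteq> carrier V"
    have "circ_cls K M N n g \<in> carrier (circ_sp K M N n)" by (rule circ_cls_closed[OF M N step(2)])
    then show "c \<odot>\<^bsub>schur K M FN\<^esub> clsM (\<mu>, map (\<lambda>p. clsN (arg_of vs p)) ps) \<oplus>\<^bsub>schur K M FN\<^esub> expand vs y =
        expand vs (c \<odot>\<^bsub>circ_sp K M N n\<^esub> circ_cls K M N n g \<oplus>\<^bsub>circ_sp K M N n\<^esub> y)"
      using expand_lin[OF vs(2)] expand_cls[OF vs(2)] vs(1) step g
      by (simp add: lin_maps_add lin_maps_smult module_smult[OF circ_module[OF M N]])
  qed
qed

lemma expand_schur_hom: "schur_hom K (circ K M N) V (schur K M FN) (\<lambda>(y, vs). expand vs y)"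
proof (rule schur_homI, unfold prod.case sp_circ[OF M N])
  fix vs assume "vs \<noteq> []" "set vs \<subseteq> carrier V"
  then show "expand vs \<in> lin_maps K (circ_sp K M N (length vs)) (schur K M FN)" by (intro expand_lin)
next
  fix y vs \<sigma> assume g: "(y, vs) \<in> schur_gens (circ K M N) V" and s: "\<sigma> permutes {..<length vs}"
  have vs: "set vs \<subseteq> carrier V" and y: "y \<in> carrier (circ_sp K M N (length vs))"
    using schur_gensD[OF g] by (auto simp: sp_circ[OF M N])
  have vs': "set (lperm \<sigma> vs) \<subseteq> carrier V" using vs s by (simp add: set_lperm)
  note a = circ_act_cls[OF M N s]
  show "expand vs (act (circ K M N) (length vs) y \<sigma>) = expand (lperm \<sigma> vs) y"
  proof (rule circ_lin_maps_eqI[OF M N FM lin_maps_compose[OF a(1) expand_lin[OF vs]] expand_lin[OF vs', unfolded length_lperm] _ y])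
    fix \<mu> ps assume g: "(\<mu>, ps) \<in> circ_gens M N (length vs)"
    \<comment> \<open>Reading \<open>vs\<close> at labels moved by the inverse of
      \<open>\<sigma>\<close> is the same as reading \<open>lperm \<sigma> vs\<close> at the
      original labels.\<close>
    have "arg_of vs (relabel (Hilbert_Choice.inv \<sigma>) p) = arg_of (lperm \<sigma> vs) p" if "p \<in> set ps" for p
      using circ_gensD(6)[OF g that] s by (auto simp: arg_of_def nth_lperm)
    then have "map (\<lambda>p. clsN (arg_of vs p)) (map (relabel (Hilbert_Choice.inv \<sigma>)) ps) = map (\<lambda>p. clsN (arg_of (lperm \<sigma> vs) p)) ps"
      by simp
    then show "expand vs (act (circ K M N) (length vs) (circ_cls K M N (length vs) (\<mu>, ps)) \<sigma>) = expand (lperm \<sigma> vs) (circ_cls K M N (length vs) (\<mu>, ps))"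
      using expand_cls[OF vs circ_gens_relabel[OF g permutes_inv[OF s]]] expand_cls[OF vs', unfolded length_lperm, OF g] a(2)[OF g] by (simp only:)
  qed
qed (rule expand_mlin)

lemma schur_circ_fun:
  shows "schur_circ K M N V \<in> Hom (Vect K) (schur K (circ K M N) V) (schur K M FN)"
    and "set vs \<subseteq> carrier V \<Longrightarrow> (\<mu>, ps) \<in> circ_gens M N (length vs) \<Longrightarrow>
      vmap_fun (schur_circ K M N V) (schur_cls K (circ K M N) V (circ_cls K M N (length vs) (\<mu>, ps), vs)) =
      clsM (\<mu>, map (\<lambda>p. clsN (arg_of vs p)) ps)"
proof -
  note MN = circ_smodule[OF M N]
  have e: "schur_circ K M N V = (schur K (circ K M N) V, \<lambda>x\<in>carrier (schur K (circ K M N) V). lin_ext (schur K M FN) (\<lambda>(y, vs). expand vs y) x, schur K M FN)"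
    by (simp add: schur_circ_def expand_def arg_of_def)
  show "schur_circ K M N V \<in> Hom (Vect K) (schur K (circ K M N) V) (schur K M FN)"
    unfolding e by (intro Vect_HomI schur_module MN V FM schur_lin_ext expand_schur_hom)
  assume vs: "set vs \<subseteq> carrier V" and g: "(\<mu>, ps) \<in> circ_gens M N (length vs)"
  have "vs \<noteq> []" using circ_gensD(1,3,6)[OF g] by (cases ps) fastforce+
  then have "(circ_cls K M N (length vs) (\<mu>, ps), vs) \<in> schur_gens (circ K M N) V"
    using vs circ_cls_closed[OF M N g] by (intro schur_gensI) (auto simp: sp_circ[OF M N])
  then show "vmap_fun (schur_circ K M N V) (schur_cls K (circ K M N) V (circ_cls K M N (length vs) (\<mu>, ps), vs)) = clsM (\<mu>, map (\<lambda>p. clsN (arg_of vs p)) ps)"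
    unfolding e by (simp add: schur_cls_closed[OF MN V] schur_lin_ext_cls[OF MN V FM expand_schur_hom] expand_cls[OF vs g])
qed

lemma circ_gens_pos: "(\<mu>, ps) \<in> circ_gens M N n \<Longrightarrow> n > 0"
  using circ_gensD(1,3,6) by (cases ps) fastforce+

lemma schur_circ_gens:
  assumes "set vs \<subseteq> carrier V" "(\<mu>, ps) \<in> circ_gens M N (length vs)"
  shows "(circ_cls K M N (length vs) (\<mu>, ps), vs) \<in> schur_gens (circ K M N) V"
  using assms circ_cls_closed[OF M N assms(2)] circ_gens_pos[OF assms(2)]
  by (intro schur_gensI) (auto simp: sp_circ[OF M N])

text \<open>Spanning in two stages: generators of the Schur functor carry an arbitrary plethysm
  element, which is a combination of plethysm generators.\<close>

lemma schur_circ_lin_maps_eqI: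
  assumes W: "module K W" and f: "f \<in> lin_maps K (schur K (circ K M N) V) W" and f': "f' \<in> lin_maps K (schur K (circ K M N) V) W"
    and eq: "\<And>\<mu> ps vs. set vs \<subseteq> carrier V \<Longrightarrow> (\<mu>, ps) \<in> circ_gens M N (length vs) \<Longrightarrow>
      f (schur_cls K (circ K M N) V (circ_cls K M N (length vs) (\<mu>, ps), vs)) = f' (schur_cls K (circ K M N) V (circ_cls K M N (length vs) (\<mu>, ps), vs))"
    and x: "x \<in> carrier (schur K (circ K M N) V)"
  shows "f x = f' x"
proof (rule schur_lin_maps_eqI[OF circ_smodule[OF M N] V W f f' _ x])
  fix y vs assume g: "(y, vs) \<in> schur_gens (circ K M N) V"
  note MN = circ_smodule[OF M N]
  have vs: "vs \<noteq> []" "set vs \<subseteq> carrier V" and y: "y \<in> carrier (circ_sp K M N (length vs))"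
    using schur_gensD[OF g] by (auto simp: sp_circ[OF M N])
  note l = schur_hom_lin[OF schur_cls_hom[OF MN V] vs, unfolded sp_circ[OF M N]]
  show "f (schur_cls K (circ K M N) V (y, vs)) = f' (schur_cls K (circ K M N) V (y, vs))"
    by (rule circ_lin_maps_eqI[OF M N W lin_maps_compose[OF l f] lin_maps_compose[OF l f'] eq[OF vs(2)] y])
qed

end

end

section \<open>The inverse map, by multilinear extension\<close>

context ground_ring
begin

context
  fixes M N :: "('k, 'a) smodule" and V :: "('k, 'a) vs"
  assumes M: "is_smodule K M" and N: "is_smodule K N" and V: "module K V"
begin

private abbreviation "FV \<equiv> schur K N V"
private abbreviation "cN \<equiv> schur_cls K N V"
private abbreviation "cM \<equiv> schur_cls K M FV"
private abbreviation "MN \<equiv> circ K M N"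

private lemmas FV = schur_inner_module[OF M N V]
private lemmas FMV = schur_outer_module[OF M N V]
private lemmas MN = circ_smodule[OF M N]

text \<open>The value of the inverse on a tensor of generators: their inputs are concatenated and
  the blocks numbered consecutively. Other tensors are reached by multilinear extension.\<close>

definition assemble :: "('k, 'a) univ \<Rightarrow> ('k, 'a) gen list \<Rightarrow> ('k, 'a) univ" where
  "assemble \<mu> gs = (let vs = concat (map snd gs) in
     schur_cls K MN V (circ_cls K M N (length vs) (\<mu>, blk 0 gs), vs))"

lemma snd_gens_closed: "set gs \<subseteq> schur_gens N V \<Longrightarrow> set (concat (map snd gs)) \<subseteq> carrier V"
  by (force simp: schur_gens_def)

lemma assemble_gens:
  assumes "gs \<noteq> []" "\<mu> \<in> carrier (sp M (length gs))" "set gs \<subseteq> schur_gens N V" "length us = length (concat (map snd gs))" "set us \<subseteq> carrier V"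
  shows "(circ_cls K M N (length us) (\<mu>, blk 0 gs), us) \<in> schur_gens MN V"
  using schur_circ_gens[OF M N V assms(5), of \<mu> "blk 0 gs"] blk_gens[OF assms(1-3)] assms(4) by simp

lemma assemble_closed:
  assumes "gs \<noteq> []" "\<mu> \<in> carrier (sp M (length gs))" "set gs \<subseteq> schur_gens N V"
  shows "assemble \<mu> gs \<in> carrier (schur K MN V)"
  unfolding assemble_def Let_def
  by (intro schur_cls_closed MN V assemble_gens assms snd_gens_closed HOL.refl)

text \<open>The balance relations allow one to renumber the inputs, so that the labels become consecutive.\<close>

lemma cls_assemble:
  assumes g: "(\<mu>, ps) \<in> circ_gens M N (length vs)" and vs: "set vs \<subseteq> carrier V"
  shows "schur_cls K MN V (circ_cls K M N (length vs) (\<mu>, ps), vs) = assemble \<mu> (map (arg_of vs) ps)"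
proof -
  let ?n = "length vs" and ?l = "concat (map labels_of ps)" and ?gs = "map (arg_of vs) ps"
  note D = circ_gensD[OF g]
  define w where "w i = (if i < ?n then ?l ! i else i)" for i
  have "bij_betw w {..<?n} {..<?n}"
    using bij_betw_nth[OF D(4), of "{..<?n}" "{..<?n}"] D(3,5)
    by (subst bij_betw_cong[where g = "(!) ?l"]) (auto simp: w_def)
  then have w: "w permutes {..<?n}" by (intro bij_imp_permutes) (auto simp: w_def)
  have us: "concat (map snd ?gs) = map (\<lambda>i. vs ! i) ?l"
    by (simp add: arg_of_def map_concat comp_def)
  also have "\<dots> = lperm (Hilbert_Choice.inv w) vs"
    using D(3) permutes_inv_inv[OF w]
    by (intro nth_equalityI) (auto simp: nth_lperm permutes_inv[OF w] w_def)
  finally have us: "concat (map snd ?gs) = lperm (Hilbert_Choice.inv w) vs" .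
  have gs: "set ?gs \<subseteq> schur_gens N V" using arg_of_gens[OF g _ HOL.refl vs] by auto
  have b: "(\<mu>, blk 0 ?gs) \<in> circ_gens M N ?n"
    using blk_gens[of ?gs \<mu> M N V] D gs us by simp
  have "map (relabel w) (blk 0 ?gs) = map (relabel (\<lambda>i. ?l ! i)) (blk 0 ?gs)"
    using circ_gensD(6)[OF b] by (auto simp: relabel_def w_def)
  also have "\<dots> = ps" using blk_relabel[of ps "[]" vs] D(6) by simp
  finally have r: "map (relabel w) (blk 0 ?gs) = ps" .
  have bg: "(circ_cls K M N ?n (\<mu>, blk 0 ?gs), vs) \<in> schur_gens MN V" by (rule schur_circ_gens[OF M N V vs b])
  have "assemble \<mu> ?gs = schur_cls K MN V (circ_cls K M N ?n (\<mu>, blk 0 ?gs), lperm (Hilbert_Choice.inv w) vs)"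
    unfolding assemble_def us by simp
  also have "\<dots> = schur_cls K MN V (act MN ?n (circ_cls K M N ?n (\<mu>, blk 0 ?gs)) (Hilbert_Choice.inv w), vs)"
    using schur_hom_balance[OF schur_cls_hom[OF MN V] bg permutes_inv[OF w]] by simp
  also have "\<dots> = schur_cls K MN V (circ_cls K M N ?n (\<mu>, ps), vs)"
    unfolding circ_act_cls(2)[OF M N permutes_inv[OF w] b] permutes_inv_inv[OF w] r ..
  finally show ?thesis by simp
qed

lemma assemble_lin:
  assumes gs: "gs \<noteq> []" "set gs \<subseteq> schur_gens N V"
  shows "(\<lambda>\<mu>. assemble \<mu> gs) \<in> lin_maps K (sp M (length gs)) (schur K MN V)"
proof (cases "carrier (sp M (length gs)) = {}")
  case True
  then show ?thesis by (auto intro: lin_mapsI)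
next
  case False
  \<comment> \<open>Linearity in the operation is stated at an existing generator, so some operation
    is needed to start from.\<close>
  then obtain \<mu> where \<mu>: "\<mu> \<in> carrier (sp M (length gs))" by auto
  have vs: "concat (map snd gs) \<noteq> []" "set (concat (map snd gs)) \<subseteq> carrier V"
    using gs snd_gens_closed[OF gs(2)] by (cases gs; force simp: schur_gens_def)+
  show ?thesis unfolding assemble_def Let_def
    by (rule lin_maps_compose[OF circ_hom_op[OF circ_cls_hom[OF M N] blk_gens[OF gs(1) \<mu> gs(2)], unfolded length_blk] schur_hom_lin[OF schur_cls_hom[OF MN V] vs, unfolded sp_circ[OF M N]]])
qed

text \<open>Permuting the blocks destroys their consecutive numbering. \<open>cls_assemble\<close>
  restores it by permuting the inputs along with the blocks, and the result is
  \<open>assemble\<close> of the permuted list.\<close>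

lemma assemble_balance:
  assumes gs: "gs \<noteq> []" "set gs \<subseteq> schur_gens N V" and \<mu>: "\<mu> \<in> carrier (sp M (length gs))" and s: "\<sigma> permutes {..<length gs}"
  shows "assemble (act M (length gs) \<mu> \<sigma>) gs = assemble \<mu> (lperm \<sigma> gs)"
proof -
  let ?vs = "concat (map snd gs)"
  note vs = snd_gens_closed[OF gs(2)]
  note b = blk_gens[OF gs(1) \<mu> gs(2)]
  have s': "\<sigma> permutes {..<length (blk 0 gs)}" using s by simp
  have "assemble (act M (length gs) \<mu> \<sigma>) gs = schur_cls K MN V (circ_cls K M N (length ?vs) (\<mu>, lperm \<sigma> (blk 0 gs)), ?vs)"
    using circ_hom_outer[OF circ_cls_hom[OF M N] b s'] by (simp add: assemble_def Let_def)
  also have "\<dots> = assemble \<mu> (map (arg_of ?vs) (lperm \<sigma> (blk 0 gs)))"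
    by (rule cls_assemble[OF circ_gens_lperm[OF b s'] vs])
  also have "map (arg_of ?vs) (lperm \<sigma> (blk 0 gs)) = lperm \<sigma> gs"
    using arg_of_blk[of "[]" gs] by (simp add: map_lperm[OF s'])
  finally show ?thesis .
qed

text \<open>This feeds the relation premise of \<open>mlin_extension\<close>: with generators in the
  other slots, \<open>assemble\<close> respects the relations of \<open>F_N(V)\<close> in the slot
  of \<open>g\<close>.\<close>

lemma assemble_arg_hom:
  assumes gs: "set gs \<subseteq> schur_gens N V" "set gs' \<subseteq> schur_gens N V" and \<mu>: "\<mu> \<in> carrier (sp M (Suc (length gs + length gs')))"
  shows "schur_hom K N V (schur K MN V) (\<lambda>g. assemble \<mu> (gs @ g # gs'))"
proof (rule schur_homI)
  let ?pre = "concat (map snd gs)" and ?post = "concat (map snd gs')"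
  have G: "gs @ g # gs' \<noteq> []" "\<mu> \<in> carrier (sp M (length (gs @ g # gs')))" for g using \<mu> by auto
  note cl = snd_gens_closed[OF gs(1)] snd_gens_closed[OF gs(2)]
  {
    fix n \<nu> assume n: "n > 0" "\<nu> \<in> carrier (sp N n)"
    \<comment> \<open>The operation and all labels depend only on the length of \<open>vs\<close>.
      Multilinearity is thus inherited from a segment of the long list of inputs.\<close>
    define P where "P = blk 0 gs @ Labelled \<nu> [length ?pre..<length ?pre + n] # blk (length ?pre + n) gs'"
    define m where "m = length ?pre + n + length ?post"
    have e: "assemble \<mu> (gs @ (\<nu>, vs) # gs') = schur_cls K MN V (circ_cls K M N m (\<mu>, P), ?pre @ vs @ ?post)" if "length vs = n" for vs
      using that by (simp add: assemble_def Let_def blk_append m_def P_def add.assoc)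
    show "mlin K n V (schur K MN V) (\<lambda>vs. assemble \<mu> (gs @ (\<nu>, vs) # gs'))"
    proof (cases "carrier V = {}")
      case True
      then have False using module.axioms(2)[OF V] by (simp add: abelian_group_def abelian_monoid_def comm_monoid_def monoid_def) 
      then show ?thesis ..
    next
      case False
      then obtain v where v: "v \<in> carrier V" by auto
      have "(\<nu>, replicate n v) \<in> schur_gens N V" using n v by (intro schur_gensI) auto
      then have "(\<mu>, blk 0 (gs @ (\<nu>, replicate n v) # gs')) \<in> circ_gens M N m"
        using blk_gens[of "gs @ (\<nu>, replicate n v) # gs'" \<mu> M N V] G(2) gs by (simp add: m_def add.assoc)
      then have "(\<mu>, P) \<in> circ_gens M N m" by (simp add: blk_append P_def)
      then have y: "circ_cls K M N m (\<mu>, P) \<in> carrier (sp MN m)" using circ_cls_closed[OF M N] sp_circ[OF M N] by simp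
      have m: "m > 0" using n by (simp add: m_def)
      note ml = schur_hom_mlin[OF schur_cls_hom[OF MN V] m y]
      have "mlin K n V (schur K MN V) (\<lambda>vs. schur_cls K MN V (circ_cls K M N m (\<mu>, P), ?pre @ vs @ ?post))"
      proof (rule mlinI)
        fix vs assume vs: "length vs = n" "set vs \<subseteq> carrier V"
        have l: "length (?pre @ vs @ ?post) = m" "set (?pre @ vs @ ?post) \<subseteq> carrier V" using vs cl by (auto simp: m_def)
        show "schur_cls K MN V (circ_cls K M N m (\<mu>, P), ?pre @ vs @ ?post) \<in> carrier (schur K MN V)"
          using mlin_closed[OF ml l] .
        fix i v assume i: "i < n" and v: "v \<in> carrier V"
        have up: "?pre @ vs[i := u] @ ?post = (?pre @ vs @ ?post)[length ?pre + i := u]" for u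
          using i vs by (simp add: list_update_append)
        have i': "length ?pre + i < m" using i by (simp add: m_def)
        show "schur_cls K MN V (circ_cls K M N m (\<mu>, P), ?pre @ vs[i := v \<oplus>\<^bsub>V\<^esub> w] @ ?post) =
            schur_cls K MN V (circ_cls K M N m (\<mu>, P), ?pre @ vs[i := v] @ ?post) \<oplus>\<^bsub>schur K MN V\<^esub>
            schur_cls K MN V (circ_cls K M N m (\<mu>, P), ?pre @ vs[i := w] @ ?post)" if "w \<in> carrier V" for w
          unfolding up by (rule mlin_add[OF ml l i' v that])
        show "schur_cls K MN V (circ_cls K M N m (\<mu>, P), ?pre @ vs[i := c \<odot>\<^bsub>V\<^esub> v] @ ?post) =
            c \<odot>\<^bsub>schur K MN V\<^esub> schur_cls K MN V (circ_cls K M N m (\<mu>, P), ?pre @ vs[i := v] @ ?post)" if "c \<in> carrier K" for c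
          unfolding up by (rule mlin_smult[OF ml l i' that v])
      qed
      then show ?thesis by (rule mlin_cong[OF _ V]) (simp add: e)
    qed
  next
    fix vs assume vs: "vs \<noteq> []" "set vs \<subseteq> carrier V"
    \<comment> \<open>Now inputs and labels are fixed and only the operation of block
      \<open>length gs\<close> varies.\<close>
    define P where "P \<nu> = blk 0 gs @ Labelled \<nu> [length ?pre..<length ?pre + length vs] # blk (length ?pre + length vs) gs'" for \<nu>
    define m where "m = length ?pre + length vs + length ?post"
    have e: "assemble \<mu> (gs @ (\<nu>, vs) # gs') = schur_cls K MN V (circ_cls K M N m (\<mu>, P \<nu>), ?pre @ vs @ ?post)" for \<nu>
      by (simp add: assemble_def Let_def blk_append m_def P_def add.assoc)
    have Pg: "(\<mu>, P \<nu>) \<in> circ_gens M N m" if "\<nu> \<in> carrier (sp N (length vs))" for \<nu>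
    proof -
      have "(\<nu>, vs) \<in> schur_gens N V" using vs that by (intro schur_gensI) auto
      then have "(\<mu>, blk 0 (gs @ (\<nu>, vs) # gs')) \<in> circ_gens M N m"
        using blk_gens[of "gs @ (\<nu>, vs) # gs'" \<mu> M N V] G(2) gs by (simp add: m_def add.assoc)
      then show ?thesis by (simp add: blk_append P_def)
    qed
    have us: "?pre @ vs @ ?post \<noteq> []" "set (?pre @ vs @ ?post) \<subseteq> carrier V" "length (?pre @ vs @ ?post) = m"
      using vs cl by (auto simp: m_def)
    interpret Nn: module K "sp N (length vs)" using vs by (intro smodule_module N) auto
    \<comment> \<open>Linearity in a block presupposes a generator with an operation in that block;
      the zero of \<open>N\<close> serves as a placeholder and is overwritten.\<close>
    have "(\<lambda>\<nu>'. circ_cls K M N m (\<mu>, (P \<zero>\<^bsub>sp N (length vs)\<^esub>)[length gs := Labelled \<nu>' [length ?pre..<length ?pre + length vs]]))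
        \<in> lin_maps K (sp N (length vs)) (circ_sp K M N m)"
      using circ_hom_arg[OF circ_cls_hom[OF M N] Pg[of "\<zero>\<^bsub>sp N (length vs)\<^esub>"], of "length gs" "\<zero>\<^bsub>sp N (length vs)\<^esub>" "[length ?pre..<length ?pre + length vs]"]
      by (simp add: P_def nth_append)
    then have "(\<lambda>\<nu>. circ_cls K M N m (\<mu>, P \<nu>)) \<in> lin_maps K (sp N (length vs)) (circ_sp K M N m)"
      by (simp add: P_def list_update_append)
    from lin_maps_compose[OF this schur_hom_lin[OF schur_cls_hom[OF MN V] us(1,2), unfolded us(3) sp_circ[OF M N]]]
    show "(\<lambda>\<nu>. assemble \<mu> (gs @ (\<nu>, vs) # gs')) \<in> lin_maps K (sp N (length vs)) (schur K MN V)"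
      unfolding e .
  next
    fix \<nu> vs \<tau> assume g: "(\<nu>, vs) \<in> schur_gens N V" and t: "\<tau> permutes {..<length vs}"
    note gD = schur_gensD[OF g]
    let ?l = "[length ?pre..<length ?pre + length vs]"
    let ?us = "?pre @ vs @ ?post"
    \<comment> \<open>Balance in the slot is the inner balance of the plethysm: it permutes the
      labels of one block, and renumbering turns this into a permutation of the inputs of that
      block.\<close>
    define P where "P p = blk 0 gs @ p # blk (length ?pre + length vs) gs'" for p :: "('k, 'a) univ"
    have us: "set ?us \<subseteq> carrier V" using gD cl by auto
    have b: "(\<mu>, P (Labelled \<nu> ?l)) \<in> circ_gens M N (length ?us)"
      using blk_gens[of "gs @ (\<nu>, vs) # gs'" \<mu> M N V] G(2) gs g by (simp add: P_def blk_append)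
    have i: "length gs < length (P p)" "P p ! length gs = p" "(P p)[length gs := p'] = P p'" for p p'
      by (simp_all add: P_def nth_append list_update_append)
    have lm: "mset (lperm \<tau> ?l) = mset ?l" unfolding lperm_def by (rule mset_permute_list) (use permutes_inv[OF t] in simp)
    have b': "(\<mu>, P (Labelled \<nu> (lperm \<tau> ?l))) \<in> circ_gens M N (length ?us)"
      using circ_gens_update[OF b i(1) i(2), of \<nu> "lperm \<tau> ?l"] gD lm i(3) by simp
    have "assemble \<mu> (gs @ (act N (length vs) \<nu> \<tau>, vs) # gs') =
        schur_cls K MN V (circ_cls K M N (length ?us) (\<mu>, P (Labelled (act N (length vs) \<nu> \<tau>) ?l)), ?us)"
      by (simp add: assemble_def Let_def blk_append P_def add.assoc)
    also have "\<dots> = schur_cls K MN V (circ_cls K M N (length ?us) (\<mu>, P (Labelled \<nu> (lperm \<tau> ?l))), ?us)"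
      using circ_hom_inner[OF circ_cls_hom[OF M N] b i(1) i(2), of \<tau>] t i(3) by simp
    also have "\<dots> = assemble \<mu> (map (arg_of ?us) (P (Labelled \<nu> (lperm \<tau> ?l))))"
      by (rule cls_assemble[OF b' us])
    also have "map (arg_of ?us) (P (Labelled \<nu> (lperm \<tau> ?l))) = gs @ (\<nu>, lperm \<tau> vs) # gs'"
    proof -
      have "map (arg_of ?us) (P (Labelled \<nu> ?l)) = gs @ (\<nu>, vs) # gs'"
        using arg_of_blk[of "[]" "gs @ (\<nu>, vs) # gs'"] by (simp add: P_def blk_append)
      moreover have "length (map (arg_of ?us) (blk 0 gs)) = length gs" by simp
      ultimately have *: "map (arg_of ?us) (blk 0 gs) = gs" "arg_of ?us (Labelled \<nu> ?l) = (\<nu>, vs)" "map (arg_of ?us) (blk (length ?pre + length vs) gs') = gs'"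
        unfolding P_def map_append list.map by (metis append_eq_append_conv list.inject)+
      have "arg_of ?us (Labelled \<nu> (lperm \<tau> ?l)) = (\<nu>, lperm \<tau> (map (\<lambda>i. ?us ! i) ?l))"
        using t by (simp add: arg_of_def map_lperm)
      also have "\<dots> = (\<nu>, lperm \<tau> vs)" using *(2) by (simp add: arg_of_def)
      finally show ?thesis using *(1,3) by (simp add: P_def)
    qed
    finally show "assemble \<mu> (gs @ (act N (length vs) \<nu> \<tau>, vs) # gs') = assemble \<mu> (gs @ (\<nu>, lperm \<tau> vs) # gs')" .
  }
qed

lemma schur_circ_assemble:
  assumes gs: "gs \<noteq> []" "\<mu> \<in> carrier (sp M (length gs))" "set gs \<subseteq> schur_gens N V"
  shows "vmap_fun (schur_circ K M N V) (assemble \<mu> gs) = cM (\<mu>, map cN gs)"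
proof -
  have "map (\<lambda>p. cN (arg_of (concat (map snd gs)) p)) (blk 0 gs) = map cN gs"
    using arg_cong[OF arg_of_blk[of "[]" gs], of "map cN"] by (simp add: comp_def)
  then show ?thesis
    using schur_circ_fun(2)[OF M N V snd_gens_closed[OF gs(3)] blk_gens[OF gs]] by (simp add: assemble_def Let_def)
qed

text \<open>The multilinear maps are chosen separately for each \<open>\<mu>\<close>. Their
  dependence on \<open>\<mu>\<close> is not part of the choice and is recovered afterwards from
  uniqueness.\<close>

lemma disassemble_ex:
  "\<exists>h. \<forall>k>0. \<forall>\<mu>\<in>carrier (sp M k). mlin K k FV (schur K MN V) (h k \<mu>) \<and>
     (\<forall>gs. length gs = k \<longrightarrow> set gs \<subseteq> schur_gens N V \<longrightarrow> h k \<mu> (map cN gs) = assemble \<mu> gs)"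
proof -
  interpret P: presentation K "schur_gens N V" "schur_rels K N V" by (rule schur_presentation[OF N V])
  have fold: "schur_cls K N V = (\<lambda>g. pres_cls K (schur_gens N V) (schur_rels K N V) [(\<one>, g)])" by (simp add: schur_cls_def[abs_def])
  have "\<exists>h. mlin K k FV (schur K MN V) h \<and> (\<forall>gs. length gs = k \<longrightarrow> set gs \<subseteq> schur_gens N V \<longrightarrow> h (map cN gs) = assemble \<mu> gs)"
    if "k > 0" "\<mu> \<in> carrier (sp M k)" for k \<mu>
    unfolding schur_def[of K N] fold
  proof (rule P.mlin_extension[OF schur_module[OF MN V]])
    fix gs assume "length gs = k" "set gs \<subseteq> schur_gens N V"
    then show "assemble \<mu> gs \<in> carrier (schur K MN V)" using that by (intro assemble_closed) auto
  next
    fix gs gs' ts us assume *: "Suc (length gs + length gs') = k" "set gs \<subseteq> schur_gens N V" "set gs' \<subseteq> schur_gens N V" "(ts, us) \<in> schur_rels K N V"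
    show "leval (schur K MN V) (\<lambda>g. assemble \<mu> (gs @ g # gs')) ts = leval (schur K MN V) (\<lambda>g. assemble \<mu> (gs @ g # gs')) us"
      by (rule schur_hom_resp[OF N V schur_module[OF MN V] assemble_arg_hom[OF *(2,3)] *(4)]) (use *(1) that in simp)
  qed
  then show ?thesis by metis
qed

lemma mlin_schur_eqI:
  assumes "module K W" "mlin K k FV W f" "mlin K k FV W f'"
    "\<And>gs. length gs = k \<Longrightarrow> set gs \<subseteq> schur_gens N V \<Longrightarrow> f (map cN gs) = f' (map cN gs)"
    "length ys = k" "set ys \<subseteq> carrier FV"
  shows "f ys = f' ys"
proof -
  interpret P: presentation K "schur_gens N V" "schur_rels K N V" by (rule schur_presentation[OF N V])
  have fold: "schur_cls K N V = (\<lambda>g. pres_cls K (schur_gens N V) (schur_rels K N V) [(\<one>, g)])" by (simp add: schur_cls_def[abs_def])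
  show ?thesis
    using assms P.mlin_presented_eqI[of W k f f' ys] unfolding schur_def[of K N] fold by blast
qed

text \<open>Additivity, homogeneity and balance of the chosen maps in \<open>\<mu>\<close> are
  equations between multilinear maps, hence follow from the same properties of
  \<open>assemble\<close> on generators. The maps then define a linear map back, and both composites
  are the identity because they are so on generators.\<close>

lemma schur_circ_bij: "bij_betw (vmap_fun (schur_circ K M N V)) (carrier (schur K MN V)) (carrier (schur K M FV))"
proof -
  obtain h where h: "\<And>k \<mu>. k > 0 \<Longrightarrow> \<mu> \<in> carrier (sp M k) \<Longrightarrow> mlin K k FV (schur K MN V) (h k \<mu>)"
     "\<And>k \<mu> gs. k > 0 \<Longrightarrow> \<mu> \<in> carrier (sp M k) \<Longrightarrow> length gs = k \<Longrightarrow> set gs \<subseteq> schur_gens N V \<Longrightarrow> h k \<mu> (map cN gs) = assemble \<mu> gs"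
    using disassemble_ex by metis
  let ?h = "\<lambda>(\<mu>, ys). h (length ys) \<mu> ys"
  note W = schur_module[OF MN V]
  have hom: "schur_hom K M FV (schur K MN V) ?h"
  proof (rule schur_homI, unfold prod.case)
    fix n \<mu> assume n: "n > 0" "\<mu> \<in> carrier (sp M n)"
    show "mlin K n FV (schur K MN V) (\<lambda>ys. h (length ys) \<mu> ys)"
      by (rule mlin_cong[OF h(1)[OF n] FV]) simp
  next
    fix ys assume ys: "ys \<noteq> []" "set ys \<subseteq> carrier FV"
    let ?k = "length ys"
    have k: "?k > 0" using ys by simp
    interpret W: module K "schur K MN V" by (rule W)
    interpret Mk: module K "sp M ?k" by (rule smodule_module[OF M k])
    \<comment> \<open>The zero map is the second summand that makes \<open>mlin_comb\<close> cover
      plain scalar multiples.\<close>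
    have zero: "mlin K ?k FV (schur K MN V) (\<lambda>ys. \<zero>\<^bsub>schur K MN V\<^esub>)" by (rule mlin_zero[OF W])
    have gs0: "gs \<noteq> []" if "length gs = ?k" for gs :: "('k, 'a) gen list" using that k by auto
    show "(\<lambda>\<mu>. h ?k \<mu> ys) \<in> lin_maps K (sp M ?k) (schur K MN V)"
    proof (rule lin_mapsI)
      fix \<mu> assume m: "\<mu> \<in> carrier (sp M ?k)"
      note c1 = mlin_closed[OF h(1)[OF k m]]
      show "h ?k \<mu> ys \<in> carrier (schur K MN V)" by (rule c1[OF HOL.refl ys(2)])
      show "h ?k (\<mu> \<oplus>\<^bsub>sp M ?k\<^esub> \<mu>') ys = h ?k \<mu> ys \<oplus>\<^bsub>schur K MN V\<^esub> h ?k \<mu>' ys" if m': "\<mu>' \<in> carrier (sp M ?k)" for \<mu>'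
      proof -
        have ml: "mlin K ?k FV (schur K MN V) (\<lambda>ys. h ?k \<mu> ys \<oplus>\<^bsub>schur K MN V\<^esub> h ?k \<mu>' ys)"
          by (rule mlin_cong[OF mlin_comb[OF FV W h(1)[OF k m] h(1)[OF k m'] one_closed] FV]) (simp add: c1)
        show ?thesis
        proof (rule mlin_schur_eqI[OF W h(1)[OF k Mk.a_closed[OF m m']] ml _ HOL.refl ys(2)])
          fix gs assume gs: "length gs = ?k" "set gs \<subseteq> schur_gens N V"
          show "h ?k (\<mu> \<oplus>\<^bsub>sp M ?k\<^esub> \<mu>') (map cN gs) = h ?k \<mu> (map cN gs) \<oplus>\<^bsub>schur K MN V\<^esub> h ?k \<mu>' (map cN gs)"
            using lin_maps_add[OF assemble_lin[OF gs0[OF gs(1)] gs(2)], of \<mu> \<mu>'] gs m m' by (simp add: h(2)[OF k _ gs])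
        qed
      qed
      show "h ?k (c \<odot>\<^bsub>sp M ?k\<^esub> \<mu>) ys = c \<odot>\<^bsub>schur K MN V\<^esub> h ?k \<mu> ys" if c: "c \<in> carrier K" for c
      proof -
        have ml: "mlin K ?k FV (schur K MN V) (\<lambda>ys. c \<odot>\<^bsub>schur K MN V\<^esub> h ?k \<mu> ys)"
          by (rule mlin_cong[OF mlin_comb[OF FV W h(1)[OF k m] zero c] FV]) (simp add: c1 c)
        show ?thesis
        proof (rule mlin_schur_eqI[OF W h(1)[OF k Mk.smult_closed[OF c m]] ml _ HOL.refl ys(2)])
          fix gs assume gs: "length gs = ?k" "set gs \<subseteq> schur_gens N V"
          show "h ?k (c \<odot>\<^bsub>sp M ?k\<^esub> \<mu>) (map cN gs) = c \<odot>\<^bsub>schur K MN V\<^esub> h ?k \<mu> (map cN gs)"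
            using lin_maps_smult[OF assemble_lin[OF gs0[OF gs(1)] gs(2)], of c \<mu>] gs m c by (simp add: h(2)[OF k _ gs])
        qed
      qed
    qed
  next
    fix \<mu> ys \<sigma> assume g: "(\<mu>, ys) \<in> schur_gens M FV" and s: "\<sigma> permutes {..<length ys}"
    let ?k = "length ys"
    have ys: "?k > 0" "\<mu> \<in> carrier (sp M ?k)" "set ys \<subseteq> carrier FV" using schur_gensD[OF g] by auto
    note a = smodule_act_closed[OF M ys(1) s ys(2)]
    show "h ?k (act M ?k \<mu> \<sigma>) ys = h (length (lperm \<sigma> ys)) \<mu> (lperm \<sigma> ys)"
      unfolding length_lperm
    proof (rule mlin_schur_eqI[OF W h(1)[OF ys(1) a] mlin_lperm[OF h(1)[OF ys(1,2)] s] _ HOL.refl ys(3)])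
      fix gs assume gs: "length gs = ?k" "set gs \<subseteq> schur_gens N V"
      have s': "\<sigma> permutes {..<length gs}" using s gs by simp
      have "gs \<noteq> []" using gs ys(1) by auto
      then show "h ?k (act M ?k \<mu> \<sigma>) (map cN gs) = h ?k \<mu> (lperm \<sigma> (map cN gs))"
        unfolding map_lperm[OF s', symmetric]
        using assemble_balance[OF _ gs(2), of \<mu> \<sigma>] h(2)[OF ys(1) a gs] h(2)[OF ys(1,2), of "lperm \<sigma> gs"] gs ys s'
        by (simp add: set_lperm)
    qed
  qed
  let ?f = "vmap_fun (schur_circ K M N V)" and ?g = "lin_ext (schur K MN V) ?h"
  note g = schur_lin_ext[OF M FV W hom] and gc = schur_lin_ext_cls[OF M FV W hom]
  note f = Vect_Hom_lin[OF schur_circ_fun(1)[OF M N V]]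
  have gh: "?g (cM (\<mu>, map cN gs)) = assemble \<mu> gs" if gs: "gs \<noteq> []" "\<mu> \<in> carrier (sp M (length gs))" "set gs \<subseteq> schur_gens N V" for \<mu> gs
  proof -
    have "(\<mu>, map cN gs) \<in> schur_gens M FV" using gs by (intro schur_gensI) (auto intro: schur_cls_closed[OF N V])
    from gc[OF this] show ?thesis using h(2)[OF _ gs(2) HOL.refl gs(3)] gs(1) by simp
  qed
  have gf: "?g (?f x) = x" if x: "x \<in> carrier (schur K MN V)" for x
  proof (rule schur_circ_lin_maps_eqI[OF M N V W lin_maps_compose[OF f g] lin_maps_id _ x])
    fix \<mu> ps vs assume vs: "set vs \<subseteq> carrier V" and p: "(\<mu>, ps) \<in> circ_gens M N (length vs)"
    have "set (map (arg_of vs) ps) \<subseteq> schur_gens N V" using arg_of_gens[OF p _ HOL.refl vs] by auto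
    then show "?g (?f (schur_cls K MN V (circ_cls K M N (length vs) (\<mu>, ps), vs))) = schur_cls K MN V (circ_cls K M N (length vs) (\<mu>, ps), vs)"
      using gh[of "map (arg_of vs) ps" \<mu>] circ_gensD(1,2)[OF p] unfolding schur_circ_fun(2)[OF M N V vs p] unfolding cls_assemble[OF p vs]
      by (simp add: comp_def)
  qed
  have fg: "?f (?g x) = x" if x: "x \<in> carrier (schur K M FV)" for x
  proof (rule schur_lin_maps_eqI[OF M FV FMV lin_maps_compose[OF g f] lin_maps_id _ x])
    fix \<mu> ys assume y: "(\<mu>, ys) \<in> schur_gens M FV"
    have ys: "length ys > 0" "\<mu> \<in> carrier (sp M (length ys))" "set ys \<subseteq> carrier FV" using schur_gensD[OF y] by auto
    \<comment> \<open>The arguments \<open>ys\<close> are arbitrary elements, so this comparison too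
      is made on generators, by uniqueness of multilinear maps.\<close>
    have "?f (h (length ys) \<mu> ys) = cM (\<mu>, ys)"
    proof (rule mlin_schur_eqI[OF FMV mlin_compose[OF h(1)[OF ys(1,2)] f] schur_hom_mlin[OF schur_cls_hom[OF M FV] ys(1,2)] _ HOL.refl ys(3)])
      fix gs assume gs: "length gs = length ys" "set gs \<subseteq> schur_gens N V"
      moreover have "gs \<noteq> []" using gs ys by auto
      ultimately show "?f (h (length ys) \<mu> (map cN gs)) = cM (\<mu>, map cN gs)"
        using schur_circ_assemble[of gs \<mu>] ys by (subst h(2)[OF ys(1,2) gs]) auto
    qed
    then show "?f (?g (cM (\<mu>, ys))) = cM (\<mu>, ys)" using gc[OF y] by simp
  qed
  show ?thesis
    by (rule bij_betw_byWitness[where f' = ?g]) (use gf fg in \<open>auto intro: lin_maps_closed[OF f] lin_maps_closed[OF g]\<close>)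
qed

end

lemma schur_circ_natural:
  assumes M: "is_smodule K M" and N: "is_smodule K N" and a: "a \<in> Hom (Vect K) V W"
  shows "schur_circ K M N W \<bullet>\<^bsub>Vect K\<^esub> schur_map K (circ K M N) a = schur_map K M (schur_map K N a) \<bullet>\<^bsub>Vect K\<^esub> schur_circ K M N V"
proof -
  note V = Vect_Hom_module(1)[OF a] and W = Vect_Hom_module(2)[OF a] and MN = circ_smodule[OF M N]
  note A = schur_map_fun[OF MN a] and B = schur_map_fun[OF N a]
  note C = schur_map_fun[OF M B(1)] and cV = schur_circ_fun[OF M N V] and cW = schur_circ_fun[OF M N W]
  have H1: "schur_circ K M N W \<bullet>\<^bsub>Vect K\<^esub> schur_map K (circ K M N) a \<in> Hom (Vect K) (schur K (circ K M N) V) (schur K M (schur K N W))"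
    by (rule Vect_comp_Hom[OF A(1) cW(1)])
  have H2: "schur_map K M (schur_map K N a) \<bullet>\<^bsub>Vect K\<^esub> schur_circ K M N V \<in> Hom (Vect K) (schur K (circ K M N) V) (schur K M (schur K N W))"
    by (rule Vect_comp_Hom[OF cV(1) C(1)])
  show ?thesis
  proof (rule Vect_Hom_eqI[OF H1 H2])
    fix x assume x: "x \<in> carrier (schur K (circ K M N) V)"
    show "vmap_fun (schur_circ K M N W \<bullet>\<^bsub>Vect K\<^esub> schur_map K (circ K M N) a) x = vmap_fun (schur_map K M (schur_map K N a) \<bullet>\<^bsub>Vect K\<^esub> schur_circ K M N V) x"
    proof (rule schur_circ_lin_maps_eqI[OF M N V Vect_Hom_module(2)[OF H1] Vect_Hom_lin[OF H1] Vect_Hom_lin[OF H2] _ x])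
      fix \<mu> ps vs assume vs: "set vs \<subseteq> carrier V" and g: "(\<mu>, ps) \<in> circ_gens M N (length vs)"
      note G = schur_circ_gens[OF M N V vs g]
      have vs': "set (map (vmap_fun a) vs) \<subseteq> carrier W" using vs Vect_Hom_closed[OF a] by auto
      have g': "(\<mu>, ps) \<in> circ_gens M N (length (map (vmap_fun a) vs))" using g by simp
      have e: "arg_of (map (vmap_fun a) vs) p = (fst (arg_of vs p), map (vmap_fun a) (snd (arg_of vs p)))" if "p \<in> set ps" for p
        using circ_gensD(6)[OF g that] by (auto simp: arg_of_def)
      have "map (\<lambda>p. schur_cls K N W (arg_of (map (vmap_fun a) vs) p)) ps = map (vmap_fun (schur_map K N a)) (map (\<lambda>p. schur_cls K N V (arg_of vs p)) ps)"
        using B(2)[of "fst (arg_of vs p)" "snd (arg_of vs p)" for p] arg_of_gens[OF g _ HOL.refl vs] by (auto simp: e)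
      then show "vmap_fun (schur_circ K M N W \<bullet>\<^bsub>Vect K\<^esub> schur_map K (circ K M N) a) (schur_cls K (circ K M N) V (circ_cls K M N (length vs) (\<mu>, ps), vs)) =
         vmap_fun (schur_map K M (schur_map K N a) \<bullet>\<^bsub>Vect K\<^esub> schur_circ K M N V) (schur_cls K (circ K M N) V (circ_cls K M N (length vs) (\<mu>, ps), vs))"
        using cW(2)[OF vs' g'] cV(2)[OF vs g] C(2)[OF arg_cls_closed[OF M N V g HOL.refl vs]] A(2)[OF G] schur_cls_closed[OF MN V G]
        by (simp only: vmap_fun_comp[OF A(1) cW(1)] vmap_fun_comp[OF cV(1) C(1)] length_map)
    qed
  qed
qed

text \<open>Naturality in the right factor of the plethysm. It is applied to \<open>s_unit\<close>
  and \<open>s_counit\<close>, to pass between \<open>A\<close> and the unit S-module.\<close>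

lemma schur_circ_inner_natural:
  fixes M N N' :: "('k, 'a) smodule"
  assumes M: "is_smodule K M" and N: "is_smodule K N" "is_smodule K N'" and f: "smor K N N' f" and V: "module K V"
    and x: "x \<in> carrier (schur K (circ K M N) V)"
  shows "vmap_fun (schur_circ K M N' V) (vmap_fun (schur_nat K (circ K M N) (circ K M N') (circ_map K M N' sid f) V) x) =
    vmap_fun (schur_map K M (schur_nat K N N' f V)) (vmap_fun (schur_circ K M N V) x)"
proof -
  have "(sid :: ('k, 'a) smap) n = (\<lambda>x. x)" for n by (simp add: fun_eq_iff sid_def)
  then have id: "smor K M M sid" by (simp add: smor_def lin_maps_id)
  note MN = circ_smodule[OF M N(1)] and MN' = circ_smodule[OF M N(2)]
  note cm = circ_map_smor[OF M M N id f] and cf = circ_map_fun[OF M M N id f]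
  note A = schur_nat_fun[OF MN MN' cm V] and B = schur_nat_fun[OF N f V] 
  note C = schur_map_fun[OF M B(1)] and c = schur_circ_fun[OF M N(1) V] and c' = schur_circ_fun[OF M N(2) V]
  note H1 = lin_maps_compose[OF Vect_Hom_lin[OF A(1)] Vect_Hom_lin[OF c'(1)]]
  note H2 = lin_maps_compose[OF Vect_Hom_lin[OF c(1)] Vect_Hom_lin[OF C(1)]]
  show ?thesis
  proof (rule schur_circ_lin_maps_eqI[OF M N(1) V Vect_Hom_module(2)[OF C(1)] H1 H2 _ x])
    fix \<mu> ps vs assume vs: "set vs \<subseteq> carrier V" and g: "(\<mu>, ps) \<in> circ_gens M N (length vs)"
    note G = schur_circ_gens[OF M N(1) V vs g]
    have g': "(\<mu>, map (on_ops f) ps) \<in> circ_gens M N' (length vs)"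
      using circ_gens_on_ops[OF id f g] by (simp add: sid_def)
    have e: "arg_of vs (on_ops f p) = (f (length (snd (arg_of vs p))) (fst (arg_of vs p)), snd (arg_of vs p))" for p
      by (simp add: arg_of_def)
    have "map (\<lambda>p. schur_cls K N' V (arg_of vs p)) (map (on_ops f) ps) = map (vmap_fun (schur_nat K N N' f V)) (map (\<lambda>p. schur_cls K N V (arg_of vs p)) ps)"
      using B(2)[of "fst (arg_of vs p)" "snd (arg_of vs p)" for p] arg_of_gens[OF g _ HOL.refl vs] by (auto simp: e)
    then show "vmap_fun (schur_circ K M N' V) (vmap_fun (schur_nat K (circ K M N) (circ K M N') (circ_map K M N' sid f) V) (schur_cls K (circ K M N) V (circ_cls K M N (length vs) (\<mu>, ps), vs))) =
      vmap_fun (schur_map K M (schur_nat K N N' f V)) (vmap_fun (schur_circ K M N V) (schur_cls K (circ K M N) V (circ_cls K M N (length vs) (\<mu>, ps), vs)))"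
      using c'(2)[OF vs g'] c(2)[OF vs g] C(2)[OF arg_cls_closed[OF M N(1) V g HOL.refl vs]] A(2)[OF G] cf(2)[OF g] by (simp add: sid_def del: map_map map_eq_conv)
  qed
qed

end

section \<open>Eilenberg-Moore categories\<close>

lemma em_alg_simps [simp]:
  "Ob (em_alg C F m e) = em_algs C F m e"
  "Dom (em_alg C F m e) (X, f, Y) = X" "Cod (em_alg C F m e) (X, f, Y) = Y"
  "(Y', g, Z) \<bullet>\<^bsub>em_alg C F m e\<^esub> (X, f, Y) = (X, g \<bullet>\<^bsub>C\<^esub> f, Z)"
  "Ide (em_alg C F m e) X = (X, Ide C (fst X), X)"
  by (simp_all add: em_alg_def)

lemma em_coalg_simps [simp]:
  "Ob (em_coalg C F m e) = em_coalgs C F m e"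
  "Dom (em_coalg C F m e) (X, f, Y) = X" "Cod (em_coalg C F m e) (X, f, Y) = Y"
  "(Y', g, Z) \<bullet>\<^bsub>em_coalg C F m e\<^esub> (X, f, Y) = (X, g \<bullet>\<^bsub>C\<^esub> f, Z)"
  "Ide (em_coalg C F m e) X = (X, Ide C (fst X), X)"
  by (simp_all add: em_coalg_def)

locale category_loc =
  fixes C :: "('o, 'a) category" (structure)
  assumes category: "is_category C"
begin

lemma arr_ob [simp]: "f \<in> Arr C \<Longrightarrow> Dom C f \<in> Ob C" "f \<in> Arr C \<Longrightarrow> Cod C f \<in> Ob C"
  using category by (auto simp: is_category_def)

lemma ide_arr [simp]: "X \<in> Ob C \<Longrightarrow> Ide C X \<in> Arr C" "X \<in> Ob C \<Longrightarrow> Dom C (Ide C X) = X" "X \<in> Ob C \<Longrightarrow> Cod C (Ide C X) = X"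
  using category by (auto simp: is_category_def Hom_def)

lemma comp_arr [simp]:
  assumes "f \<in> Arr C" "g \<in> Arr C" "Cod C f = Dom C g"
  shows "g \<bullet> f \<in> Arr C" "Dom C (g \<bullet> f) = Dom C f" "Cod C (g \<bullet> f) = Cod C g"
  using category assms by (auto simp: is_category_def Hom_def)

lemma comp_ide [simp]: "f \<in> Arr C \<Longrightarrow> Dom C f = X \<Longrightarrow> f \<bullet> Ide C X = f" "f \<in> Arr C \<Longrightarrow> Cod C f = X \<Longrightarrow> Ide C X \<bullet> f = f"
  using category by (auto simp: is_category_def)

lemma comp_assoc [simp]:
  "f \<in> Arr C \<Longrightarrow> g \<in> Arr C \<Longrightarrow> h \<in> Arr C \<Longrightarrow> Cod C f = Dom C g \<Longrightarrow> Cod C g = Dom C h \<Longrightarrow> (h \<bullet> g) \<bullet> f = h \<bullet> (g \<bullet> f)"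
  using category by (auto simp: is_category_def)

text \<open>Composites are kept associated to the right; in this form an equation
  \<open>g \<bullet> f = k\<close> can be applied in the middle of such a composite.\<close>

lemma comp_tail:
  "g \<bullet> f = k \<Longrightarrow> f \<in> Arr C \<Longrightarrow> g \<in> Arr C \<Longrightarrow> Cod C f = Dom C g \<Longrightarrow> x \<in> Arr C \<Longrightarrow> Cod C x = Dom C f \<Longrightarrow> g \<bullet> (f \<bullet> x) = k \<bullet> x"
  by (metis comp_assoc)

lemma iso_cancel:
  assumes "iso_arr C f" "f \<bullet> x = f \<bullet> y" "x \<in> Arr C" "y \<in> Arr C" "Cod C x = Dom C f" "Cod C y = Dom C f"
  shows "x = y"
proof -
  obtain g where g: "f \<in> Arr C" "g \<in> Hom C (Cod C f) (Dom C f)" "g \<bullet> f = Ide C (Dom C f)"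
    using assms(1) by (auto simp: iso_arr_def)
  have "g \<bullet> (f \<bullet> x) = g \<bullet> (f \<bullet> y)" by (simp only: assms(2))
  moreover have "g \<bullet> (f \<bullet> z) = z" if "z \<in> Arr C" "Cod C z = Dom C f" for z
    using g that comp_tail[OF g(3), of z] by (simp add: Hom_def)
  ultimately show ?thesis using assms(3-6) by metis
qed

lemma iso_cancel_right:
  assumes "iso_arr C f" "x \<bullet> f = y \<bullet> f" "x \<in> Arr C" "y \<in> Arr C" "Dom C x = Cod C f" "Dom C y = Cod C f"
  shows "x = y"
proof -
  obtain g where g: "f \<in> Arr C" "g \<in> Hom C (Cod C f) (Dom C f)" "f \<bullet> g = Ide C (Cod C f)"
    using assms(1) by (auto simp: iso_arr_def)
  have "(x \<bullet> f) \<bullet> g = (y \<bullet> f) \<bullet> g" by (simp only: assms(2))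
  moreover have "(z \<bullet> f) \<bullet> g = z" if "z \<in> Arr C" "Dom C z = Cod C f" for z
    using g that by (simp add: Hom_def)
  ultimately show ?thesis using assms(3-6) by metis
qed

lemma isoI:
  assumes "f \<in> Arr C" "g \<in> Arr C" "Dom C g = Cod C f" "Cod C g = Dom C f" "g \<bullet> f = Ide C (Dom C f)" "f \<bullet> g = Ide C (Cod C f)"
  shows "iso_arr C f"
  unfolding iso_arr_def Hom_def using assms by blast

lemma isoE:
  assumes "iso_arr C f"
  obtains g where "f \<in> Arr C" "g \<in> Arr C" "Dom C g = Cod C f" "Cod C g = Dom C f" "g \<bullet> f = Ide C (Dom C f)" "f \<bullet> g = Ide C (Cod C f)"
  using assms unfolding iso_arr_def Hom_def by blast

lemma iso_comp:
  assumes "iso_arr C f" "iso_arr C g" "Cod C f = Dom C g"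
  shows "iso_arr C (g \<bullet> f)"
proof -
  obtain f' where f: "f \<in> Arr C" "f' \<in> Arr C" "Dom C f' = Cod C f" "Cod C f' = Dom C f" "f' \<bullet> f = Ide C (Dom C f)" "f \<bullet> f' = Ide C (Cod C f)"
    using assms(1) by (rule isoE)
  obtain g' where g: "g \<in> Arr C" "g' \<in> Arr C" "Dom C g' = Cod C g" "Cod C g' = Dom C g" "g' \<bullet> g = Ide C (Dom C g)" "g \<bullet> g' = Ide C (Cod C g)"
    using assms(2) by (rule isoE)
  have "g' \<bullet> (g \<bullet> f) = f" "f \<bullet> (f' \<bullet> g') = g'"
    using comp_tail[OF g(5)] comp_tail[OF f(6)] f g assms(3) by auto
  then show ?thesis using f g assms(3) by (intro isoI[of _ "f' \<bullet> g'"]) simp_all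
qed

end

locale endofunctor = category_loc +
  fixes F assumes endo: "is_functor C C F"
begin

lemma F_ob [simp]: "X \<in> Ob C \<Longrightarrow> FOb F X \<in> Ob C"
  using endo by (auto simp: is_functor_def)

lemma F_arr [simp]: "f \<in> Arr C \<Longrightarrow> FArr F f \<in> Arr C" "f \<in> Arr C \<Longrightarrow> Dom C (FArr F f) = FOb F (Dom C f)" "f \<in> Arr C \<Longrightarrow> Cod C (FArr F f) = FOb F (Cod C f)"
  using endo by (auto simp: is_functor_def Hom_def)

lemma F_ide [simp]: "X \<in> Ob C \<Longrightarrow> FArr F (Ide C X) = Ide C (FOb F X)"
  using endo by (auto simp: is_functor_def)

lemma F_comp [simp]: "f \<in> Arr C \<Longrightarrow> g \<in> Arr C \<Longrightarrow> Cod C f = Dom C g \<Longrightarrow> FArr F (g \<bullet> f) = FArr F g \<bullet> FArr F f"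
  using endo by (auto simp: is_functor_def)

lemma F_tail:
  assumes "g \<bullet> f = k \<bullet> j" and "f \<in> Arr C" "g \<in> Arr C" "Cod C f = Dom C g" "k \<in> Arr C" "j \<in> Arr C" "Cod C j = Dom C k"
    and "x \<in> Arr C" "Cod C x = FOb F (Dom C f)"
  shows "FArr F g \<bullet> (FArr F f \<bullet> x) = FArr F k \<bullet> (FArr F j \<bullet> x)"
proof -
  have "Dom C f = Dom C j" using comp_arr(2)[of f g] comp_arr(2)[of j k] assms(1-7) by metis
  then have "FArr F (g \<bullet> f) \<bullet> x = FArr F g \<bullet> (FArr F f \<bullet> x)" "FArr F (k \<bullet> j) \<bullet> x = FArr F k \<bullet> (FArr F j \<bullet> x)"
    using assms(2-9) by simp_all
  then show ?thesis unfolding assms(1) by simp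
qed

lemma F_fuse:
  assumes "g \<bullet> f = k" and "f \<in> Arr C" "g \<in> Arr C" "Cod C f = Dom C g" "x \<in> Arr C" "Cod C x = FOb F (Dom C f)"
  shows "FArr F g \<bullet> (FArr F f \<bullet> x) = FArr F k \<bullet> x"
  using assms(2-6) unfolding assms(1)[symmetric] by simp

lemma F_iso: "iso_arr C f \<Longrightarrow> iso_arr C (FArr F f)"
proof (elim isoE)
  fix g assume g: "f \<in> Arr C" "g \<in> Arr C" "Dom C g = Cod C f" "Cod C g = Dom C f" "g \<bullet> f = Ide C (Dom C f)" "f \<bullet> g = Ide C (Cod C f)"
  have "FArr F g \<bullet> FArr F f = Ide C (FOb F (Dom C f))" "FArr F f \<bullet> FArr F g = Ide C (FOb F (Cod C f))"
    using F_comp[of f g] F_comp[of g f] g by simp_all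
  then show ?thesis using g by (intro isoI[of _ "FArr F g"]) simp_all
qed

lemma em_alg_arr_iff: "(X, f, Y) \<in> Arr (em_alg C F m e) \<longleftrightarrow>
    X \<in> em_algs C F m e \<and> Y \<in> em_algs C F m e \<and> f \<in> Hom C (fst X) (fst Y) \<and> f \<bullet> snd X = snd Y \<bullet> FArr F f"
  by (simp add: em_alg_def)

lemma em_coalg_arr_iff: "(X, f, Y) \<in> Arr (em_coalg C F m e) \<longleftrightarrow>
    X \<in> em_coalgs C F m e \<and> Y \<in> em_coalgs C F m e \<and> f \<in> Hom C (fst X) (fst Y) \<and> snd Y \<bullet> f = FArr F f \<bullet> snd X"
  by (simp add: em_coalg_def)

lemma em_alg_comp:
  assumes f: "(X, f, Y) \<in> Arr (em_alg C F m e)" and g: "(Y, g, Z) \<in> Arr (em_alg C F m e)"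
  shows "(X, g \<bullet> f, Z) \<in> Arr (em_alg C F m e)"
proof -
  have X: "snd X \<in> Arr C" "Dom C (snd X) = FOb F (fst X)" "Cod C (snd X) = fst X" "f \<in> Arr C" "Dom C f = fst X" "Cod C f = fst Y"
    and Y: "snd Y \<in> Arr C" "Dom C (snd Y) = FOb F (fst Y)" "Cod C (snd Y) = fst Y" "g \<in> Arr C" "Dom C g = fst Y" "Cod C g = fst Z"
    and Z: "snd Z \<in> Arr C" "Dom C (snd Z) = FOb F (fst Z)" "Cod C (snd Z) = fst Z"
    and sq: "f \<bullet> snd X = snd Y \<bullet> FArr F f" "g \<bullet> snd Y = snd Z \<bullet> FArr F g"
    using f g unfolding em_alg_arr_iff by (auto simp: em_algs_def Hom_def)
  have "(g \<bullet> f) \<bullet> snd X = snd Z \<bullet> FArr F (g \<bullet> f)"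
    using sq(1) comp_tail[OF sq(2), of "FArr F f"] X Y Z by simp
  then show ?thesis using f g X Y unfolding em_alg_arr_iff by (simp add: Hom_def)
qed

lemma em_alg_category: "is_category (em_alg C F m e)"
  unfolding is_category_def
proof (intro conjI ballI impI)
  fix a assume a: "a \<in> Arr (em_alg C F m e)"
  obtain X f Y where [simp]: "a = (X, f, Y)" by (metis prod.exhaust)
  note aD = a[simplified, unfolded em_alg_arr_iff]
  show "Dom (em_alg C F m e) a \<in> Ob (em_alg C F m e)" "Cod (em_alg C F m e) a \<in> Ob (em_alg C F m e)"
    using aD by (simp_all add: em_alg_def)
  show "a \<bullet>\<^bsub>em_alg C F m e\<^esub> Ide (em_alg C F m e) (Dom (em_alg C F m e) a) = a"
    "Ide (em_alg C F m e) (Cod (em_alg C F m e) a) \<bullet>\<^bsub>em_alg C F m e\<^esub> a = a"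
    using aD by (simp_all add: em_alg_def Hom_def)
  fix b assume b: "b \<in> Arr (em_alg C F m e)" and ab: "Cod (em_alg C F m e) a = Dom (em_alg C F m e) b"
  obtain g Z where [simp]: "b = (Y, g, Z)" using ab by (cases b) (auto simp: em_alg_def)
  note bD = b[simplified, unfolded em_alg_arr_iff]
  show "b \<bullet>\<^bsub>em_alg C F m e\<^esub> a \<in> Hom (em_alg C F m e) (Dom (em_alg C F m e) a) (Cod (em_alg C F m e) b)"
    using em_alg_comp[of X f Y m e g Z] a b unfolding Hom_def by (simp add: em_alg_def)
  fix c assume c: "c \<in> Arr (em_alg C F m e)" and bc: "Cod (em_alg C F m e) b = Dom (em_alg C F m e) c"
  obtain h W where [simp]: "c = (Z, h, W)" using bc by (cases c) (auto simp: em_alg_def)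
  note cD = c[simplified, unfolded em_alg_arr_iff]
  show "(c \<bullet>\<^bsub>em_alg C F m e\<^esub> b) \<bullet>\<^bsub>em_alg C F m e\<^esub> a = c \<bullet>\<^bsub>em_alg C F m e\<^esub> b \<bullet>\<^bsub>em_alg C F m e\<^esub> a"
    using aD bD cD by (simp add: em_alg_def Hom_def)
next
  fix X assume "X \<in> Ob (em_alg C F m e)"
  then show "Ide (em_alg C F m e) X \<in> Hom (em_alg C F m e) X X"
    by (auto simp: em_alg_def em_algs_def Hom_def)
qed

lemma em_coalg_comp:
  assumes f: "(X, f, Y) \<in> Arr (em_coalg C F m e)" and g: "(Y, g, Z) \<in> Arr (em_coalg C F m e)"
  shows "(X, g \<bullet> f, Z) \<in> Arr (em_coalg C F m e)"
proof -
  have X: "snd X \<in> Arr C" "Cod C (snd X) = FOb F (fst X)" "Dom C (snd X) = fst X" "f \<in> Arr C" "Dom C f = fst X" "Cod C f = fst Y"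
    and Y: "snd Y \<in> Arr C" "Cod C (snd Y) = FOb F (fst Y)" "Dom C (snd Y) = fst Y" "g \<in> Arr C" "Dom C g = fst Y" "Cod C g = fst Z"
    and Z: "snd Z \<in> Arr C" "Cod C (snd Z) = FOb F (fst Z)" "Dom C (snd Z) = fst Z"
    and sq: "snd Y \<bullet> f = FArr F f \<bullet> snd X" "snd Z \<bullet> g = FArr F g \<bullet> snd Y"
    using f g unfolding em_coalg_arr_iff by (auto simp: em_coalgs_def Hom_def)
  have "snd Z \<bullet> (g \<bullet> f) = FArr F (g \<bullet> f) \<bullet> snd X"
    using sq(1) comp_tail[OF sq(2), of f] X Y Z by simp
  then show ?thesis using f g X Y unfolding em_coalg_arr_iff by (simp add: Hom_def)
qed

lemma em_coalg_category: "is_category (em_coalg C F m e)"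
  unfolding is_category_def
proof (intro conjI ballI impI)
  fix a assume a: "a \<in> Arr (em_coalg C F m e)"
  obtain X f Y where [simp]: "a = (X, f, Y)" by (metis prod.exhaust)
  note aD = a[simplified, unfolded em_coalg_arr_iff]
  show "Dom (em_coalg C F m e) a \<in> Ob (em_coalg C F m e)" "Cod (em_coalg C F m e) a \<in> Ob (em_coalg C F m e)"
    using aD by (simp_all add: em_coalg_def)
  show "a \<bullet>\<^bsub>em_coalg C F m e\<^esub> Ide (em_coalg C F m e) (Dom (em_coalg C F m e) a) = a"
    "Ide (em_coalg C F m e) (Cod (em_coalg C F m e) a) \<bullet>\<^bsub>em_coalg C F m e\<^esub> a = a"
    using aD by (simp_all add: em_coalg_def Hom_def)
  fix b assume b: "b \<in> Arr (em_coalg C F m e)" and ab: "Cod (em_coalg C F m e) a = Dom (em_coalg C F m e) b"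
  obtain g Z where [simp]: "b = (Y, g, Z)" using ab by (cases b) (auto simp: em_coalg_def)
  note bD = b[simplified, unfolded em_coalg_arr_iff]
  show "b \<bullet>\<^bsub>em_coalg C F m e\<^esub> a \<in> Hom (em_coalg C F m e) (Dom (em_coalg C F m e) a) (Cod (em_coalg C F m e) b)"
    using em_coalg_comp[of X f Y m e g Z] a b unfolding Hom_def by (simp add: em_coalg_def)
  fix c assume c: "c \<in> Arr (em_coalg C F m e)" and bc: "Cod (em_coalg C F m e) b = Dom (em_coalg C F m e) c"
  obtain h W where [simp]: "c = (Z, h, W)" using bc by (cases c) (auto simp: em_coalg_def)
  note cD = c[simplified, unfolded em_coalg_arr_iff]
  show "(c \<bullet>\<^bsub>em_coalg C F m e\<^esub> b) \<bullet>\<^bsub>em_coalg C F m e\<^esub> a = c \<bullet>\<^bsub>em_coalg C F m e\<^esub> b \<bullet>\<^bsub>em_coalg C F m e\<^esub> a"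
    using aD bD cD by (simp add: em_coalg_def Hom_def)
next
  fix X assume "X \<in> Ob (em_coalg C F m e)"
  then show "Ide (em_coalg C F m e) X \<in> Hom (em_coalg C F m e) X X"
    by (auto simp: em_coalg_def em_coalgs_def Hom_def)
qed

text \<open>The inverse of an underlying isomorphism is automatically a morphism of algebras:
  \<open>f\<close> is cancelled from both sides of the square for its inverse.\<close>

lemma em_alg_iso:
  assumes f: "(X, f, Y) \<in> Arr (em_alg C F m e)" and iso: "iso_arr C f"
  shows "iso_arr (em_alg C F m e) (X, f, Y)"
proof -
  obtain g where g: "f \<in> Arr C" "g \<in> Arr C" "Dom C g = Cod C f" "Cod C g = Dom C f" "g \<bullet> f = Ide C (Dom C f)" "f \<bullet> g = Ide C (Cod C f)"
    using iso by (rule isoE)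
  have X: "snd X \<in> Arr C" "Dom C (snd X) = FOb F (fst X)" "Cod C (snd X) = fst X" "fst X = Dom C f"
    and Y: "snd Y \<in> Arr C" "Dom C (snd Y) = FOb F (fst Y)" "Cod C (snd Y) = fst Y" "fst Y = Cod C f"
    and sq: "f \<bullet> snd X = snd Y \<bullet> FArr F f"
    using f unfolding em_alg_arr_iff by (auto simp: em_algs_def Hom_def)
  have fg: "FArr F f \<bullet> FArr F g = Ide C (FOb F (Cod C f))" using F_comp[of g f] g by simp
  have "f \<bullet> (g \<bullet> snd Y) = f \<bullet> (snd X \<bullet> FArr F g)"
    using g X Y comp_tail[OF sq, of "FArr F g"] comp_tail[OF g(6), of "snd Y"] fg by simp
  then have "g \<bullet> snd Y = snd X \<bullet> FArr F g"
    by (rule iso_cancel[OF iso]) (use g X Y in simp_all)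
  then have "(Y, g, X) \<in> Hom (em_alg C F m e) Y X"
    using f g X Y by (auto simp: em_alg_def Hom_def)
  then show ?thesis
    unfolding iso_arr_def using f g X Y by (intro conjI bexI[of _ "(Y, g, X)"]) simp_all
qed

lemma em_coalg_iso:
  assumes f: "(X, f, Y) \<in> Arr (em_coalg C F m e)" and iso: "iso_arr C f"
  shows "iso_arr (em_coalg C F m e) (X, f, Y)"
proof -
  obtain g where g: "f \<in> Arr C" "g \<in> Arr C" "Dom C g = Cod C f" "Cod C g = Dom C f" "g \<bullet> f = Ide C (Dom C f)" "f \<bullet> g = Ide C (Cod C f)"
    using iso by (rule isoE)
  have X: "snd X \<in> Arr C" "Cod C (snd X) = FOb F (fst X)" "Dom C (snd X) = fst X" "fst X = Dom C f"
    and Y: "snd Y \<in> Arr C" "Cod C (snd Y) = FOb F (fst Y)" "Dom C (snd Y) = fst Y" "fst Y = Cod C f"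
    and sq: "snd Y \<bullet> f = FArr F f \<bullet> snd X"
    using f unfolding em_coalg_arr_iff by (auto simp: em_coalgs_def Hom_def)
  have gf: "FArr F g \<bullet> FArr F f = Ide C (FOb F (Dom C f))" using F_comp[of f g] g by simp
  have "(FArr F g \<bullet> snd Y) \<bullet> f = (snd X \<bullet> g) \<bullet> f"
    using g X Y sq comp_tail[OF gf, of "snd X"] by simp
  then have "FArr F g \<bullet> snd Y = snd X \<bullet> g"
    by (rule iso_cancel_right[OF iso]) (use g X Y in simp_all)
  then have "(Y, g, X) \<in> Hom (em_coalg C F m e) Y X"
    using f g X Y by (auto simp: em_coalg_def Hom_def)
  then show ?thesis
    unfolding iso_arr_def using f g X Y by (intro conjI bexI[of _ "(Y, g, X)"]) simp_all
qed

end

text \<open>The entwining laws for \<open>m\<close> and \<open>e\<close> give associativity and unit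
  law of the lifted action; naturality of \<open>l\<close> gives the functor on arrows.\<close>

lemma lift_functor:
  assumes "is_category C" "is_functor C C T" "is_functor C C G" "entwining C T m e G \<delta> \<epsilon> l"
    and m: "\<And>X. X \<in> Ob C \<Longrightarrow> m X \<in> Hom C (FOb T (FOb T X)) (FOb T X)"
    and e: "\<And>X. X \<in> Ob C \<Longrightarrow> e X \<in> Hom C X (FOb T X)"
  shows "is_functor (em_alg C T m e) (em_alg C T m e) (lift_func C G l)"
proof -
  interpret C: category_loc C by unfold_locales fact
  interpret T: endofunctor C T by unfold_locales fact
  interpret G: endofunctor C G by unfold_locales fact
  have l: "l X \<in> Arr C" "Dom C (l X) = FOb T (FOb G X)" "Cod C (l X) = FOb G (FOb T X)" if "X \<in> Ob C" for X
    using assms(4) that by (auto simp: entwining_def nat_trans_def comp_func_def Hom_def)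
  have ln: "l (Cod C f) \<bullet>\<^bsub>C\<^esub> FArr T (FArr G f) = FArr G (FArr T f) \<bullet>\<^bsub>C\<^esub> l (Dom C f)" if "f \<in> Arr C" for f
    using assms(4) that by (auto simp: entwining_def nat_trans_def comp_func_def)
  have lm: "l X \<bullet>\<^bsub>C\<^esub> m (FOb G X) = FArr G (m X) \<bullet>\<^bsub>C\<^esub> (l (FOb T X) \<bullet>\<^bsub>C\<^esub> FArr T (l X))"
    and le: "l X \<bullet>\<^bsub>C\<^esub> e (FOb G X) = FArr G (e X)" if "X \<in> Ob C" for X
    using assms(4) that by (auto simp: entwining_def)
  note m' = m[unfolded Hom_def, simplified] and e' = e[unfolded Hom_def, simplified]
  have lo: "lift_ob C G l X \<in> em_algs C T m e" if X: "X \<in> em_algs C T m e" for X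
  proof -
    obtain V h where [simp]: "X = (V, h)" by (rule prod.exhaust)
    have V: "V \<in> Ob C" "h \<in> Arr C" "Dom C h = FOb T V" "Cod C h = V" and hm: "h \<bullet>\<^bsub>C\<^esub> m V = h \<bullet>\<^bsub>C\<^esub> FArr T h" and he: "h \<bullet>\<^bsub>C\<^esub> e V = Ide C V"
      using X by (auto simp: em_algs_def Hom_def)
    have ghm: "FArr G h \<bullet>\<^bsub>C\<^esub> FArr G (m V) = FArr G h \<bullet>\<^bsub>C\<^esub> FArr G (FArr T h)"
      and ghe: "FArr G h \<bullet>\<^bsub>C\<^esub> FArr G (e V) = Ide C (FOb G V)"
      using arg_cong[OF hm, of "FArr G"] arg_cong[OF he, of "FArr G"] V m' e' by simp_all
    have "FArr G h \<bullet>\<^bsub>C\<^esub> (l V \<bullet>\<^bsub>C\<^esub> m (FOb G V)) = FArr G h \<bullet>\<^bsub>C\<^esub> (l V \<bullet>\<^bsub>C\<^esub> (FArr T (FArr G h) \<bullet>\<^bsub>C\<^esub> FArr T (l V)))"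
      using C.comp_tail[OF ghm, of "l (FOb T V) \<bullet>\<^bsub>C\<^esub> FArr T (l V)"] C.comp_tail[OF ln[of h], of "FArr T (l V)"] V l m' by (simp add: lm)
    moreover have "FArr G h \<bullet>\<^bsub>C\<^esub> (l V \<bullet>\<^bsub>C\<^esub> e (FOb G V)) = Ide C (FOb G V)" using ghe V by (simp add: le)
    ultimately show ?thesis using V l m' e' by (simp add: em_algs_def lift_ob_def Hom_def)
  qed
  have la: "(lift_ob C G l X, FArr G f, lift_ob C G l Y) \<in> Arr (em_alg C T m e)" if f: "(X, f, Y) \<in> Arr (em_alg C T m e)" for X f Y
  proof -
    obtain V h W k where [simp]: "X = (V, h)" "Y = (W, k)" by (metis prod.exhaust)
    have V: "V \<in> Ob C" "h \<in> Arr C" "Dom C h = FOb T V" "Cod C h = V" "k \<in> Arr C" "Dom C k = FOb T W" "Cod C k = W"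
      "f \<in> Arr C" "Dom C f = V" "Cod C f = W" "W \<in> Ob C" and sq: "f \<bullet>\<^bsub>C\<^esub> h = k \<bullet>\<^bsub>C\<^esub> FArr T f"
      using f by (auto simp: em_algs_def Hom_def em_alg_def)
    have gsq: "FArr G f \<bullet>\<^bsub>C\<^esub> FArr G h = FArr G k \<bullet>\<^bsub>C\<^esub> FArr G (FArr T f)"
      using arg_cong[OF sq, of "FArr G"] V by simp
    have "FArr G f \<bullet>\<^bsub>C\<^esub> (FArr G h \<bullet>\<^bsub>C\<^esub> l V) = FArr G k \<bullet>\<^bsub>C\<^esub> (l W \<bullet>\<^bsub>C\<^esub> FArr T (FArr G f))"
      using C.comp_tail[OF gsq, of "l V"] ln[of f] V l by simp
    then show ?thesis using f lo[of X] lo[of Y] V l by (simp add: em_alg_def lift_ob_def Hom_def)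
  qed
  show ?thesis
    unfolding is_functor_def
  proof (intro conjI T.em_alg_category ballI impI)
    fix X assume X: "X \<in> Ob (em_alg C T m e)"
    then have X': "X \<in> em_algs C T m e" by (simp add: em_alg_def)
    show "FOb (lift_func C G l) X \<in> Ob (em_alg C T m e)" using lo[OF X'] by (simp add: em_alg_def lift_func_def)
    show "FArr (lift_func C G l) (Ide (em_alg C T m e) X) = Ide (em_alg C T m e) (FOb (lift_func C G l) X)"
      using X' by (auto simp: em_alg_def lift_func_def lift_ob_def em_algs_def)
  next
    fix a assume a: "a \<in> Arr (em_alg C T m e)"
    obtain X f Y where [simp]: "a = (X, f, Y)" by (metis prod.exhaust)
    show "FArr (lift_func C G l) a \<in> Hom (em_alg C T m e) (FOb (lift_func C G l) (Dom (em_alg C T m e) a)) (FOb (lift_func C G l) (Cod (em_alg C T m e) a))"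
      using la[of X f Y] a by (simp add: lift_func_def Hom_def)
    fix b assume b: "b \<in> Arr (em_alg C T m e)" and ab: "Cod (em_alg C T m e) a = Dom (em_alg C T m e) b"
    obtain Y' g Z where [simp]: "b = (Y', g, Z)" by (metis prod.exhaust)
    show "FArr (lift_func C G l) (b \<bullet>\<^bsub>em_alg C T m e\<^esub> a) = FArr (lift_func C G l) b \<bullet>\<^bsub>em_alg C T m e\<^esub> FArr (lift_func C G l) a"
      using a b ab by (auto simp: em_alg_def lift_func_def Hom_def)
  qed
qed

section \<open>The comparison functor\<close>

text \<open>The interface between linear algebra and category theory. \<open>eG\<close> is the
  inclusion belonging to \<open>C\<close>, \<open>pT\<close> the projection belonging to
  \<open>A\<close>, and \<open>a\<close> the coaction on free algebras. \<open>P\<close> and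
  \<open>inc\<close> form an equalizer of \<open>\<theta>\<close> and \<open>eG\<close> for every
  arrow \<open>\<theta>\<close> of this type, without splitting. The monad laws besides
  \<open>m_Te\<close> are contained in \<open>free_bialg\<close>.\<close>

locale entwined_comparison =
  C: category_loc C + T: endofunctor C T + G: endofunctor C G
  for C :: "('o, 'a) category" (structure) and T G :: "('o, 'a, 'o, 'a) func" +
  fixes m e \<delta> \<epsilon> l :: "'o \<Rightarrow> 'a" and eG pT a :: "'o \<Rightarrow> 'a"
    and P :: "'o \<Rightarrow> 'a \<Rightarrow> 'o" and inc :: "'o \<Rightarrow> 'a \<Rightarrow> 'a"
  assumes entw: "entwining C T m e G \<delta> \<epsilon> l"
    and e_nat: "nat_trans C C id_func T e" and m_nat: "nat_trans C C (comp_func T T) T m"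
    and \<delta>_nat: "nat_trans C C G (comp_func G G) \<delta>" and \<epsilon>_nat: "nat_trans C C G id_func \<epsilon>"
    and pT_nat: "nat_trans C C T id_func pT" and eG_nat: "nat_trans C C id_func G eG"
    and pT_e: "X \<in> Ob C \<Longrightarrow> pT X \<bullet> e X = Ide C X"
    and m_Te: "X \<in> Ob C \<Longrightarrow> m X \<bullet> FArr T (e X) = Ide C (FOb T X)"
    and free_bialg: "X \<in> Ob C \<Longrightarrow> ((FOb T X, m X), ((FOb T X, m X), a X, lift_ob C G l (FOb T X, m X)))
      \<in> em_coalgs (em_alg C T m e) (lift_func C G l) (lift_comult C G l \<delta>) (lift_counit C G l \<epsilon>)"
    and a_e: "X \<in> Ob C \<Longrightarrow> a X \<bullet> e X = eG (FOb T X) \<bullet> e X"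
    and phi_iso: "X \<in> Ob C \<Longrightarrow> iso_arr C (FArr G (pT X) \<bullet> a X)"
    and kappa_iso: "(H, h) \<in> em_algs C T m e \<Longrightarrow> iso_arr C (FArr G h \<bullet> a H)"
    and P_ob: "H \<in> Ob C \<Longrightarrow> \<theta> \<in> Hom C H (FOb G H) \<Longrightarrow> P H \<theta> \<in> Ob C"
    and inc_hom: "H \<in> Ob C \<Longrightarrow> \<theta> \<in> Hom C H (FOb G H) \<Longrightarrow> inc H \<theta> \<in> Hom C (P H \<theta>) H"
    and inc_eq: "H \<in> Ob C \<Longrightarrow> \<theta> \<in> Hom C H (FOb G H) \<Longrightarrow> \<theta> \<bullet> inc H \<theta> = eG H \<bullet> inc H \<theta>"
    and inc_univ: "H \<in> Ob C \<Longrightarrow> \<theta> \<in> Hom C H (FOb G H) \<Longrightarrow> f \<in> Arr C \<Longrightarrow> Cod C f = H \<Longrightarrow> \<theta> \<bullet> f = eG H \<bullet> f \<Longrightarrow>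
      \<exists>g\<in>Hom C (Dom C f) (P H \<theta>). inc H \<theta> \<bullet> g = f"
    and inc_mono: "H \<in> Ob C \<Longrightarrow> \<theta> \<in> Hom C H (FOb G H) \<Longrightarrow> f \<in> Arr C \<Longrightarrow> g \<in> Arr C \<Longrightarrow> Cod C f = P H \<theta> \<Longrightarrow> Cod C g = P H \<theta> \<Longrightarrow>
      inc H \<theta> \<bullet> f = inc H \<theta> \<bullet> g \<Longrightarrow> f = g"
begin

abbreviation "TO \<equiv> FOb T"
abbreviation "TA \<equiv> FArr T"
abbreviation "GO \<equiv> FOb G"
abbreviation "GA \<equiv> FArr G"
abbreviation "Alg \<equiv> em_alg C T m e"
abbreviation "lift \<equiv> lift_func C G l"
abbreviation "Bialg \<equiv> em_coalg Alg lift (lift_comult C G l \<delta>) (lift_counit C G l \<epsilon>)"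

lemma nat_typing [simp]:
  assumes "X \<in> Ob C"
  shows "e X \<in> Arr C" "Dom C (e X) = X" "Cod C (e X) = TO X"
    "m X \<in> Arr C" "Dom C (m X) = TO (TO X)" "Cod C (m X) = TO X"
    "\<delta> X \<in> Arr C" "Dom C (\<delta> X) = GO X" "Cod C (\<delta> X) = GO (GO X)"
    "\<epsilon> X \<in> Arr C" "Dom C (\<epsilon> X) = GO X" "Cod C (\<epsilon> X) = X"
    "pT X \<in> Arr C" "Dom C (pT X) = TO X" "Cod C (pT X) = X"
    "eG X \<in> Arr C" "Dom C (eG X) = X" "Cod C (eG X) = GO X"
    "l X \<in> Arr C" "Dom C (l X) = TO (GO X)" "Cod C (l X) = GO (TO X)"
  using assms e_nat m_nat \<delta>_nat \<epsilon>_nat pT_nat eG_nat entw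
  by (auto simp: nat_trans_def id_func_def comp_func_def Hom_def entwining_def)

lemma nat_eqs:
  assumes "f \<in> Arr C"
  shows "e (Cod C f) \<bullet> f = TA f \<bullet> e (Dom C f)" "m (Cod C f) \<bullet> TA (TA f) = TA f \<bullet> m (Dom C f)"
    "\<delta> (Cod C f) \<bullet> GA f = GA (GA f) \<bullet> \<delta> (Dom C f)" "\<epsilon> (Cod C f) \<bullet> GA f = f \<bullet> \<epsilon> (Dom C f)"
    "pT (Cod C f) \<bullet> TA f = f \<bullet> pT (Dom C f)" "eG (Cod C f) \<bullet> f = GA f \<bullet> eG (Dom C f)"
    "l (Cod C f) \<bullet> TA (GA f) = GA (TA f) \<bullet> l (Dom C f)"
  using assms e_nat m_nat \<delta>_nat \<epsilon>_nat pT_nat eG_nat entw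
  by (auto simp: nat_trans_def id_func_def comp_func_def entwining_def)

text \<open>All identities below are stated for composites with a further arrow \<open>x\<close> on the right, so that
  they rewrite terms normalised by associativity to the right.\<close>

lemma nat_tail:
  assumes "f \<in> Arr C" "x \<in> Arr C" "V = Dom C f" "W = Cod C f"
  shows "Cod C x = V \<Longrightarrow> e W \<bullet> (f \<bullet> x) = TA f \<bullet> (e V \<bullet> x)"
    "Cod C x = TO (TO V) \<Longrightarrow> m W \<bullet> (TA (TA f) \<bullet> x) = TA f \<bullet> (m V \<bullet> x)"
    "Cod C x = GO V \<Longrightarrow> \<delta> W \<bullet> (GA f \<bullet> x) = GA (GA f) \<bullet> (\<delta> V \<bullet> x)"
    "Cod C x = GO V \<Longrightarrow> \<epsilon> W \<bullet> (GA f \<bullet> x) = f \<bullet> (\<epsilon> V \<bullet> x)"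
    "Cod C x = TO V \<Longrightarrow> pT W \<bullet> (TA f \<bullet> x) = f \<bullet> (pT V \<bullet> x)"
    "Cod C x = V \<Longrightarrow> eG W \<bullet> (f \<bullet> x) = GA f \<bullet> (eG V \<bullet> x)"
    "Cod C x = TO (GO V) \<Longrightarrow> l W \<bullet> (TA (GA f) \<bullet> x) = GA (TA f) \<bullet> (l V \<bullet> x)"
  using C.comp_tail[OF nat_eqs(1)[OF assms(1)], of x] C.comp_tail[OF nat_eqs(2)[OF assms(1)], of x]
    C.comp_tail[OF nat_eqs(3)[OF assms(1)], of x] C.comp_tail[OF nat_eqs(4)[OF assms(1)], of x]
    C.comp_tail[OF nat_eqs(5)[OF assms(1)], of x] C.comp_tail[OF nat_eqs(6)[OF assms(1)], of x]
    C.comp_tail[OF nat_eqs(7)[OF assms(1)], of x] assms by simp_all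

text \<open>Trivial with an identity for \<open>x\<close>; its use is to prove equations between
  arrows by rewriting with the tail forms.\<close>

lemma arr_eqI:
  assumes "f \<in> Arr C" "g \<in> Arr C" "Dom C f = X" "Dom C g = X"
    and "\<And>x. x \<in> Arr C \<Longrightarrow> Cod C x = X \<Longrightarrow> f \<bullet> x = g \<bullet> x"
  shows "f = g"
  using assms(5)[of "Ide C X"] assms(1-4) C.arr_ob(1)[of f] by simp

lemma alg_iff: "(H, h) \<in> em_algs C T m e \<longleftrightarrow> H \<in> Ob C \<and> h \<in> Arr C \<and> Dom C h = TO H \<and> Cod C h = H \<and>
    h \<bullet> m H = h \<bullet> TA h \<and> h \<bullet> e H = Ide C H"
  by (auto simp: em_algs_def Hom_def)

definition is_bialg where
  "is_bialg H h \<theta> \<longleftrightarrow> (H, h) \<in> em_algs C T m e \<and> \<theta> \<in> Hom C H (GO H) \<and>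
     \<delta> H \<bullet> \<theta> = GA \<theta> \<bullet> \<theta> \<and> \<epsilon> H \<bullet> \<theta> = Ide C H \<and> \<theta> \<bullet> h = GA h \<bullet> (l H \<bullet> TA \<theta>)"

abbreviation "bialg H h \<theta> \<equiv> ((H, h), ((H, h), \<theta>, lift_ob C G l (H, h)))"

lemma lift_functor': "is_functor Alg Alg lift"
  by (rule lift_functor[OF C.category T.endo G.endo entw]) (simp_all add: Hom_def)

sublocale Alg: endofunctor Alg lift
  by unfold_locales (use T.em_alg_category lift_functor' in auto)

lemma bialg_iff: "bialg H h \<theta> \<in> Ob Bialg \<longleftrightarrow> is_bialg H h \<theta>"
proof (cases "(H, h) \<in> em_algs C T m e")
  case True
  then have 1: "lift_ob C G l (H, h) \<in> em_algs C T m e" 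
    using Alg.F_ob[of "(H, h)"] by (simp add: lift_func_def)
  have H: "H \<in> Ob C" "h \<in> Arr C" "Dom C h = TO H" "Cod C h = H" using True by (auto simp: alg_iff)
  have "((H, h), \<theta>, lift_ob C G l (H, h)) \<in> Hom Alg (H, h) (lift_ob C G l (H, h)) \<longleftrightarrow>
      \<theta> \<in> Hom C H (GO H) \<and> \<theta> \<bullet> h = GA h \<bullet> (l H \<bullet> TA \<theta>)"
    unfolding Hom_def[of Alg] using True 1 H by (auto simp: T.em_alg_arr_iff lift_ob_def Hom_def)
  then show ?thesis
    using True by (auto simp: em_coalgs_def is_bialg_def lift_comult_def lift_counit_def lift_func_def)
qed (auto simp: em_coalgs_def is_bialg_def)

lemma BialgE:
  assumes "B \<in> Ob Bialg" obtains H h \<theta> where "B = bialg H h \<theta>" "is_bialg H h \<theta>"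
proof -
  obtain H h X \<theta> Y where [simp]: "B = ((H, h), (X, \<theta>, Y))" by (metis prod.exhaust)
  have "X = (H, h)" "Y = lift_ob C G l (H, h)" using assms by (auto simp: em_coalgs_def Hom_def lift_func_def)
  then show ?thesis using that[of H h \<theta>] assms bialg_iff[of H h \<theta>] by simp
qed

section \<open>Free bialgebras and the comonad morphism\<close>

lemma bialg_free: "X \<in> Ob C \<Longrightarrow> is_bialg (TO X) (m X) (a X)"
  using free_bialg bialg_iff by simp

lemma a_typing [simp]: "X \<in> Ob C \<Longrightarrow> a X \<in> Arr C" "X \<in> Ob C \<Longrightarrow> Dom C (a X) = TO X" "X \<in> Ob C \<Longrightarrow> Cod C (a X) = GO (TO X)"
  using bialg_free[of X] by (auto simp: is_bialg_def Hom_def)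

lemma free_eqs:
  assumes "X \<in> Ob C"
  shows "m X \<bullet> m (TO X) = m X \<bullet> TA (m X)" "m X \<bullet> e (TO X) = Ide C (TO X)"
    "\<delta> (TO X) \<bullet> a X = GA (a X) \<bullet> a X" "\<epsilon> (TO X) \<bullet> a X = Ide C (TO X)"
    "a X \<bullet> m X = GA (m X) \<bullet> (l (TO X) \<bullet> TA (a X))"
  using bialg_free[OF assms] by (auto simp: is_bialg_def alg_iff)

lemma free_tail:
  assumes "X \<in> Ob C" "x \<in> Arr C"
  shows "Cod C x = TO X \<Longrightarrow> m X \<bullet> (e (TO X) \<bullet> x) = x"
    "Cod C x = TO X \<Longrightarrow> m X \<bullet> (TA (e X) \<bullet> x) = x"
    "Cod C x = TO X \<Longrightarrow> \<delta> (TO X) \<bullet> (a X \<bullet> x) = GA (a X) \<bullet> (a X \<bullet> x)"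
    "Cod C x = TO X \<Longrightarrow> \<epsilon> (TO X) \<bullet> (a X \<bullet> x) = x"
    "Cod C x = TO (TO X) \<Longrightarrow> a X \<bullet> (m X \<bullet> x) = GA (m X) \<bullet> (l (TO X) \<bullet> (TA (a X) \<bullet> x))"
    "Cod C x = X \<Longrightarrow> a X \<bullet> (e X \<bullet> x) = eG (TO X) \<bullet> (e X \<bullet> x)"
    "Cod C x = X \<Longrightarrow> pT X \<bullet> (e X \<bullet> x) = x"
  using C.comp_tail[OF free_eqs(2)[OF assms(1)], of x] C.comp_tail[OF m_Te[OF assms(1)], of x]
    C.comp_tail[OF free_eqs(3)[OF assms(1)], of x] C.comp_tail[OF free_eqs(4)[OF assms(1)], of x]
    C.comp_tail[OF free_eqs(5)[OF assms(1)], of x] C.comp_tail[OF a_e[OF assms(1)], of x]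
    C.comp_tail[OF pT_e[OF assms(1)], of x] assms by simp_all

text \<open>The coaction is a morphism of algebras on a free algebra, hence determined by its
  restriction along \<open>e\<close>, which is \<open>eG \<bullet> e\<close>. Inserting
  \<open>m \<bullet> T e\<close> for the identity makes this explicit, and the outcome is the
  coaction used by the comparison functor.\<close>

lemma a_eq: "X \<in> Ob C \<Longrightarrow> a X = l X \<bullet> TA (eG X)"
proof (rule arr_eqI[where X = "TO X"])
  fix x assume X: "X \<in> Ob C" and x: "x \<in> Arr C" "Cod C x = TO X"
  have "a X \<bullet> x = a X \<bullet> (m X \<bullet> (TA (e X) \<bullet> x))" using X x by (simp add: free_tail(2))
  also have "\<dots> = GA (m X) \<bullet> (l (TO X) \<bullet> (TA (a X) \<bullet> (TA (e X) \<bullet> x)))" using X x by (intro free_tail(5)) simp_all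
  also have "TA (a X) \<bullet> (TA (e X) \<bullet> x) = TA (eG (TO X)) \<bullet> (TA (e X) \<bullet> x)"
    by (rule T.F_tail[OF a_e]) (use X x in simp_all)
  also have "\<dots> = TA (GA (e X)) \<bullet> (TA (eG X) \<bullet> x)"
    by (rule T.F_tail) (use X x nat_eqs(6)[of "e X"] in simp_all)
  also have "l (TO X) \<bullet> \<dots> = GA (TA (e X)) \<bullet> (l X \<bullet> (TA (eG X) \<bullet> x))"
    by (rule nat_tail) (use X x in simp_all)
  also have "GA (m X) \<bullet> \<dots> = l X \<bullet> (TA (eG X) \<bullet> x)"
    using G.F_fuse[OF m_Te[OF X], of "l X \<bullet> (TA (eG X) \<bullet> x)"] X x by simp
  finally show "a X \<bullet> x = (l X \<bullet> TA (eG X)) \<bullet> x" using X x by simp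
qed simp_all

lemma a_nat:
  assumes "f \<in> Arr C"
  shows "a (Cod C f) \<bullet> TA f = GA (TA f) \<bullet> a (Dom C f)"
proof (rule arr_eqI[where X = "TO (Dom C f)"])
  fix x assume x: "x \<in> Arr C" "Cod C x = TO (Dom C f)"
  have "TA (eG (Cod C f)) \<bullet> (TA f \<bullet> x) = TA (GA f) \<bullet> (TA (eG (Dom C f)) \<bullet> x)"
    by (rule T.F_tail[OF nat_eqs(6)]) (use assms x in simp_all)
  then show "(a (Cod C f) \<bullet> TA f) \<bullet> x = (GA (TA f) \<bullet> a (Dom C f)) \<bullet> x"
    using assms x by (simp add: a_eq nat_tail)
qed (use assms in simp_all)

lemma a_tail: "f \<in> Arr C \<Longrightarrow> x \<in> Arr C \<Longrightarrow> V = Dom C f \<Longrightarrow> W = Cod C f \<Longrightarrow> Cod C x = TO V \<Longrightarrow> a W \<bullet> (TA f \<bullet> x) = GA (TA f) \<bullet> (a V \<bullet> x)"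
  using C.comp_tail[OF a_nat[of f], of x] by simp

text \<open>The comonad of free algebras sends \<open>(H, h)\<close> to \<open>(T H, m H)\<close>,
  with counit \<open>h\<close> and comultiplication \<open>T (e H)\<close>. The next lemmas verify,
  in tail form, that \<open>kap\<close> is a morphism of comonads.\<close>

definition "kap H h = GA h \<bullet> a H"

context
  fixes H h assumes alg: "(H, h) \<in> em_algs C T m e"
begin

lemma alg_typing [simp]: "H \<in> Ob C" "h \<in> Arr C" "Dom C h = TO H" "Cod C h = H"
  and alg_eqs: "h \<bullet> m H = h \<bullet> TA h" "h \<bullet> e H = Ide C H"
  using alg by (auto simp: alg_iff)

lemma kap_typing [simp]: "kap H h \<in> Arr C" "Dom C (kap H h) = TO H" "Cod C (kap H h) = GO H"
  by (simp_all add: kap_def)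

lemma alg_tail:
  assumes "x \<in> Arr C"
  shows "Cod C x = TO (TO H) \<Longrightarrow> h \<bullet> (m H \<bullet> x) = h \<bullet> (TA h \<bullet> x)"
    "Cod C x = H \<Longrightarrow> h \<bullet> (e H \<bullet> x) = x"
  using C.comp_tail[OF alg_eqs(1), of x] C.comp_tail[OF alg_eqs(2), of x] assms by simp_all

lemma kap_iso: "iso_arr C (kap H h)"
  unfolding kap_def by (rule kappa_iso[OF alg])

text \<open>A composite of two algebra morphisms: the coaction \<open>a H\<close>, and the image
  under the lifted comonad of \<open>h\<close>, which is one by associativity of the action.\<close>

lemma kap_alg:
  assumes "x \<in> Arr C" "Cod C x = TO (TO H)"
  shows "kap H h \<bullet> (m H \<bullet> x) = GA h \<bullet> (l H \<bullet> (TA (kap H h) \<bullet> x))"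
proof -
  have "GA h \<bullet> (GA (m H) \<bullet> (l (TO H) \<bullet> (TA (a H) \<bullet> x))) = GA h \<bullet> (GA (TA h) \<bullet> (l (TO H) \<bullet> (TA (a H) \<bullet> x)))"
    by (rule G.F_tail[OF alg_eqs(1)]) (use assms in simp_all)
  then show ?thesis using assms by (simp add: kap_def free_tail nat_tail)
qed

lemma kap_counit:
  assumes "x \<in> Arr C" "Cod C x = TO H" shows "\<epsilon> H \<bullet> (kap H h \<bullet> x) = h \<bullet> x"
  using assms by (simp add: kap_def free_tail nat_tail)

lemma kap_e:
  assumes "x \<in> Arr C" "Cod C x = H" shows "kap H h \<bullet> (e H \<bullet> x) = eG H \<bullet> x"
proof -
  have "kap H h \<bullet> (e H \<bullet> x) = GA h \<bullet> (eG (TO H) \<bullet> (e H \<bullet> x))" using assms by (simp add: kap_def free_tail)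
  also have "\<dots> = eG H \<bullet> (h \<bullet> (e H \<bullet> x))" using assms by (subst nat_tail(6)[of h _ "TO H"]) simp_all
  also have "h \<bullet> (e H \<bullet> x) = x" using assms by (rule alg_tail)
  finally show ?thesis .
qed

end

lemma alg_free: "X \<in> Ob C \<Longrightarrow> (TO X, m X) \<in> em_algs C T m e"
  using bialg_free by (simp add: is_bialg_def)

text \<open>By naturality of \<open>a\<close> the inner \<open>kap\<close> collapses through
  \<open>m \<bullet> T e = 1\<close>. What remains is coassociativity of \<open>a H\<close> and
  naturality of \<open>\<delta>\<close> at \<open>h\<close>.\<close>

lemma kap_comult:
  assumes alg: "(H, h) \<in> em_algs C T m e" and x: "x \<in> Arr C" "Cod C x = TO H"
  shows "GA (kap H h) \<bullet> (kap (TO H) (m H) \<bullet> (TA (e H) \<bullet> x)) = \<delta> H \<bullet> (kap H h \<bullet> x)"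
proof -
  note [simp] = alg_typing[OF alg]
  have "GA (m H) \<bullet> (GA (TA (e H)) \<bullet> (a H \<bullet> x)) = a H \<bullet> x"
    using G.F_fuse[OF m_Te[of H], of "a H \<bullet> x"] x by simp
  then show ?thesis using x by (simp add: kap_def free_tail nat_tail a_tail)
qed

lemma kap_nat:
  assumes alg: "(H, h) \<in> em_algs C T m e" "(H', h') \<in> em_algs C T m e"
    and f: "f \<in> Arr C" "Dom C f = H" "Cod C f = H'" "f \<bullet> h = h' \<bullet> TA f" and x: "x \<in> Arr C" "Cod C x = TO H"
  shows "kap H' h' \<bullet> (TA f \<bullet> x) = GA f \<bullet> (kap H h \<bullet> x)"
proof -
  note [simp] = alg_typing[OF alg(1)] alg_typing[OF alg(2)]
  have "GA f \<bullet> (GA h \<bullet> (a H \<bullet> x)) = GA h' \<bullet> (GA (TA f) \<bullet> (a H \<bullet> x))"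
    by (rule G.F_tail[OF f(4)]) (use f x in simp_all)
  then show ?thesis using f x by (simp add: kap_def a_tail)
qed

section \<open>Splitting a bialgebra over its primitive part\<close>

context
  fixes H h \<theta> assumes B: "is_bialg H h \<theta>"
begin

lemma bialg_alg: "(H, h) \<in> em_algs C T m e"
  using B by (simp add: is_bialg_def)

lemmas bialg_typing1 [simp] = alg_typing[OF bialg_alg] kap_typing[OF bialg_alg]

lemma bialg_hom: "\<theta> \<in> Hom C H (GO H)" 
  and bialg_typing2 [simp]: "\<theta> \<in> Arr C" "Dom C \<theta> = H" "Cod C \<theta> = GO H"
  and bialg_eqs: "\<delta> H \<bullet> \<theta> = GA \<theta> \<bullet> \<theta>" "\<epsilon> H \<bullet> \<theta> = Ide C H" "\<theta> \<bullet> h = GA h \<bullet> (l H \<bullet> TA \<theta>)"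
  using B by (auto simp: is_bialg_def Hom_def)

lemma bialg_tail:
  assumes "x \<in> Arr C"
  shows "Cod C x = H \<Longrightarrow> \<delta> H \<bullet> (\<theta> \<bullet> x) = GA \<theta> \<bullet> (\<theta> \<bullet> x)"
    "Cod C x = H \<Longrightarrow> \<epsilon> H \<bullet> (\<theta> \<bullet> x) = x"
    "Cod C x = TO H \<Longrightarrow> \<theta> \<bullet> (h \<bullet> x) = GA h \<bullet> (l H \<bullet> (TA \<theta> \<bullet> x))"
  using C.comp_tail[OF bialg_eqs(1), of x] C.comp_tail[OF bialg_eqs(2), of x] C.comp_tail[OF bialg_eqs(3), of x] assms by simp_all

lemma Pr_typing [simp]: "P H \<theta> \<in> Ob C" "inc H \<theta> \<in> Arr C" "Dom C (inc H \<theta>) = P H \<theta>" "Cod C (inc H \<theta>) = H"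
  using P_ob[OF _ bialg_hom] inc_hom[OF _ bialg_hom] by (simp_all add: Hom_def)

text \<open>The section \<open>S = \<kappa>\<^sup>-\<^sup>1\<theta>\<close> of \<open>h\<close> is a coaction of the comonad on algebras given by free algebras.
  Since \<open>e\<close> has the natural retraction \<open>pT\<close>, the equalizer of \<open>S\<close> and \<open>e\<close>, which is that of \<open>\<theta>\<close>
  and \<open>eG\<close>, is split by the idempotent \<open>pT \<bullet> S\<close>.\<close>

lemma section_ex:
  "\<exists>S r. S \<in> Arr C \<and> Dom C S = H \<and> Cod C S = TO H \<and> kap H h \<bullet> S = \<theta> \<and> h \<bullet> S = Ide C H \<and> S \<bullet> h = m H \<bullet> TA S \<and>
     S \<bullet> inc H \<theta> = e H \<bullet> inc H \<theta> \<and> r \<in> Arr C \<and> Dom C r = H \<and> Cod C r = P H \<theta> \<and> r \<bullet> inc H \<theta> = Ide C (P H \<theta>) \<and>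
     TA (inc H \<theta>) \<bullet> (TA r \<bullet> S) = S"
proof -
  note kiso = kap_iso[OF bialg_alg]
  obtain k where k: "k \<in> Arr C" "Dom C k = GO H" "Cod C k = TO H" "kap H h \<bullet> k = Ide C (GO H)"
    using kiso by (rule C.isoE) simp
  define S where "S = k \<bullet> \<theta>"
  have S [simp]: "S \<in> Arr C" "Dom C S = H" "Cod C S = TO H" using k by (simp_all add: S_def)
  have kS: "kap H h \<bullet> S = \<theta>" unfolding S_def using C.comp_tail[OF k(4), of \<theta>] k by simp
  have kS': "kap H h \<bullet> (S \<bullet> x) = \<theta> \<bullet> x" if "x \<in> Arr C" "Cod C x = H" for x
    using C.comp_tail[OF kS, of x] that by simp
  have hS: "h \<bullet> S = Ide C H"
    using kap_counit[OF bialg_alg, of S] kS bialg_eqs(2) by simp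
  \<comment> \<open>\<open>\<theta>\<close> is an algebra morphism into the lifted algebra and
    \<open>kap\<close> is one as well, so \<open>S\<close> becomes one after cancelling
    \<open>kap\<close>.\<close>
  have SA: "S \<bullet> h = m H \<bullet> TA S"
  proof (rule C.iso_cancel[OF kiso])
    have "TA (kap H h) \<bullet> TA S = TA \<theta>" using arg_cong[OF kS, of TA] by simp
    then show "kap H h \<bullet> (S \<bullet> h) = kap H h \<bullet> (m H \<bullet> TA S)"
      using kS'[of h] kap_alg[OF bialg_alg, of "TA S"] bialg_eqs(3) by simp
  qed simp_all
  \<comment> \<open>Both sides become \<open>G \<theta> \<bullet> \<theta>\<close> after
    \<open>kap\<close> at the free algebra and \<open>G kap\<close>: the left one by naturality of
    \<open>kap\<close> at the algebra morphism \<open>S\<close>, the right one by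
    \<open>kap_comult\<close> and coassociativity of \<open>\<theta>\<close>. Both arrows are
    isomorphisms.\<close>
  have TSS: "TA S \<bullet> S = TA (e H) \<bullet> S"
  proof -
    have k2: "iso_arr C (kap (TO H) (m H))" by (rule kap_iso[OF alg_free]) simp
    have [simp]: "kap (TO H) (m H) \<in> Arr C" "Dom C (kap (TO H) (m H)) = TO (TO H)" "Cod C (kap (TO H) (m H)) = GO (TO H)"
      using kap_typing[OF alg_free[of H]] by simp_all
    have "GA (kap H h) \<bullet> (kap (TO H) (m H) \<bullet> (TA S \<bullet> S)) = GA (kap H h) \<bullet> (GA S \<bullet> (kap H h \<bullet> S))"
      using kap_nat[OF bialg_alg alg_free[of H] S _, of S] SA by simp
    also have "\<dots> = GA \<theta> \<bullet> \<theta>"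
      using G.F_fuse[OF kS, of \<theta>] kS by simp
    also have "\<dots> = GA (kap H h) \<bullet> (kap (TO H) (m H) \<bullet> (TA (e H) \<bullet> S))"
      using kap_comult[OF bialg_alg, of S] kS bialg_eqs(1) by simp
    finally have "kap (TO H) (m H) \<bullet> (TA S \<bullet> S) = kap (TO H) (m H) \<bullet> (TA (e H) \<bullet> S)"
      by (rule C.iso_cancel[OF G.F_iso[OF kiso]]) simp_all
    then show ?thesis by (rule C.iso_cancel[OF k2]) simp_all
  qed
  define E where "E = pT H \<bullet> S"
  have E [simp]: "E \<in> Arr C" "Dom C E = H" "Cod C E = H" by (simp_all add: E_def)
  \<comment> \<open>Naturality of \<open>pT\<close>, once at \<open>S\<close> and once at
    \<open>e H\<close>, applied to the two sides of \<open>TSS\<close>.\<close>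
  have SE: "S \<bullet> E = e H \<bullet> E"
  proof -
    have "S \<bullet> E = pT (TO H) \<bullet> (TA S \<bullet> S)" using nat_tail(5)[of S S H "TO H"] by (simp add: E_def)
    also have "\<dots> = e H \<bullet> E" unfolding TSS using nat_tail(5)[of "e H" S H "TO H"] by (simp add: E_def)
    finally show ?thesis .
  qed
  \<comment> \<open>\<open>kap\<close> carries \<open>S\<close> to \<open>\<theta>\<close> and
    \<open>e\<close> to \<open>eG\<close>; so \<open>SE\<close> says that the image of
    \<open>E\<close> is primitive, and \<open>E\<close> factors through the equalizer.\<close>
  have "\<theta> \<bullet> E = eG H \<bullet> E" using kS'[of E] SE kap_e[OF bialg_alg, of E] by simp
  then obtain r where r [simp]: "r \<in> Arr C" "Dom C r = H" "Cod C r = P H \<theta>" and ir: "inc H \<theta> \<bullet> r = E"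
    using inc_univ[OF _ bialg_hom, of E] by (auto simp: Hom_def)
  have Si: "S \<bullet> inc H \<theta> = e H \<bullet> inc H \<theta>"
  proof (rule C.iso_cancel[OF kiso])
    show "kap H h \<bullet> (S \<bullet> inc H \<theta>) = kap H h \<bullet> (e H \<bullet> inc H \<theta>)"
      using kS'[of "inc H \<theta>"] kap_e[OF bialg_alg, of "inc H \<theta>"] inc_eq[OF _ bialg_hom] by simp
  qed simp_all
  \<comment> \<open>\<open>E\<close> fixes the primitive part, as \<open>S\<close> agrees with
    \<open>e\<close> there and \<open>pT\<close> retracts \<open>e\<close>; since \<open>inc\<close>
    is monic, \<open>r\<close> is a retraction of it.\<close>
  have "inc H \<theta> \<bullet> (r \<bullet> inc H \<theta>) = E \<bullet> inc H \<theta>" using C.comp_tail[OF ir, of "inc H \<theta>"] by simp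
  also have "\<dots> = inc H \<theta>" using Si free_tail(7)[of H "inc H \<theta>"] by (simp add: E_def)
  finally have ri: "r \<bullet> inc H \<theta> = Ide C (P H \<theta>)"
    using inc_mono[OF _ bialg_hom, of "r \<bullet> inc H \<theta>" "Ide C (P H \<theta>)"] by simp
  \<comment> \<open>\<open>T E\<close> is \<open>T pT \<bullet> T S\<close>; by \<open>TSS\<close>
    the factor \<open>T S\<close> may be replaced by \<open>T e\<close> in front of
    \<open>S\<close>, and \<open>pT\<close> cancels it.\<close>
  have "TA (inc H \<theta>) \<bullet> (TA r \<bullet> S) = TA E \<bullet> S"
    using T.F_fuse[OF ir, of S] by simp
  also have "\<dots> = TA (pT H) \<bullet> (TA S \<bullet> S)" by (simp add: E_def)
  also have "\<dots> = S" unfolding TSS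
    using T.F_fuse[OF pT_e[of H], of S] by simp
  finally show ?thesis using kS hS SA Si ri by (intro exI[of _ S] exI[of _ r]) simp
qed

text \<open>The inverse is \<open>T r \<bullet> S\<close>. One composite reduces to
  \<open>h \<bullet> S\<close>, because \<open>S\<close> factors through \<open>T inc\<close>. In
  the other, \<open>S\<close> passes \<open>h\<close> as \<open>m \<bullet> T S\<close>, agrees with
  \<open>e\<close> on primitives, and \<open>m \<bullet> T e\<close> cancels.\<close>

lemma counit_iso: "iso_arr C (h \<bullet> TA (inc H \<theta>))"
proof -
  obtain S r where S [simp]: "S \<in> Arr C" "Dom C S = H" "Cod C S = TO H" and hS: "h \<bullet> S = Ide C H" and Sh: "S \<bullet> h = m H \<bullet> TA S"
    and Si: "S \<bullet> inc H \<theta> = e H \<bullet> inc H \<theta>" and r [simp]: "r \<in> Arr C" "Dom C r = H" "Cod C r = P H \<theta>" and ri: "r \<bullet> inc H \<theta> = Ide C (P H \<theta>)"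
    and TS: "TA (inc H \<theta>) \<bullet> (TA r \<bullet> S) = S" using section_ex by blast
  have "TA r \<bullet> (S \<bullet> (h \<bullet> TA (inc H \<theta>))) = TA r \<bullet> (m H \<bullet> (TA S \<bullet> TA (inc H \<theta>)))"
    using C.comp_tail[OF Sh, of "TA (inc H \<theta>)"] by simp
  also have "TA S \<bullet> TA (inc H \<theta>) = TA (e H) \<bullet> TA (inc H \<theta>)" using arg_cong[OF Si, of TA] by simp
  also have "m H \<bullet> (TA (e H) \<bullet> TA (inc H \<theta>)) = TA (inc H \<theta>)" by (simp add: free_tail)
  also have "TA r \<bullet> TA (inc H \<theta>) = Ide C (TO (P H \<theta>))" using arg_cong[OF ri, of TA] by simp
  finally have 1: "TA r \<bullet> (S \<bullet> (h \<bullet> TA (inc H \<theta>))) = Ide C (TO (P H \<theta>))" .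
  show ?thesis
    by (rule C.isoI[of _ "TA r \<bullet> S"]) (simp_all add: 1 TS hS)
qed

lemma counit_alg: "((TO (P H \<theta>), m (P H \<theta>)), h \<bullet> TA (inc H \<theta>), (H, h)) \<in> Arr Alg"
proof -
  have "h \<bullet> (TA (inc H \<theta>) \<bullet> m (P H \<theta>)) = h \<bullet> (TA h \<bullet> TA (TA (inc H \<theta>)))"
    using nat_eqs(2)[of "inc H \<theta>"] alg_tail(1)[OF bialg_alg, of "TA (TA (inc H \<theta>))"] by simp
  then show ?thesis
    using bialg_alg alg_free[of "P H \<theta>"] by (simp add: T.em_alg_arr_iff Hom_def)
qed

text \<open>On primitives \<open>\<theta>\<close> is \<open>eG\<close>, so the bialgebra square
  produces \<open>l \<bullet> T eG\<close>, which is the coaction \<open>a\<close> by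
  \<open>a_eq\<close>.\<close>

lemma counit_coalg: "\<theta> \<bullet> (h \<bullet> TA (inc H \<theta>)) = GA (h \<bullet> TA (inc H \<theta>)) \<bullet> a (P H \<theta>)"
proof -
  have "TA \<theta> \<bullet> TA (inc H \<theta>) = TA (eG H) \<bullet> TA (inc H \<theta>)"
    using arg_cong[OF inc_eq[OF _ bialg_hom], of TA] by simp
  then have "\<theta> \<bullet> (h \<bullet> TA (inc H \<theta>)) = GA h \<bullet> (a H \<bullet> TA (inc H \<theta>))"
    using bialg_tail(3)[of "TA (inc H \<theta>)"] by (simp add: a_eq)
  then show ?thesis using a_nat[of "inc H \<theta>"] by simp
qed

lemma counit_inc: "(h \<bullet> TA (inc H \<theta>)) \<bullet> e (P H \<theta>) = inc H \<theta>"
  using nat_eqs(1)[of "inc H \<theta>"] alg_tail(2)[OF bialg_alg, of "inc H \<theta>"] by simp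

lemma bialg_coalg: "(H, \<theta>) \<in> em_coalgs C G \<delta> \<epsilon>"
  using bialg_hom bialg_eqs by (simp add: em_coalgs_def)

end

section \<open>Cofreeness\<close>

lemma phi_e: "X \<in> Ob C \<Longrightarrow> (GA (pT X) \<bullet> a X) \<bullet> e X = eG X"
proof -
  assume X: "X \<in> Ob C"
  have "GA (pT X) \<bullet> (eG (TO X) \<bullet> e X) = eG X \<bullet> (pT X \<bullet> e X)"
    using nat_tail(6)[of "pT X" "e X" "TO X" X] X by simp
  then show ?thesis using X by (simp add: a_e pT_e)
qed

text \<open>Naturality of \<open>\<delta>\<close> and coassociativity of \<open>a X\<close>. Without
  the tail \<open>x\<close> it says that \<open>G (pT X) \<bullet> a X\<close> is a coalgebra
  morphism from \<open>(T X, a X)\<close> to the cofree coalgebra on \<open>X\<close>.\<close>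

lemma phi_coalg:
  assumes X: "X \<in> Ob C" and x: "x \<in> Arr C" "Cod C x = TO X"
  shows "\<delta> X \<bullet> (GA (pT X) \<bullet> (a X \<bullet> x)) = GA (GA (pT X)) \<bullet> (GA (a X) \<bullet> (a X \<bullet> x))"
  using assms by (simp add: nat_tail free_tail)

text \<open>The comonad axioms at \<open>X\<close> are transported from \<open>(T X, a X)\<close> along the isomorphism \<open>G (pT X) \<bullet> a X\<close>.\<close>

lemma cofree_coalg:
  assumes X: "X \<in> Ob C"
  shows "(GO X, \<delta> X) \<in> em_coalgs C G \<delta> \<epsilon>"
proof -
  define p where "p = GA (pT X) \<bullet> a X"
  have p [simp]: "p \<in> Arr C" "Dom C p = TO X" "Cod C p = GO X" and iso: "iso_arr C p"
    using X phi_iso by (simp_all add: p_def)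
  have 1: "\<delta> X \<bullet> p = GA p \<bullet> a X" using phi_coalg[OF X, of "Ide C (TO X)"] X by (simp add: p_def)
  have 2: "GA (\<delta> X) \<bullet> (GA p \<bullet> a X) = GA (GA p \<bullet> a X) \<bullet> a X"
    by (rule G.F_fuse[OF 1]) (use X in simp_all)
  have 3: "\<delta> (GO X) \<bullet> (GA p \<bullet> a X) = GA (GA p) \<bullet> (\<delta> (TO X) \<bullet> a X)"
    by (rule nat_tail(3)) (use X in simp_all)
  have "\<delta> (GO X) \<bullet> \<delta> X = GA (\<delta> X) \<bullet> \<delta> X"
  proof (rule C.iso_cancel_right[OF iso])
    have "(\<delta> (GO X) \<bullet> \<delta> X) \<bullet> p = \<delta> (GO X) \<bullet> (\<delta> X \<bullet> p)" "(GA (\<delta> X) \<bullet> \<delta> X) \<bullet> p = GA (\<delta> X) \<bullet> (\<delta> X \<bullet> p)"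
      using X by simp_all
    then show "(\<delta> (GO X) \<bullet> \<delta> X) \<bullet> p = (GA (\<delta> X) \<bullet> \<delta> X) \<bullet> p"
      unfolding 1 2 3 free_eqs(3)[OF X] using X by simp
  qed (use X in simp_all)
  moreover have "\<epsilon> (GO X) \<bullet> \<delta> X = Ide C (GO X)"
  proof (rule C.iso_cancel_right[OF iso])
    have "(\<epsilon> (GO X) \<bullet> \<delta> X) \<bullet> p = \<epsilon> (GO X) \<bullet> (\<delta> X \<bullet> p)" using X by simp
    also have "\<dots> = p \<bullet> (\<epsilon> (TO X) \<bullet> a X)" unfolding 1
      by (rule nat_tail(4)) (use X in simp_all)
    also have "\<dots> = Ide C (GO X) \<bullet> p" unfolding free_eqs(4)[OF X] using X by simp
    finally show "(\<epsilon> (GO X) \<bullet> \<delta> X) \<bullet> p = Ide C (GO X) \<bullet> p" .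
  qed (use X in simp_all)
  ultimately show ?thesis using X by (simp add: em_coalgs_def Hom_def)
qed

text \<open>Freeness is the counit of the equivalence. For cofreeness its inverse is followed by the
  coalgebra isomorphism \<open>G pT \<bullet> a\<close> at the primitive part; as this carries
  \<open>e\<close> to \<open>eG\<close>, the inclusions of the primitive part match.\<close>

theorem bialg_free_cofree:
  assumes B: "is_bialg H h \<theta>"
  shows "\<exists>f. iso_arr Alg ((TO (P H \<theta>), m (P H \<theta>)), f, (H, h)) \<and> f \<bullet> e (P H \<theta>) = inc H \<theta> \<and> f \<in> Hom C (TO (P H \<theta>)) H"
    and "\<exists>f. iso_arr (em_coalg C G \<delta> \<epsilon>) ((H, \<theta>), f, (GO (P H \<theta>), \<delta> (P H \<theta>))) \<and> f \<bullet> inc H \<theta> = eG (P H \<theta>) \<and> f \<in> Hom C H (GO (P H \<theta>))"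
proof -
  note [simp] = bialg_typing1[OF B] bialg_typing2[OF B] Pr_typing[OF B]
  let ?f = "h \<bullet> TA (inc H \<theta>)" and ?X = "P H \<theta>"
  let ?p = "GA (pT ?X) \<bullet> a ?X"
  show "\<exists>f. iso_arr Alg ((TO ?X, m ?X), f, (H, h)) \<and> f \<bullet> e ?X = inc H \<theta> \<and> f \<in> Hom C (TO ?X) H"
    using T.em_alg_iso[OF counit_alg[OF B] counit_iso[OF B]] counit_inc[OF B] by (intro exI[of _ ?f]) (simp add: Hom_def)
  obtain g where g: "g \<in> Arr C" "Dom C g = H" "Cod C g = TO ?X" "g \<bullet> ?f = Ide C (TO ?X)" "?f \<bullet> g = Ide C H"
    using counit_iso[OF B] by (rule C.isoE) simp
  have f: "?f \<in> Arr C" "Dom C ?f = TO ?X" "Cod C ?f = H" by simp_all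
  have giso: "iso_arr C g" by (rule C.isoI[of _ ?f]) (use g f in simp_all)
  \<comment> \<open>The inverse of a coalgebra isomorphism is again a coalgebra morphism: the
    isomorphism is cancelled on the right.\<close>
  have ga: "a ?X \<bullet> g = GA g \<bullet> \<theta>"
  proof (rule C.iso_cancel_right[OF counit_iso[OF B]])
    have "(GA g \<bullet> \<theta>) \<bullet> ?f = GA g \<bullet> (\<theta> \<bullet> ?f)" using g by simp
    also have "\<dots> = a ?X" unfolding counit_coalg[OF B] using G.F_fuse[OF g(4), of "a ?X"] g f by (simp del: G.F_comp)
    also have "\<dots> = (a ?X \<bullet> g) \<bullet> ?f" using g by simp
    finally show "(a ?X \<bullet> g) \<bullet> ?f = (GA g \<bullet> \<theta>) \<bullet> ?f" by simp
  qed (use g in simp_all)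
  have "\<delta> ?X \<bullet> (?p \<bullet> g) = GA (?p \<bullet> g) \<bullet> \<theta>"
    using phi_coalg[of ?X g] G.F_tail[OF ga, of \<theta>] g ga by simp
  then have "((H, \<theta>), ?p \<bullet> g, (GO ?X, \<delta> ?X)) \<in> Arr (em_coalg C G \<delta> \<epsilon>)"
    using bialg_coalg[OF B] cofree_coalg[of ?X] g by (simp add: G.em_coalg_arr_iff Hom_def)
  from G.em_coalg_iso[OF this C.iso_comp[OF giso phi_iso[of ?X]]] g
  have "iso_arr (em_coalg C G \<delta> \<epsilon>) ((H, \<theta>), ?p \<bullet> g, (GO ?X, \<delta> ?X))" by simp
  moreover have "(?p \<bullet> g) \<bullet> inc H \<theta> = eG ?X"
  proof -
    have "(?p \<bullet> g) \<bullet> inc H \<theta> = ?p \<bullet> (g \<bullet> (?f \<bullet> e ?X))" unfolding counit_inc[OF B] using g by simp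
    also have "g \<bullet> (?f \<bullet> e ?X) = e ?X" using C.comp_tail[OF g(4), of "e ?X"] g f by simp
    finally show ?thesis using phi_e[of ?X] by simp
  qed
  moreover have "?p \<bullet> g \<in> Hom C H (GO ?X)" using g by (simp add: Hom_def)
  ultimately show "\<exists>f. iso_arr (em_coalg C G \<delta> \<epsilon>) ((H, \<theta>), f, (GO ?X, \<delta> ?X)) \<and> f \<bullet> inc H \<theta> = eG ?X \<and> f \<in> Hom C H (GO ?X)"
    by blast
qed

section \<open>The functor of primitives and the equivalence\<close>

lemma Bialg_category: "is_category Bialg"
  by (rule Alg.em_coalg_category)

lemma bialg_arr_iff:
  assumes B: "is_bialg H h \<theta>" and B': "is_bialg H' h' \<theta>'"
  shows "(bialg H h \<theta>, (X, f, Y), bialg H' h' \<theta>') \<in> Arr Bialg \<longleftrightarrow>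
    X = (H, h) \<and> Y = (H', h') \<and> ((H, h), f, (H', h')) \<in> Arr Alg \<and> \<theta>' \<bullet> f = GA f \<bullet> \<theta>"
proof -
  have "bialg H h \<theta> \<in> Ob Bialg" "bialg H' h' \<theta>' \<in> Ob Bialg" using B B' bialg_iff by auto
  then show ?thesis unfolding Alg.em_coalg_arr_iff
    by (auto simp: lift_func_def Hom_def)
qed

lemma BialgArrE:
  assumes "A \<in> Arr Bialg"
  obtains H h \<theta> f H' h' \<theta>' where "A = (bialg H h \<theta>, ((H, h), f, (H', h')), bialg H' h' \<theta>')" "is_bialg H h \<theta>" "is_bialg H' h' \<theta>'"
    "f \<in> Arr C" "Dom C f = H" "Cod C f = H'" "f \<bullet> h = h' \<bullet> TA f" "\<theta>' \<bullet> f = GA f \<bullet> \<theta>"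
proof -
  obtain B X f Y B' where A: "A = (B, (X, f, Y), B')" by (metis prod.exhaust)
  have "B \<in> Ob Bialg" "B' \<in> Ob Bialg" using assms unfolding A Alg.em_coalg_arr_iff by auto
  then obtain H h \<theta> H' h' \<theta>' where B: "B = bialg H h \<theta>" "is_bialg H h \<theta>" "B' = bialg H' h' \<theta>'" "is_bialg H' h' \<theta>'"
    by (metis BialgE)
  have "X = (H, h)" "Y = (H', h')" "((H, h), f, (H', h')) \<in> Arr Alg" "\<theta>' \<bullet> f = GA f \<bullet> \<theta>"
    using assms bialg_arr_iff[OF B(2,4), of X f Y] unfolding A B(1,3) by auto
  then show ?thesis using that[of H h \<theta> f H' h' \<theta>'] A B by (auto simp: T.em_alg_arr_iff Hom_def)
qed

definition "comp_ob X = bialg (TO X) (m X) (l X \<bullet> TA (eG X))"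

definition "comp_fun = \<lparr>FOb = comp_ob,
  FArr = \<lambda>f. (comp_ob (Dom C f), ((TO (Dom C f), m (Dom C f)), TA f, (TO (Cod C f), m (Cod C f))), comp_ob (Cod C f))\<rparr>"

definition "prim_ob B = P (fst (fst B)) (fst (snd (snd B)))"

definition "prim_inc B = inc (fst (fst B)) (fst (snd (snd B)))"

text \<open>On arrows this is restriction to primitive parts. It is named by \<open>THE\<close>,
  since the equalizer property gives a unique factorisation but no formula for it.\<close>

definition prim_fun ::
  "(('o \<times> 'a) \<times> ('o \<times> 'a, 'a) tarr, (('o \<times> 'a) \<times> ('o \<times> 'a, 'a) tarr, ('o \<times> 'a, 'a) tarr) tarr, 'o, 'a) func" where
  "prim_fun = \<lparr>FOb = prim_ob,
  FArr = \<lambda>(B, (X, f, Y), B'). (THE g. g \<in> Hom C (prim_ob B) (prim_ob B') \<and> prim_inc B' \<bullet> g = f \<bullet> prim_inc B)\<rparr>"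

lemma prim_simps [simp]: "prim_ob (bialg H h \<theta>) = P H \<theta>" "prim_inc (bialg H h \<theta>) = inc H \<theta>"
  by (simp_all add: prim_ob_def prim_inc_def)

lemma comp_ob: "X \<in> Ob C \<Longrightarrow> comp_ob X = bialg (TO X) (m X) (a X)"
  by (simp add: comp_ob_def a_eq)

lemma prim_factor:
  assumes B: "is_bialg H h \<theta>" and f: "f \<in> Arr C" "Cod C f = H" "\<theta> \<bullet> f = eG H \<bullet> f"
  shows "\<exists>!g. g \<in> Hom C (Dom C f) (P H \<theta>) \<and> inc H \<theta> \<bullet> g = f"
  using inc_univ[OF _ bialg_hom[OF B] f] inc_mono[OF _ bialg_hom[OF B]] bialg_typing1[OF B]
  unfolding Hom_def by (metis (mono_tags, lifting) mem_Collect_eq)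

lemma prim_fun_arr:
  assumes B: "is_bialg H h \<theta>" "is_bialg H' h' \<theta>'" and f: "f \<in> Arr C" "Dom C f = H" "Cod C f = H'" "\<theta>' \<bullet> f = GA f \<bullet> \<theta>"
  shows "FArr prim_fun (bialg H h \<theta>, ((H, h), f, (H', h')), bialg H' h' \<theta>') \<in> Hom C (P H \<theta>) (P H' \<theta>') \<and>
     inc H' \<theta>' \<bullet> FArr prim_fun (bialg H h \<theta>, ((H, h), f, (H', h')), bialg H' h' \<theta>') = f \<bullet> inc H \<theta>"
proof -
  note [simp] = bialg_typing1[OF B(1)] bialg_typing2[OF B(1)] Pr_typing[OF B(1)] bialg_typing1[OF B(2)] bialg_typing2[OF B(2)] Pr_typing[OF B(2)]
  have "\<theta>' \<bullet> (f \<bullet> inc H \<theta>) = GA f \<bullet> (\<theta> \<bullet> inc H \<theta>)"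
    using C.comp_tail[OF f(4), of "inc H \<theta>"] f(1-3) by simp
  also have "\<theta> \<bullet> inc H \<theta> = eG H \<bullet> inc H \<theta>" by (rule inc_eq[OF _ bialg_hom[OF B(1)]]) simp
  also have "GA f \<bullet> (eG H \<bullet> inc H \<theta>) = eG H' \<bullet> (f \<bullet> inc H \<theta>)"
    by (rule nat_tail(6)[symmetric]) (use f(1-3) in simp_all)
  finally have "\<exists>!g. g \<in> Hom C (P H \<theta>) (P H' \<theta>') \<and> inc H' \<theta>' \<bullet> g = f \<bullet> inc H \<theta>"
    using prim_factor[OF B(2), of "f \<bullet> inc H \<theta>"] f(1-3) by simp
  from theI'[OF this] show ?thesis by (simp add: prim_fun_def)
qed

lemma prim_eqI:
  assumes "is_bialg H h \<theta>" "g \<in> Hom C X (P H \<theta>)" "g' \<in> Hom C X (P H \<theta>)" "inc H \<theta> \<bullet> g = inc H \<theta> \<bullet> g'"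
  shows "g = g'"
  using inc_mono[OF _ bialg_hom[OF assms(1)], of g g'] assms bialg_typing1[OF assms(1)] by (simp add: Hom_def)

lemma prim_functor: "is_functor Bialg C prim_fun"
  unfolding is_functor_def
proof (intro conjI ballI impI Bialg_category C.category)
  fix B assume "B \<in> Ob Bialg"
  then obtain H h \<theta> where B: "B = bialg H h \<theta>" "is_bialg H h \<theta>" by (rule BialgE)
  note [simp] = bialg_typing1[OF B(2)] bialg_typing2[OF B(2)] Pr_typing[OF B(2)]
  show "FOb prim_fun B \<in> Ob C" by (simp add: prim_fun_def B)
  have e: "Ide Bialg B = (bialg H h \<theta>, ((H, h), Ide C H, (H, h)), bialg H h \<theta>)" by (simp add: B)
  have "FArr prim_fun (Ide Bialg B) = Ide C (P H \<theta>)"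
    unfolding e
    by (rule prim_eqI[OF B(2), of _ "P H \<theta>"]) (use prim_fun_arr[OF B(2,2), of "Ide C H"] in \<open>simp_all add: Hom_def\<close>)
  then show "FArr prim_fun (Ide Bialg B) = Ide C (FOb prim_fun B)" by (simp add: prim_fun_def B)
next
  fix A assume "A \<in> Arr Bialg"
  then obtain H h \<theta> f H' h' \<theta>' where A: "A = (bialg H h \<theta>, ((H, h), f, (H', h')), bialg H' h' \<theta>')" and B: "is_bialg H h \<theta>" "is_bialg H' h' \<theta>'"
    and f: "f \<in> Arr C" "Dom C f = H" "Cod C f = H'" "f \<bullet> h = h' \<bullet> TA f" "\<theta>' \<bullet> f = GA f \<bullet> \<theta>"
    by (rule BialgArrE)
  note Qf = prim_fun_arr[OF B f(1-3,5)]
  show "FArr prim_fun A \<in> Hom C (FOb prim_fun (Dom Bialg A)) (FOb prim_fun (Cod Bialg A))"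
    using Qf unfolding A by (simp add: prim_fun_def)
  fix A' assume A': "A' \<in> Arr Bialg" and AA: "Cod Bialg A = Dom Bialg A'"
  from A' obtain H1 h1 \<theta>1 f' H'' h'' \<theta>'' where A1: "A' = (bialg H1 h1 \<theta>1, ((H1, h1), f', (H'', h'')), bialg H'' h'' \<theta>'')" and B': "is_bialg H1 h1 \<theta>1" "is_bialg H'' h'' \<theta>''"
    and f': "f' \<in> Arr C" "Dom C f' = H1" "Cod C f' = H''" "f' \<bullet> h1 = h'' \<bullet> TA f'" "\<theta>'' \<bullet> f' = GA f' \<bullet> \<theta>1"
    by (rule BialgArrE)
  have [simp]: "H1 = H'" "h1 = h'" "\<theta>1 = \<theta>'" using AA unfolding A A1 by auto
  note Qf' = prim_fun_arr[OF B' f'(1-3,5)]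
  note [simp] = bialg_typing1[OF B(1)] bialg_typing2[OF B(1)] Pr_typing[OF B(1)] bialg_typing1[OF B(2)] bialg_typing2[OF B(2)] Pr_typing[OF B(2)]
    bialg_typing1[OF B'(2)] bialg_typing2[OF B'(2)] Pr_typing[OF B'(2)]
  have "\<theta>'' \<bullet> (f' \<bullet> f) = GA (f' \<bullet> f) \<bullet> \<theta>"
    using C.comp_tail[OF f'(5), of f] f' f by simp
  then have Qff: "FArr prim_fun (bialg H h \<theta>, ((H, h), f' \<bullet> f, (H'', h'')), bialg H'' h'' \<theta>'') \<in> Hom C (P H \<theta>) (P H'' \<theta>'') \<and>
     inc H'' \<theta>'' \<bullet> FArr prim_fun (bialg H h \<theta>, ((H, h), f' \<bullet> f, (H'', h'')), bialg H'' h'' \<theta>'') = (f' \<bullet> f) \<bullet> inc H \<theta>"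
    using f f' by (intro prim_fun_arr[OF B(1) B'(2)]) simp_all
  have c: "A' \<bullet>\<^bsub>Bialg\<^esub> A = (bialg H h \<theta>, ((H, h), f' \<bullet> f, (H'', h'')), bialg H'' h'' \<theta>'')"
    unfolding A A1 by simp
  let ?q = "FArr prim_fun A" and ?q' = "FArr prim_fun A'"
  have q: "?q \<in> Arr C" "Dom C ?q = P H \<theta>" "Cod C ?q = P H' \<theta>'" "inc H' \<theta>' \<bullet> ?q = f \<bullet> inc H \<theta>"
    and q': "?q' \<in> Arr C" "Dom C ?q' = P H' \<theta>'" "Cod C ?q' = P H'' \<theta>''" "inc H'' \<theta>'' \<bullet> ?q' = f' \<bullet> inc H' \<theta>'"
    using Qf Qf' unfolding A A1 by (simp_all add: Hom_def)
  show "FArr prim_fun (A' \<bullet>\<^bsub>Bialg\<^esub> A) = ?q' \<bullet> ?q"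
  proof (rule prim_eqI[OF B'(2), of _ "P H \<theta>"])
    have "inc H'' \<theta>'' \<bullet> (?q' \<bullet> ?q) = f' \<bullet> (f \<bullet> inc H \<theta>)"
      using C.comp_tail[OF q'(4), of ?q] q q' f f' by simp
    then show "inc H'' \<theta>'' \<bullet> FArr prim_fun (A' \<bullet>\<^bsub>Bialg\<^esub> A) = inc H'' \<theta>'' \<bullet> (?q' \<bullet> ?q)"
      using Qff f f' unfolding c by simp
  qed (use Qff q q' in \<open>simp_all add: c Hom_def\<close>)
qed

lemma comp_arr:
  assumes "f \<in> Arr C"
  shows "FArr comp_fun f \<in> Arr Bialg"
    and "FArr comp_fun f = (bialg (TO (Dom C f)) (m (Dom C f)) (a (Dom C f)),
      ((TO (Dom C f), m (Dom C f)), TA f, (TO (Cod C f), m (Cod C f))), bialg (TO (Cod C f)) (m (Cod C f)) (a (Cod C f)))"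
proof -
  show e: "FArr comp_fun f = (bialg (TO (Dom C f)) (m (Dom C f)) (a (Dom C f)),
      ((TO (Dom C f), m (Dom C f)), TA f, (TO (Cod C f), m (Cod C f))), bialg (TO (Cod C f)) (m (Cod C f)) (a (Cod C f)))"
    using assms by (simp add: comp_fun_def comp_ob)
  show "FArr comp_fun f \<in> Arr Bialg" unfolding e
    using assms alg_free[of "Dom C f"] alg_free[of "Cod C f"] nat_eqs(2)[OF assms] a_nat[OF assms]
    by (subst bialg_arr_iff[OF bialg_free bialg_free]) (simp_all add: T.em_alg_arr_iff Hom_def)
qed

lemma comp_functor: "is_functor C Bialg comp_fun"
  unfolding is_functor_def
proof (intro conjI ballI impI Bialg_category C.category)
  fix X assume X: "X \<in> Ob C"
  show "FOb comp_fun X \<in> Ob Bialg" using X bialg_free[OF X] bialg_iff by (simp add: comp_fun_def comp_ob)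
  show "FArr comp_fun (Ide C X) = Ide Bialg (FOb comp_fun X)" using X by (simp add: comp_fun_def comp_ob)
next
  fix f assume f: "f \<in> Arr C"
  show "FArr comp_fun f \<in> Hom Bialg (FOb comp_fun (Dom C f)) (FOb comp_fun (Cod C f))"
    using comp_arr(1)[OF f] by (simp add: Hom_def) (simp add: comp_fun_def)
  fix g assume "g \<in> Arr C" "Cod C f = Dom C g"
  then show "FArr comp_fun (g \<bullet> f) = FArr comp_fun g \<bullet>\<^bsub>Bialg\<^esub> FArr comp_fun f"
    using f by (simp add: comp_fun_def)
qed

text \<open>The unit of the equivalence; \<open>e X\<close> factors through the primitive part of
  the free bialgebra by the hypothesis \<open>a_e\<close>.\<close>

definition "unit_arr X = (THE g. g \<in> Hom C X (P (TO X) (a X)) \<and> inc (TO X) (a X) \<bullet> g = e X)"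

lemma unit_arr:
  assumes "X \<in> Ob C"
  shows "unit_arr X \<in> Arr C" "Dom C (unit_arr X) = X" "Cod C (unit_arr X) = P (TO X) (a X)" "inc (TO X) (a X) \<bullet> unit_arr X = e X"
proof -
  have "\<exists>!g. g \<in> Hom C X (P (TO X) (a X)) \<and> inc (TO X) (a X) \<bullet> g = e X"
    using prim_factor[OF bialg_free[OF assms], of "e X"] a_e[OF assms] assms by simp
  from theI'[OF this] show "unit_arr X \<in> Arr C" "Dom C (unit_arr X) = X" "Cod C (unit_arr X) = P (TO X) (a X)" "inc (TO X) (a X) \<bullet> unit_arr X = e X"
    by (simp_all add: unit_arr_def Hom_def)
qed

text \<open>The inverse is \<open>pT X\<close> restricted to primitives. That
  \<open>e X \<bullet> pT X\<close> fixes the primitives of \<open>T X\<close> is checked after the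
  isomorphism \<open>G (pT X) \<bullet> a X\<close>, where \<open>phi_e\<close> and naturality of
  \<open>eG\<close> apply.\<close>

lemma unit_arr_iso:
  assumes X: "X \<in> Ob C"
  shows "iso_arr C (unit_arr X)"
proof -
  let ?i = "inc (TO X) (a X)"
  note [simp] = Pr_typing[OF bialg_free[OF X]] unit_arr(1-3)[OF X] X
  note u = unit_arr(4)[OF X]
  have "e X \<bullet> (pT X \<bullet> ?i) = ?i"
  proof (rule C.iso_cancel[OF phi_iso[OF X]])
    have "(GA (pT X) \<bullet> a X) \<bullet> (e X \<bullet> (pT X \<bullet> ?i)) = eG X \<bullet> (pT X \<bullet> ?i)"
      using C.comp_tail[OF phi_e[OF X], of "pT X \<bullet> ?i"] by simp
    also have "\<dots> = GA (pT X) \<bullet> (eG (TO X) \<bullet> ?i)" by (rule nat_tail(6)) simp_all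
    also have "\<dots> = (GA (pT X) \<bullet> a X) \<bullet> ?i"
      using inc_eq[OF _ bialg_hom[OF bialg_free[OF X]]] by simp
    finally show "(GA (pT X) \<bullet> a X) \<bullet> (e X \<bullet> (pT X \<bullet> ?i)) = (GA (pT X) \<bullet> a X) \<bullet> ?i" .
  qed simp_all
  then have 1: "unit_arr X \<bullet> (pT X \<bullet> ?i) = Ide C (P (TO X) (a X))"
    using C.comp_tail[OF u, of "pT X \<bullet> ?i"]
      prim_eqI[OF bialg_free[OF X], of "unit_arr X \<bullet> (pT X \<bullet> ?i)" "P (TO X) (a X)" "Ide C (P (TO X) (a X))"]
    by (simp add: Hom_def)
  have 2: "(pT X \<bullet> ?i) \<bullet> unit_arr X = Ide C X" using u pT_e[OF X] by simp
  show ?thesis by (rule C.isoI[of _ "pT X \<bullet> ?i"]) (use 1 2 in \<open>simp_all del: C.comp_assoc\<close>)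
qed

theorem comparison_equivalence: "is_equivalence C Bialg comp_fun"
  unfolding is_equivalence_def
proof (intro conjI exI)
  show "is_functor C Bialg comp_fun" by (rule comp_functor)
  show "is_functor Bialg C prim_fun" by (rule prim_functor)
  show "nat_iso C C id_func (comp_func prim_fun comp_fun) unit_arr"
    unfolding nat_iso_def nat_trans_def
  proof (intro conjI ballI unit_arr_iso)
    fix X assume X: "X \<in> Ob C"
    then show "unit_arr X \<in> Hom C (FOb id_func X) (FOb (comp_func prim_fun comp_fun) X)"
      using unit_arr[OF X] by (simp add: Hom_def id_func_def comp_func_def comp_fun_def prim_fun_def comp_ob)
  next
    fix f assume f: "f \<in> Arr C"
    let ?X = "Dom C f" and ?Y = "Cod C f"
    have ob: "?X \<in> Ob C" "?Y \<in> Ob C" using f by simp_all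
    note [simp] = Pr_typing[OF bialg_free[OF ob(1)]] unit_arr(1-3)[OF ob(1)] Pr_typing[OF bialg_free[OF ob(2)]] unit_arr(1-3)[OF ob(2)]
    let ?q = "FArr prim_fun (FArr comp_fun f)"
    have q: "?q \<in> Arr C" "Dom C ?q = P (TO ?X) (a ?X)" "Cod C ?q = P (TO ?Y) (a ?Y)" "inc (TO ?Y) (a ?Y) \<bullet> ?q = TA f \<bullet> inc (TO ?X) (a ?X)"
      using prim_fun_arr[OF bialg_free[OF ob(1)] bialg_free[OF ob(2)] T.F_arr[OF f] a_nat[OF f]]
      unfolding comp_arr(2)[OF f] Hom_def by blast+
    have "unit_arr ?Y \<bullet> f = ?q \<bullet> unit_arr ?X"
    proof (rule prim_eqI[OF bialg_free[OF ob(2)], of _ ?X])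
      have "inc (TO ?Y) (a ?Y) \<bullet> (unit_arr ?Y \<bullet> f) = e ?Y \<bullet> f"
        using C.comp_tail[OF unit_arr(4)[OF ob(2)], of f] f by simp
      also have "\<dots> = TA f \<bullet> (inc (TO ?X) (a ?X) \<bullet> unit_arr ?X)"
        using nat_eqs(1)[OF f] unit_arr(4)[OF ob(1)] by simp
      also have "\<dots> = inc (TO ?Y) (a ?Y) \<bullet> (?q \<bullet> unit_arr ?X)"
        using C.comp_tail[OF q(4), of "unit_arr ?X"] q f by simp
      finally show "inc (TO ?Y) (a ?Y) \<bullet> (unit_arr ?Y \<bullet> f) = inc (TO ?Y) (a ?Y) \<bullet> (?q \<bullet> unit_arr ?X)" .
    qed (use f q in \<open>simp_all add: Hom_def\<close>)
    then show "unit_arr (Cod C f) \<bullet> FArr id_func f = FArr (comp_func prim_fun comp_fun) f \<bullet> unit_arr (Dom C f)"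
      by (simp add: id_func_def comp_func_def)
  qed
  \<comment> \<open>The counit at a bialgebra is the algebra map extending the inclusion of its
    primitive part.\<close>
  let ?\<epsilon> = "\<lambda>B. (comp_ob (prim_ob B), ((TO (prim_ob B), m (prim_ob B)), snd (fst B) \<bullet> TA (prim_inc B), fst B), B)"
  have e: "?\<epsilon> (bialg H h \<theta>) = (bialg (TO (P H \<theta>)) (m (P H \<theta>)) (a (P H \<theta>)), ((TO (P H \<theta>), m (P H \<theta>)), h \<bullet> TA (inc H \<theta>), (H, h)), bialg H h \<theta>)"
    if B: "is_bialg H h \<theta>" for H h \<theta> using Pr_typing[OF B] by (simp add: comp_ob)
  have ea: "?\<epsilon> (bialg H h \<theta>) \<in> Arr Bialg" if B: "is_bialg H h \<theta>" for H h \<theta>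
    unfolding e[OF B] using counit_alg[OF B] counit_coalg[OF B]
    by (subst bialg_arr_iff[OF bialg_free[OF Pr_typing(1)[OF B]] B]) simp
  show "nat_iso Bialg Bialg (comp_func comp_fun prim_fun) id_func ?\<epsilon>"
    unfolding nat_iso_def nat_trans_def
  proof (intro conjI ballI)
    fix B assume "B \<in> Ob Bialg"
    then obtain H h \<theta> where B: "B = bialg H h \<theta>" "is_bialg H h \<theta>" by (rule BialgE)
    show "?\<epsilon> B \<in> Hom Bialg (FOb (comp_func comp_fun prim_fun) B) (FOb id_func B)"
      using ea[OF B(2)] unfolding B(1) Hom_def by (simp add: comp_func_def comp_fun_def prim_fun_def id_func_def)
    \<comment> \<open>An isomorphism of \<open>C\<close> lifts through both Eilenberg-Moore layers,
      first to algebras, then to comodules over the lifted comonad.\<close>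
    show "iso_arr Bialg (?\<epsilon> B)"
      using ea[OF B(2)] unfolding B(1) e[OF B(2)]
      by (intro Alg.em_coalg_iso T.em_alg_iso counit_alg[OF B(2)] counit_iso[OF B(2)])
  next
    fix A assume "A \<in> Arr Bialg"
    then obtain H h \<theta> f H' h' \<theta>' where A: "A = (bialg H h \<theta>, ((H, h), f, (H', h')), bialg H' h' \<theta>')" and B: "is_bialg H h \<theta>" "is_bialg H' h' \<theta>'"
      and f: "f \<in> Arr C" "Dom C f = H" "Cod C f = H'" "f \<bullet> h = h' \<bullet> TA f" "\<theta>' \<bullet> f = GA f \<bullet> \<theta>"
      by (rule BialgArrE)
    note [simp] = bialg_typing1[OF B(1)] bialg_typing2[OF B(1)] Pr_typing[OF B(1)] bialg_typing1[OF B(2)] bialg_typing2[OF B(2)] Pr_typing[OF B(2)]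
    let ?q = "FArr prim_fun A"
    have q: "?q \<in> Arr C" "Dom C ?q = P H \<theta>" "Cod C ?q = P H' \<theta>'" "inc H' \<theta>' \<bullet> ?q = f \<bullet> inc H \<theta>"
      using prim_fun_arr[OF B f(1-3,5)] unfolding A by (simp_all add: Hom_def)
    have "(h' \<bullet> TA (inc H' \<theta>')) \<bullet> TA ?q = f \<bullet> (h \<bullet> TA (inc H \<theta>))"
    proof -
      have "TA (inc H' \<theta>') \<bullet> TA ?q = TA f \<bullet> TA (inc H \<theta>)" using arg_cong[OF q(4), of TA] q(1-3) f(1-3) by simp
      then show ?thesis using C.comp_tail[OF f(4), of "TA (inc H \<theta>)"] q(1-3) f(1-3) by simp
    qed
    then show "?\<epsilon> (Cod Bialg A) \<bullet>\<^bsub>Bialg\<^esub> FArr (comp_func comp_fun prim_fun) A = FArr id_func A \<bullet>\<^bsub>Bialg\<^esub> ?\<epsilon> (Dom Bialg A)"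
      using q by (simp add: comp_func_def id_func_def comp_fun_def) (simp add: A)
  qed
qed

end

section \<open>Isomorphisms of vector spaces and the arity filtration\<close>

lemma vmap_inv_fun:
  assumes a: "a \<in> Hom (Vect K) V W" and bij: "bij_betw (vmap_fun a) (carrier V) (carrier W)"
  shows "vmap_inv a \<in> Hom (Vect K) W V"
    and "x \<in> carrier V \<Longrightarrow> vmap_fun (vmap_inv a) (vmap_fun a x) = x"
    and "y \<in> carrier W \<Longrightarrow> vmap_fun a (vmap_fun (vmap_inv a) y) = y"
proof -
  obtain f where f: "a = (V, f, W)" "module K V" "module K W" "f \<in> lin_maps K V W" "vmap_fun a = f"
    using a by (auto simp: Vect_Hom_iff vmap_fun_def)
  interpret V: module K V by fact
  let ?g = "inv_into (carrier V) f"
  note bij' = bij[unfolded f(5)]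
  have g: "?g y \<in> carrier V" "f (?g y) = y" if "y \<in> carrier W" for y
    using bij_betw_imp_surj_on[OF bij'] that by (auto simp: inv_into_into f_inv_into_f)
  have gf: "?g (f x) = x" if "x \<in> carrier V" for x
    using bij_betw_inv_into_left[OF bij' that] .
  have "?g \<in> lin_maps K W V"
  proof (rule lin_mapsI)
    fix x y assume "x \<in> carrier W" "y \<in> carrier W"
    then have "?g (f (?g x \<oplus>\<^bsub>V\<^esub> ?g y)) = ?g (x \<oplus>\<^bsub>W\<^esub> y)" using g lin_maps_add[OF f(4)] by simp
    then show "?g (x \<oplus>\<^bsub>W\<^esub> y) = ?g x \<oplus>\<^bsub>V\<^esub> ?g y" using g \<open>x \<in> _\<close> \<open>y \<in> _\<close> gf[of "?g x \<oplus>\<^bsub>V\<^esub> ?g y"] by simp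
  next
    fix c y assume "c \<in> carrier K" "y \<in> carrier W"
    then have "?g (f (c \<odot>\<^bsub>V\<^esub> ?g y)) = ?g (c \<odot>\<^bsub>W\<^esub> y)" using g lin_maps_smult[OF f(4)] by simp
    then show "?g (c \<odot>\<^bsub>W\<^esub> y) = c \<odot>\<^bsub>V\<^esub> ?g y" using g \<open>c \<in> _\<close> \<open>y \<in> _\<close> gf[of "c \<odot>\<^bsub>V\<^esub> ?g y"] by simp
  qed (rule g)
  then show "vmap_inv a \<in> Hom (Vect K) W V" using f by (simp add: vmap_inv_def Vect_HomI)
  show "x \<in> carrier V \<Longrightarrow> vmap_fun (vmap_inv a) (vmap_fun a x) = x"
    using lin_maps_closed[OF f(4)] gf unfolding f(5) by (simp add: vmap_inv_def f(1))
  show "y \<in> carrier W \<Longrightarrow> vmap_fun a (vmap_fun (vmap_inv a) y) = y"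
    using g unfolding f(5) by (simp add: vmap_inv_def f(1))
qed

lemma Vect_iso:
  assumes a: "a \<in> Hom (Vect K) V W" and bij: "bij_betw (vmap_fun a) (carrier V) (carrier W)"
  shows "iso_arr (Vect K) a"
proof -
  note i = vmap_inv_fun[OF a bij]
  note m = Vect_Hom_module[OF a]
  have D: "Dom (Vect K) a = V" "Cod (Vect K) a = W" "a \<in> Arr (Vect K)" using a by (auto simp: Hom_def)
  have "vmap_inv a \<bullet>\<^bsub>Vect K\<^esub> a = Ide (Vect K) V"
    by (rule Vect_Hom_eqI[OF Vect_comp_Hom[OF a i(1)] Vect_Ide_Hom[OF m(1)]])
      (simp only: vmap_fun_comp[OF a i(1)] vmap_fun_Ide i(2))
  moreover have "a \<bullet>\<^bsub>Vect K\<^esub> vmap_inv a = Ide (Vect K) W"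
    by (rule Vect_Hom_eqI[OF Vect_comp_Hom[OF i(1) a] Vect_Ide_Hom[OF m(2)]])
      (simp only: vmap_fun_comp[OF i(1) a] vmap_fun_Ide i(3))
  ultimately show ?thesis using i(1) D unfolding iso_arr_def by auto
qed

text \<open>The sum of the summands of arity at most \<open>n\<close>, taken as the span of their
  generators; in this form no presented space has to be decomposed by arity.\<close>

inductive_set filt :: "'k ring \<Rightarrow> ('k, 'a) smodule \<Rightarrow> ('k, 'a) vs \<Rightarrow> nat \<Rightarrow> ('k, 'a) univ set" for K M V n where
  filt_zero: "\<zero>\<^bsub>schur K M V\<^esub> \<in> filt K M V n"
| filt_step: "c \<in> carrier K \<Longrightarrow> (\<mu>, vs) \<in> schur_gens M V \<Longrightarrow> length vs \<le> n \<Longrightarrow> y \<in> filt K M V n \<Longrightarrow>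
    c \<odot>\<^bsub>schur K M V\<^esub> schur_cls K M V (\<mu>, vs) \<oplus>\<^bsub>schur K M V\<^esub> y \<in> filt K M V n"

lemma filt_mono: "x \<in> filt K M V n \<Longrightarrow> n \<le> n' \<Longrightarrow> x \<in> filt K M V n'"
  by (induction rule: filt.induct) (auto intro: filt.intros)

context ground_ring
begin

context
  fixes M :: "('k, 'a) smodule" and V :: "('k, 'a) vs"
  assumes M: "is_smodule K M" and V: "module K V"
begin

private abbreviation "SV \<equiv> schur K M V"
private lemmas SV = schur_module[OF M V]

interpretation F: module K "schur K M V" by (rule SV)

lemma filt_closed: "x \<in> filt K M V n \<Longrightarrow> x \<in> carrier SV"
  by (induction rule: filt.induct) (auto intro: schur_cls_closed[OF M V])

lemma filt_add: "x \<in> filt K M V n \<Longrightarrow> y \<in> filt K M V n \<Longrightarrow> x \<oplus>\<^bsub>SV\<^esub> y \<in> filt K M V n"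
proof (induction rule: filt.induct)
  case filt_zero
  then show ?case using filt_closed by simp
next
  case (filt_step c \<mu> vs x)
  then show ?case
    using filt.filt_step[OF filt_step(1-3) filt_step(5)] filt_closed schur_cls_closed[OF M V filt_step(2)]
    by (simp add: F.a_assoc)
qed

lemma filt_smult: "d \<in> carrier K \<Longrightarrow> x \<in> filt K M V n \<Longrightarrow> d \<odot>\<^bsub>SV\<^esub> x \<in> filt K M V n"
proof (rotate_tac, induction rule: filt.induct)
  case filt_zero
  then show ?case by (simp add: filt.filt_zero)
next
  case (filt_step c \<mu> vs x)
  then show ?case
    using filt.filt_step[of "d \<otimes> c" K \<mu> vs M V n "d \<odot>\<^bsub>SV\<^esub> x"] filt_closed schur_cls_closed[OF M V filt_step(2)]
    by (simp add: F.smult_r_distr F.smult_assoc1)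
qed

lemma filt_gen: "(\<mu>, vs) \<in> schur_gens M V \<Longrightarrow> length vs \<le> n \<Longrightarrow> schur_cls K M V (\<mu>, vs) \<in> filt K M V n"
  using filt_step[of \<one> K \<mu> vs M V n "\<zero>\<^bsub>SV\<^esub>"] filt_zero[of K M V n] schur_cls_closed[OF M V, of "(\<mu>, vs)"]
  by (simp add: F.smult_one)

text \<open>Generators have at least one argument, so nothing but zero has degree 0. The inductions
  in \<open>unitriangular_bij\<close> start here.\<close>

lemma filt_zero_iff: "x \<in> filt K M V 0 \<Longrightarrow> x = \<zero>\<^bsub>SV\<^esub>"
  by (induction rule: filt.induct) (auto simp: schur_gens_def)

lemma filt_exhaust: "x \<in> carrier SV \<Longrightarrow> \<exists>n. x \<in> filt K M V n"
proof (induction rule: schur_induct[OF M V, consumes 1, case_names zero step])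
  case zero
  then show ?case using filt_zero by blast
next
  case (step c g y)
  obtain \<mu> vs where g: "g = (\<mu>, vs)" by (rule prod.exhaust)
  obtain n where "y \<in> filt K M V n" using step by blast
  then have "y \<in> filt K M V (max n (length vs))" by (rule filt_mono) simp
  then show ?case using step g filt_step[of c K \<mu> vs M V "max n (length vs)" y] unfolding schur_cls_def by auto
qed

lemma filt_minus: "x \<in> filt K M V n \<Longrightarrow> \<ominus>\<^bsub>SV\<^esub> x \<in> filt K M V n"
  using filt_smult[of "\<ominus> \<one>" x n] filt_closed[of x n] F.smult_l_minus[of \<one> x] by (simp add: F.smult_one)

text \<open>The difference from the identity lowers arity, hence is locally nilpotent, because the
  filtration starts at zero and exhausts the space. Both halves are inductions on the degree. The
  term \<open>length vs - 1\<close> is a true predecessor, as generators have arguments.\<close>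

lemma unitriangular_bij:
  assumes \<xi>: "\<xi> \<in> lin_maps K SV SV"
    and tri: "\<And>\<mu> vs. (\<mu>, vs) \<in> schur_gens M V \<Longrightarrow>
      \<exists>d\<in>filt K M V (length vs - 1). \<xi> (schur_cls K M V (\<mu>, vs)) = schur_cls K M V (\<mu>, vs) \<oplus>\<^bsub>SV\<^esub> d"
  shows "bij_betw \<xi> (carrier SV) (carrier SV)"
proof -
  have tri': "\<exists>d\<in>filt K M V (n - 1). \<xi> x = x \<oplus>\<^bsub>SV\<^esub> d" if "x \<in> filt K M V n" for x n
    using that
  proof (induction rule: filt.induct)
    case filt_zero
    then show ?case using lin_maps_zero[OF SV SV \<xi>] by (intro bexI[of _ "\<zero>\<^bsub>SV\<^esub>"]) (auto intro: filt.filt_zero)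
  next
    case (filt_step c \<mu> vs y)
    obtain d1 where d1: "d1 \<in> filt K M V (length vs - 1)" "\<xi> (schur_cls K M V (\<mu>, vs)) = schur_cls K M V (\<mu>, vs) \<oplus>\<^bsub>SV\<^esub> d1"
      using tri[OF filt_step(2)] by blast
    have d1': "d1 \<in> filt K M V (n - 1)" using filt_mono[OF d1(1)] filt_step(3) by simp
    obtain d2 where d2: "d2 \<in> filt K M V (n - 1)" "\<xi> y = y \<oplus>\<^bsub>SV\<^esub> d2" using filt_step by blast
    note cl = schur_cls_closed[OF M V filt_step(2)] filt_closed[OF filt_step(4)] filt_closed[OF d1'] filt_closed[OF d2(1)]
    have "\<xi> (c \<odot>\<^bsub>SV\<^esub> schur_cls K M V (\<mu>, vs) \<oplus>\<^bsub>SV\<^esub> y) =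
       (c \<odot>\<^bsub>SV\<^esub> schur_cls K M V (\<mu>, vs) \<oplus>\<^bsub>SV\<^esub> y) \<oplus>\<^bsub>SV\<^esub> (c \<odot>\<^bsub>SV\<^esub> d1 \<oplus>\<^bsub>SV\<^esub> d2)"
      using cl filt_step(1) d1 d2 by (simp add: lin_maps_add[OF \<xi>] lin_maps_smult[OF \<xi>] F.smult_r_distr F.a_ac)
    moreover have "c \<odot>\<^bsub>SV\<^esub> d1 \<oplus>\<^bsub>SV\<^esub> d2 \<in> filt K M V (n - 1)"
      by (intro filt_add filt_smult filt_step(1) d1' d2)
    ultimately show ?case by blast
  qed
  \<comment> \<open>From \<open>\<xi> x = 0\<close> it follows that \<open>x\<close> is the negative
    of an element one degree lower, so \<open>x\<close> itself descends, down to degree 0.\<close>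
  have inj: "x = \<zero>\<^bsub>SV\<^esub>" if "x \<in> filt K M V n" "\<xi> x = \<zero>\<^bsub>SV\<^esub>" for x n
    using that
  proof (induction n)
    case 0
    then show ?case by (intro filt_zero_iff)
  next
    case (Suc n)
    obtain d where d: "d \<in> filt K M V n" "x \<oplus>\<^bsub>SV\<^esub> d = \<zero>\<^bsub>SV\<^esub>" using tri'[OF Suc(2)] Suc(3) by auto
    then have "x = \<ominus>\<^bsub>SV\<^esub> d" using filt_closed[OF Suc(2)] filt_closed[OF d(1)] by (intro F.minus_equality[symmetric]) auto
    then show ?case using Suc filt_minus[OF d(1)] by simp
  qed
  \<comment> \<open>If \<open>\<xi> y\<close> is \<open>y\<close> plus a lower \<open>d\<close>, and
    \<open>x\<close> is a preimage of \<open>d\<close>, then \<open>y - x\<close> is a preimage of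
    \<open>y\<close>. Subtraction is written with the scalar -1, so that linearity of
    \<open>\<xi>\<close> applies directly.\<close>
  have surj: "\<exists>x\<in>carrier SV. \<xi> x = y" if "y \<in> filt K M V n" for y n
    using that
  proof (induction n arbitrary: y)
    case 0
    then have "y = \<zero>\<^bsub>SV\<^esub>" by (rule filt_zero_iff)
    then show ?case using lin_maps_zero[OF SV SV \<xi>] by auto
  next
    case (Suc n)
    obtain d where d: "d \<in> filt K M V n" "\<xi> y = y \<oplus>\<^bsub>SV\<^esub> d" using tri'[OF Suc(2)] by auto
    obtain x where x: "x \<in> carrier SV" "\<xi> x = d" using Suc(1)[OF d(1)] by blast
    have y: "y \<in> carrier SV" "d \<in> carrier SV" using filt_closed Suc(2) d(1) by auto
    have "\<xi> ((\<ominus> \<one>) \<odot>\<^bsub>SV\<^esub> x) = \<ominus>\<^bsub>SV\<^esub> d"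
      using x y lin_maps_smult[OF \<xi>, of "\<ominus> \<one>" x] F.smult_l_minus[of \<one> d] by (simp add: F.smult_one)
    then have "\<xi> (y \<oplus>\<^bsub>SV\<^esub> (\<ominus> \<one>) \<odot>\<^bsub>SV\<^esub> x) = y"
      using x y d(2) by (simp add: lin_maps_add[OF \<xi>] F.a_assoc F.r_neg)
    then show ?case using x y by (intro bexI[of _ "y \<oplus>\<^bsub>SV\<^esub> (\<ominus> \<one>) \<odot>\<^bsub>SV\<^esub> x"]) auto
  qed
  have "inj_on \<xi> (carrier SV)"
  proof (rule inj_onI)
    fix x y assume x: "x \<in> carrier SV" and y: "y \<in> carrier SV" and eq: "\<xi> x = \<xi> y"
    have cl: "\<xi> y \<in> carrier SV" by (rule lin_maps_closed[OF \<xi> y])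
    have "\<xi> ((\<ominus> \<one>) \<odot>\<^bsub>SV\<^esub> y) = \<ominus>\<^bsub>SV\<^esub> \<xi> y"
      using y cl lin_maps_smult[OF \<xi>, of "\<ominus> \<one>" y] F.smult_l_minus[of \<one> "\<xi> y"] by (simp add: F.smult_one)
    then have 0: "\<xi> (x \<oplus>\<^bsub>SV\<^esub> (\<ominus> \<one>) \<odot>\<^bsub>SV\<^esub> y) = \<zero>\<^bsub>SV\<^esub>"
      using x y eq cl by (simp add: lin_maps_add[OF \<xi>] F.r_neg)
    have "x \<oplus>\<^bsub>SV\<^esub> (\<ominus> \<one>) \<odot>\<^bsub>SV\<^esub> y \<in> carrier SV" using x y by simp
    then obtain n where "x \<oplus>\<^bsub>SV\<^esub> (\<ominus> \<one>) \<odot>\<^bsub>SV\<^esub> y \<in> filt K M V n" using filt_exhaust by blast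
    from inj[OF this 0] have "x \<oplus>\<^bsub>SV\<^esub> \<ominus>\<^bsub>SV\<^esub> y = \<zero>\<^bsub>SV\<^esub>" using y F.smult_l_minus[of \<one> y] by (simp add: F.smult_one)
    then show "x = y" using x y F.minus_equality[of x "\<ominus>\<^bsub>SV\<^esub> y"] by simp
  qed
  moreover have "\<xi> ` carrier SV = carrier SV"
    using surj filt_exhaust lin_maps_closed[OF \<xi>] by (auto simp: image_iff) metis
  ultimately show ?thesis by (simp add: bij_betw_def)
qed

end

lemma filt_map:
  assumes M: "is_smodule K M" "is_smodule K N" and V: "module K V" "module K W" and f: "f \<in> lin_maps K (schur K M V) (schur K N W)"
    and g: "\<And>\<mu> vs. (\<mu>, vs) \<in> schur_gens M V \<Longrightarrow> f (schur_cls K M V (\<mu>, vs)) \<in> filt K N W (length vs)"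
    and x: "x \<in> filt K M V n"
  shows "f x \<in> filt K N W n"
  using x
proof (induction rule: filt.induct)
  case filt_zero
  then show ?case using lin_maps_zero[OF schur_module schur_module f] M V by (simp add: filt.filt_zero)
next
  case (filt_step c \<mu> vs y)
  then show ?case
    using schur_cls_closed[OF M(1) V(1) filt_step(2)] filt_closed[OF M(1) V(1) filt_step(4)] filt_mono[OF g[OF filt_step(2)] filt_step(3)]
      module_smult[OF schur_module[OF M(1) V(1)] filt_step(1)]
    by (simp add: lin_maps_add[OF f] lin_maps_smult[OF f] filt_add[OF M(2) V(2)] filt_smult[OF M(2) V(2)])
qed

section \<open>The unit S-module\<close>

lemma ground_module: "module K (ground K)"
proof (rule moduleI)
  show "abelian_group (ground K)"
  proof (rule abelian_groupI)
    fix x assume "x \<in> carrier (ground K)"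
    then show "\<exists>y\<in>carrier (ground K). y \<oplus>\<^bsub>ground K\<^esub> x = \<zero>\<^bsub>ground K\<^esub>" by (auto simp: ground_def l_neg intro!: bexI[of _ "\<ominus> _"])
  qed (auto simp: ground_def a_ac)
qed (auto simp: ground_def l_distr r_distr m_assoc is_cring)

lemma sunit_smodule: "is_smodule K (sunit K)"
proof -
  have "module K ((ground K)\<lparr>carrier := {Scalar \<zero>}\<rparr>)"
    by (rule moduleI[OF is_cring abelian_groupI]) (auto simp: ground_def)
  then show ?thesis using ground_module by (auto simp: is_smodule_def sunit_def lin_maps_id)
qed

lemma sunit_one: "sp (sunit K) 1 = ground K"
  by (simp add: sunit_def)

lemma permutes_one: "\<sigma> permutes {..<Suc 0} \<Longrightarrow> \<sigma> = id"
  by (simp add: lessThan_Suc)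

lemma s_counit_smor:
  fixes M :: "('k, 'a) smodule"
  assumes M: "is_smodule K M" "sp M 1 = ground K"
  shows "smor K M (sunit K) (s_counit K)"
  unfolding smor_def
proof (intro allI impI conjI ballI)
  fix n :: nat assume n: "n > 0"
  show "s_counit K n \<in> lin_maps K (sp M n) (sp (sunit K) n)"
    using M(2) by (intro lin_mapsI) (auto simp: s_counit_def sunit_def ground_def)
  fix x \<sigma> assume x: "x \<in> carrier (sp M n)" and s: "\<sigma> permutes {..<n}"
  show "s_counit K n (act M n x \<sigma>) = act (sunit K) n (s_counit K n x) \<sigma>"
    using x s permutes_one[of \<sigma>] M(1) by (cases "n = 1") (auto simp: s_counit_def sunit_def is_smodule_def)
qed

lemma s_unit_smor:
  fixes M :: "('k, 'a) smodule"
  assumes M: "is_smodule K M" "sp M 1 = ground K"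
  shows "smor K (sunit K) M (s_unit M)"
  unfolding smor_def
proof (intro allI impI conjI ballI)
  fix n :: nat assume n: "n > 0"
  interpret Mn: module K "sp M n" by (rule smodule_module[OF M(1) n])
  show "s_unit M n \<in> lin_maps K (sp (sunit K) n) (sp M n)"
    using M(2) by (intro lin_mapsI) (auto simp: s_unit_def sunit_def)
  fix x :: "('k, 'a) univ" and \<sigma> assume x: "x \<in> carrier (sp (sunit K) n)" and s: "\<sigma> permutes {..<n}"
  have "act M n \<zero>\<^bsub>sp M n\<^esub> \<sigma> = \<zero>\<^bsub>sp M n\<^esub>"
    using lin_maps_zero[OF _ _ smodule_act_lin[OF M(1) n s]] Mn.module_axioms by blast
  then show "s_unit M n (act (sunit K) n x \<sigma>) = act M n (s_unit M n x) \<sigma>"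
    using x s permutes_one[of \<sigma>] M by (cases "n = 1") (auto simp: s_unit_def sunit_def is_smodule_def)
qed

context
  fixes M :: "('k, 'a) smodule" assumes M: "is_smodule K M"
begin

private abbreviation "U n \<equiv> map (\<lambda>i. Labelled (Scalar \<one>) [i]) [0..<n] :: ('k, 'a) univ list"

lemma sunit_block:
  "s \<in> carrier K \<Longrightarrow> Labelled (Scalar s) [i] \<in> {Labelled \<nu> l |\<nu> l. l \<noteq> [] \<and> \<nu> \<in> carrier (sp (sunit K :: ('k, 'a) smodule) (length l))}"
  by (intro CollectI exI[of _ "Scalar s"] exI[of _ "[i]"]) (simp add: sunit_def ground_def)

lemma runit_gens: "n > 0 \<Longrightarrow> \<mu> \<in> carrier (sp M n) \<Longrightarrow> (\<mu>, U n) \<in> circ_gens M (sunit K) n"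
proof -
  assume *: "n > 0" "\<mu> \<in> carrier (sp M n)"
  note sunit_block[OF one_closed]
  moreover have "concat (map labels_of (U n)) = [0..<n]" by (simp add: comp_def)
  ultimately show ?thesis using * by (simp add: circ_gens_iff image_subset_iff)
qed

lemma runit_inv_lin:
  assumes "n > 0"
  shows "runit_inv K M n \<in> lin_maps K (sp M n) (circ_sp K M (sunit K) n)"
proof (cases "carrier (sp M n) = {}")
  case True
  then show ?thesis by (auto intro: lin_mapsI)
next
  case False
  then obtain \<mu> where "\<mu> \<in> carrier (sp M n)" by auto
  from circ_hom_op[OF circ_cls_hom[OF M sunit_smodule] runit_gens[OF assms this]]
  show ?thesis by (simp add: runit_inv_def[abs_def])
qed

text \<open>\<open>runit\<close> is a set-theoretic inverse of \<open>runit_inv\<close>, and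
  surjectivity makes it a section. A generator with a block of several labels vanishes, because the
  unit S-module is zero there. Otherwise every block is a scalar on one label; the scalars are
  pulled out and the order of the labels is absorbed into the operation by outer balance.\<close>

lemma runit_inv_surj:
  assumes n: "n > 0" and x: "x \<in> carrier (circ_sp K M (sunit K) n)"
  shows "\<exists>\<mu>\<in>carrier (sp M n). x = runit_inv K M n \<mu>"
  using x
proof (induction rule: circ_induct[OF M sunit_smodule, consumes 1, case_names zero step])
  case zero
  show ?case using lin_maps_zero[OF smodule_module[OF M n] circ_module[OF M sunit_smodule] runit_inv_lin[OF n]]
      abelian_monoid.zero_closed[OF abelian_group.axioms(1)[OF module.axioms(2)[OF smodule_module[OF M n]]]] by metis
next
  case (step c g y)
  interpret W: module K "circ_sp K M (sunit K) n" by (rule circ_module[OF M sunit_smodule])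
  obtain \<mu> ps where g: "g = (\<mu>, ps)" by (rule prod.exhaust)
  note G = step(2)[unfolded g]
  note D = circ_gensD[OF G]
  note hom = circ_cls_hom[OF M sunit_smodule, of n]
  have gen: "\<exists>\<mu>'\<in>carrier (sp M n). circ_cls K M (sunit K) n (\<mu>, ps) = runit_inv K M n \<mu>'"
  proof (cases "\<forall>p\<in>set ps. length (labels_of p) = 1")
    case False
    then obtain p where "p \<in> set ps" "length (labels_of p) \<noteq> 1" by blast
    then obtain i where i: "i < length ps" "length (labels_of (ps ! i)) \<noteq> 1" by (auto simp: in_set_conv_nth)
    let ?l = "labels_of (ps ! i)"
    note Di = D(6)[OF nth_mem[OF i(1)]]
    have l: "ps ! i = Labelled (op_of (ps ! i)) ?l" "op_of (ps ! i) = Scalar \<zero>" using Di i by (auto simp: sunit_def)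
    have z: "\<zero>\<^bsub>sp (sunit K) (length ?l)\<^esub> = Scalar \<zero>" using i by (simp add: sunit_def ground_def)
    have "length ?l > 0" using Di by simp
    from lin_maps_zero[OF smodule_module[OF sunit_smodule this] W.module_axioms circ_hom_arg[OF hom G i(1) l(1)]]
    have "circ_cls K M (sunit K) n (\<mu>, ps[i := Labelled (Scalar \<zero>) ?l]) = \<zero>\<^bsub>circ_sp K M (sunit K) n\<^esub>"
      unfolding z .
    moreover have "ps[i := Labelled (Scalar \<zero>) ?l] = ps" using l by (metis list_update_id)
    ultimately show ?thesis
      using lin_maps_zero[OF smodule_module[OF M n] W.module_axioms runit_inv_lin[OF n]]
      abelian_monoid.zero_closed[OF abelian_group.axioms(1)[OF module.axioms(2)[OF smodule_module[OF M n]]]] by metis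
  next
    case True
    have one: "p = Labelled (Scalar (scalar_of (op_of p))) [hd (labels_of p)] \<and> scalar_of (op_of p) \<in> carrier K" if "p \<in> set ps" for p
    proof -
      have "length (labels_of p) = Suc 0" using True that by simp
      then obtain j where j: "labels_of p = [j]" by (cases "labels_of p") auto
      then show ?thesis using D(6)[OF that] by (auto simp: sunit_def ground_def)
    qed
    have len: "length ps = n"
    proof -
      have "map length (map labels_of ps) = map (\<lambda>_. 1) ps" using True by simp
      then have "sum_list (map length (map labels_of ps)) = length ps" by (simp only: sum_list_triv) simp
      then show ?thesis using D(3) by (simp add: length_concat)
    qed
    \<comment> \<open>The word of the labels, continued by the identity beyond \<open>n\<close>, as
      \<open>permutes\<close> demands.\<close>
    define w where "w i = (if i < n then hd (labels_of (ps ! i)) else i)" for i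
    have cat: "concat (map labels_of ps) = map w [0..<n]"
    proof -
      have "labels_of p = [hd (labels_of p)]" if "p \<in> set ps" for p
      proof -
        have "length (labels_of p) = Suc 0" using True that by simp
        then show ?thesis by (cases "labels_of p") auto
      qed
      then have "map labels_of ps = map (\<lambda>p. [hd (labels_of p)]) ps" by (intro map_cong) auto
      then have "concat (map labels_of ps) = map (\<lambda>p. hd (labels_of p)) ps" by (simp only: concat_map_singleton)
      also have "\<dots> = map w [0..<n]" using len by (intro nth_equalityI) (auto simp: w_def)
      finally show ?thesis .
    qed
    have "bij_betw w {..<n} {..<n}"
      using D(4,5) unfolding cat by (auto simp: bij_betw_def distinct_map lessThan_atLeast0)
    then have w: "w permutes {..<n}" by (intro bij_imp_permutes) (auto simp: w_def)
    have iw: "Hilbert_Choice.inv w permutes {..<length (U n)}" using permutes_inv[OF w] by simp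
    note mu = D(2)[unfolded len]
    \<comment> \<open>Blocks with prescribed scalars on the labels of \<open>w\<close>. In
      \<open>main\<close> the list \<open>ss\<close> is padded with ones, so that each step of the
      induction turns one scalar into a coefficient in front.\<close>
    let ?P = "\<lambda>ss. map2 (\<lambda>s i. Labelled (Scalar s) [w i]) ss [0..<n] :: ('k, 'a) univ list"
    have main: "\<exists>\<mu>'\<in>carrier (sp M n). circ_cls K M (sunit K) n (\<mu>, ?P (ss @ replicate (n - length ss) \<one>)) = runit_inv K M n \<mu>'"
      if "length ss \<le> n" "set ss \<subseteq> carrier K" for ss
      using that
    proof (induction ss rule: rev_induct)
      case Nil
      \<comment> \<open>With all scalars equal to 1 the blocks are those of \<open>runit_inv\<close>
        in another order, and outer balance moves the permutation to \<open>\<mu>\<close>.\<close>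
      have "lperm (Hilbert_Choice.inv w) (U n) = ?P (replicate n \<one>)"
        using iw permutes_inv_inv[OF w] permutes_in_image[OF w] by (intro nth_equalityI) (auto simp: nth_lperm)
      then have "circ_cls K M (sunit K) n (\<mu>, ?P (replicate n \<one>)) = runit_inv K M n (act M n \<mu> (Hilbert_Choice.inv w))"
        using circ_hom_outer[OF hom runit_gens[OF n mu] iw] by (simp add: runit_inv_def)
      then show ?case using smodule_act_closed[OF M n permutes_inv[OF w] mu] by auto
    next
      case (snoc s ss)
      let ?q = "?P (ss @ replicate (n - length ss) \<one>)" and ?j = "length ss"
      have j: "?j < n" using snoc by simp
      have nthq: "?P ts ! k = Labelled (Scalar (ts ! k)) [w k]" if "k < n" "length ts = n" for k ts using that by simp
      have "set (?P ts) \<subseteq> {Labelled \<nu> l |\<nu> l. l \<noteq> [] \<and> \<nu> \<in> carrier (sp (sunit K) (length l))}" if ts: "set ts \<subseteq> carrier K" "length ts = n" for ts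
      proof
        fix p assume "p \<in> set (?P ts)"
        then obtain k where "k < n" "p = ?P ts ! k" using ts by (auto simp: in_set_conv_nth)
        then have "p = Labelled (Scalar (ts ! k)) [w k]" "ts ! k \<in> carrier K" using ts nthq by (auto simp: subset_iff)
        then show "p \<in> {Labelled \<nu> l |\<nu> l. l \<noteq> [] \<and> \<nu> \<in> carrier (sp (sunit K :: ('k, 'a) smodule) (length l))}"
          by (simp only: sunit_block)
      qed
      moreover have "concat (map labels_of (?P ts)) = map w [0..<n]" if "length ts = n" for ts :: "'k list"
      proof -
        have "map labels_of (?P ts) = map (\<lambda>i. [w i]) [0..<n]" using that by (intro nth_equalityI) auto
        then show ?thesis by simp
      qed
      ultimately have Pg: "(\<mu>, ?P ts) \<in> circ_gens M (sunit K) n" if "set ts \<subseteq> carrier K" "length ts = n" for ts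
        using G n that mu unfolding circ_gens_iff cat by (auto simp: len)
      have qg: "(\<mu>, ?q) \<in> circ_gens M (sunit K) n" using snoc by (intro Pg) auto
      have nj: "?q ! ?j = Labelled (Scalar \<one>) [w ?j]" using j by (subst nthq) (auto simp: nth_append)
      have up: "?P ((ss @ [s]) @ replicate (n - length (ss @ [s])) \<one>) = ?q[?j := Labelled (Scalar s) [w ?j]]"
        using j by (intro nth_equalityI) (auto simp: nth_list_update nth_append nthq)
      have l: "(\<lambda>\<nu>'. circ_cls K M (sunit K) n (\<mu>, ?q[?j := Labelled \<nu>' [w ?j]])) \<in> lin_maps K (ground K) (circ_sp K M (sunit K) n)"
        using circ_hom_arg[OF hom qg _ nj] j by (simp add: sunit_one[simplified])
      have s: "s \<in> carrier K" "Scalar s = s \<odot>\<^bsub>ground K\<^esub> Scalar \<one>" using snoc by (auto simp: ground_def)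
      have "circ_cls K M (sunit K) n (\<mu>, ?q[?j := Labelled (Scalar s) [w ?j]]) = s \<odot>\<^bsub>circ_sp K M (sunit K) n\<^esub> circ_cls K M (sunit K) n (\<mu>, ?q[?j := Labelled (Scalar \<one>) [w ?j]])"
        using lin_maps_smult[OF l s(1), of "Scalar \<one>"] s(2) by (simp add: ground_def)
      also have "?q[?j := Labelled (Scalar \<one>) [w ?j]] = ?q" using nj by (metis list_update_id)
      finally have e: "circ_cls K M (sunit K) n (\<mu>, ?P ((ss @ [s]) @ replicate (n - length (ss @ [s])) \<one>)) = s \<odot>\<^bsub>circ_sp K M (sunit K) n\<^esub> circ_cls K M (sunit K) n (\<mu>, ?q)"
        unfolding up .
      obtain \<mu>' where "\<mu>' \<in> carrier (sp M n)" "circ_cls K M (sunit K) n (\<mu>, ?q) = runit_inv K M n \<mu>'" using snoc by auto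
      then show ?case unfolding e
        using lin_maps_smult[OF runit_inv_lin[OF n] s(1), of \<mu>'] module_smult[OF smodule_module[OF M n] s(1), of \<mu>'] by metis
    qed
    have "?P (map (\<lambda>p. scalar_of (op_of p)) ps) = ps"
      using len one by (intro nth_equalityI) (auto simp: w_def)
    then show ?thesis using main[of "map (\<lambda>p. scalar_of (op_of p)) ps"] len one by auto
  qed
  then obtain \<mu>' where m': "\<mu>' \<in> carrier (sp M n)" "circ_cls K M (sunit K) n g = runit_inv K M n \<mu>'" unfolding g by blast
  obtain \<mu>'' where m'': "\<mu>'' \<in> carrier (sp M n)" "y = runit_inv K M n \<mu>''" using step by blast
  note Mn = smodule_module[OF M n]
  have "c \<odot>\<^bsub>circ_sp K M (sunit K) n\<^esub> circ_cls K M (sunit K) n g \<oplus>\<^bsub>circ_sp K M (sunit K) n\<^esub> y = runit_inv K M n (c \<odot>\<^bsub>sp M n\<^esub> \<mu>' \<oplus>\<^bsub>sp M n\<^esub> \<mu>'')"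
    using m' m'' step(1) lin_maps_add[OF runit_inv_lin[OF n]] lin_maps_smult[OF runit_inv_lin[OF n]] module_smult[OF Mn] by simp
  then show ?case using m' m'' step(1) module_add[OF Mn] module_smult[OF Mn] by metis
qed

lemma runit_inv_runit:
  assumes "n > 0" "x \<in> carrier (circ_sp K M (sunit K) n)"
  shows "runit_inv K M n (runit K M n x) = x" "runit K M n x \<in> carrier (sp M n)"
proof -
  have "x \<in> runit_inv K M n ` carrier (sp M n)" using runit_inv_surj[OF assms] by auto
  then show "runit_inv K M n (runit K M n x) = x" "runit K M n x \<in> carrier (sp M n)"
    by (simp_all add: runit_def f_inv_into_f inv_into_into)
qed

text \<open>Through the plethysm with the unit S-module the arguments of a generator get wrapped by
  the unit; this is how unit identities between S-modules reach the Schur functors.\<close>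

lemma schur_circ_runit_inv:
  assumes V: "module K V" and g: "(\<mu>, vs) \<in> schur_gens M V"
  shows "vmap_fun (schur_circ K M (sunit K) V) (schur_cls K (circ K M (sunit K)) V (runit_inv K M (length vs) \<mu>, vs)) =
      schur_cls K M (schur K (sunit K) V) (\<mu>, map (vmap_fun (schur_unit K (sunit K) V)) vs)"
proof -
  note D = schur_gensD[OF g]
  have "map (\<lambda>p. schur_cls K (sunit K) V (arg_of vs p)) (U (length vs)) = map (vmap_fun (schur_unit K (sunit K) V)) vs"
    using D schur_unit_fun(2)[OF sunit_smodule sunit_one V]
    by (intro nth_equalityI) (auto simp: arg_of_def subset_iff)
  then show ?thesis
    using schur_circ_fun(2)[OF M sunit_smodule V _ runit_gens[of "length vs" \<mu>]] D unfolding runit_inv_def by simp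
qed

end

end

section \<open>Operads and cooperads\<close>

lemma smor_comp: "smor K M N f \<Longrightarrow> smor K N P g \<Longrightarrow> smor K M P (g \<cdot>\<^sub>s f)"
proof -
  assume f: "smor K M N f" and g: "smor K N P g"
  have "(g \<cdot>\<^sub>s f) n = (\<lambda>x. g n (f n x))" for n by (simp add: fun_eq_iff scomp_def)
  then show ?thesis
    using lin_maps_compose[OF smor_lin[OF f] smor_lin[OF g]] smor_act[OF f] smor_act[OF g] smor_closed[OF f]
    by (simp add: smor_def)
qed

lemma smor_sid:
  fixes M :: "('k, 'a) smodule"
  shows "smor K M M sid"
proof -
  have "(sid :: ('k, 'a) smap) n = (\<lambda>x. x)" for n by (simp add: fun_eq_iff sid_def)
  then show "smor K M M (sid :: ('k, 'a) smap)" by (simp add: smor_def lin_maps_id)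
qed

text \<open>Each nonempty block contributes at least one label, so blocks and labels are equal in
  number only when all blocks are singletons. This decides whether a summand of \<open>C o A\<close>
  lowers the arity.\<close>

lemma concat_ones:
  assumes "\<And>x. x \<in> set xs \<Longrightarrow> f x \<noteq> []"
  shows "length xs \<le> length (concat (map f xs))"
    and "length xs = length (concat (map f xs)) \<Longrightarrow> x \<in> set xs \<Longrightarrow> length (f x) = 1"
    and "\<forall>x\<in>set xs. length (f x) = 1 \<Longrightarrow> length xs = length (concat (map f xs))"
proof -
  have "length xs \<le> length (concat (map f xs)) \<and> (length xs = length (concat (map f xs)) \<longrightarrow> (\<forall>x\<in>set xs. length (f x) = 1))
    \<and> ((\<forall>x\<in>set xs. length (f x) = 1) \<longrightarrow> length xs = length (concat (map f xs)))"
    using assms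
  proof (induction xs)
    case (Cons x xs)
    have "length (f x) \<ge> 1" using Cons.prems[of x] by (cases "f x") auto
    then show ?case using Cons by auto
  qed simp
  then show "length xs \<le> length (concat (map f xs))"
    and "length xs = length (concat (map f xs)) \<Longrightarrow> x \<in> set xs \<Longrightarrow> length (f x) = 1"
    and "\<forall>x\<in>set xs. length (f x) = 1 \<Longrightarrow> length xs = length (concat (map f xs))" by blast+
qed

context ground_ring
begin

lemma schur_cls_zero_arg:
  assumes M: "is_smodule K M" and V: "module K V" and g: "(\<mu>, vs) \<in> schur_gens M V" and z: "\<zero>\<^bsub>V\<^esub> \<in> set vs"
  shows "schur_cls K M V (\<mu>, vs) = \<zero>\<^bsub>schur K M V\<^esub>"
proof -
  note D = schur_gensD[OF g]
  obtain i where i: "i < length vs" "vs ! i = \<zero>\<^bsub>V\<^esub>" using z by (auto simp: in_set_conv_nth)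
  have ml: "mlin K (length vs) V (schur K M V) (\<lambda>vs. schur_cls K M V (\<mu>, vs))"
    by (rule schur_hom_mlin[OF schur_cls_hom[OF M V]]) (use D in auto)
  have "(\<lambda>y. schur_cls K M V (\<mu>, vs[i := y])) \<in> lin_maps K V (schur K M V)"
    by (rule mlin_arg_lin[OF ml]) (use D i in auto)
  from lin_maps_zero[OF V schur_module[OF M V] this] show ?thesis using i by (metis list_update_id)
qed

lemma schur_unit_scalar:
  assumes M: "is_smodule K M" "sp M 1 = ground K" and V: "module K V" and g: "(\<mu>, [v]) \<in> schur_gens M V"
  shows "scalar_of \<mu> \<in> carrier K \<and> schur_cls K M V (\<mu>, [v]) = scalar_of \<mu> \<odot>\<^bsub>schur K M V\<^esub> vmap_fun (schur_unit K M V) v"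
proof -
  have v: "v \<in> carrier V" "\<mu> \<in> carrier (sp M 1)" using schur_gensD[OF g] by auto
  then have s: "scalar_of \<mu> \<in> carrier K" "\<mu> = scalar_of \<mu> \<odot>\<^bsub>sp M 1\<^esub> Scalar \<one>" "Scalar \<one> \<in> carrier (sp M 1)"
    unfolding M(2) by (auto simp: ground_def)
  have "(\<lambda>\<mu>. schur_cls K M V (\<mu>, [v])) \<in> lin_maps K (sp M 1) (schur K M V)"
    using schur_hom_lin[OF schur_cls_hom[OF M(1) V], of "[v]"] v by simp
  from lin_maps_smult[OF this s(1,3)] s(1,2) show ?thesis using schur_unit_fun(2)[OF M V v(1)] by simp
qed

lemma schur_nat_comp_fun:
  assumes M: "is_smodule K M" "is_smodule K N" "is_smodule K P" and f: "smor K M N f" and g: "smor K N P g" and V: "module K V"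
    and x: "x \<in> carrier (schur K M V)"
  shows "vmap_fun (schur_nat K N P g V) (vmap_fun (schur_nat K M N f V) x) = vmap_fun (schur_nat K M P (g \<cdot>\<^sub>s f) V) x"
proof -
  note F = schur_nat_fun[OF M(1,2) f V] and G = schur_nat_fun[OF M(2,3) g V] and H = schur_nat_fun[OF M(1,3) smor_comp[OF f g] V]
  show ?thesis
    by (rule schur_lin_maps_eqI[OF M(1) V schur_module[OF M(3) V] lin_maps_compose[OF Vect_Hom_lin[OF F(1)] Vect_Hom_lin[OF G(1)]] Vect_Hom_lin[OF H(1)] _ x])
      (simp add: F(2) H(2) G(2)[OF smor_gens[OF f]] scomp_def)
qed

lemma schur_nat_smor_eq:
  assumes M: "is_smodule K M" and f: "smor K M M f" and eq: "smor_eq M f sid" and V: "module K V" and x: "x \<in> carrier (schur K M V)"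
  shows "vmap_fun (schur_nat K M M f V) x = x"
proof -
  note F = schur_nat_fun[OF M M f V]
  show ?thesis
    by (rule schur_lin_maps_eqI[OF M V schur_module[OF M V] Vect_Hom_lin[OF F(1)] lin_maps_id _ x])
      (use eq in \<open>auto simp: F(2) smor_eq_def sid_def dest!: schur_gensD intro: schur_gensI\<close>)
qed

context
  fixes A :: "('k, 'a) smodule" and \<gamma> :: "('k, 'a) smap"
  assumes A: "is_smodule K A" "sp A 1 = ground K" and \<gamma>: "smor K (circ K A A) A \<gamma>"
begin

private lemmas AA = circ_smodule[OF A(1) A(1)]

text \<open>The product is defined with the inverse of \<open>schur_circ\<close>. As
  \<open>schur_circ\<close> is onto, knowing the product on its image suffices, and the inverse need
  not be unfolded again.\<close>

lemma operad_mult_fun: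
  assumes V: "module K V"
  shows "operad_mult K A \<gamma> V \<in> Hom (Vect K) (schur K A (schur K A V)) (schur K A V)"
    and "z \<in> carrier (schur K (circ K A A) V) \<Longrightarrow>
      vmap_fun (operad_mult K A \<gamma> V) (vmap_fun (schur_circ K A A V) z) = vmap_fun (schur_nat K (circ K A A) A \<gamma> V) z"
proof -
  note c = schur_circ_fun(1)[OF A(1) A(1) V]
  note i = vmap_inv_fun[OF c schur_circ_bij[OF A(1) A(1) V]]
  note n = schur_nat_fun(1)[OF AA A(1) \<gamma> V]
  show "operad_mult K A \<gamma> V \<in> Hom (Vect K) (schur K A (schur K A V)) (schur K A V)"
    unfolding operad_mult_def by (rule Vect_comp_Hom[OF i(1) n])
  show "z \<in> carrier (schur K (circ K A A) V) \<Longrightarrow>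
      vmap_fun (operad_mult K A \<gamma> V) (vmap_fun (schur_circ K A A V) z) = vmap_fun (schur_nat K (circ K A A) A \<gamma> V) z"
    unfolding operad_mult_def by (simp add: vmap_fun_comp[OF i(1) n] Vect_Hom_closed[OF c] i(2))
qed

lemma operad_mult_nat:
  "nat_trans (Vect K) (Vect K) (comp_func (schur_func K A) (schur_func K A)) (schur_func K A) (operad_mult K A \<gamma>)"
proof (rule nat_transI)
  fix V W :: "('k, 'a) vs" and a assume a: "a \<in> Hom (Vect K) V W"
  note V = Vect_Hom_module(1)[OF a] and W = Vect_Hom_module(2)[OF a]
  note F = schur_map_fun(1)[OF A(1) a]
  note FF = schur_map_fun(1)[OF A(1) F] and FAA = schur_map_fun(1)[OF AA a]
  note cV = schur_circ_fun(1)[OF A(1) A(1) V] and cW = schur_circ_fun(1)[OF A(1) A(1) W]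
  note nV = schur_nat_fun(1)[OF AA A(1) \<gamma> V] and nW = schur_nat_fun(1)[OF AA A(1) \<gamma> W]
  note mV = operad_mult_fun[OF V] and mW = operad_mult_fun[OF W]
  have "operad_mult K A \<gamma> W \<bullet>\<^bsub>Vect K\<^esub> schur_map K A (schur_map K A a) = schur_map K A a \<bullet>\<^bsub>Vect K\<^esub> operad_mult K A \<gamma> V"
  proof (rule Vect_Hom_eqI[OF Vect_comp_Hom[OF FF mW(1)] Vect_comp_Hom[OF mV(1) F]])
    fix y assume y: "y \<in> carrier (schur K A (schur K A V))"
    then obtain z where z: "z \<in> carrier (schur K (circ K A A) V)" "y = vmap_fun (schur_circ K A A V) z"
      using bij_betw_imp_surj_on[OF schur_circ_bij[OF A(1) A(1) V]] by (auto simp: image_iff)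
    have e1: "vmap_fun (schur_map K A (schur_map K A a)) y = vmap_fun (schur_circ K A A W) (vmap_fun (schur_map K (circ K A A) a) z)"
      using arg_cong[OF schur_circ_natural[OF A(1) A(1) a], of "\<lambda>f. vmap_fun f z"] z
      by (simp add: vmap_fun_comp[OF FAA cW] vmap_fun_comp[OF cV FF])
    have e2: "vmap_fun (schur_nat K (circ K A A) A \<gamma> W) (vmap_fun (schur_map K (circ K A A) a) z) =
        vmap_fun (schur_map K A a) (vmap_fun (schur_nat K (circ K A A) A \<gamma> V) z)"
    proof -
      have "schur_nat K (circ K A A) A \<gamma> W \<bullet>\<^bsub>Vect K\<^esub> schur_map K (circ K A A) a = schur_map K A a \<bullet>\<^bsub>Vect K\<^esub> schur_nat K (circ K A A) A \<gamma> V"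
        using schur_nat_trans[OF AA A(1) \<gamma>] a by (auto simp: nat_trans_def schur_func_def Hom_def)
      from arg_cong[OF this, of "\<lambda>f. vmap_fun f z"] z(1) show ?thesis
        by (simp add: vmap_fun_comp[OF FAA nW] vmap_fun_comp[OF nV F])
    qed
    show "vmap_fun (operad_mult K A \<gamma> W \<bullet>\<^bsub>Vect K\<^esub> schur_map K A (schur_map K A a)) y = vmap_fun (schur_map K A a \<bullet>\<^bsub>Vect K\<^esub> operad_mult K A \<gamma> V) y"
      unfolding vmap_fun_comp[OF FF mW(1) y] vmap_fun_comp[OF mV(1) F y] e1 mW(2)[OF Vect_Hom_closed[OF FAA z(1)]] e2
      unfolding z(2) mV(2)[OF z(1)] ..
  qed
  then show "operad_mult K A \<gamma> W \<bullet>\<^bsub>Vect K\<^esub> FArr (comp_func (schur_func K A) (schur_func K A)) a = FArr (schur_func K A) a \<bullet>\<^bsub>Vect K\<^esub> operad_mult K A \<gamma> V"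
    by (simp add: comp_func_def schur_func_def)
qed (simp add: comp_func_def schur_func_def operad_mult_fun)

text \<open>The right unit axiom of the operad, transported through the plethysm of \<open>A\<close>
  with the unit S-module: \<open>T e\<close> factors over \<open>runit_inv\<close> and
  \<open>s_unit\<close>, so that \<open>\<gamma>\<close> meets exactly the composite of the
  axiom.\<close>

lemma operad_mult_map_unit:
  assumes u: "smor_eq A (\<gamma> \<cdot>\<^sub>s circ_map K A A sid (s_unit A) \<cdot>\<^sub>s runit_inv K A) sid" and V: "module K V"
  shows "operad_mult K A \<gamma> V \<bullet>\<^bsub>Vect K\<^esub> schur_map K A (schur_unit K A V) = Ide (Vect K) (schur K A V)"
proof -
  note e = schur_unit_fun[OF A V] and e1 = schur_unit_fun[OF sunit_smodule sunit_one V]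
  note Te = schur_map_fun[OF A(1) e(1)] and m = operad_mult_fun[OF V]
  note su = s_unit_smor[OF A] and A1 = circ_smodule[OF A(1) sunit_smodule]
  note ns = schur_nat_fun[OF sunit_smodule A(1) su V]
  note Tns = schur_map_fun[OF A(1) ns(1)]
  note id = smor_sid[of K A]
  note cm = circ_map_smor[OF A(1) A(1) sunit_smodule A(1) id su]
  note ncm = schur_nat_fun[OF A1 AA cm V]
  show ?thesis
  proof (rule schur_Hom_eqI[OF A(1) V Vect_comp_Hom[OF Te(1) m(1)] Vect_Ide_Hom[OF schur_module[OF A(1) V]]])
    fix \<mu> vs assume g: "(\<mu>, vs) \<in> schur_gens A V"
    note D = schur_gensD[OF g]
    have cl: "schur_cls K A V (\<mu>, vs) \<in> carrier (schur K A V)" by (rule schur_cls_closed[OF A(1) V g])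
    have g1: "(\<mu>, map (vmap_fun (schur_unit K (sunit K) V)) vs) \<in> schur_gens A (schur K (sunit K) V)"
      by (rule lin_gens[OF Vect_Hom_lin[OF e1(1)] g])
    have r: "runit_inv K A (length vs) \<mu> \<in> carrier (circ_sp K A (sunit K) (length vs))"
      using lin_maps_closed[OF runit_inv_lin[OF A(1)]] D by blast
    have rg: "(runit_inv K A (length vs) \<mu>, vs) \<in> schur_gens (circ K A (sunit K)) V"
      using r D by (intro schur_gensI) (auto simp: sp_circ[OF A(1) sunit_smodule])
    let ?x = "schur_cls K (circ K A (sunit K)) V (runit_inv K A (length vs) \<mu>, vs)"
    have x: "?x \<in> carrier (schur K (circ K A (sunit K)) V)" by (rule schur_cls_closed[OF A1 V rg])
    have "vmap_fun (schur_nat K (sunit K) A (s_unit A) V) (vmap_fun (schur_unit K (sunit K) V) v) = vmap_fun (schur_unit K A V) v"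
      if "v \<in> carrier V" for v
    proof -
      have "(Scalar \<one>, [v]) \<in> schur_gens (sunit K) V" using that by (auto simp: schur_gens_def sunit_def ground_def)
      then show ?thesis using ns(2) that by (simp add: e1(2) e(2) s_unit_def)
    qed
    then have "map (vmap_fun (schur_unit K A V)) vs = map (vmap_fun (schur_nat K (sunit K) A (s_unit A) V)) (map (vmap_fun (schur_unit K (sunit K) V)) vs)"
      using D by (auto simp: subset_iff)
    then have "vmap_fun (schur_map K A (schur_unit K A V)) (schur_cls K A V (\<mu>, vs)) =
        vmap_fun (schur_map K A (schur_nat K (sunit K) A (s_unit A) V)) (schur_cls K A (schur K (sunit K) V) (\<mu>, map (vmap_fun (schur_unit K (sunit K) V)) vs))"
      using Te(2)[OF g] Tns(2)[OF g1] by (simp del: map_map map_eq_conv)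
    also have "\<dots> = vmap_fun (schur_map K A (schur_nat K (sunit K) A (s_unit A) V)) (vmap_fun (schur_circ K A (sunit K) V) ?x)"
      unfolding schur_circ_runit_inv[OF A(1) V g] ..
    also have "\<dots> = vmap_fun (schur_circ K A A V) (vmap_fun (schur_nat K (circ K A (sunit K)) (circ K A A) (circ_map K A A sid (s_unit A)) V) ?x)"
      by (rule schur_circ_inner_natural[OF A(1) sunit_smodule A(1) su V x, symmetric])
    finally have "vmap_fun (operad_mult K A \<gamma> V) (vmap_fun (schur_map K A (schur_unit K A V)) (schur_cls K A V (\<mu>, vs))) =
        vmap_fun (schur_nat K (circ K A A) A \<gamma> V) (vmap_fun (schur_nat K (circ K A (sunit K)) (circ K A A) (circ_map K A A sid (s_unit A)) V) ?x)"
      using m(2)[OF Vect_Hom_closed[OF ncm(1) x]] by simp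
    also have "\<dots> = schur_cls K A V (\<gamma> (length vs) (circ_map K A A sid (s_unit A) (length vs) (runit_inv K A (length vs) \<mu>)), vs)"
      using ncm(2)[OF rg] schur_nat_fun(2)[OF AA A(1) \<gamma> V smor_gens[OF cm rg]] by simp
    also have "\<dots> = schur_cls K A V (\<mu>, vs)"
      using u D by (auto simp: smor_eq_def scomp_def sid_def)
    finally show "vmap_fun (operad_mult K A \<gamma> V \<bullet>\<^bsub>Vect K\<^esub> schur_map K A (schur_unit K A V)) (schur_cls K A V (\<mu>, vs)) =
        vmap_fun (Ide (Vect K) (schur K A V)) (schur_cls K A V (\<mu>, vs))"
      by (simp only: vmap_fun_comp[OF Te(1) m(1) cl] vmap_fun_Ide[OF cl])
  qed
qed

end

lemma circ_nat_trans:
  fixes C M N :: "('k, 'a) smodule"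
  assumes C: "is_smodule K C" and M: "is_smodule K M" "is_smodule K N" and f: "smor K C (circ K M N) f"
  shows "nat_trans (Vect K) (Vect K) (schur_func K C) (comp_func (schur_func K M) (schur_func K N))
    (\<lambda>V. schur_circ K M N V \<bullet>\<^bsub>Vect K\<^esub> schur_nat K C (circ K M N) f V)"
proof (rule nat_transI)
  note MN = circ_smodule[OF M]
  note H = Vect_comp_Hom[OF schur_nat_fun(1)[OF C MN f] schur_circ_fun(1)[OF M]]
  show "schur_circ K M N V \<bullet>\<^bsub>Vect K\<^esub> schur_nat K C (circ K M N) f V \<in> Hom (Vect K) (FOb (schur_func K C) V) (FOb (comp_func (schur_func K M) (schur_func K N)) V)"
    if "module K V" for V :: "('k, 'a) vs"
    using H[OF that that] by (simp add: comp_func_def schur_func_def)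
  fix V W :: "('k, 'a) vs" and a assume a: "a \<in> Hom (Vect K) V W"
  note V = Vect_Hom_module(1)[OF a] and W = Vect_Hom_module(2)[OF a]
  interpret Ve: category_loc "Vect K :: (('k, 'a) vs, ('k, 'a) vmap) category" by unfold_locales (rule Vect_category)
  have 1: "schur_nat K C (circ K M N) f W \<bullet>\<^bsub>Vect K\<^esub> schur_map K C a = schur_map K (circ K M N) a \<bullet>\<^bsub>Vect K\<^esub> schur_nat K C (circ K M N) f V"
    using schur_nat_trans[OF C MN f] a by (auto simp: nat_trans_def schur_func_def Hom_def)
  note h = schur_nat_fun(1)[OF C MN f V] schur_nat_fun(1)[OF C MN f W] schur_circ_fun(1)[OF M V] schur_circ_fun(1)[OF M W]
     schur_map_fun(1)[OF C a] schur_map_fun(1)[OF MN a] schur_map_fun(1)[OF M(1) schur_map_fun(1)[OF M(2) a]]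
  note h' = h[unfolded Hom_def mem_Collect_eq]
  have "(schur_circ K M N W \<bullet>\<^bsub>Vect K\<^esub> schur_nat K C (circ K M N) f W) \<bullet>\<^bsub>Vect K\<^esub> schur_map K C a =
      schur_map K M (schur_map K N a) \<bullet>\<^bsub>Vect K\<^esub> (schur_circ K M N V \<bullet>\<^bsub>Vect K\<^esub> schur_nat K C (circ K M N) f V)"
    using h' 1 Ve.comp_tail[OF schur_circ_natural[OF M a], of "schur_nat K C (circ K M N) f V"]
    by (simp add: Ve.comp_assoc del: Vect_simps)
  then show "(schur_circ K M N W \<bullet>\<^bsub>Vect K\<^esub> schur_nat K C (circ K M N) f W) \<bullet>\<^bsub>Vect K\<^esub> FArr (schur_func K C) a =
      FArr (comp_func (schur_func K M) (schur_func K N)) a \<bullet>\<^bsub>Vect K\<^esub> (schur_circ K M N V \<bullet>\<^bsub>Vect K\<^esub> schur_nat K C (circ K M N) f V)"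
    by (simp add: comp_func_def schur_func_def)
qed

section \<open>The coaction on free algebras\<close>

context
  fixes A C :: "('k, 'a) smodule" and \<alpha> :: "('k, 'a) smap"
  assumes A: "is_smodule K A" "sp A 1 = ground K" and C: "is_smodule K C" "sp C 1 = ground K" and \<alpha>: "smor K A (circ K C A) \<alpha>"
begin

private lemmas CA = circ_smodule[OF C(1) A(1)]

lemma coaction_fun:
  assumes V: "module K V"
  shows "coaction_nat K A C \<alpha> V \<in> Hom (Vect K) (schur K A V) (schur K C (schur K A V))"
    and "(\<mu>, vs) \<in> schur_gens A V \<Longrightarrow> vmap_fun (coaction_nat K A C \<alpha> V) (schur_cls K A V (\<mu>, vs)) =
      vmap_fun (schur_circ K C A V) (schur_cls K (circ K C A) V (\<alpha> (length vs) \<mu>, vs))"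
proof -
  note n = schur_nat_fun[OF A(1) CA \<alpha> V] and c = schur_circ_fun(1)[OF C(1) A(1) V]
  show "coaction_nat K A C \<alpha> V \<in> Hom (Vect K) (schur K A V) (schur K C (schur K A V))"
    unfolding coaction_nat_def by (rule Vect_comp_Hom[OF n(1) c])
  show "(\<mu>, vs) \<in> schur_gens A V \<Longrightarrow> vmap_fun (coaction_nat K A C \<alpha> V) (schur_cls K A V (\<mu>, vs)) =
      vmap_fun (schur_circ K C A V) (schur_cls K (circ K C A) V (\<alpha> (length vs) \<mu>, vs))"
    unfolding coaction_nat_def by (simp add: vmap_fun_comp[OF n(1) c] schur_cls_closed[OF A(1) V] n(2))
qed

text \<open>Since \<open>C(1)\<close> and \<open>A(1)\<close> are the ground field, \<open>(C \<circ> A)(1)\<close> is spanned by one element, and the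
  counit axiom determines the coefficient.\<close>

lemma coaction_unit:
  assumes V: "module K V" and counit: "schur_counit K C (schur K A V) \<bullet>\<^bsub>Vect K\<^esub> coaction_nat K A C \<alpha> V = Ide (Vect K) (schur K A V)"
  shows "coaction_nat K A C \<alpha> V \<bullet>\<^bsub>Vect K\<^esub> schur_unit K A V = schur_unit K C (schur K A V) \<bullet>\<^bsub>Vect K\<^esub> schur_unit K A V"
proof -
  note TV = schur_module[OF A(1) V]
  note GTV = schur_module[OF C(1) TV]
  note a = coaction_fun[OF V] and e = schur_unit_fun[OF A V] and eC = schur_unit_fun[OF C TV] and ec = schur_counit_fun(1)[OF C TV]
  show ?thesis
  proof (rule Vect_Hom_eqI[OF Vect_comp_Hom[OF e(1) a(1)] Vect_comp_Hom[OF e(1) eC(1)]])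
    fix v assume v: "v \<in> carrier V"
    let ?ev = "vmap_fun (schur_unit K A V) v"
    let ?f = "\<lambda>z. vmap_fun (schur_circ K C A V) (schur_cls K (circ K C A) V (z, [v]))"
    have ev: "?ev \<in> carrier (schur K A V)" by (rule Vect_Hom_closed[OF e(1) v])
    have eev: "vmap_fun (schur_unit K C (schur K A V)) ?ev \<in> carrier (schur K C (schur K A V))" by (rule Vect_Hom_closed[OF eC(1) ev])
    interpret G: module K "schur K C (schur K A V)" by (rule GTV)
    have "(\<lambda>z. schur_cls K (circ K C A) V (z, [v])) \<in> lin_maps K (circ_sp K C A (Suc 0)) (schur K (circ K C A) V)"
      using schur_hom_lin[OF schur_cls_hom[OF CA V], of "[v]"] v by (simp add: sp_circ[OF C(1) A(1)])
    note f = lin_maps_compose[OF this Vect_Hom_lin[OF schur_circ_fun(1)[OF C(1) A(1) V]]]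
    have "\<exists>s\<in>carrier K. ?f z = s \<odot>\<^bsub>schur K C (schur K A V)\<^esub> vmap_fun (schur_unit K C (schur K A V)) ?ev"
      if "z \<in> carrier (circ_sp K C A (Suc 0))" for z
      using that
    proof (induction rule: circ_induct[OF C(1) A(1), consumes 1, case_names zero step])
      case zero
      show ?case using lin_maps_zero[OF circ_module[OF C(1) A(1)] GTV f] eev by (intro bexI[of _ \<zero>]) auto
    next
      case (step c g y)
      obtain \<mu> ps where g: "g = (\<mu>, ps)" by (rule prod.exhaust)
      note G = step(2)[unfolded g]
      note D = circ_gensD[OF G]
      have ne: "labels_of p \<noteq> []" if "p \<in> set ps" for p using D(6)[OF that] by simp
      \<comment> \<open>One label in all and no empty block: there is exactly one block, carrying
        exactly this label.\<close>
      note co = concat_ones[of ps labels_of, OF ne, unfolded D(3)]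
      have "length ps = Suc 0" using co(1) D(1) by (cases ps) auto
      then obtain p where ps: "ps = [p]" by (cases ps) auto
      then have "length (labels_of p) = Suc 0" using co(2)[of p] by simp
      then obtain j where j: "labels_of p = [j]" by (cases "labels_of p") auto
      have j0: "j = 0" using D(5) ps j by (simp add: lessThan_Suc)
      have ag: "(op_of p, [v]) \<in> schur_gens A V" using D(6)[of p] ps j v by (auto intro!: schur_gensI)
      note sA = schur_unit_scalar[OF A V ag]
      have "(\<mu>, [schur_cls K A V (op_of p, [v])]) \<in> schur_gens C (schur K A V)"
        using D(2) ps schur_cls_closed[OF A(1) V ag] by (auto intro!: schur_gensI)
      note sC = schur_unit_scalar[OF C TV this]
      have arg: "arg_of [v] p = (op_of p, [v])" using j j0 by (simp add: arg_of_def)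
      have Gv: "(\<mu>, ps) \<in> circ_gens C A (length [v])" using G by simp
      have "?f (circ_cls K C A (Suc 0) g) = schur_cls K C (schur K A V) (\<mu>, [schur_cls K A V (op_of p, [v])])"
        using schur_circ_fun(2)[OF C(1) A(1) V _ Gv] v by (simp add: g ps arg)
      also have "\<dots> = scalar_of \<mu> \<odot>\<^bsub>schur K C (schur K A V)\<^esub> vmap_fun (schur_unit K C (schur K A V)) (schur_cls K A V (op_of p, [v]))"
        using sC by (rule conjunct2)
      also have "\<dots> = (scalar_of \<mu> \<otimes> scalar_of (op_of p)) \<odot>\<^bsub>schur K C (schur K A V)\<^esub> vmap_fun (schur_unit K C (schur K A V)) ?ev"
        using sA sC ev eev by (simp add: lin_maps_smult[OF Vect_Hom_lin[OF eC(1)]] G.smult_assoc1)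
      finally have gen: "?f (circ_cls K C A (Suc 0) g) = (scalar_of \<mu> \<otimes> scalar_of (op_of p)) \<odot>\<^bsub>schur K C (schur K A V)\<^esub> vmap_fun (schur_unit K C (schur K A V)) ?ev" .
      obtain s where s: "s \<in> carrier K" "?f y = s \<odot>\<^bsub>schur K C (schur K A V)\<^esub> vmap_fun (schur_unit K C (schur K A V)) ?ev" using step by blast
      let ?s = "scalar_of \<mu> \<otimes> scalar_of (op_of p)"
      have sc: "?s \<in> carrier K" using sA sC by simp
      have gc: "circ_cls K C A (Suc 0) g \<in> carrier (circ_sp K C A (Suc 0))" by (rule circ_cls_closed[OF C(1) A(1) step(2)])
      have "?f (c \<odot>\<^bsub>circ_sp K C A (Suc 0)\<^esub> circ_cls K C A (Suc 0) g \<oplus>\<^bsub>circ_sp K C A (Suc 0)\<^esub> y) =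
         c \<odot>\<^bsub>schur K C (schur K A V)\<^esub> ?f (circ_cls K C A (Suc 0) g) \<oplus>\<^bsub>schur K C (schur K A V)\<^esub> ?f y"
        using lin_maps_add[OF f module_smult[OF circ_module[OF C(1) A(1)] step(1) gc] step(3)] lin_maps_smult[OF f step(1) gc] by simp
      also have "\<dots> = (c \<otimes> ?s \<oplus> s) \<odot>\<^bsub>schur K C (schur K A V)\<^esub> vmap_fun (schur_unit K C (schur K A V)) ?ev"
        unfolding gen s(2) using step(1) sc s(1) eev by (simp add: G.smult_l_distr G.smult_assoc1)
      finally show ?case using step(1) sc s(1) by blast
    qed
    moreover have one: "(Scalar \<one>, [v]) \<in> schur_gens A V" using v A(2) by (auto simp: schur_gens_def ground_def)
    moreover have "\<alpha> (Suc 0) (Scalar \<one>) \<in> carrier (circ_sp K C A (Suc 0))"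
      using smor_closed[OF \<alpha>, of "Suc 0" "Scalar \<one>"] A(2) by (simp add: sp_circ[OF C(1) A(1)] ground_def)
    ultimately obtain s where s: "s \<in> carrier K" "vmap_fun (coaction_nat K A C \<alpha> V) ?ev = s \<odot>\<^bsub>schur K C (schur K A V)\<^esub> vmap_fun (schur_unit K C (schur K A V)) ?ev"
      using a(2)[OF one] e(2)[OF v] by auto
    \<comment> \<open>The counit yields only that \<open>s\<close> fixes \<open>?ev\<close>, not
      that \<open>s\<close> is 1, since \<open>v\<close> may be zero. Moving \<open>s\<close>
      through the linear unit of \<open>C\<close> is enough.\<close>
    have "?ev = vmap_fun (schur_counit K C (schur K A V)) (vmap_fun (coaction_nat K A C \<alpha> V) ?ev)"
      using arg_cong[OF counit, of "\<lambda>f. vmap_fun f ?ev"] unfolding vmap_fun_comp[OF a(1) ec ev] vmap_fun_Ide[OF ev] by simp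
    also have "\<dots> = s \<odot>\<^bsub>schur K A V\<^esub> ?ev"
      unfolding s(2) using s(1) eev schur_counit_unit[OF C TV ev] by (simp add: lin_maps_smult[OF Vect_Hom_lin[OF ec]])
    finally have "vmap_fun (schur_unit K C (schur K A V)) ?ev = vmap_fun (coaction_nat K A C \<alpha> V) ?ev"
      unfolding s(2) using lin_maps_smult[OF Vect_Hom_lin[OF eC(1)] s(1) ev] by metis
    then show "vmap_fun (coaction_nat K A C \<alpha> V \<bullet>\<^bsub>Vect K\<^esub> schur_unit K A V) v = vmap_fun (schur_unit K C (schur K A V) \<bullet>\<^bsub>Vect K\<^esub> schur_unit K A V) v"
      unfolding vmap_fun_comp[OF e(1) a(1) v] vmap_fun_comp[OF e(1) eC(1) v] by simp
  qed
qed

abbreviation "phi_map \<equiv> runit K C \<cdot>\<^sub>s circ_map K C (sunit K) sid (s_counit K) \<cdot>\<^sub>s \<alpha>"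

text \<open>The isomorphism hypothesis is about a morphism of S-modules built with
  \<open>runit\<close>; this identifies its transformation with the arrow
  \<open>G pT \<bullet> a\<close> of the categorical part. The projection of \<open>A\<close> is
  factored through the unit S-module, so that \<open>schur_circ_inner_natural\<close>
  applies.\<close>

lemma phi_schur_nat:
  assumes V: "module K V" and p: "smor K A C phi_map"
  shows "schur_map K C (schur_counit K A V) \<bullet>\<^bsub>Vect K\<^esub> coaction_nat K A C \<alpha> V = schur_nat K A C phi_map V"
proof -
  note TV = schur_module[OF A(1) V]
  note a = coaction_fun[OF V] and pA = schur_counit_fun[OF A V] and p1 = schur_counit_fun[OF sunit_smodule sunit_one V]
  note GpA = schur_map_fun[OF C(1) pA(1)] and Gp1 = schur_map_fun[OF C(1) p1(1)]
  note sc = s_counit_smor[OF A] and C1 = circ_smodule[OF C(1) sunit_smodule]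
  note ns = schur_nat_fun[OF A(1) sunit_smodule sc V]
  note Gns = schur_map_fun[OF C(1) ns(1)]
  note id = smor_sid[of K C]
  note cm = circ_map_smor[OF C(1) C(1) A(1) sunit_smodule id sc]
  note ncm = schur_nat_fun[OF CA C1 cm V] and n = schur_nat_fun[OF A(1) C(1) p V]
  have comp: "schur_counit K (sunit K) V \<bullet>\<^bsub>Vect K\<^esub> schur_nat K A (sunit K) (s_counit K) V = schur_counit K A V"
  proof (rule schur_Hom_eqI[OF A(1) V Vect_comp_Hom[OF ns(1) p1(1)] pA(1)])
    fix \<mu> vs assume g: "(\<mu>, vs) \<in> schur_gens A V"
    show "vmap_fun (schur_counit K (sunit K) V \<bullet>\<^bsub>Vect K\<^esub> schur_nat K A (sunit K) (s_counit K) V) (schur_cls K A V (\<mu>, vs)) = vmap_fun (schur_counit K A V) (schur_cls K A V (\<mu>, vs))"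
      using p1(2)[OF smor_gens[OF sc g]] pA(2)[OF g] ns(2)[OF g]
      by (simp add: vmap_fun_comp[OF ns(1) p1(1) schur_cls_closed[OF A(1) V g]] s_counit_def)
  qed
  have Gcomp: "schur_map K C (schur_counit K A V) = schur_map K C (schur_counit K (sunit K) V) \<bullet>\<^bsub>Vect K\<^esub> schur_map K C (schur_nat K A (sunit K) (s_counit K) V)"
  proof -
    interpret E: endofunctor "Vect K :: (('k, 'a) vs, ('k, 'a) vmap) category" "schur_func K C"
      by unfold_locales (rule Vect_category, rule schur_functor[OF C(1)])
    show ?thesis using E.F_comp[of "schur_nat K A (sunit K) (s_counit K) V" "schur_counit K (sunit K) V"] ns(1) p1(1)
      unfolding comp by (simp add: Hom_def schur_func_def)
  qed
  show ?thesis
  proof (rule schur_Hom_eqI[OF A(1) V Vect_comp_Hom[OF a(1) GpA(1)] n(1)])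
    fix \<mu> vs assume g: "(\<mu>, vs) \<in> schur_gens A V"
    note D = schur_gensD[OF g]
    let ?n = "length vs"
    \<comment> \<open>\<open>w\<close> is the value in the plethysm of \<open>C\<close> with the
      unit S-module, and \<open>c\<close> the operation of \<open>C\<close> that the right unit
      isomorphism assigns to it.\<close>
    define w where "w = circ_map K C (sunit K) sid (s_counit K) ?n (\<alpha> ?n \<mu>)"
    define c where "c = runit K C ?n w"
    have ag: "(\<alpha> ?n \<mu>, vs) \<in> schur_gens (circ K C A) V" by (rule smor_gens[OF \<alpha> g])
    let ?z = "schur_cls K (circ K C A) V (\<alpha> ?n \<mu>, vs)"
    have z: "?z \<in> carrier (schur K (circ K C A) V)" by (rule schur_cls_closed[OF CA V ag])
    have "w \<in> carrier (sp (circ K C (sunit K)) ?n)"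
      unfolding w_def using smor_closed[OF cm, of ?n "\<alpha> ?n \<mu>"] schur_gensD[OF ag] by simp
    then have c: "runit_inv K C ?n c = w" "c \<in> carrier (sp C ?n)"
      unfolding c_def using D runit_inv_runit[OF C(1), of ?n w] by (simp_all add: sp_circ[OF C(1) sunit_smodule])
    have cg: "(c, vs) \<in> schur_gens C V" using c(2) D by (intro schur_gensI) auto
    have cg1: "(c, map (vmap_fun (schur_unit K (sunit K) V)) vs) \<in> schur_gens C (schur K (sunit K) V)"
      by (rule lin_gens[OF Vect_Hom_lin[OF schur_unit_fun(1)[OF sunit_smodule sunit_one V]] cg])
    have az: "vmap_fun (schur_circ K C A V) ?z \<in> carrier (schur K C (schur K A V))"
      by (rule Vect_Hom_closed[OF schur_circ_fun(1)[OF C(1) A(1) V] z])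
    have "vmap_fun (schur_map K C (schur_counit K A V)) (vmap_fun (schur_circ K C A V) ?z) =
        vmap_fun (schur_map K C (schur_counit K (sunit K) V)) (vmap_fun (schur_map K C (schur_nat K A (sunit K) (s_counit K) V)) (vmap_fun (schur_circ K C A V) ?z))"
      unfolding Gcomp by (rule vmap_fun_comp[OF Gns(1) Gp1(1) az])
    also have "vmap_fun (schur_map K C (schur_nat K A (sunit K) (s_counit K) V)) (vmap_fun (schur_circ K C A V) ?z) =
        vmap_fun (schur_circ K C (sunit K) V) (schur_cls K (circ K C (sunit K)) V (runit_inv K C ?n c, vs))"
      unfolding schur_circ_inner_natural[OF C(1) A(1) sunit_smodule sc V z, symmetric] ncm(2)[OF ag] c(1) w_def ..
    also have "\<dots> = schur_cls K C (schur K (sunit K) V) (c, map (vmap_fun (schur_unit K (sunit K) V)) vs)"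
      by (rule schur_circ_runit_inv[OF C(1) V cg])
    also have "vmap_fun (schur_map K C (schur_counit K (sunit K) V)) \<dots> = schur_cls K C V (c, vs)"
    proof -
      have "map (vmap_fun (schur_counit K (sunit K) V)) (map (vmap_fun (schur_unit K (sunit K) V)) vs) = vs"
        using D schur_counit_unit[OF sunit_smodule sunit_one V] by (simp add: map_idI subset_iff)
      then show ?thesis unfolding Gp1(2)[OF cg1] by simp
    qed
    also have "\<dots> = vmap_fun (schur_nat K A C phi_map V) (schur_cls K A V (\<mu>, vs))"
      using n(2)[OF g] by (simp add: c_def w_def scomp_def)
    finally show "vmap_fun (schur_map K C (schur_counit K A V) \<bullet>\<^bsub>Vect K\<^esub> coaction_nat K A C \<alpha> V) (schur_cls K A V (\<mu>, vs)) =
        vmap_fun (schur_nat K A C phi_map V) (schur_cls K A V (\<mu>, vs))"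
      unfolding vmap_fun_comp[OF a(1) GpA(1) schur_cls_closed[OF A(1) V g]] a(2)[OF g] .
  qed
qed

text \<open>On a summand \<open>(c; a\<^sub>1, \<dots>, a\<^sub>k)\<close> of \<open>(C \<circ> A)(n)\<close> with \<open>k = n\<close> all \<open>a\<^sub>j\<close> are scalars, so that \<open>h\<close> and the
  counit agree there; for \<open>k < n\<close> the counit gives \<open>0\<close> and \<open>h\<close> an element of arity \<open>k\<close>.\<close>

lemma action_counit_filt:
  assumes V: "module K V" and h: "h \<in> Hom (Vect K) (schur K A V) V"
    and hu: "\<And>v. v \<in> carrier V \<Longrightarrow> vmap_fun h (vmap_fun (schur_unit K A V) v) = v"
    and vs: "vs \<noteq> []" "set vs \<subseteq> carrier V" and z: "z \<in> carrier (circ_sp K C A (length vs))"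
  shows "\<exists>d\<in>filt K C V (length vs - 1).
    vmap_fun (schur_map K C h) (vmap_fun (schur_circ K C A V) (schur_cls K (circ K C A) V (z, vs))) =
    vmap_fun (schur_map K C (schur_counit K A V)) (vmap_fun (schur_circ K C A V) (schur_cls K (circ K C A) V (z, vs))) \<oplus>\<^bsub>schur K C V\<^esub> d"
proof -
  note TV = schur_module[OF A(1) V] and GV = schur_module[OF C(1) V]
  note pA = schur_counit_fun[OF A V]
  note GpA = schur_map_fun[OF C(1) pA(1)] and Gh = schur_map_fun[OF C(1) h]
  interpret G: module K "schur K C V" by (rule GV)
  note c = schur_circ_fun[OF C(1) A(1) V]
  note i = schur_hom_lin[OF schur_cls_hom[OF CA V] vs, unfolded sp_circ[OF C(1) A(1)]]
  note ic = lin_maps_compose[OF i Vect_Hom_lin[OF c(1)]]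
  note f = lin_maps_compose[OF ic Vect_Hom_lin[OF Gh(1)]] and f' = lin_maps_compose[OF ic Vect_Hom_lin[OF GpA(1)]]
  let ?f = "\<lambda>z. vmap_fun (schur_map K C h) (vmap_fun (schur_circ K C A V) (schur_cls K (circ K C A) V (z, vs)))"
  let ?f' = "\<lambda>z. vmap_fun (schur_map K C (schur_counit K A V)) (vmap_fun (schur_circ K C A V) (schur_cls K (circ K C A) V (z, vs)))"
  show ?thesis using z
  proof (induction rule: circ_induct[OF C(1) A(1), consumes 1, case_names zero step])
    case zero
    show ?case
      using lin_maps_zero[OF circ_module[OF C(1) A(1)] GV f] lin_maps_zero[OF circ_module[OF C(1) A(1)] GV f']
      by (intro bexI[of _ "\<zero>\<^bsub>schur K C V\<^esub>"]) (auto intro: filt_zero)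
  next
    case (step k g y)
    obtain \<mu> ps where g: "g = (\<mu>, ps)" by (rule prod.exhaust)
    note G = step(2)[unfolded g]
    note D = circ_gensD[OF G]
    let ?bs = "map (\<lambda>p. schur_cls K A V (arg_of vs p)) ps"
    have bg: "(\<mu>, ?bs) \<in> schur_gens C (schur K A V)" by (rule arg_cls_closed[OF C(1) A(1) V G HOL.refl vs(2)])
    have e: "?f (circ_cls K C A (length vs) g) = schur_cls K C V (\<mu>, map (vmap_fun h) ?bs)"
      "?f' (circ_cls K C A (length vs) g) = schur_cls K C V (\<mu>, map (vmap_fun (schur_counit K A V)) ?bs)"
      unfolding g c(2)[OF vs(2) G] using Gh(2)[OF bg] GpA(2)[OF bg] by simp_all
    have cl: "(\<mu>, map (vmap_fun h) ?bs) \<in> schur_gens C V" "(\<mu>, map (vmap_fun (schur_counit K A V)) ?bs) \<in> schur_gens C V"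
      using lin_gens[OF Vect_Hom_lin[OF h] bg] lin_gens[OF Vect_Hom_lin[OF pA(1)] bg] by auto
    have ag: "arg_of vs p \<in> schur_gens A V" if "p \<in> set ps" for p by (rule arg_of_gens[OF G that HOL.refl vs(2)])
    have ne: "labels_of p \<noteq> []" if "p \<in> set ps" for p using D(6)[OF that] by simp
    note co = concat_ones[of ps labels_of, OF ne, unfolded D(3)]
    have gen: "\<exists>d\<in>filt K C V (length vs - 1). ?f (circ_cls K C A (length vs) g) = ?f' (circ_cls K C A (length vs) g) \<oplus>\<^bsub>schur K C V\<^esub> d"
    proof (cases "length ps = length vs")
      case True
      have "vmap_fun h (schur_cls K A V (arg_of vs p)) = vmap_fun (schur_counit K A V) (schur_cls K A V (arg_of vs p))" if p: "p \<in> set ps" for p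
      proof -
        have "length (labels_of p) = 1" by (rule co(2)[OF _ True p])
        then obtain j where "labels_of p = [j]" by (cases "labels_of p") auto
        then have arg: "arg_of vs p = (op_of p, [vs ! j])" by (simp add: arg_of_def)
        have g1: "(op_of p, [vs ! j]) \<in> schur_gens A V" using ag[OF p] arg by simp
        have v: "vs ! j \<in> carrier V" using schur_gensD[OF g1] by simp
        note s = schur_unit_scalar[OF A V g1]
        have ev: "vmap_fun (schur_unit K A V) (vs ! j) \<in> carrier (schur K A V)"
          by (rule Vect_Hom_closed[OF schur_unit_fun(1)[OF A V] v])
        show ?thesis unfolding arg using s ev hu[OF v] schur_counit_unit[OF A V v]
          by (simp add: lin_maps_smult[OF Vect_Hom_lin[OF h]] lin_maps_smult[OF Vect_Hom_lin[OF pA(1)]])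
      qed
      then have eq: "map (vmap_fun h) ?bs = map (vmap_fun (schur_counit K A V)) ?bs" by simp
      show ?thesis unfolding e eq using schur_cls_closed[OF C(1) V cl(2)]
        by (intro bexI[of _ "\<zero>\<^bsub>schur K C V\<^esub>"]) (simp_all add: filt_zero del: map_map)
    next
      case False
      then have lt: "length ps \<le> length vs - 1" using co(1) by simp
      obtain p where p: "p \<in> set ps" "length (labels_of p) \<noteq> 1" using co(3) False by blast
      \<comment> \<open>One block with several inputs is killed by the projection of
        \<open>A\<close>, and a zero argument kills the whole tensor.\<close>
      have "vmap_fun (schur_counit K A V) (schur_cls K A V (arg_of vs p)) = \<zero>\<^bsub>V\<^esub>"
        using pA(2)[OF ag[OF p(1), unfolded arg_of_def]] p(2) by (simp add: arg_of_def)
      then have "\<zero>\<^bsub>V\<^esub> \<in> set (map (vmap_fun (schur_counit K A V)) ?bs)" using p(1) by force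
      from schur_cls_zero_arg[OF C(1) V cl(2) this] e(2)
      have "?f' (circ_cls K C A (length vs) g) = \<zero>\<^bsub>schur K C V\<^esub>" by simp
      then show ?thesis
        using e(1) schur_cls_closed[OF C(1) V cl(1)] filt_gen[OF C(1) V cl(1), of "length vs - 1"] lt
        by (intro bexI[of _ "schur_cls K C V (\<mu>, map (vmap_fun h) ?bs)"]) (simp_all del: map_map)
    qed
    then obtain d1 where d1: "d1 \<in> filt K C V (length vs - 1)" "?f (circ_cls K C A (length vs) g) = ?f' (circ_cls K C A (length vs) g) \<oplus>\<^bsub>schur K C V\<^esub> d1" by blast
    obtain d2 where d2: "d2 \<in> filt K C V (length vs - 1)" "?f y = ?f' y \<oplus>\<^bsub>schur K C V\<^esub> d2" using step by blast
    have gc: "circ_cls K C A (length vs) g \<in> carrier (circ_sp K C A (length vs))" by (rule circ_cls_closed[OF C(1) A(1) step(2)])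
    note kgc = module_smult[OF circ_module[OF C(1) A(1)] step(1) gc]
    have "?f (k \<odot>\<^bsub>circ_sp K C A (length vs)\<^esub> circ_cls K C A (length vs) g \<oplus>\<^bsub>circ_sp K C A (length vs)\<^esub> y) =
        k \<odot>\<^bsub>schur K C V\<^esub> (?f' (circ_cls K C A (length vs) g) \<oplus>\<^bsub>schur K C V\<^esub> d1) \<oplus>\<^bsub>schur K C V\<^esub> (?f' y \<oplus>\<^bsub>schur K C V\<^esub> d2)"
      using lin_maps_add[OF f kgc step(3)] lin_maps_smult[OF f step(1) gc] d1(2) d2(2) by simp
    also have "\<dots> = (k \<odot>\<^bsub>schur K C V\<^esub> ?f' (circ_cls K C A (length vs) g) \<oplus>\<^bsub>schur K C V\<^esub> ?f' y) \<oplus>\<^bsub>schur K C V\<^esub> (k \<odot>\<^bsub>schur K C V\<^esub> d1 \<oplus>\<^bsub>schur K C V\<^esub> d2)"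
      using lin_maps_closed[OF f' gc] lin_maps_closed[OF f' step(3)] filt_closed[OF C(1) V d1(1)] filt_closed[OF C(1) V d2(1)] step(1)
      by (simp add: G.smult_r_distr G.a_ac)
    also have "k \<odot>\<^bsub>schur K C V\<^esub> ?f' (circ_cls K C A (length vs) g) \<oplus>\<^bsub>schur K C V\<^esub> ?f' y =
        ?f' (k \<odot>\<^bsub>circ_sp K C A (length vs)\<^esub> circ_cls K C A (length vs) g \<oplus>\<^bsub>circ_sp K C A (length vs)\<^esub> y)"
      using lin_maps_add[OF f' kgc step(3)] lin_maps_smult[OF f' step(1) gc] by simp
    finally show ?case
      using filt_add[OF C(1) V filt_smult[OF C(1) V step(1) d1(1)] d2(1)] by blast
  qed
qed

context
  assumes iso: "smor_iso K A C phi_map"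
begin

lemma phi_inverse:
  obtains \<psi> where "smor K C A \<psi>"
    "\<And>V x. module K V \<Longrightarrow> x \<in> carrier (schur K A V) \<Longrightarrow> vmap_fun (schur_nat K C A \<psi> V) (vmap_fun (schur_nat K A C phi_map V) x) = x"
    "\<And>V x. module K V \<Longrightarrow> x \<in> carrier (schur K C V) \<Longrightarrow> vmap_fun (schur_nat K A C phi_map V) (vmap_fun (schur_nat K C A \<psi> V) x) = x"
proof -
  obtain \<psi> where p: "smor K A C phi_map" and \<psi>: "smor K C A \<psi>" "smor_eq A (\<psi> \<cdot>\<^sub>s phi_map) sid" "smor_eq C (phi_map \<cdot>\<^sub>s \<psi>) sid"
    using iso unfolding smor_iso_def by blast
  show ?thesis
    by (rule that[OF \<psi>(1)])
      (simp_all only: schur_nat_comp_fun[OF A(1) C(1) A(1) p \<psi>(1)] schur_nat_comp_fun[OF C(1) A(1) C(1) \<psi>(1) p]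
        schur_nat_smor_eq[OF A(1) smor_comp[OF p \<psi>(1)] \<psi>(2)] schur_nat_smor_eq[OF C(1) smor_comp[OF \<psi>(1) p] \<psi>(3)])
qed

lemma phi_smor: "smor K A C phi_map"
  using iso by (simp add: smor_iso_def)

lemma coaction_phi_iso:
  assumes V: "module K V"
  shows "iso_arr (Vect K) (schur_map K C (schur_counit K A V) \<bullet>\<^bsub>Vect K\<^esub> coaction_nat K A C \<alpha> V)"
proof -
  obtain \<psi> where \<psi>: "smor K C A \<psi>"
    "\<And>V x. module K V \<Longrightarrow> x \<in> carrier (schur K A V) \<Longrightarrow> vmap_fun (schur_nat K C A \<psi> V) (vmap_fun (schur_nat K A C phi_map V) x) = x"
    "\<And>V x. module K V \<Longrightarrow> x \<in> carrier (schur K C V) \<Longrightarrow> vmap_fun (schur_nat K A C phi_map V) (vmap_fun (schur_nat K C A \<psi> V) x) = x"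
    by (rule phi_inverse) blast
  note p = schur_nat_fun(1)[OF A(1) C(1) phi_smor V] and q = schur_nat_fun(1)[OF C(1) A(1) \<psi>(1) V]
  have "bij_betw (vmap_fun (schur_nat K A C phi_map V)) (carrier (schur K A V)) (carrier (schur K C V))"
    by (rule bij_betw_byWitness[where f' = "vmap_fun (schur_nat K C A \<psi> V)"])
      (use \<psi>(2,3)[OF V] Vect_Hom_closed[OF p] Vect_Hom_closed[OF q] in auto)
  then show ?thesis unfolding phi_schur_nat[OF V phi_smor] by (rule Vect_iso[OF p])
qed

text \<open>The inverse of \<open>\<phi>\<close> comes from a morphism of S-modules and so preserves
  arity. Its composite with \<open>\<kappa>\<close> is therefore the identity up to lower arity and
  \<open>unitriangular_bij\<close> applies; composing with \<open>\<phi>\<close> again recovers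
  \<open>\<kappa>\<close>.\<close>

lemma coaction_kappa_iso:
  assumes V: "module K V" and h: "h \<in> Hom (Vect K) (schur K A V) V" and hu: "h \<bullet>\<^bsub>Vect K\<^esub> schur_unit K A V = Ide (Vect K) V"
  shows "iso_arr (Vect K) (schur_map K C h \<bullet>\<^bsub>Vect K\<^esub> coaction_nat K A C \<alpha> V)"
proof -
  obtain \<psi> where \<psi>: "smor K C A \<psi>"
    "\<And>V x. module K V \<Longrightarrow> x \<in> carrier (schur K A V) \<Longrightarrow> vmap_fun (schur_nat K C A \<psi> V) (vmap_fun (schur_nat K A C phi_map V) x) = x"
    "\<And>V x. module K V \<Longrightarrow> x \<in> carrier (schur K C V) \<Longrightarrow> vmap_fun (schur_nat K A C phi_map V) (vmap_fun (schur_nat K C A \<psi> V) x) = x"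
    by (rule phi_inverse) blast
  note p = schur_nat_fun[OF A(1) C(1) phi_smor V] and q = schur_nat_fun[OF C(1) A(1) \<psi>(1) V]
  note a = coaction_fun[OF V] and Gh = schur_map_fun(1)[OF C(1) h] and e = schur_unit_fun(1)[OF A V]
  note Gp = schur_map_fun(1)[OF C(1) schur_counit_fun(1)[OF A V]]
  note k = Vect_comp_Hom[OF a(1) Gh]
  let ?k = "vmap_fun (schur_map K C h \<bullet>\<^bsub>Vect K\<^esub> coaction_nat K A C \<alpha> V)"
  let ?p = "vmap_fun (schur_nat K A C phi_map V)" and ?q = "vmap_fun (schur_nat K C A \<psi> V)"
  have hu': "vmap_fun h (vmap_fun (schur_unit K A V) v) = v" if "v \<in> carrier V" for v
    using arg_cong[OF hu, of "\<lambda>f. vmap_fun f v"] unfolding vmap_fun_comp[OF e h that] vmap_fun_Ide[OF that] .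
  have "bij_betw (\<lambda>x. ?q (?k x)) (carrier (schur K A V)) (carrier (schur K A V))"
  proof (rule unitriangular_bij[OF A(1) V lin_maps_compose[OF Vect_Hom_lin[OF k] Vect_Hom_lin[OF q(1)]]])
    fix \<mu> vs assume g: "(\<mu>, vs) \<in> schur_gens A V"
    note D = schur_gensD[OF g]
    let ?x = "schur_cls K A V (\<mu>, vs)"
    have x: "?x \<in> carrier (schur K A V)" by (rule schur_cls_closed[OF A(1) V g])
    have az: "\<alpha> (length vs) \<mu> \<in> carrier (circ_sp K C A (length vs))"
      using smor_closed[OF \<alpha>, of "length vs" \<mu>] D by (simp add: sp_circ[OF C(1) A(1)])
    obtain d where d: "d \<in> filt K C V (length vs - 1)"
      "vmap_fun (schur_map K C h) (vmap_fun (coaction_nat K A C \<alpha> V) ?x) = vmap_fun (schur_map K C (schur_counit K A V)) (vmap_fun (coaction_nat K A C \<alpha> V) ?x) \<oplus>\<^bsub>schur K C V\<^esub> d"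
      unfolding a(2)[OF g] using action_counit_filt[OF V h hu' _ _ az] D by blast
    have kx: "?k ?x = ?p ?x \<oplus>\<^bsub>schur K C V\<^esub> d"
      using d(2) unfolding phi_schur_nat[OF V phi_smor, symmetric] vmap_fun_comp[OF a(1) Gh x] vmap_fun_comp[OF a(1) Gp x] .
    have "?q (?k ?x) = ?x \<oplus>\<^bsub>schur K A V\<^esub> ?q d"
      unfolding kx using lin_maps_add[OF Vect_Hom_lin[OF q(1)] Vect_Hom_closed[OF p(1) x] filt_closed[OF C(1) V d(1)]] \<psi>(2)[OF V x] by simp
    moreover have "?q d \<in> filt K A V (length vs - 1)"
      by (rule filt_map[OF C(1) A(1) V V Vect_Hom_lin[OF q(1)] _ d(1)])
        (simp add: q(2) filt_gen[OF A(1) V smor_gens[OF \<psi>(1)]])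
    ultimately show "\<exists>d\<in>filt K A V (length vs - 1). ?q (?k ?x) = ?x \<oplus>\<^bsub>schur K A V\<^esub> d" by blast
  qed
  moreover have "bij_betw ?p (carrier (schur K A V)) (carrier (schur K C V))"
    by (rule bij_betw_byWitness[where f' = ?q])
      (use \<psi>(2,3)[OF V] Vect_Hom_closed[OF p(1)] Vect_Hom_closed[OF q(1)] in auto)
  ultimately have "bij_betw (?p \<circ> (\<lambda>x. ?q (?k x))) (carrier (schur K A V)) (carrier (schur K C V))"
    by (rule bij_betw_trans)
  then have "bij_betw ?k (carrier (schur K A V)) (carrier (schur K C V))"
    by (rule iffD1[OF bij_betw_cong, rotated]) (simp add: \<psi>(3)[OF V] Vect_Hom_closed[OF k])
  then show ?thesis by (rule Vect_iso[OF k])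
qed

end
end
end

section \<open>The primitive part\<close>

context ground_ring
begin

definition prim_incl :: "('k, 'a) smodule \<Rightarrow> ('k, 'a) vs \<Rightarrow> ('k, 'a) vmap \<Rightarrow> ('k, 'a) vmap" where
  "prim_incl C H \<theta> = (Prim K C H \<theta>, \<lambda>x\<in>carrier (Prim K C H \<theta>). x, H)"

lemma submodule_module:
  assumes V: "module K V" and S: "S \<subseteq> carrier V" "\<zero>\<^bsub>V\<^esub> \<in> S"
    and add: "\<And>x y. x \<in> S \<Longrightarrow> y \<in> S \<Longrightarrow> x \<oplus>\<^bsub>V\<^esub> y \<in> S"
    and smult: "\<And>c x. c \<in> carrier K \<Longrightarrow> x \<in> S \<Longrightarrow> c \<odot>\<^bsub>V\<^esub> x \<in> S"
  shows "module K (V\<lparr>carrier := S\<rparr>)"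
proof -
  interpret V: module K V by (rule V)
  have cl: "x \<in> S \<Longrightarrow> x \<in> carrier V" for x using S by auto
  show ?thesis
  proof (rule moduleI)
    show "abelian_group (V\<lparr>carrier := S\<rparr>)"
    proof (rule abelian_groupI)
      fix x assume "x \<in> carrier (V\<lparr>carrier := S\<rparr>)"
      then have x: "x \<in> S" by simp
      then show "\<exists>y\<in>carrier (V\<lparr>carrier := S\<rparr>). y \<oplus>\<^bsub>V\<lparr>carrier := S\<rparr>\<^esub> x = \<zero>\<^bsub>V\<lparr>carrier := S\<rparr>\<^esub>"
        using smult[of "\<ominus> \<one>" x] cl[OF x] V.smult_l_minus[of \<one> x]
        by (intro bexI[of _ "(\<ominus> \<one>) \<odot>\<^bsub>V\<^esub> x"]) (simp_all add: V.l_neg V.smult_one)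
    qed (use S add in \<open>auto simp: cl V.a_ac\<close>)
  qed (use smult in \<open>auto simp: cl V.smult_l_distr V.smult_r_distr V.smult_assoc1 is_cring\<close>)
qed

context
  fixes C :: "('k, 'a) smodule" and H :: "('k, 'a) vs" and \<theta> :: "('k, 'a) vmap"
  assumes C: "is_smodule K C" "sp C 1 = ground K" and H: "module K H" and \<theta>: "\<theta> \<in> Hom (Vect K) H (schur K C H)"
begin

lemma Prim_module: "module K (Prim K C H \<theta>)"
proof -
  interpret H: module K H by (rule H)
  note e = Vect_Hom_lin[OF schur_unit_fun(1)[OF C H]] and t = Vect_Hom_lin[OF \<theta>]
  note G = schur_module[OF C(1) H]
  show ?thesis unfolding Prim_def
    using lin_maps_zero[OF H G e] lin_maps_zero[OF H G t]
    by (intro submodule_module[OF H]) (auto simp: lin_maps_add[OF e] lin_maps_add[OF t] lin_maps_smult[OF e] lin_maps_smult[OF t])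
qed

lemma Prim_carrier: "x \<in> carrier (Prim K C H \<theta>) \<longleftrightarrow> x \<in> carrier H \<and> vmap_fun \<theta> x = vmap_fun (schur_unit K C H) x"
  by (simp add: Prim_def)

lemma Prim_lin: "f \<in> lin_maps K V (Prim K C H \<theta>) \<longleftrightarrow> f \<in> lin_maps K V H \<and> (\<forall>x\<in>carrier V. vmap_fun \<theta> (f x) = vmap_fun (schur_unit K C H) (f x))"
  by (auto simp: lin_maps_def Prim_def Pi_iff)

lemma prim_incl_hom: "prim_incl C H \<theta> \<in> Hom (Vect K) (Prim K C H \<theta>) H"
proof -
  have "(\<lambda>x. x) \<in> lin_maps K (Prim K C H \<theta>) H" by (auto simp: lin_maps_def Prim_def)
  then show ?thesis unfolding prim_incl_def by (rule Vect_HomI[OF Prim_module H])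
qed

lemma prim_incl_fun: "x \<in> carrier (Prim K C H \<theta>) \<Longrightarrow> vmap_fun (prim_incl C H \<theta>) x = x"
  by (simp add: prim_incl_def)

lemma prim_incl_eq: "\<theta> \<bullet>\<^bsub>Vect K\<^esub> prim_incl C H \<theta> = schur_unit K C H \<bullet>\<^bsub>Vect K\<^esub> prim_incl C H \<theta>"
proof -
  note i = prim_incl_hom and e = schur_unit_fun(1)[OF C H]
  show ?thesis
    by (rule Vect_Hom_eqI[OF Vect_comp_Hom[OF i \<theta>] Vect_comp_Hom[OF i e]])
      (use Prim_carrier in \<open>simp add: vmap_fun_comp[OF i \<theta>] vmap_fun_comp[OF i e] prim_incl_fun\<close>)
qed

lemma prim_incl_univ:
  assumes f: "f \<in> Hom (Vect K) V H" and eq: "\<theta> \<bullet>\<^bsub>Vect K\<^esub> f = schur_unit K C H \<bullet>\<^bsub>Vect K\<^esub> f"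
  shows "\<exists>g\<in>Hom (Vect K) V (Prim K C H \<theta>). prim_incl C H \<theta> \<bullet>\<^bsub>Vect K\<^esub> g = f"
proof -
  note e = schur_unit_fun(1)[OF C H]
  let ?g = "(V, restrict (vmap_fun f) (carrier V), Prim K C H \<theta>)"
  have "vmap_fun \<theta> (vmap_fun f x) = vmap_fun (schur_unit K C H) (vmap_fun f x)" if "x \<in> carrier V" for x
    using arg_cong[OF eq, of "\<lambda>f. vmap_fun f x"] unfolding vmap_fun_comp[OF f \<theta> that] vmap_fun_comp[OF f e that] .
  then have g: "?g \<in> Hom (Vect K) V (Prim K C H \<theta>)"
    using Vect_Hom_lin[OF f] by (intro Vect_HomI Prim_module Vect_Hom_module(1)[OF f]) (simp add: Prim_lin)
  moreover have "prim_incl C H \<theta> \<bullet>\<^bsub>Vect K\<^esub> ?g = f"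
  proof (rule Vect_Hom_eqI[OF Vect_comp_Hom[OF g prim_incl_hom] f])
    fix x assume x: "x \<in> carrier V"
    show "vmap_fun (prim_incl C H \<theta> \<bullet>\<^bsub>Vect K\<^esub> ?g) x = vmap_fun f x"
      unfolding vmap_fun_comp[OF g prim_incl_hom x] using prim_incl_fun[OF Vect_Hom_closed[OF g x]] x by simp
  qed
  ultimately show ?thesis by blast
qed

text \<open>Arrows carry their domain, so equality of the composites already identifies
  \<open>V\<close> with \<open>V'\<close>; after that the inclusion is the identity on
  elements.\<close>

lemma prim_incl_mono:
  assumes f: "f \<in> Hom (Vect K) V (Prim K C H \<theta>)" and g: "g \<in> Hom (Vect K) V' (Prim K C H \<theta>)"
    and eq: "prim_incl C H \<theta> \<bullet>\<^bsub>Vect K\<^esub> f = prim_incl C H \<theta> \<bullet>\<^bsub>Vect K\<^esub> g"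
  shows "f = g"
proof -
  have "V = V'"
    using Vect_comp_Hom[OF f prim_incl_hom] Vect_comp_Hom[OF g prim_incl_hom] eq by (auto simp: Hom_def)
  with g have g': "g \<in> Hom (Vect K) V (Prim K C H \<theta>)" by simp
  show ?thesis
  proof (rule Vect_Hom_eqI[OF f g'])
    fix x assume x: "x \<in> carrier V"
    show "vmap_fun f x = vmap_fun g x"
      using arg_cong[OF eq, of "\<lambda>f. vmap_fun f x"]
      unfolding vmap_fun_comp[OF f prim_incl_hom x] vmap_fun_comp[OF g' prim_incl_hom x]
        prim_incl_fun[OF Vect_Hom_closed[OF f x]] prim_incl_fun[OF Vect_Hom_closed[OF g' x]] .
  qed
qed

end

end

section \<open>The categorical argument applied to vector spaces\<close>

theorem mainTheorem3:
  fixes K :: "'k ring"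
    and A C :: "('k, 'a) smodule"
    and \<gamma> \<Delta> l \<alpha> :: "('k, 'a) smap"
  assumes "field K"
    and "operad K A \<gamma>"
    and "cooperad K C \<Delta>"
    and H0: "distributive_law K A \<gamma> C \<Delta> l"
    and H1: "left_comodule K C \<Delta> A \<alpha>"
      "\<forall>V\<in>Ob (Vect K). bialg_of K A C l (schur K A V) (operad_mult K A \<gamma> V) (coaction_nat K A C \<alpha> V)
         \<in> Ob (bialgebras K A \<gamma> C \<Delta> l)"
    and H2iso: "smor_iso K A C (runit K C \<cdot>\<^sub>s circ_map K C (sunit K) sid (s_counit K) \<cdot>\<^sub>s \<alpha>)"
  shows "is_equivalence (Vect K) (bialgebras K A \<gamma> C \<Delta> l) (comparison K A \<gamma> C l) \<and>
    (\<forall>H h \<theta>. bialg_of K A C l H h \<theta> \<in> Ob (bialgebras K A \<gamma> C \<Delta> l) \<longrightarrow>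
       free_on K A \<gamma> (H, h) (Prim K C H \<theta>) \<and> cofree_on K C \<Delta> (H, \<theta>) (Prim K C H \<theta>))"
proof -
  interpret K: field K by fact
  interpret ground_ring K by unfold_locales
  have A: "is_smodule K A" "sp A 1 = ground K" and \<gamma>: "smor K (circ K A A) A \<gamma>"
    and unit: "smor_eq A (\<gamma> \<cdot>\<^sub>s circ_map K A A sid (s_unit A) \<cdot>\<^sub>s runit_inv K A) sid"
    using assms(2) by (simp_all add: operad_def std_smodule_def)
  have C: "is_smodule K C" "sp C 1 = ground K" and \<Delta>: "smor K C (circ K C C) \<Delta>"
    using assms(3) by (simp_all add: cooperad_def std_smodule_def)
  have \<alpha>: "smor K A (circ K C A) \<alpha>" using H1(1) by (simp add: left_comodule_def)
  have entw: "entwining (Vect K) (schur_func K A) (operad_mult K A \<gamma>) (schur_unit K A)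
       (schur_func K C) (cooperad_comult K C \<Delta>) (schur_counit K C) (dist_nat K A C l)"
    using H0 by (simp add: distributive_law_def)
  let ?T = "schur_func K A" and ?G = "schur_func K C"
  let ?a = "coaction_nat K A C \<alpha>"
  have FO [simp]: "FOb (schur_func K M) = schur K M" "FArr (schur_func K M) = schur_map K M" for M :: "('k, 'a) smodule"
    by (simp_all add: schur_func_def)
  have free: "((schur K A V, operad_mult K A \<gamma> V), ((schur K A V, operad_mult K A \<gamma> V), ?a V, lift_ob (Vect K) ?G (dist_nat K A C l) (schur K A V, operad_mult K A \<gamma> V)))
     \<in> em_coalgs (em_alg (Vect K) ?T (operad_mult K A \<gamma>) (schur_unit K A)) (lift_func (Vect K) ?G (dist_nat K A C l))
         (lift_comult (Vect K) ?G (dist_nat K A C l) (cooperad_comult K C \<Delta>)) (lift_counit (Vect K) ?G (dist_nat K A C l) (schur_counit K C))"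
    if "module K V" for V :: "('k, 'a) vs"
    using H1(2) that by (simp add: bialg_of_def bialgebras_def operad_algebras_def)
  \<comment> \<open>The counit law of the free bialgebra, read on underlying arrows; it supplies the
    counit premise of \<open>coaction_unit\<close>.\<close>
  have counit: "schur_counit K C (schur K A V) \<bullet>\<^bsub>Vect K\<^esub> ?a V = Ide (Vect K) (schur K A V)" if "module K V" for V :: "('k, 'a) vs"
    using free[OF that] by (simp add: em_coalgs_def lift_counit_def del: Vect_simps)
  have dom: "f \<in> Hom (Vect K) (Dom (Vect K) f) (Cod (Vect K) f)" if "f \<in> Arr (Vect K)" for f :: "('k, 'a) vmap"
    using that by (simp add: Hom_def)
  interpret E: entwined_comparison "Vect K" ?T ?G "operad_mult K A \<gamma>" "schur_unit K A" "cooperad_comult K C \<Delta>" "schur_counit K C"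
    "dist_nat K A C l" "schur_unit K C" "schur_counit K A" ?a "Prim K C" "prim_incl C"
  proof
    show "is_category (Vect K :: (('k, 'a) vs, ('k, 'a) vmap) category)" by (rule Vect_category)
    show "is_functor (Vect K) (Vect K) ?T" "is_functor (Vect K) (Vect K) ?G" by (rule schur_functor A C)+
    show "nat_trans (Vect K) (Vect K) id_func ?T (schur_unit K A)" "nat_trans (Vect K) (Vect K) id_func ?G (schur_unit K C)"
      by (rule schur_unit_nat_trans A C)+
    show "nat_trans (Vect K) (Vect K) ?T id_func (schur_counit K A)" "nat_trans (Vect K) (Vect K) ?G id_func (schur_counit K C)"
      by (rule schur_counit_nat_trans A C)+
    show "nat_trans (Vect K) (Vect K) (comp_func ?T ?T) ?T (operad_mult K A \<gamma>)" by (rule operad_mult_nat[OF A \<gamma>])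
    show "nat_trans (Vect K) (Vect K) ?G (comp_func ?G ?G) (cooperad_comult K C \<Delta>)"
      using circ_nat_trans[OF C(1) C(1) C(1) \<Delta>] by (simp add: cooperad_comult_def[abs_def])
  next
    fix X :: "('k, 'a) vs" assume "X \<in> Ob (Vect K)"
    then have X: "module K X" by simp
    note e = schur_unit_fun(1)[OF A X] and p = schur_counit_fun(1)[OF A X]
    show "schur_counit K A X \<bullet>\<^bsub>Vect K\<^esub> schur_unit K A X = Ide (Vect K) X"
      by (rule Vect_Hom_eqI[OF Vect_comp_Hom[OF e p] Vect_Ide_Hom[OF X]])
        (simp add: vmap_fun_comp[OF e p] schur_counit_unit[OF A X])
    show "operad_mult K A \<gamma> X \<bullet>\<^bsub>Vect K\<^esub> FArr ?T (schur_unit K A X) = Ide (Vect K) (FOb ?T X)"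
      using operad_mult_map_unit[OF A \<gamma> unit X] by simp
    show "((FOb ?T X, operad_mult K A \<gamma> X), ((FOb ?T X, operad_mult K A \<gamma> X), ?a X, lift_ob (Vect K) ?G (dist_nat K A C l) (FOb ?T X, operad_mult K A \<gamma> X)))
     \<in> em_coalgs (em_alg (Vect K) ?T (operad_mult K A \<gamma>) (schur_unit K A)) (lift_func (Vect K) ?G (dist_nat K A C l))
         (lift_comult (Vect K) ?G (dist_nat K A C l) (cooperad_comult K C \<Delta>)) (lift_counit (Vect K) ?G (dist_nat K A C l) (schur_counit K C))"
      using free[OF X] by simp
    show "?a X \<bullet>\<^bsub>Vect K\<^esub> schur_unit K A X = schur_unit K C (FOb ?T X) \<bullet>\<^bsub>Vect K\<^esub> schur_unit K A X"
      using coaction_unit[OF A C \<alpha> X counit[OF X]] by simp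
    show "iso_arr (Vect K) (FArr ?G (schur_counit K A X) \<bullet>\<^bsub>Vect K\<^esub> ?a X)"
      using coaction_phi_iso[OF A C \<alpha> H2iso X] by simp
  next
    fix H :: "('k, 'a) vs" and h assume "(H, h) \<in> em_algs (Vect K) ?T (operad_mult K A \<gamma>) (schur_unit K A)"
    then have "module K H" "h \<in> Hom (Vect K) (schur K A H) H" "h \<bullet>\<^bsub>Vect K\<^esub> schur_unit K A H = Ide (Vect K) H"
      by (simp_all add: em_algs_def del: Vect_simps(5))
    then show "iso_arr (Vect K) (FArr ?G h \<bullet>\<^bsub>Vect K\<^esub> ?a H)"
      using coaction_kappa_iso[OF A C \<alpha> H2iso] by simp
  next
    fix H :: "('k, 'a) vs" and \<theta> assume "H \<in> Ob (Vect K)" "\<theta> \<in> Hom (Vect K) H (FOb ?G H)"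
    then have H: "module K H" "\<theta> \<in> Hom (Vect K) H (schur K C H)" by simp_all
    show "Prim K C H \<theta> \<in> Ob (Vect K)" using Prim_module[OF C H] by simp
    show "prim_incl C H \<theta> \<in> Hom (Vect K) (Prim K C H \<theta>) H" by (rule prim_incl_hom[OF C H])
    show "\<theta> \<bullet>\<^bsub>Vect K\<^esub> prim_incl C H \<theta> = schur_unit K C H \<bullet>\<^bsub>Vect K\<^esub> prim_incl C H \<theta>" by (rule prim_incl_eq[OF C H])
    fix f :: "('k, 'a) vmap" assume f: "f \<in> Arr (Vect K)"
    show "Cod (Vect K) f = H \<Longrightarrow> \<theta> \<bullet>\<^bsub>Vect K\<^esub> f = schur_unit K C H \<bullet>\<^bsub>Vect K\<^esub> f \<Longrightarrow>
       \<exists>g\<in>Hom (Vect K) (Dom (Vect K) f) (Prim K C H \<theta>). prim_incl C H \<theta> \<bullet>\<^bsub>Vect K\<^esub> g = f"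
      using prim_incl_univ[OF C H, of f "Dom (Vect K) f"] dom[OF f] by simp
    fix g :: "('k, 'a) vmap" assume g: "g \<in> Arr (Vect K)"
    show "Cod (Vect K) f = Prim K C H \<theta> \<Longrightarrow> Cod (Vect K) g = Prim K C H \<theta> \<Longrightarrow>
       prim_incl C H \<theta> \<bullet>\<^bsub>Vect K\<^esub> f = prim_incl C H \<theta> \<bullet>\<^bsub>Vect K\<^esub> g \<Longrightarrow> f = g"
      using prim_incl_mono[OF C H, of f "Dom (Vect K) f" g "Dom (Vect K) g"] dom[OF f] dom[OF g] by simp
  qed (rule entw)
  have B: "bialgebras K A \<gamma> C \<Delta> l = E.Bialg" by (simp add: bialgebras_def operad_algebras_def)
  have "comparison K A \<gamma> C l = E.comp_fun"
    by (simp add: comparison_def E.comp_fun_def E.comp_ob_def comparison_ob_def bialg_of_def free_alg_def Let_def fun_eq_iff)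
  then have "is_equivalence (Vect K) (bialgebras K A \<gamma> C \<Delta> l) (comparison K A \<gamma> C l)"
    using E.comparison_equivalence by (simp add: B)
  moreover have "free_on K A \<gamma> (H, h) (Prim K C H \<theta>) \<and> cofree_on K C \<Delta> (H, \<theta>) (Prim K C H \<theta>)"
    if "bialg_of K A C l H h \<theta> \<in> Ob (bialgebras K A \<gamma> C \<Delta> l)" for H h \<theta>
  proof -
    have b: "E.is_bialg H h \<theta>" using that by (simp only: E.bialg_iff[symmetric] B bialg_of_def)
    then have H: "module K H" "\<theta> \<in> Hom (Vect K) H (schur K C H)" 
      using E.alg_typing(1)[OF E.bialg_alg[OF b]] E.bialg_hom[OF b] by simp_all
    let ?P = "Prim K C H \<theta>"
    note P = Prim_module[OF C H] and i = prim_incl_hom[OF C H] and ix = prim_incl_fun[OF C H]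
    note eA = schur_unit_fun(1)[OF A P] and eC = schur_unit_fun(1)[OF C P]
    obtain f where f: "iso_arr E.Alg ((schur K A ?P, operad_mult K A \<gamma> ?P), f, (H, h))"
      "f \<bullet>\<^bsub>Vect K\<^esub> schur_unit K A ?P = prim_incl C H \<theta>" "f \<in> Hom (Vect K) (schur K A ?P) H"
      using E.bialg_free_cofree(1)[OF b] unfolding FO by blast
    have "vmap_fun f (vmap_fun (schur_unit K A ?P) x) = x" if x: "x \<in> carrier ?P" for x
      using arg_cong[OF f(2), of "\<lambda>f. vmap_fun f x"] unfolding vmap_fun_comp[OF eA f(3) x] ix[OF x] .
    then have 1: "free_on K A \<gamma> (H, h) ?P"
      using f(1) unfolding free_on_def free_alg_def operad_algebras_def by blast
    obtain g where g: "iso_arr (em_coalg (Vect K) ?G (cooperad_comult K C \<Delta>) (schur_counit K C)) ((H, \<theta>), g, (schur K C ?P, cooperad_comult K C \<Delta> ?P))"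
      "g \<bullet>\<^bsub>Vect K\<^esub> prim_incl C H \<theta> = schur_unit K C ?P" "g \<in> Hom (Vect K) H (schur K C ?P)"
      using E.bialg_free_cofree(2)[OF b] unfolding FO by blast
    have "vmap_fun g x = vmap_fun (schur_unit K C ?P) x" if x: "x \<in> carrier ?P" for x
      using arg_cong[OF g(2), of "\<lambda>f. vmap_fun f x"] unfolding vmap_fun_comp[OF i g(3) x] ix[OF x] .
    then have 2: "cofree_on K C \<Delta> (H, \<theta>) ?P"
      using g(1) unfolding cofree_on_def cofree_coalg_def cooperad_coalgebras_def by blast
    show ?thesis using 1 2 by blast
  qed
  ultimately show ?thesis by blast
qed

end
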